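(* Let $\Lambda$ be a basic connected Nakayama algebra with $n$ simple modules. Let $(P_1,\ldots,P_n)$ be a Kupisch series for $\Lambda$ with corresponding admissible sequence $c=(c_1,\ldots,c_n)$, $c_j=l(P_j)$, with indices regarded as elements of $\mathbb{Z}_n=\mathbb{Z}/n\mathbb{Z}$. Let $\mathcal{P}_c=\{i\in\mathbb{Z}_n\mid c_{i+1}=c_i+1\}$ (which labels all indecomposable projective non-injective $\Lambda$-modules) and $\mathcal{Q}_c=\{i\in\mathbb{Z}_n\mid c_{i+1}\le c_i\}$ (which labels all indecomposable projective-injective $\Lambda$-modules). Then there exists a tilting module in $\mathcal{C}_\Lambda$ if and only if $$\mathcal{P}_c\subseteq\{j-c_j\in\mathbb{Z}_n\mid j\in\mathcal{Q}_c\}.$$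
   Context: All modules are finitely generated left modules. An artin algebra is a Nakayama algebra if all its indecomposable projective and indecomposable injective modules are uniserial. $l(M)$ denotes the length of $M$, and $\tau$ the Auslander-Reiten translation. A Kupisch series for $\Lambda$ is an ordering $(P_1,\ldots,P_n)$ of representatives of the isomorphism classes of indecomposable projective modules such that (a) $P_{i+1}/\operatorname{rad}P_{i+1}\cong\tau^{-1}(P_i/\operatorname{rad}P_i)$ for $1\le i\le n-1$, and, if $l(P_1)\ne 1$, $P_1/\operatorname{rad}P_1\cong\tau^{-1}(P_n/\operatorname{rad}P_n)$; (b) $l(P_i)\ge 2$ for $2\le i\le n$; (c) $l(P_{i+1})\le l(P_i)+1$ for $1\le i\le n-1$ and $l(P_1)\le l(P_n)+1$. The corresponding admissible sequence is $(l(P_1),\ldots,l(P_n))$. Let $\widetilde{Q}$ be the direct sum of representatives of the isomorphism classes of all indecomposable projective-injective $\Lambda$-modules; $\mathcal{C}_\Lambda=(\operatorname{Gen}\widetilde{Q})\cap(\operatorname{Cogen}\widetilde{Q})$ is the full subcategory of modules $M$ that admit both an epimorphism $\widetilde{Q}^m\to M$ and a monomorphism $M\to\widetilde{Q}^{m'}$ for some $m,m'$. A basic $\Lambda$-module $T$ is tilting if (1) $\operatorname{projdim}T\le 1$, (2) $\operatorname{Ext}^1_\Lambda(T,T)=0$, (3) there is an exact sequence $0\to\Lambda\to T_0\to T_1\to 0$ with $T_0,T_1\in\operatorname{add}T$. *)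

theory Defs
  imports "HOL-Algebra.Module" "HOL-Algebra.Ideal"
begin

section \<open>Modules over a not necessarily commutative ring\<close>

text \<open>HOL-Algebra's locale \<open>module\<close> demands a commutative ring of scalars; its record type and its
  notion of submodule carry over. The fields \<open>mult\<close> and \<open>one\<close> of a module record have no meaning.\<close>

locale left_module = R?: ring R + M?: abelian_group M
  for R :: "('a, 'r) ring_scheme" (structure) and M :: "('a, 'm) module" (structure) +
  assumes smult_closed [simp, intro]:
      "\<lbrakk>a \<in> carrier R; x \<in> carrier M\<rbrakk> \<Longrightarrow> a \<odot>\<^bsub>M\<^esub> x \<in> carrier M"
    and smult_l_distr:
      "\<lbrakk>a \<in> carrier R; b \<in> carrier R; x \<in> carrier M\<rbrakk> \<Longrightarrow>
        (a \<oplus>\<^bsub>R\<^esub> b) \<odot>\<^bsub>M\<^esub> x = a \<odot>\<^bsub>M\<^esub> x \<oplus>\<^bsub>M\<^esub> b \<odot>\<^bsub>M\<^esub> x"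
    and smult_r_distr:
      "\<lbrakk>a \<in> carrier R; x \<in> carrier M; y \<in> carrier M\<rbrakk> \<Longrightarrow>
        a \<odot>\<^bsub>M\<^esub> (x \<oplus>\<^bsub>M\<^esub> y) = a \<odot>\<^bsub>M\<^esub> x \<oplus>\<^bsub>M\<^esub> a \<odot>\<^bsub>M\<^esub> y"
    and smult_assoc:
      "\<lbrakk>a \<in> carrier R; b \<in> carrier R; x \<in> carrier M\<rbrakk> \<Longrightarrow>
        (a \<otimes>\<^bsub>R\<^esub> b) \<odot>\<^bsub>M\<^esub> x = a \<odot>\<^bsub>M\<^esub> (b \<odot>\<^bsub>M\<^esub> x)"
    and smult_one [simp]:
      "x \<in> carrier M \<Longrightarrow> \<one>\<^bsub>R\<^esub> \<odot>\<^bsub>M\<^esub> x = x"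

definition fg_module :: "('a, 'r) ring_scheme \<Rightarrow> ('a, 'm) module \<Rightarrow> bool" where
  "fg_module R M \<longleftrightarrow> left_module R M \<and>
    (\<exists>S. finite S \<and> S \<subseteq> carrier M \<and> (\<forall>N. submodule N R M \<and> S \<subseteq> N \<longrightarrow> N = carrier M))"

text \<open>Homomorphisms are extensional functions, so that equality of homomorphisms is equality in HOL
  and \<open>module_hom R M N\<close> really is the set \<open>Hom\<^sub>R(M, N)\<close>.\<close>

definition module_hom ::
  "('a, 'r) ring_scheme \<Rightarrow> ('a, 'm) module \<Rightarrow> ('a, 'n) module \<Rightarrow> ('m \<Rightarrow> 'n) set" where
  "module_hom R M N = {f \<in> carrier M \<rightarrow>\<^sub>E carrier N.
    (\<forall>x \<in> carrier M. \<forall>y \<in> carrier M. f (x \<oplus>\<^bsub>M\<^esub> y) = f x \<oplus>\<^bsub>N\<^esub> f y) \<and>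
    (\<forall>a \<in> carrier R. \<forall>x \<in> carrier M. f (a \<odot>\<^bsub>M\<^esub> x) = a \<odot>\<^bsub>N\<^esub> f x)}"

definition module_mono ::
  "('a, 'r) ring_scheme \<Rightarrow> ('a, 'm) module \<Rightarrow> ('a, 'n) module \<Rightarrow> ('m \<Rightarrow> 'n) set" where
  "module_mono R M N = {f \<in> module_hom R M N. inj_on f (carrier M)}"

definition module_epi ::
  "('a, 'r) ring_scheme \<Rightarrow> ('a, 'm) module \<Rightarrow> ('a, 'n) module \<Rightarrow> ('m \<Rightarrow> 'n) set" where
  "module_epi R M N = {f \<in> module_hom R M N. f ` carrier M = carrier N}"

definition module_iso ::
  "('a, 'r) ring_scheme \<Rightarrow> ('a, 'm) module \<Rightarrow> ('a, 'n) module \<Rightarrow> bool" where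
  "module_iso R M N \<longleftrightarrow> (\<exists>f \<in> module_hom R M N. bij_betw f (carrier M) (carrier N))"

text \<open>Every finitely generated module over a ring with elements of type \<open>'a\<close> is isomorphic to a
  quotient of some \<open>R\<^sup>m\<close>, hence to a module with carrier in \<open>(nat \<Rightarrow> 'a) set\<close>
  (lemma \<open>fg_module_iso_fmod\<close> below). Quantification over all finitely generated modules, up to
  isomorphism, is therefore quantification over the following type.\<close>

type_synonym 'a fmod = "('a, (nat \<Rightarrow> 'a) set) module"

lemma (in left_module) smult_zero_left: "x \<in> carrier M \<Longrightarrow> \<zero>\<^bsub>R\<^esub> \<odot>\<^bsub>M\<^esub> x = \<zero>\<^bsub>M\<^esub>"
  using smult_l_distr[of "\<zero>\<^bsub>R\<^esub>" "\<zero>\<^bsub>R\<^esub>" x]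
  by (metis R.add.one_closed R.add.r_one M.add.l_cancel_one' smult_closed)

lemma (in left_module) smult_zero_right: "a \<in> carrier R \<Longrightarrow> a \<odot>\<^bsub>M\<^esub> \<zero>\<^bsub>M\<^esub> = \<zero>\<^bsub>M\<^esub>"
  using smult_r_distr[of a "\<zero>\<^bsub>M\<^esub>" "\<zero>\<^bsub>M\<^esub>"]
  by (metis M.add.one_closed M.add.r_one M.add.l_cancel_one' smult_closed)

lemma (in left_module) submoduleI':
  assumes "H \<subseteq> carrier M" "\<zero>\<^bsub>M\<^esub> \<in> H"
    and "\<And>x y. \<lbrakk>x \<in> H; y \<in> H\<rbrakk> \<Longrightarrow> x \<oplus>\<^bsub>M\<^esub> y \<in> H"
    and "\<And>a x. \<lbrakk>a \<in> carrier R; x \<in> H\<rbrakk> \<Longrightarrow> a \<odot>\<^bsub>M\<^esub> x \<in> H"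
  shows "submodule H R M"
proof -
  have neg: "\<ominus>\<^bsub>M\<^esub> x = (\<ominus>\<^bsub>R\<^esub> \<one>\<^bsub>R\<^esub>) \<odot>\<^bsub>M\<^esub> x" if "x \<in> carrier M" for x
  proof -
    have "(\<ominus>\<^bsub>R\<^esub> \<one>\<^bsub>R\<^esub>) \<odot>\<^bsub>M\<^esub> x \<oplus>\<^bsub>M\<^esub> x = (\<ominus>\<^bsub>R\<^esub> \<one>\<^bsub>R\<^esub> \<oplus>\<^bsub>R\<^esub> \<one>\<^bsub>R\<^esub>) \<odot>\<^bsub>M\<^esub> x"
      using that smult_l_distr[of "\<ominus>\<^bsub>R\<^esub> \<one>\<^bsub>R\<^esub>" "\<one>\<^bsub>R\<^esub>" x] by simp
    also have "\<dots> = \<zero>\<^bsub>M\<^esub>" using smult_zero_left[OF that] by (simp add: R.l_neg)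
    finally show ?thesis using that by (simp add: M.minus_equality)
  qed
  show ?thesis
  proof (intro submodule.intro subgroup.intro submodule_axioms.intro)
    fix x assume "x \<in> H"
    then have "inv\<^bsub>add_monoid M\<^esub> x = (\<ominus>\<^bsub>R\<^esub> \<one>\<^bsub>R\<^esub>) \<odot>\<^bsub>M\<^esub> x"
      using neg assms(1) by (auto simp: a_inv_def)
    then show "inv\<^bsub>add_monoid M\<^esub> x \<in> H" using assms(4) \<open>x \<in> H\<close> by simp
  qed (use assms in auto)
qed

lemma (in left_module) smult_finsum:
  assumes "finite I" "f \<in> I \<rightarrow> carrier M" "a \<in> carrier R"
  shows "a \<odot>\<^bsub>M\<^esub> (\<Oplus>\<^bsub>M\<^esub>i\<in>I. f i) = (\<Oplus>\<^bsub>M\<^esub>i\<in>I. a \<odot>\<^bsub>M\<^esub> f i)"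
  using assms(1,2)
proof (induction I)
  case empty
  then show ?case using assms(3) by (simp add: smult_zero_right)
next
  case (insert i I)
  then have "f i \<in> carrier M" "f \<in> I \<rightarrow> carrier M" "(\<lambda>j. a \<odot>\<^bsub>M\<^esub> f j) \<in> I \<rightarrow> carrier M"
    using assms(3) by auto
  then show ?case using insert assms(3)
    by (simp add: M.finsum_insert M.finsum_closed smult_r_distr)
qed

lemma fg_moduleE:
  assumes "fg_module R M"
  obtains S where "finite S" "S \<subseteq> carrier M"
    "\<And>N. submodule N R M \<Longrightarrow> S \<subseteq> N \<Longrightarrow> N = carrier M"
  using assms by (auto simp: fg_module_def)

text \<open>Transport of a module structure along an injection.\<close>

definition transport_module :: "('m \<Rightarrow> 'n) \<Rightarrow> ('a, 'm) module \<Rightarrow> ('a, 'n) module" where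
  "transport_module \<psi> M = (let \<theta> = the_inv_into (carrier M) \<psi> in
    \<lparr>carrier = \<psi> ` carrier M, mult = undefined, one = undefined, zero = \<psi> \<zero>\<^bsub>M\<^esub>,
     add = (\<lambda>x y. \<psi> (\<theta> x \<oplus>\<^bsub>M\<^esub> \<theta> y)), smult = (\<lambda>a x. \<psi> (a \<odot>\<^bsub>M\<^esub> \<theta> x))\<rparr>)"

lemma transport_module_fg:
  assumes fg: "fg_module R M" and inj: "inj_on \<psi> (carrier M)"
  shows "fg_module R (transport_module \<psi> M) \<and> module_iso R M (transport_module \<psi> M)"
proof -
  let ?N = "transport_module \<psi> M"
  interpret left_module R M using fg by (simp add: fg_module_def)
  have th [simp]: "the_inv_into (carrier M) \<psi> (\<psi> x) = x" if "x \<in> carrier M" for x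
    using inj that by (simp add: the_inv_into_f_f)
  have sel: "carrier ?N = \<psi> ` carrier M" "zero ?N = \<psi> \<zero>\<^bsub>M\<^esub>"
    by (simp_all add: transport_module_def Let_def)
  have ad: "add ?N (\<psi> x) (\<psi> y) = \<psi> (x \<oplus>\<^bsub>M\<^esub> y)" if "x \<in> carrier M" "y \<in> carrier M" for x y
    using that by (simp add: transport_module_def Let_def)
  have sm: "smult ?N a (\<psi> x) = \<psi> (a \<odot>\<^bsub>M\<^esub> x)" if "x \<in> carrier M" for a x
    using that by (simp add: transport_module_def Let_def)
  have ab: "abelian_group ?N"
  proof (rule abelian_groupI)
    fix x assume "x \<in> carrier ?N"
    then obtain u where "u \<in> carrier M" "x = \<psi> u" by (auto simp: sel)
    then show "\<exists>y \<in> carrier ?N. add ?N y x = zero ?N"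
      by (intro bexI[of _ "\<psi> (\<ominus>\<^bsub>M\<^esub> u)"]) (auto simp: sel ad M.l_neg)
  qed (auto simp: sel ad M.a_assoc intro: arg_cong[OF M.a_comm])
  have lm: "left_module R ?N"
    by (intro left_module.intro ab R.ring_axioms left_module_axioms.intro)
      (auto simp: sel ad sm smult_l_distr smult_r_distr smult_assoc)
  obtain S where S: "finite S" "S \<subseteq> carrier M"
    "\<And>N. submodule N R M \<Longrightarrow> S \<subseteq> N \<Longrightarrow> N = carrier M"
    using fg_moduleE[OF fg] by metis
  have gen: "L = carrier ?N" if L: "submodule L R ?N" "\<psi> ` S \<subseteq> L" for L
  proof -
    interpret L: submodule L R ?N by (rule L(1))
    have Lsub: "L \<subseteq> \<psi> ` carrier M" using L.subset sel by simp
    let ?H = "{x \<in> carrier M. \<psi> x \<in> L}"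
    have "submodule ?H R M"
    proof (rule submoduleI')
      show "\<zero>\<^bsub>M\<^esub> \<in> ?H" using L.one_closed sel by simp
      show "x \<oplus>\<^bsub>M\<^esub> y \<in> ?H" if "x \<in> ?H" "y \<in> ?H" for x y
        using that L.m_closed[of "\<psi> x" "\<psi> y"] by (simp add: ad)
      show "a \<odot>\<^bsub>M\<^esub> x \<in> ?H" if "a \<in> carrier R" "x \<in> ?H" for a x
        using that L.smult_closed[of a "\<psi> x"] by (simp add: sm)
    qed auto
    moreover have "S \<subseteq> ?H" using S(2) L(2) by auto
    ultimately have "?H = carrier M" by (rule S(3))
    then show ?thesis using Lsub sel by auto
  qed
  have "fg_module R ?N" unfolding fg_module_def
  proof (intro conjI exI[of _ "\<psi> ` S"] allI impI lm)
    show "finite (\<psi> ` S)" using S(1) by simp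
    show "\<psi> ` S \<subseteq> carrier ?N" using S(2) sel by auto
    show "L = carrier ?N" if "submodule L R ?N \<and> \<psi> ` S \<subseteq> L" for L using that gen by blast
  qed
  moreover have "module_iso R M ?N" unfolding module_iso_def
  proof (rule bexI[of _ "restrict \<psi> (carrier M)"])
    show "bij_betw (restrict \<psi> (carrier M)) (carrier M) (carrier ?N)"
      using inj by (auto simp: bij_betw_def sel inj_on_def)
    show "restrict \<psi> (carrier M) \<in> module_hom R M ?N"
      by (auto simp: module_hom_def sel ad sm)
  qed
  ultimately show ?thesis by blast
qed

lemma fg_module_iso_fmod:
  fixes R :: "('a, 'r) ring_scheme" and M :: "('a, 'm) module"
  assumes "fg_module R M"
  shows "\<exists>N :: 'a fmod. fg_module R N \<and> module_iso R M N"
proof -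
  interpret left_module R M using assms by (simp add: fg_module_def)
  obtain S where S: "finite S" "S \<subseteq> carrier M"
    "\<And>N. submodule N R M \<Longrightarrow> S \<subseteq> N \<Longrightarrow> N = carrier M"
    using fg_moduleE[OF assms] by metis
  obtain b where b: "bij_betw b {..<card S} S"
    using S(1) ex_bij_betw_nat_finite[OF S(1)] by (auto simp: atLeast0LessThan)
  let ?I = "{..<card S}"
  have bM: "b i \<in> carrier M" if "i < card S" for i
    using that b S(2) by (auto simp: bij_betw_def)
  define C where "C = (?I \<rightarrow>\<^sub>E carrier R)"
  define e where "e r = (\<Oplus>\<^bsub>M\<^esub>i\<in>?I. r i \<odot>\<^bsub>M\<^esub> b i)" for r
  have C: "r i \<in> carrier R" if "r \<in> C" "i < card S" for r i using that by (auto simp: C_def)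
  have eM: "e r \<in> carrier M" if "r \<in> C" for r
    unfolding e_def by (rule M.finsum_closed) (auto simp: bM C that)
  note zz = smult_zero_left
  have "submodule (e ` C) R M"
  proof (rule submoduleI')
    show "e ` C \<subseteq> carrier M" using eM by auto
    have "e (\<lambda>i\<in>?I. \<zero>\<^bsub>R\<^esub>) = (\<Oplus>\<^bsub>M\<^esub>i\<in>?I. \<zero>\<^bsub>M\<^esub>)"
      unfolding e_def by (rule M.finsum_cong') (auto simp: zz bM)
    also have "\<dots> = \<zero>\<^bsub>M\<^esub>" by simp
    finally show "\<zero>\<^bsub>M\<^esub> \<in> e ` C"
      by (intro image_eqI[of _ _ "\<lambda>i\<in>?I. \<zero>\<^bsub>R\<^esub>"]) (auto simp: C_def)
  next
    fix x y assume "x \<in> e ` C" "y \<in> e ` C"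
    then obtain r s where rs: "r \<in> C" "s \<in> C" "x = e r" "y = e s" by auto
    have addC: "(\<lambda>i\<in>?I. r i \<oplus>\<^bsub>R\<^esub> s i) \<in> C"
      unfolding C_def by (rule restrict_PiE_iff[THEN iffD2]) (simp add: C rs(1,2))
    have "e (\<lambda>i\<in>?I. r i \<oplus>\<^bsub>R\<^esub> s i) = (\<Oplus>\<^bsub>M\<^esub>i\<in>?I. r i \<odot>\<^bsub>M\<^esub> b i \<oplus>\<^bsub>M\<^esub> s i \<odot>\<^bsub>M\<^esub> b i)"
      unfolding e_def by (rule M.finsum_cong') (auto simp: smult_l_distr bM C rs)
    also have "\<dots> = x \<oplus>\<^bsub>M\<^esub> y"
      unfolding rs e_def by (rule M.finsum_addf) (auto simp: bM C rs)
    finally show "x \<oplus>\<^bsub>M\<^esub> y \<in> e ` C"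
      using addC by (intro image_eqI[of _ _ "\<lambda>i\<in>?I. r i \<oplus>\<^bsub>R\<^esub> s i"]) simp_all
  next
    fix a x assume a: "a \<in> carrier R" and "x \<in> e ` C"
    then obtain r where r: "r \<in> C" "x = e r" by auto
    have mulC: "(\<lambda>i\<in>?I. a \<otimes>\<^bsub>R\<^esub> r i) \<in> C"
      unfolding C_def by (rule restrict_PiE_iff[THEN iffD2]) (simp add: C r(1) a)
    have "e (\<lambda>i\<in>?I. a \<otimes>\<^bsub>R\<^esub> r i) = (\<Oplus>\<^bsub>M\<^esub>i\<in>?I. a \<odot>\<^bsub>M\<^esub> (r i \<odot>\<^bsub>M\<^esub> b i))"
      unfolding e_def by (rule M.finsum_cong') (auto simp: smult_assoc bM C r a)
    also have "\<dots> = a \<odot>\<^bsub>M\<^esub> x"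
      unfolding r e_def by (rule smult_finsum[symmetric]) (auto simp: bM C r a)
    finally show "a \<odot>\<^bsub>M\<^esub> x \<in> e ` C"
      using mulC by (intro image_eqI[of _ _ "\<lambda>i\<in>?I. a \<otimes>\<^bsub>R\<^esub> r i"]) simp_all
  qed
  moreover have "S \<subseteq> e ` C"
  proof
    fix x assume "x \<in> S"
    then obtain j where j: "j < card S" "x = b j" using b by (auto simp: bij_betw_def)
    let ?r = "\<lambda>i\<in>?I. if i = j then \<one>\<^bsub>R\<^esub> else \<zero>\<^bsub>R\<^esub>"
    have "e ?r = (\<Oplus>\<^bsub>M\<^esub>i\<in>?I. if j = i then b i else \<zero>\<^bsub>M\<^esub>)"
      unfolding e_def by (rule M.finsum_cong') (auto simp: zz bM)
    also have "\<dots> = b j" by (rule M.finsum_singleton) (auto simp: j bM)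
    finally show "x \<in> e ` C" using j by (intro image_eqI[of _ _ ?r]) (auto simp: C_def)
  qed
  ultimately have surj: "e ` C = carrier M" by (rule S(3))
  have "inj_on (\<lambda>x. {r \<in> C. e r = x}) (carrier M)"
  proof (rule inj_onI)
    fix x y assume "x \<in> carrier M" "{r \<in> C. e r = x} = {r \<in> C. e r = y}"
    moreover from \<open>x \<in> carrier M\<close> obtain r where "r \<in> C" "e r = x"
      using surj by (metis imageE)
    ultimately show "x = y" by blast
  qed
  from transport_module_fg[OF assms this] show ?thesis by blast
qed

abbreviation sub_module :: "('a, 'm) module \<Rightarrow> 'm set \<Rightarrow> ('a, 'm) module" where
  "sub_module M N \<equiv> M\<lparr>carrier := N\<rparr>"

definition quot_module :: "('a, 'm) module \<Rightarrow> 'm set \<Rightarrow> ('a, 'm set) module" where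
  "quot_module M N = \<lparr>carrier = a_rcosets\<^bsub>M\<^esub> N, mult = undefined, one = undefined,
    zero = N, add = set_add M, smult = (\<lambda>a X. \<Union>x\<in>X. N +>\<^bsub>M\<^esub> (a \<odot>\<^bsub>M\<^esub> x))\<rparr>"

definition regular_module :: "('a, 'r) ring_scheme \<Rightarrow> ('a, 'a) module" where
  "regular_module R = \<lparr>carrier = carrier R, mult = mult R, one = one R,
    zero = zero R, add = add R, smult = mult R\<rparr>"

definition power_module :: "('a, 'm) module \<Rightarrow> nat \<Rightarrow> ('a, nat \<Rightarrow> 'm) module" where
  "power_module M m = \<lparr>carrier = {..<m} \<rightarrow>\<^sub>E carrier M, mult = undefined, one = undefined,
    zero = (\<lambda>i\<in>{..<m}. \<zero>\<^bsub>M\<^esub>), add = (\<lambda>x y. \<lambda>i\<in>{..<m}. x i \<oplus>\<^bsub>M\<^esub> y i),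
    smult = (\<lambda>a x. \<lambda>i\<in>{..<m}. a \<odot>\<^bsub>M\<^esub> x i)\<rparr>"

text \<open>\<open>M\<close> is the internal direct sum of its submodules \<open>N i\<close>.\<close>

definition direct_decomposition ::
  "('a, 'r) ring_scheme \<Rightarrow> ('a, 'm) module \<Rightarrow> nat set \<Rightarrow> (nat \<Rightarrow> 'm set) \<Rightarrow> bool" where
  "direct_decomposition R M I N \<longleftrightarrow> finite I \<and> (\<forall>i\<in>I. submodule (N i) R M) \<and>
    (\<forall>x \<in> carrier M. \<exists>!f. f \<in> Pi\<^sub>E I N \<and> x = (\<Oplus>\<^bsub>M\<^esub>i\<in>I. f i))"

definition direct_summand :: "('a, 'r) ring_scheme \<Rightarrow> ('a, 'm) module \<Rightarrow> 'm set \<Rightarrow> bool" where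
  "direct_summand R M A \<longleftrightarrow> submodule A R M \<and>
    (\<exists>B. submodule B R M \<and> A \<inter> B = {\<zero>\<^bsub>M\<^esub>} \<and> A <+>\<^bsub>M\<^esub> B = carrier M)"

definition indecomposable :: "('a, 'r) ring_scheme \<Rightarrow> ('a, 'm) module \<Rightarrow> bool" where
  "indecomposable R M \<longleftrightarrow> left_module R M \<and> carrier M \<noteq> {\<zero>\<^bsub>M\<^esub>} \<and>
    (\<forall>A B. submodule A R M \<and> submodule B R M \<and> A \<inter> B = {\<zero>\<^bsub>M\<^esub>} \<and> A <+>\<^bsub>M\<^esub> B = carrier M
      \<longrightarrow> A = {\<zero>\<^bsub>M\<^esub>} \<or> B = {\<zero>\<^bsub>M\<^esub>})"

definition basic_module :: "('a, 'r) ring_scheme \<Rightarrow> ('a, 'm) module \<Rightarrow> bool" where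
  "basic_module R M \<longleftrightarrow> left_module R M \<and> (\<exists>I N. direct_decomposition R M I N \<and>
    (\<forall>i\<in>I. indecomposable R (sub_module M (N i))) \<and>
    (\<forall>i\<in>I. \<forall>j\<in>I. i \<noteq> j \<longrightarrow> \<not> module_iso R (sub_module M (N i)) (sub_module M (N j))))"

definition simple_module :: "('a, 'r) ring_scheme \<Rightarrow> ('a, 'm) module \<Rightarrow> bool" where
  "simple_module R M \<longleftrightarrow> left_module R M \<and> carrier M \<noteq> {\<zero>\<^bsub>M\<^esub>} \<and>
    (\<forall>N. submodule N R M \<longrightarrow> N = {\<zero>\<^bsub>M\<^esub>} \<or> N = carrier M)"

definition uniserial :: "('a, 'r) ring_scheme \<Rightarrow> ('a, 'm) module \<Rightarrow> bool" where
  "uniserial R M \<longleftrightarrow> left_module R M \<and>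
    (\<forall>A B. submodule A R M \<and> submodule B R M \<longrightarrow> A \<subseteq> B \<or> B \<subseteq> A)"

definition maximal_submodule :: "('a, 'r) ring_scheme \<Rightarrow> ('a, 'm) module \<Rightarrow> 'm set \<Rightarrow> bool" where
  "maximal_submodule R M N \<longleftrightarrow> submodule N R M \<and> N \<noteq> carrier M \<and>
    (\<forall>L. submodule L R M \<and> N \<subseteq> L \<longrightarrow> L = N \<or> L = carrier M)"

definition module_rad :: "('a, 'r) ring_scheme \<Rightarrow> ('a, 'm) module \<Rightarrow> 'm set" where
  "module_rad R M = {x \<in> carrier M. \<forall>N. maximal_submodule R M N \<longrightarrow> x \<in> N}"

abbreviation module_top :: "('a, 'r) ring_scheme \<Rightarrow> ('a, 'm) module \<Rightarrow> ('a, 'm set) module" where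
  "module_top R M \<equiv> quot_module M (module_rad R M)"

definition composition_series ::
  "('a, 'r) ring_scheme \<Rightarrow> ('a, 'm) module \<Rightarrow> nat \<Rightarrow> (nat \<Rightarrow> 'm set) \<Rightarrow> bool" where
  "composition_series R M k N \<longleftrightarrow> N 0 = {\<zero>\<^bsub>M\<^esub>} \<and> N k = carrier M \<and>
    (\<forall>i\<le>k. submodule (N i) R M) \<and>
    (\<forall>i<k. maximal_submodule R (sub_module M (N (Suc i))) (N i))"

definition module_length :: "('a, 'r) ring_scheme \<Rightarrow> ('a, 'm) module \<Rightarrow> nat" where
  "module_length R M = (THE k. \<exists>N. composition_series R M k N)"

section \<open>Projective and injective modules, resolutions, Ext\<close>

text \<open>All notions are relative to the category of finitely generated modules.\<close>

definition projective :: "('a, 'r) ring_scheme \<Rightarrow> ('a, 'm) module \<Rightarrow> bool" where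
  "projective R P \<longleftrightarrow> fg_module R P \<and>
    (\<forall>(X :: 'a fmod) (Y :: 'a fmod). fg_module R X \<and> fg_module R Y \<longrightarrow>
      (\<forall>f \<in> module_epi R X Y. \<forall>g \<in> module_hom R P Y. \<exists>h \<in> module_hom R P X.
        g = compose (carrier P) f h))"

definition injective :: "('a, 'r) ring_scheme \<Rightarrow> ('a, 'm) module \<Rightarrow> bool" where
  "injective R E \<longleftrightarrow> fg_module R E \<and>
    (\<forall>(X :: 'a fmod) (Y :: 'a fmod). fg_module R X \<and> fg_module R Y \<longrightarrow>
      (\<forall>f \<in> module_mono R X Y. \<forall>g \<in> module_hom R X E. \<exists>h \<in> module_hom R Y E.
        g = compose (carrier X) h f))"

definition projective_resolution ::
  "('a, 'r) ring_scheme \<Rightarrow> ('a, 'm) module \<Rightarrow> (nat \<Rightarrow> 'a fmod) \<Rightarrow>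
    (nat \<Rightarrow> (nat \<Rightarrow> 'a) set \<Rightarrow> (nat \<Rightarrow> 'a) set) \<Rightarrow> ((nat \<Rightarrow> 'a) set \<Rightarrow> 'm) \<Rightarrow> bool" where
  "projective_resolution R M P d \<epsilon> \<longleftrightarrow>
    (\<forall>i. projective R (P i)) \<and> (\<forall>i. d i \<in> module_hom R (P (Suc i)) (P i)) \<and>
    \<epsilon> \<in> module_epi R (P 0) M \<and>
    d 0 ` carrier (P 1) = a_kernel (P 0) M \<epsilon> \<and>
    (\<forall>i. d (Suc i) ` carrier (P (Suc (Suc i))) = a_kernel (P (Suc i)) (P i) (d i))"

definition projdim_le :: "('a, 'r) ring_scheme \<Rightarrow> ('a, 'm) module \<Rightarrow> nat \<Rightarrow> bool" where
  "projdim_le R M k \<longleftrightarrow> (\<exists>P d \<epsilon>. projective_resolution R M P d \<epsilon> \<and>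
    (\<forall>i>k. carrier (P i) = {\<zero>\<^bsub>P i\<^esub>}))"

text \<open>\<open>Ext\<^sup>k(M, N)\<close> is the quotient of the cocycles by the coboundaries in degree \<open>k\<close> of the complex
  \<open>Hom(P, N)\<close>, where \<open>P\<close> is any projective resolution of \<open>M\<close>.\<close>

definition Ext_cocycles where
  "Ext_cocycles R P d N k = {f \<in> module_hom R (P k) N.
    compose (carrier (P (Suc k))) f (d k) = (\<lambda>x\<in>carrier (P (Suc k)). \<zero>\<^bsub>N\<^esub>)}"

definition Ext_coboundaries where
  "Ext_coboundaries R P d N k = (case k of
      0 \<Rightarrow> {\<lambda>x\<in>carrier (P 0). \<zero>\<^bsub>N\<^esub>}
    | Suc j \<Rightarrow> (\<lambda>g. compose (carrier (P (Suc j))) g (d j)) ` module_hom R (P j) N)"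

definition Ext_vanishes ::
  "('a, 'r) ring_scheme \<Rightarrow> nat \<Rightarrow> ('a, 'm) module \<Rightarrow> ('a, 'n) module \<Rightarrow> bool" where
  "Ext_vanishes R k M N \<longleftrightarrow> (\<exists>P d \<epsilon>. projective_resolution R M P d \<epsilon> \<and>
    Ext_cocycles R P d N k = Ext_coboundaries R P d N k)"

definition projective_cover ::
  "('a, 'r) ring_scheme \<Rightarrow> ('a, 'p) module \<Rightarrow> ('a, 'm) module \<Rightarrow> ('p \<Rightarrow> 'm) \<Rightarrow> bool" where
  "projective_cover R P M f \<longleftrightarrow> projective R P \<and> f \<in> module_epi R P M \<and>
    (\<forall>L. submodule L R P \<and> f ` L = carrier M \<longrightarrow> L = carrier P)"

definition injective_envelope ::
  "('a, 'r) ring_scheme \<Rightarrow> ('a, 'm) module \<Rightarrow> ('a, 'e) module \<Rightarrow> ('m \<Rightarrow> 'e) \<Rightarrow> bool" where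
  "injective_envelope R M E f \<longleftrightarrow> injective R E \<and> f \<in> module_mono R M E \<and>
    (\<forall>L. submodule L R E \<and> L \<inter> f ` carrier M = {\<zero>\<^bsub>E\<^esub>} \<longrightarrow> L = {\<zero>\<^bsub>E\<^esub>})"

section \<open>Artin algebras and the Auslander-Reiten translation\<close>

definition restrict_scalars :: "('k \<Rightarrow> 'a) \<Rightarrow> ('a, 'm) module \<Rightarrow> ('k, 'm) module" where
  "restrict_scalars \<phi> M = \<lparr>carrier = carrier M, mult = mult M, one = one M,
    zero = zero M, add = add M, smult = (\<lambda>r x. \<phi> r \<odot>\<^bsub>M\<^esub> x)\<rparr>"

definition artinian_cring :: "('k, 's) ring_scheme \<Rightarrow> bool" where
  "artinian_cring K \<longleftrightarrow> cring K \<and>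
    (\<forall>I :: nat \<Rightarrow> 'k set. (\<forall>i. ideal (I i) K \<and> I (Suc i) \<subseteq> I i) \<longrightarrow> (\<exists>m. \<forall>i\<ge>m. I i = I m))"

locale artin_algebra = ring \<Lambda>
  for K :: "('k, 's) ring_scheme" and \<phi> :: "'k \<Rightarrow> 'a" and \<Lambda> :: "('a, 'r) ring_scheme" +
  assumes artinian: "artinian_cring K"
    and structure_hom: "\<phi> \<in> ring_hom K \<Lambda>"
    and central: "\<lbrakk>r \<in> carrier K; a \<in> carrier \<Lambda>\<rbrakk> \<Longrightarrow> \<phi> r \<otimes>\<^bsub>\<Lambda>\<^esub> a = a \<otimes>\<^bsub>\<Lambda>\<^esub> \<phi> r"
    and fg_over_base: "fg_module K (restrict_scalars \<phi> (regular_module \<Lambda>))"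

text \<open>Right modules are left modules over the opposite ring.\<close>

definition op_ring :: "('a, 'r) ring_scheme \<Rightarrow> ('a, 'r) ring_scheme" where
  "op_ring R = R\<lparr>mult := (\<lambda>x y. y \<otimes>\<^bsub>R\<^esub> x)\<rparr>"

text \<open>The duality \<open>D = Hom\<^sub>K(-, J)\<close>, for \<open>J\<close> an injective envelope of \<open>K / rad K\<close>, sends \<open>\<Lambda>\<close>-modules
  to modules over the opposite ring.\<close>

definition dual_module ::
  "('k, 's) ring_scheme \<Rightarrow> ('k \<Rightarrow> 'a) \<Rightarrow> ('k, 'j) module \<Rightarrow> ('a, 'm) module \<Rightarrow> ('a, 'm \<Rightarrow> 'j) module" where
  "dual_module K \<phi> J M = \<lparr>carrier = module_hom K (restrict_scalars \<phi> M) J,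
    mult = undefined, one = undefined, zero = (\<lambda>x\<in>carrier M. \<zero>\<^bsub>J\<^esub>),
    add = (\<lambda>f g. \<lambda>x\<in>carrier M. f x \<oplus>\<^bsub>J\<^esub> g x), smult = (\<lambda>a f. \<lambda>x\<in>carrier M. f (a \<odot>\<^bsub>M\<^esub> x))\<rparr>"

text \<open>The functor \<open>Hom\<^sub>R(-, R)\<close> from \<open>R\<close>-modules to modules over \<open>op_ring R\<close>.\<close>

definition star_module :: "('a, 'r) ring_scheme \<Rightarrow> ('a, 'm) module \<Rightarrow> ('a, 'm \<Rightarrow> 'a) module" where
  "star_module R M = \<lparr>carrier = module_hom R M (regular_module R),
    mult = undefined, one = undefined, zero = (\<lambda>x\<in>carrier M. \<zero>\<^bsub>R\<^esub>),
    add = (\<lambda>f g. \<lambda>x\<in>carrier M. f x \<oplus>\<^bsub>R\<^esub> g x), smult = (\<lambda>a f. \<lambda>x\<in>carrier M. f x \<otimes>\<^bsub>R\<^esub> a)\<rparr>"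

text \<open>\<open>X \<cong> Tr M\<close>: for a minimal projective presentation \<open>P\<^sub>1 \<rightarrow> P\<^sub>0 \<rightarrow> M \<rightarrow> 0\<close> with first map \<open>d\<close>, the
  module \<open>X\<close> is a cokernel of \<open>Hom(d, R) : Hom\<^sub>R(P\<^sub>0, R) \<rightarrow> Hom\<^sub>R(P\<^sub>1, R)\<close>.\<close>

definition is_transpose ::
  "('a, 'r) ring_scheme \<Rightarrow> ('a, 'm) module \<Rightarrow> ('a, 'n) module \<Rightarrow> bool" where
  "is_transpose R M X \<longleftrightarrow> left_module (op_ring R) X \<and>
    (\<exists>(P0 :: 'a fmod) (P1 :: 'a fmod) \<epsilon> d \<pi>.
      projective_cover R P0 M \<epsilon> \<and>
      projective_cover R P1 (sub_module P0 (a_kernel P0 M \<epsilon>)) d \<and>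
      \<pi> \<in> module_epi (op_ring R) (star_module R P1) X \<and>
      a_kernel (star_module R P1) X \<pi> =
        (\<lambda>f. compose (carrier P1) f d) ` carrier (star_module R P0))"

text \<open>\<open>X \<cong> \<tau>\<^sup>-\<^sup>1 M\<close>, where \<open>\<tau>\<^sup>-\<^sup>1 = Tr D\<close>.\<close>

definition is_inverse_AR_translate ::
  "('k, 's) ring_scheme \<Rightarrow> ('k \<Rightarrow> 'a) \<Rightarrow> ('a, 'r) ring_scheme \<Rightarrow>
    ('a, 'm) module \<Rightarrow> ('a, 'n) module \<Rightarrow> bool" where
  "is_inverse_AR_translate K \<phi> \<Lambda> M X \<longleftrightarrow> (\<exists>(J :: 'k fmod) \<iota>.
    injective_envelope K (module_top K (regular_module K)) J \<iota> \<and>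
    is_transpose (op_ring \<Lambda>) (dual_module K \<phi> J M) X)"

section \<open>Nakayama algebras and Kupisch series\<close>

locale nakayama_algebra = artin_algebra K \<phi> \<Lambda>
  for K :: "('k, 's) ring_scheme" and \<phi> :: "'k \<Rightarrow> 'a" and \<Lambda> :: "('a, 'r) ring_scheme" +
  assumes projective_uniserial:
      "\<lbrakk>projective \<Lambda> (P :: 'a fmod); indecomposable \<Lambda> P\<rbrakk> \<Longrightarrow> uniserial \<Lambda> P"
    and injective_uniserial:
      "\<lbrakk>injective \<Lambda> (E :: 'a fmod); indecomposable \<Lambda> E\<rbrakk> \<Longrightarrow> uniserial \<Lambda> E"

text \<open>A connected ring is nonzero and not a direct product of two nonzero rings, equivalently not
  the direct sum of two nonzero two-sided ideals.\<close>

definition connected_ring :: "('a, 'r) ring_scheme \<Rightarrow> bool" where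
  "connected_ring R \<longleftrightarrow> ring R \<and> carrier R \<noteq> {\<zero>\<^bsub>R\<^esub>} \<and>
    (\<forall>A B. ideal A R \<and> ideal B R \<and> A \<inter> B = {\<zero>\<^bsub>R\<^esub>} \<and> A <+>\<^bsub>R\<^esub> B = carrier R
      \<longrightarrow> A = {\<zero>\<^bsub>R\<^esub>} \<or> B = {\<zero>\<^bsub>R\<^esub>})"

definition has_n_simples :: "('a, 'r) ring_scheme \<Rightarrow> nat \<Rightarrow> bool" where
  "has_n_simples R n \<longleftrightarrow> (\<exists>S :: nat \<Rightarrow> 'a fmod.
    (\<forall>i<n. simple_module R (S i)) \<and>
    (\<forall>i<n. \<forall>j<n. i \<noteq> j \<longrightarrow> \<not> module_iso R (S i) (S j)) \<and>
    (\<forall>X :: 'a fmod. simple_module R X \<longrightarrow> (\<exists>i<n. module_iso R X (S i))))"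

definition kupisch_series ::
  "('k, 's) ring_scheme \<Rightarrow> ('k \<Rightarrow> 'a) \<Rightarrow> ('a, 'r) ring_scheme \<Rightarrow> nat \<Rightarrow> (nat \<Rightarrow> 'a fmod) \<Rightarrow> bool" where
  "kupisch_series K \<phi> \<Lambda> n P \<longleftrightarrow>
    (\<forall>i\<in>{1..n}. projective \<Lambda> (P i) \<and> indecomposable \<Lambda> (P i)) \<and>
    (\<forall>i\<in>{1..n}. \<forall>j\<in>{1..n}. i \<noteq> j \<longrightarrow> \<not> module_iso \<Lambda> (P i) (P j)) \<and>
    (\<forall>X :: 'a fmod. projective \<Lambda> X \<and> indecomposable \<Lambda> X \<longrightarrow> (\<exists>i\<in>{1..n}. module_iso \<Lambda> X (P i))) \<and>
    (\<forall>i\<in>{1..<n}.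
      is_inverse_AR_translate K \<phi> \<Lambda> (module_top \<Lambda> (P i)) (module_top \<Lambda> (P (i + 1)))) \<and>
    (module_length \<Lambda> (P 1) \<noteq> 1 \<longrightarrow>
      is_inverse_AR_translate K \<phi> \<Lambda> (module_top \<Lambda> (P n)) (module_top \<Lambda> (P 1))) \<and>
    (\<forall>i\<in>{2..n}. module_length \<Lambda> (P i) \<ge> 2) \<and>
    (\<forall>i\<in>{1..<n}. module_length \<Lambda> (P (i + 1)) \<le> module_length \<Lambda> (P i) + 1) \<and>
    module_length \<Lambda> (P 1) \<le> module_length \<Lambda> (P n) + 1"

text \<open>Elements of \<open>\<int>/n\<int>\<close> are represented by their residues in \<open>{0..<n}\<close>, whereas a sequence
  \<open>c\<^sub>1, \<dots>, c\<^sub>n\<close> is indexed by \<open>{1..n}\<close>; \<open>cyclic n c i\<close> is \<open>c\<close> at the index in \<open>{1..n}\<close> congruent to \<open>i\<close>.\<close>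

definition cyclic :: "nat \<Rightarrow> (nat \<Rightarrow> 'b) \<Rightarrow> int \<Rightarrow> 'b" where
  "cyclic n c i = c (nat ((i - 1) mod int n) + 1)"

definition noninjective_labels :: "nat \<Rightarrow> (nat \<Rightarrow> nat) \<Rightarrow> int set" where
  "noninjective_labels n c = {i \<in> {0..<int n}. cyclic n c (i + 1) = cyclic n c i + 1}"

definition injective_labels :: "nat \<Rightarrow> (nat \<Rightarrow> nat) \<Rightarrow> int set" where
  "injective_labels n c = {i \<in> {0..<int n}. cyclic n c (i + 1) \<le> cyclic n c i}"

section \<open>Tilting modules and the subcategory cut out by the projective-injectives\<close>

text \<open>\<open>Q\<close> is a direct sum of representatives of the isomorphism classes of indecomposable
  projective-injective modules.\<close>

definition projinj_sum :: "('a, 'r) ring_scheme \<Rightarrow> ('a, 'm) module \<Rightarrow> bool" where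
  "projinj_sum R Q \<longleftrightarrow> left_module R Q \<and> (\<exists>I N. direct_decomposition R Q I N \<and>
    (\<forall>i\<in>I. indecomposable R (sub_module Q (N i)) \<and>
      projective R (sub_module Q (N i)) \<and> injective R (sub_module Q (N i))) \<and>
    (\<forall>i\<in>I. \<forall>j\<in>I. i \<noteq> j \<longrightarrow> \<not> module_iso R (sub_module Q (N i)) (sub_module Q (N j))) \<and>
    (\<forall>X :: 'a fmod. indecomposable R X \<and> projective R X \<and> injective R X \<longrightarrow>
      (\<exists>i\<in>I. module_iso R X (sub_module Q (N i)))))"

definition Gen :: "('a, 'r) ring_scheme \<Rightarrow> ('a, 'q) module \<Rightarrow> ('a, 'm) module set" where
  "Gen R Q = {M. fg_module R M \<and> (\<exists>m. module_epi R (power_module Q m) M \<noteq> {})}"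

definition Cogen :: "('a, 'r) ring_scheme \<Rightarrow> ('a, 'q) module \<Rightarrow> ('a, 'm) module set" where
  "Cogen R Q = {M. fg_module R M \<and> (\<exists>m. module_mono R M (power_module Q m) \<noteq> {})}"

definition C_subcategory :: "('a, 'r) ring_scheme \<Rightarrow> ('a, 'm) module set" where
  "C_subcategory R = {M. \<exists>Q :: 'a fmod. projinj_sum R Q \<and> M \<in> Gen R Q \<inter> Cogen R Q}"

definition add_category :: "('a, 'r) ring_scheme \<Rightarrow> ('a, 't) module \<Rightarrow> ('a, 'm) module set" where
  "add_category R T = {M. left_module R M \<and> (\<exists>m A. direct_summand R (power_module T m) A \<and>
    module_iso R M (sub_module (power_module T m) A))}"

definition tilting_module :: "('a, 'r) ring_scheme \<Rightarrow> ('a, 'm) module \<Rightarrow> bool" where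
  "tilting_module R T \<longleftrightarrow> fg_module R T \<and> basic_module R T \<and>
    projdim_le R T 1 \<and>
    Ext_vanishes R 1 T T \<and>
    (\<exists>(T0 :: 'a fmod) \<in> add_category R T. \<exists>(T1 :: 'a fmod) \<in> add_category R T.
      \<exists>f \<in> module_mono R (regular_module R) T0. \<exists>g \<in> module_epi R T0 T1.
        f ` carrier R = a_kernel T0 T1 g)"

end

theory Submission
  imports Defs
begin

text \<open>The Kupisch series turns \<open>\<Lambda>\<close> into a ring with orthogonal idempotents \<open>E i\<close>, \<open>i \<in> \<int>/n\<close>, summing to 1,
  radical \<open>J\<close>, and arrows \<open>A i\<close> with \<open>J E i = \<Lambda> (A i)\<close> and \<open>E (i - 1) J = (A i) \<Lambda>\<close>: the arrow from \<open>i - 1\<close> to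
  \<open>i\<close> is the first map of a minimal projective presentation, read through the transpose. The submodules
  of \<open>P\<^sub>i = \<Lambda> (E i)\<close> are then generated by the paths ending in \<open>i\<close>, and \<open>P\<^sub>k\<close> with \<open>k\<close> in \<open>\<Q>\<^sub>c\<close> is injective
  by Baer's criterion, with socle at \<open>k - c\<^sub>k + 1\<close>.

  Let \<open>T\<close> be a tilting module in \<open>\<C>\<^sub>\<Lambda>\<close> and \<open>i\<close> in \<open>\<P>\<^sub>c\<close>. Every element of \<open>E i Q\<close> is a multiple of \<open>A (i + 1)\<close>
  for injective \<open>Q\<close>, and this passes to \<open>T\<close> and to \<open>T\<^sub>0\<close>. Writing the image of \<open>E i\<close> in \<open>T\<^sub>0\<close> as \<open>A (i + 1) y\<close>,
  the image of \<open>y\<close> in \<open>T\<^sub>1\<close> is nonzero and killed by \<open>A (i + 1)\<close>; as \<open>T\<^sub>1\<close> is cogenerated by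
  projective-injectives, some \<open>P\<^sub>k\<close> with \<open>k\<close> in \<open>\<Q>\<^sub>c\<close> has socle at \<open>i + 1\<close>, that is \<open>i = k - c\<^sub>k\<close>. Conversely, the
  condition embeds the cokernel of the injective envelope of each non-injective \<open>P\<^sub>i\<close> into a
  projective-injective, and the sum of these cokernels and of all projective-injectives is tilting.\<close>


section \<open>Submodules, homomorphisms and isomorphisms\<close>

text \<open>The series relates simple tops only through \<open>Tr D\<close>; no quiver, no nilpotent
  radical and no almost split sequence is given. What a minimal presentation with simple transpose
  yields is cyclicity: its first term is cyclic, hence so is the radical of the second, and a
  generator of that radical is the arrow. Nilpotence has to be won separately, from descending
  chains over the artinian base. The obstacle is a simple \<open>P 1\<close>. Then no arrow into 1
  is supplied, and it must be shown that \<open>J E 1\<close> and \<open>E 0 J\<close> vanish before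
  zero may serve as that arrow. Once all submodules of the projectives are generated by paths,
  kernels, annihilators and Baer's criterion become arithmetic of path lengths modulo
  \<open>n\<close>. The number \<open>k - c k\<close> arises as follows. The cokernel of the
  envelope of a non-injective \<open>P i\<close> has composition factors from the label of the
  envelope down to \<open>i + 1\<close>, so its socle sits at \<open>i + 1\<close>, while
  \<open>P k\<close> has its socle at \<open>k - c k + 1\<close>. The condition says that these
  socles can be matched, so that the cokernels are cogenerated by projective-injectives.\<close>

lemma submodule_subset: "submodule H R M \<Longrightarrow> H \<subseteq> carrier M"
  by (simp add: submodule_def subgroup_def)

lemma submodule_zero: "submodule H R M \<Longrightarrow> \<zero>\<^bsub>M\<^esub> \<in> H"
  by (simp add: submodule_def subgroup_def)

lemma submodule_add: "\<lbrakk>submodule H R M; x \<in> H; y \<in> H\<rbrakk> \<Longrightarrow> x \<oplus>\<^bsub>M\<^esub> y \<in> H"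
  by (simp add: submodule_def subgroup_def)

lemma submodule_smult: "\<lbrakk>submodule H R M; a \<in> carrier R; x \<in> H\<rbrakk> \<Longrightarrow> a \<odot>\<^bsub>M\<^esub> x \<in> H"
  by (simp add: submodule_def submodule_axioms_def)

lemma submodule_in: "\<lbrakk>submodule H R M; x \<in> H\<rbrakk> \<Longrightarrow> x \<in> carrier M"
  using submodule_subset by blast

context left_module
begin

lemma neg_eq_smult: "x \<in> carrier M \<Longrightarrow> \<ominus>\<^bsub>M\<^esub> x = (\<ominus> \<one>) \<odot>\<^bsub>M\<^esub> x"
proof -
  assume x: "x \<in> carrier M"
  have "(\<ominus> \<one>) \<odot>\<^bsub>M\<^esub> x \<oplus>\<^bsub>M\<^esub> x = (\<ominus> \<one> \<oplus> \<one>) \<odot>\<^bsub>M\<^esub> x"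
    using x smult_l_distr[of "\<ominus> \<one>" "\<one>" x] by simp
  also have "\<dots> = \<zero>\<^bsub>M\<^esub>" using smult_zero_left[OF x] by (simp add: R.l_neg)
  finally show ?thesis using x by (simp add: M.minus_equality)
qed

lemma smult_neg: "\<lbrakk>a \<in> carrier R; x \<in> carrier M\<rbrakk> \<Longrightarrow> (\<ominus> a) \<odot>\<^bsub>M\<^esub> x = \<ominus>\<^bsub>M\<^esub> (a \<odot>\<^bsub>M\<^esub> x)"
  using smult_l_distr[of "\<ominus> a" a x] smult_zero_left[of x]
  by (metis M.minus_equality R.add.inv_closed R.l_neg smult_closed)

lemma smult_diff:
  "\<lbrakk>a \<in> carrier R; b \<in> carrier R; x \<in> carrier M\<rbrakk> \<Longrightarrow>
    (a \<ominus> b) \<odot>\<^bsub>M\<^esub> x = a \<odot>\<^bsub>M\<^esub> x \<ominus>\<^bsub>M\<^esub> b \<odot>\<^bsub>M\<^esub> x"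
  by (simp add: R.minus_eq M.minus_eq smult_l_distr smult_neg)

lemma submodule_neg: "\<lbrakk>submodule H R M; x \<in> H\<rbrakk> \<Longrightarrow> \<ominus>\<^bsub>M\<^esub> x \<in> H"
  using submodule_smult[of H R M "\<ominus> \<one>" x] submodule_in[of H R M x] by (simp add: neg_eq_smult)

lemma submodule_diff: "\<lbrakk>submodule H R M; x \<in> H; y \<in> H\<rbrakk> \<Longrightarrow> x \<ominus>\<^bsub>M\<^esub> y \<in> H"
  by (simp add: M.minus_eq submodule_add submodule_neg)

lemma submodule_finsum:
  assumes H: "submodule H R M" and "finite I" "\<And>i. i \<in> I \<Longrightarrow> f i \<in> H"
  shows "(\<Oplus>\<^bsub>M\<^esub>i\<in>I. f i) \<in> H"
  using assms(2,3)
proof (induction I)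
  case empty
  then show ?case using submodule_zero[OF H] by simp
next
  case (insert i I)
  then have "f i \<in> carrier M" "f \<in> I \<rightarrow> carrier M"
    using submodule_in[OF H] by auto
  with insert show ?case by (simp add: M.finsum_insert submodule_add[OF H])
qed

lemma carrier_submodule: "submodule (carrier M) R M"
  by (rule submoduleI') auto

lemma zero_submodule: "submodule {\<zero>\<^bsub>M\<^esub>} R M"
  by (rule submoduleI') (auto simp: smult_zero_right)

lemma cyclic_submodule: "x \<in> carrier M \<Longrightarrow> submodule {r \<odot>\<^bsub>M\<^esub> x | r. r \<in> carrier R} R M"
proof (rule submoduleI')
  assume x: "x \<in> carrier M"
  show "\<zero>\<^bsub>M\<^esub> \<in> {r \<odot>\<^bsub>M\<^esub> x | r. r \<in> carrier R}"
    using smult_zero_left[OF x] by (metis (mono_tags, lifting) R.zero_closed mem_Collect_eq)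
  show "\<And>u v. u \<in> {r \<odot>\<^bsub>M\<^esub> x | r. r \<in> carrier R} \<Longrightarrow> v \<in> {r \<odot>\<^bsub>M\<^esub> x | r. r \<in> carrier R} \<Longrightarrow>
      u \<oplus>\<^bsub>M\<^esub> v \<in> {r \<odot>\<^bsub>M\<^esub> x | r. r \<in> carrier R}"
    using x smult_l_distr by (smt (verit, best) R.add.m_closed mem_Collect_eq)
  show "\<And>a u. a \<in> carrier R \<Longrightarrow> u \<in> {r \<odot>\<^bsub>M\<^esub> x | r. r \<in> carrier R} \<Longrightarrow>
      a \<odot>\<^bsub>M\<^esub> u \<in> {r \<odot>\<^bsub>M\<^esub> x | r. r \<in> carrier R}"
    using x smult_assoc by (smt (verit, best) R.m_closed mem_Collect_eq)
qed auto

lemma submodule_sum: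
  assumes A: "submodule A R M" and B: "submodule B R M"
  shows "submodule (A <+>\<^bsub>M\<^esub> B) R M"
proof (rule submoduleI')
  note s = submodule_in[OF A] submodule_in[OF B]
  show "A <+>\<^bsub>M\<^esub> B \<subseteq> carrier M"
    using s by (auto simp: set_add_def set_mult_def)
  show "\<zero>\<^bsub>M\<^esub> \<in> A <+>\<^bsub>M\<^esub> B"
    using submodule_zero[OF A] submodule_zero[OF B]
    by (auto simp: set_add_def set_mult_def intro!: bexI[of _ "\<zero>\<^bsub>M\<^esub>"])
next
  note s = submodule_in[OF A] submodule_in[OF B]
  fix x y assume "x \<in> A <+>\<^bsub>M\<^esub> B" "y \<in> A <+>\<^bsub>M\<^esub> B"
  then obtain a b a' b' where *: "a \<in> A" "b \<in> B" "a' \<in> A" "b' \<in> B" "x = a \<oplus>\<^bsub>M\<^esub> b" "y = a' \<oplus>\<^bsub>M\<^esub> b'"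
    by (auto simp: set_add_def set_mult_def)
  then have "x \<oplus>\<^bsub>M\<^esub> y = (a \<oplus>\<^bsub>M\<^esub> a') \<oplus>\<^bsub>M\<^esub> (b \<oplus>\<^bsub>M\<^esub> b')"
    using s by (simp add: M.a_ac)
  moreover have "a \<oplus>\<^bsub>M\<^esub> a' \<in> A" "b \<oplus>\<^bsub>M\<^esub> b' \<in> B"
    using submodule_add[OF A] submodule_add[OF B] * by auto
  ultimately show "x \<oplus>\<^bsub>M\<^esub> y \<in> A <+>\<^bsub>M\<^esub> B"
    by (auto simp: set_add_def set_mult_def)
next
  note s = submodule_in[OF A] submodule_in[OF B]
  fix a x assume "a \<in> carrier R" "x \<in> A <+>\<^bsub>M\<^esub> B"
  then show "a \<odot>\<^bsub>M\<^esub> x \<in> A <+>\<^bsub>M\<^esub> B"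
    using submodule_smult[OF A] submodule_smult[OF B] s
    by (fastforce simp: set_add_def set_mult_def smult_r_distr)
qed

lemma sub_module_left_module:
  assumes H: "submodule H R M"
  shows "left_module R (sub_module M H)"
proof (intro left_module.intro left_module_axioms.intro R.ring_axioms)
  note s = submodule_in[OF H]
  show "abelian_group (sub_module M H)"
  proof (rule abelian_groupI)
    fix x assume "x \<in> carrier (sub_module M H)"
    then show "\<exists>y \<in> carrier (sub_module M H). y \<oplus>\<^bsub>sub_module M H\<^esub> x = \<zero>\<^bsub>sub_module M H\<^esub>"
      using s by (intro bexI[of _ "\<ominus>\<^bsub>M\<^esub> x"]) (auto simp: M.l_neg submodule_neg[OF H])
  qed (use s submodule_add[OF H] submodule_zero[OF H] in \<open>auto simp: M.a_ac\<close>)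
qed (use submodule_in[OF H] submodule_smult[OF H] in
    \<open>auto simp: smult_l_distr smult_r_distr smult_assoc\<close>)

lemma submodule_sub_module_iff:
  assumes H: "submodule H R M"
  shows "submodule L R (sub_module M H) \<longleftrightarrow> submodule L R M \<and> L \<subseteq> H"
proof
  interpret H: left_module R "sub_module M H" by (rule sub_module_left_module[OF H])
  assume L: "submodule L R (sub_module M H)"
  have sub: "L \<subseteq> H" using submodule_subset[OF L] by simp
  then show "submodule L R M \<and> L \<subseteq> H"
    using submodule_zero[OF L] submodule_add[OF L] submodule_smult[OF L] submodule_in[OF H]
    by (intro conjI submoduleI') auto
next
  interpret H: left_module R "sub_module M H" by (rule sub_module_left_module[OF H])
  assume L: "submodule L R M \<and> L \<subseteq> H"
  then show "submodule L R (sub_module M H)"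
    by (intro H.submoduleI') (auto intro: submodule_zero submodule_add submodule_smult)
qed

end

lemma module_hom_closed: "\<lbrakk>f \<in> module_hom R M N; x \<in> carrier M\<rbrakk> \<Longrightarrow> f x \<in> carrier N"
  by (auto simp: module_hom_def)

lemma module_hom_add:
  "\<lbrakk>f \<in> module_hom R M N; x \<in> carrier M; y \<in> carrier M\<rbrakk> \<Longrightarrow> f (x \<oplus>\<^bsub>M\<^esub> y) = f x \<oplus>\<^bsub>N\<^esub> f y"
  by (auto simp: module_hom_def)

lemma module_hom_smult:
  "\<lbrakk>f \<in> module_hom R M N; a \<in> carrier R; x \<in> carrier M\<rbrakk> \<Longrightarrow> f (a \<odot>\<^bsub>M\<^esub> x) = a \<odot>\<^bsub>N\<^esub> f x"
  by (auto simp: module_hom_def)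

lemma module_hom_ext:
  "\<lbrakk>f \<in> module_hom R M N; g \<in> module_hom R M N; \<And>x. x \<in> carrier M \<Longrightarrow> f x = g x\<rbrakk> \<Longrightarrow> f = g"
  by (rule PiE_ext[of f "carrier M" _ g]) (auto simp: module_hom_def)

lemma module_homI:
  assumes "\<And>x. x \<in> carrier M \<Longrightarrow> F x \<in> carrier N"
    and "\<And>x y. \<lbrakk>x \<in> carrier M; y \<in> carrier M\<rbrakk> \<Longrightarrow> F (x \<oplus>\<^bsub>M\<^esub> y) = F x \<oplus>\<^bsub>N\<^esub> F y"
    and "\<And>a x. \<lbrakk>a \<in> carrier R; x \<in> carrier M\<rbrakk> \<Longrightarrow> F (a \<odot>\<^bsub>M\<^esub> x) = a \<odot>\<^bsub>N\<^esub> F x"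
    and "left_module R M"
  shows "(\<lambda>x\<in>carrier M. F x) \<in> module_hom R M N"
proof -
  interpret left_module R M by fact
  show ?thesis using assms(1-3) by (auto simp: module_hom_def)
qed

lemma module_hom_zero:
  assumes "f \<in> module_hom R M N" "left_module R M" "left_module R N"
  shows "f \<zero>\<^bsub>M\<^esub> = \<zero>\<^bsub>N\<^esub>"
proof -
  interpret M: left_module R M by fact
  interpret N: left_module R N by fact
  have "f \<zero>\<^bsub>M\<^esub> = f (\<zero>\<^bsub>R\<^esub> \<odot>\<^bsub>M\<^esub> \<zero>\<^bsub>M\<^esub>)" by (simp add: M.smult_zero_left)
  also have "\<dots> = \<zero>\<^bsub>N\<^esub>"
    using assms(1) by (simp add: module_hom_smult module_hom_closed N.smult_zero_left)
  finally show ?thesis .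
qed

lemma module_hom_diff:
  assumes f: "f \<in> module_hom R M N" and MN: "left_module R M" "left_module R N"
    and x: "x \<in> carrier M" "y \<in> carrier M"
  shows "f (x \<ominus>\<^bsub>M\<^esub> y) = f x \<ominus>\<^bsub>N\<^esub> f y"
proof -
  interpret M: left_module R M by fact
  interpret N: left_module R N by fact
  show ?thesis using f x
    by (simp add: M.M.minus_eq N.M.minus_eq M.neg_eq_smult N.neg_eq_smult module_hom_add
        module_hom_smult module_hom_closed)
qed

lemma module_hom_finsum:
  assumes f: "f \<in> module_hom R M N" and MN: "left_module R M" "left_module R N"
    and "finite I" "\<And>i. i \<in> I \<Longrightarrow> x i \<in> carrier M"
  shows "f (\<Oplus>\<^bsub>M\<^esub>i\<in>I. x i) = (\<Oplus>\<^bsub>N\<^esub>i\<in>I. f (x i))"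
  using assms(4,5)
proof (induction I)
  case empty
  interpret M: left_module R M by fact
  interpret N: left_module R N by fact
  show ?case using module_hom_zero[OF f MN] by simp
next
  case (insert i I)
  interpret M: left_module R M by fact
  interpret N: left_module R N by fact
  have "x \<in> I \<rightarrow> carrier M" "x i \<in> carrier M" using insert by auto
  moreover have "(\<lambda>i. f (x i)) \<in> I \<rightarrow> carrier N" "f (x i) \<in> carrier N"
    using insert module_hom_closed[OF f] by auto
  ultimately show ?case
    using insert by (simp add: M.M.finsum_insert N.M.finsum_insert module_hom_add[OF f] M.M.finsum_closed)
qed

lemma module_hom_compose:
  assumes f: "f \<in> module_hom R M N" and g: "g \<in> module_hom R N L" and M: "left_module R M"
  shows "compose (carrier M) g f \<in> module_hom R M L"
  unfolding compose_def
  by (rule module_homI[OF _ _ _ M])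
    (use f g in \<open>auto simp: module_hom_closed module_hom_add module_hom_smult\<close>)

lemma kernel_submodule:
  assumes f: "f \<in> module_hom R M N" and MN: "left_module R M" "left_module R N"
  shows "submodule (a_kernel M N f) R M"
proof -
  interpret M: left_module R M by fact
  interpret N: left_module R N by fact
  show ?thesis unfolding a_kernel_def'
    by (rule M.submoduleI')
      (auto simp: module_hom_zero[OF f MN] module_hom_add[OF f] module_hom_smult[OF f] N.smult_zero_right)
qed

lemma image_submodule:
  assumes f: "f \<in> module_hom R M N" and MN: "left_module R M" "left_module R N"
    and H: "submodule H R M"
  shows "submodule (f ` H) R N"
proof -
  interpret M: left_module R M by fact
  interpret N: left_module R N by fact
  show ?thesis
  proof (rule N.submoduleI')
    show "f ` H \<subseteq> carrier N" using module_hom_closed[OF f] submodule_in[OF H] by auto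
    show "\<zero>\<^bsub>N\<^esub> \<in> f ` H" using module_hom_zero[OF f MN] submodule_zero[OF H] by (metis imageI)
  next
    fix u v assume "u \<in> f ` H" "v \<in> f ` H"
    then obtain x y where "x \<in> H" "y \<in> H" "u = f x" "v = f y" by auto
    then show "u \<oplus>\<^bsub>N\<^esub> v \<in> f ` H"
      using submodule_in[OF H] by (simp add: module_hom_add[OF f, symmetric] submodule_add[OF H])
  next
    fix a u assume "a \<in> carrier R" "u \<in> f ` H"
    then obtain x where "x \<in> H" "u = f x" by auto
    then show "a \<odot>\<^bsub>N\<^esub> u \<in> f ` H"
      using submodule_in[OF H] \<open>a \<in> carrier R\<close>
      by (simp add: module_hom_smult[OF f, symmetric] submodule_smult[OF H])
  qed
qed

lemma inj_on_module_hom: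
  assumes f: "f \<in> module_hom R M N" and MN: "left_module R M" "left_module R N"
    and 0: "\<And>x. \<lbrakk>x \<in> carrier M; f x = \<zero>\<^bsub>N\<^esub>\<rbrakk> \<Longrightarrow> x = \<zero>\<^bsub>M\<^esub>"
  shows "inj_on f (carrier M)"
proof (rule inj_onI)
  interpret M: left_module R M by fact
  interpret N: left_module R N by fact
  fix x y assume xy: "x \<in> carrier M" "y \<in> carrier M" "f x = f y"
  then have "f (x \<ominus>\<^bsub>M\<^esub> y) = \<zero>\<^bsub>N\<^esub>"
    using module_hom_diff[OF f MN xy(1,2)] module_hom_closed[OF f] by (simp add: N.M.minus_eq N.M.r_neg)
  then have "x \<ominus>\<^bsub>M\<^esub> y = \<zero>\<^bsub>M\<^esub>" using xy by (intro 0) auto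
  then show "x = y" using xy M.M.minus_equality[of x "\<ominus>\<^bsub>M\<^esub> y"] by (simp add: M.M.minus_eq)
qed

lemma module_isoE:
  assumes "module_iso R M N" "left_module R M"
  obtains f g where "f \<in> module_hom R M N" "g \<in> module_hom R N M"
    "\<And>x. x \<in> carrier M \<Longrightarrow> g (f x) = x" "\<And>y. y \<in> carrier N \<Longrightarrow> f (g y) = y"
proof -
  interpret M: left_module R M by fact
  obtain f where f: "f \<in> module_hom R M N" "bij_betw f (carrier M) (carrier N)"
    using assms by (auto simp: module_iso_def)
  define g where "g = (\<lambda>y\<in>carrier N. the_inv_into (carrier M) f y)"
  have gc: "g y \<in> carrier M" "f (g y) = y" if "y \<in> carrier N" for y
    using f(2) that by (auto simp: g_def bij_betw_def f_the_inv_into_f the_inv_into_into)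
  have gf: "g (f x) = x" if "x \<in> carrier M" for x
    using f that by (auto simp: g_def bij_betw_def the_inv_into_f_f)
  have "g \<in> module_hom R N M"
  proof -
    have "g (x \<oplus>\<^bsub>N\<^esub> y) = g x \<oplus>\<^bsub>M\<^esub> g y" if "x \<in> carrier N" "y \<in> carrier N" for x y
      using gf[of "g x \<oplus>\<^bsub>M\<^esub> g y"] module_hom_add[OF f(1), of "g x" "g y"] gc that by simp
    moreover have "g (a \<odot>\<^bsub>N\<^esub> x) = a \<odot>\<^bsub>M\<^esub> g x" if "a \<in> carrier R" "x \<in> carrier N" for a x
      using gf[of "a \<odot>\<^bsub>M\<^esub> g x"] module_hom_smult[OF f(1), of a "g x"] gc that by simp
    ultimately show ?thesis using gc by (auto simp: module_hom_def g_def)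
  qed
  then show ?thesis using that[OF f(1)] gc gf by blast
qed

lemma module_isoI:
  assumes "f \<in> module_hom R M N" "g \<in> module_hom R N M"
    "\<And>x. x \<in> carrier M \<Longrightarrow> g (f x) = x" "\<And>y. y \<in> carrier N \<Longrightarrow> f (g y) = y"
  shows "module_iso R M N"
  unfolding module_iso_def
  by (rule bexI[OF _ assms(1)], rule bij_betwI[of _ _ _ g])
    (use assms module_hom_closed in \<open>auto simp: Pi_iff\<close>)

lemma module_iso_sym: "\<lbrakk>module_iso R M N; left_module R M\<rbrakk> \<Longrightarrow> module_iso R N M"
  by (metis module_isoE module_isoI)

lemma module_iso_trans:
  assumes "module_iso R M N" "module_iso R N L" "left_module R M"
  shows "module_iso R M L"
proof -
  obtain f g where "f \<in> module_hom R M N" "bij_betw f (carrier M) (carrier N)"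
    "g \<in> module_hom R N L" "bij_betw g (carrier N) (carrier L)"
    using assms by (auto simp: module_iso_def)
  then show ?thesis unfolding module_iso_def
    by (intro bexI[OF _ module_hom_compose[OF _ _ assms(3)]])
      (auto simp: compose_def bij_betw_def inj_on_def module_hom_closed image_image[symmetric]
        cong: image_cong)
qed

section \<open>Finite generation, and universal properties over arbitrary carrier types\<close>

lemma fg_left_module: "fg_module R M \<Longrightarrow> left_module R M"
  by (simp add: fg_module_def)

lemma fg_module_epi:
  assumes M: "fg_module R M" and N: "left_module R N" and f: "f \<in> module_epi R M N"
  shows "fg_module R N"
proof -
  obtain S where S: "finite S" "S \<subseteq> carrier M" "\<And>N. submodule N R M \<Longrightarrow> S \<subseteq> N \<Longrightarrow> N = carrier M"
    using fg_moduleE[OF M] by metis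
  interpret M: left_module R M using M by (rule fg_left_module)
  have f': "f \<in> module_hom R M N" "f ` carrier M = carrier N" using f by (auto simp: module_epi_def)
  show ?thesis unfolding fg_module_def
  proof (intro conjI N exI[of _ "f ` S"] allI impI)
    show "finite (f ` S)" "f ` S \<subseteq> carrier N" using S f' by auto
    fix L assume L: "submodule L R N \<and> f ` S \<subseteq> L"
    have "submodule {x \<in> carrier M. f x \<in> L} R M"
      by (rule M.submoduleI')
        (use L f' N M.left_module_axioms in \<open>auto simp: module_hom_zero module_hom_add module_hom_smult
          intro: submodule_zero submodule_add submodule_smult\<close>)
    then have "{x \<in> carrier M. f x \<in> L} = carrier M" using S L by (intro S(3)) auto
    then have "f x \<in> L" if "x \<in> carrier M" for x using that by blast
    then have "carrier N \<subseteq> L" using f'(2) by (metis image_subsetI)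
    then show "L = carrier N" using L submodule_subset by blast
  qed
qed

lemma fg_module_iso:
  assumes "module_iso R M N" "fg_module R M" "left_module R N"
  shows "fg_module R N"
  using assms fg_module_epi[of R M N] by (auto simp: module_iso_def module_epi_def bij_betw_def)

text \<open>\<open>projective\<close> tests lifting only against modules of type
  \<open>'a fmod\<close>. Replacing \<open>X\<close> and \<open>Y\<close> by isomorphic copies of
  that type carries the property to all carrier types; left ideals already need this.\<close>

lemma projective_lift:
  fixes X :: "('a, 'x) module" and Y :: "('a, 'y) module"
  assumes P: "projective R P" and X: "fg_module R X" and Y: "fg_module R Y"
    and f: "f \<in> module_epi R X Y" and g: "g \<in> module_hom R P Y"
  obtains h where "h \<in> module_hom R P X" "\<And>x. x \<in> carrier P \<Longrightarrow> f (h x) = g x"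
proof -
  have lm: "left_module R X" "left_module R Y" "left_module R P"
    using P X Y by (auto simp: fg_module_def projective_def)
  obtain X' :: "'a fmod" where X': "fg_module R X'" "module_iso R X X'"
    using fg_module_iso_fmod[OF X] by blast
  obtain Y' :: "'a fmod" where Y': "fg_module R Y'" "module_iso R Y Y'"
    using fg_module_iso_fmod[OF Y] by blast
  obtain a b where ab: "a \<in> module_hom R X X'" "b \<in> module_hom R X' X"
    "\<And>x. x \<in> carrier X \<Longrightarrow> b (a x) = x" "\<And>x. x \<in> carrier X' \<Longrightarrow> a (b x) = x"
    using module_isoE[OF X'(2) lm(1)] by blast
  obtain c d where cd: "c \<in> module_hom R Y Y'" "d \<in> module_hom R Y' Y"
    "\<And>x. x \<in> carrier Y \<Longrightarrow> d (c x) = x" "\<And>x. x \<in> carrier Y' \<Longrightarrow> c (d x) = x"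
    using module_isoE[OF Y'(2) lm(2)] by blast
  have fh: "f \<in> module_hom R X Y" "f ` carrier X = carrier Y" using f by (auto simp: module_epi_def)
  define F where "F = compose (carrier X') c (compose (carrier X') f b)"
  have F: "F \<in> module_hom R X' Y'" unfolding F_def
    using ab cd fh X' by (intro module_hom_compose) (auto simp: fg_module_def)
  have Fx: "F x = c (f (b x))" if "x \<in> carrier X'" for x using that by (simp add: F_def compose_def)
  have "carrier Y' \<subseteq> F ` carrier X'"
  proof
    fix y assume y: "y \<in> carrier Y'"
    then have "d y \<in> f ` carrier X" using cd(2) fh(2) module_hom_closed by metis
    then obtain x where "x \<in> carrier X" "d y = f x" by auto
    then show "y \<in> F ` carrier X'"
      using y ab cd Fx[of "a x"] module_hom_closed[OF ab(1)] by (intro image_eqI[of _ _ "a x"]) (metis, metis)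
  qed
  then have "F \<in> module_epi R X' Y'" using F by (auto simp: module_epi_def module_hom_closed)
  moreover have "compose (carrier P) c g \<in> module_hom R P Y'"
    using g cd(1) lm(3) by (rule module_hom_compose)
  ultimately obtain h where h: "h \<in> module_hom R P X'"
    "compose (carrier P) c g = compose (carrier P) F h"
    using P X'(1) Y'(1) unfolding projective_def by metis
  show ?thesis
  proof (rule that[of "compose (carrier P) b h"])
    show "compose (carrier P) b h \<in> module_hom R P X" using h(1) ab(2) lm(3) by (rule module_hom_compose)
    fix x assume x: "x \<in> carrier P"
    have hx: "h x \<in> carrier X'" using h(1) x by (rule module_hom_closed)
    have "c (g x) = c (f (b (h x)))"
      using fun_cong[OF h(2), of x] x hx by (simp add: compose_def Fx)
    then have "g x = f (b (h x))"
      using cd(3) x hx g fh(1) ab(2) module_hom_closed by metis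
    then show "f (compose (carrier P) b h x) = g x" using x by (simp add: compose_def)
  qed
qed

text \<open>The same change of carrier type as for lifting. It is applied to left ideals, whose
  elements are ring elements.\<close>

lemma injective_extend:
  fixes X :: "('a, 'x) module" and Y :: "('a, 'y) module"
  assumes P: "injective R E" and X: "fg_module R X" and Y: "fg_module R Y"
    and f: "f \<in> module_mono R X Y" and g: "g \<in> module_hom R X E"
  obtains h where "h \<in> module_hom R Y E" "\<And>x. x \<in> carrier X \<Longrightarrow> h (f x) = g x"
proof -
  have lm: "left_module R X" "left_module R Y" "left_module R E"
    using P X Y by (auto simp: fg_module_def injective_def)
  obtain X' :: "'a fmod" where X': "fg_module R X'" "module_iso R X X'"
    using fg_module_iso_fmod[OF X] by blast
  obtain Y' :: "'a fmod" where Y': "fg_module R Y'" "module_iso R Y Y'"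
    using fg_module_iso_fmod[OF Y] by blast
  obtain a b where ab: "a \<in> module_hom R X X'" "b \<in> module_hom R X' X"
    "\<And>x. x \<in> carrier X \<Longrightarrow> b (a x) = x" "\<And>x. x \<in> carrier X' \<Longrightarrow> a (b x) = x"
    using module_isoE[OF X'(2) lm(1)] by blast
  obtain c d where cd: "c \<in> module_hom R Y Y'" "d \<in> module_hom R Y' Y"
    "\<And>x. x \<in> carrier Y \<Longrightarrow> d (c x) = x" "\<And>x. x \<in> carrier Y' \<Longrightarrow> c (d x) = x"
    using module_isoE[OF Y'(2) lm(2)] by blast
  have fh: "f \<in> module_hom R X Y" "inj_on f (carrier X)" using f by (auto simp: module_mono_def)
  have lm': "left_module R X'" "left_module R Y'" using X' Y' by (auto simp: fg_module_def)
  define F where "F = compose (carrier X') c (compose (carrier X') f b)"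
  have F: "F \<in> module_hom R X' Y'" unfolding F_def
    using ab cd fh lm' by (intro module_hom_compose)
  have Fx: "F x = c (f (b x))" if "x \<in> carrier X'" for x using that by (simp add: F_def compose_def)
  have "inj_on F (carrier X')"
  proof (rule inj_onI)
    fix x y assume xy: "x \<in> carrier X'" "y \<in> carrier X'" "F x = F y"
    then have "f (b x) = f (b y)"
      using Fx cd(3) fh(1) ab(2) module_hom_closed by metis
    then have "b x = b y" using fh(2) xy ab(2) module_hom_closed by (metis inj_onD)
    then show "x = y" using ab(4) xy by metis
  qed
  then have "F \<in> module_mono R X' Y'" using F by (auto simp: module_mono_def)
  moreover have "compose (carrier X') g b \<in> module_hom R X' E"
    using ab(2) g lm'(1) by (rule module_hom_compose)
  ultimately obtain h where h: "h \<in> module_hom R Y' E"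
    "compose (carrier X') g b = compose (carrier X') h F"
    using P X'(1) Y'(1) unfolding injective_def by metis
  show ?thesis
  proof (rule that[of "compose (carrier Y) h c"])
    show "compose (carrier Y) h c \<in> module_hom R Y E" using cd(1) h(1) lm(2) by (rule module_hom_compose)
    fix x assume x: "x \<in> carrier X"
    have ax: "a x \<in> carrier X'" using ab(1) x by (rule module_hom_closed)
    have "g x = h (c (f x))"
      using fun_cong[OF h(2), of "a x"] x ax by (simp add: compose_def Fx ab(3))
    then show "compose (carrier Y) h c (f x) = g x"
      using x fh(1) by (simp add: compose_def module_hom_closed)
  qed
qed

section \<open>Invariance under isomorphism\<close>

lemma projective_iso:
  assumes P: "projective R P" and iso: "module_iso R P Q" and Q: "left_module R Q"
  shows "projective R Q"
  unfolding projective_def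
proof (intro conjI allI impI ballI)
  have lm: "left_module R P" using P by (simp add: projective_def fg_module_def)
  obtain a b where ab: "a \<in> module_hom R P Q" "b \<in> module_hom R Q P"
    "\<And>x. x \<in> carrier P \<Longrightarrow> b (a x) = x" "\<And>x. x \<in> carrier Q \<Longrightarrow> a (b x) = x"
    using module_isoE[OF iso lm] by blast
  show "fg_module R Q" using P iso Q fg_module_iso by (auto simp: projective_def)
  fix X Y :: "'a fmod" and f g
  assume XY: "fg_module R X \<and> fg_module R Y" and f: "f \<in> module_epi R X Y" and g: "g \<in> module_hom R Q Y"
  obtain h where h: "h \<in> module_hom R P X" "\<And>x. x \<in> carrier P \<Longrightarrow> f (h x) = compose (carrier P) g a x"
    using projective_lift[OF P _ _ f module_hom_compose[OF ab(1) g lm]] XY by blast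
  show "\<exists>h\<in>module_hom R Q X. g = compose (carrier Q) f h"
  proof (intro bexI[OF _ module_hom_compose[OF ab(2) h(1) Q]] module_hom_ext[OF g])
    show "compose (carrier Q) f (compose (carrier Q) h b) \<in> module_hom R Q Y"
      using f by (intro module_hom_compose[OF module_hom_compose[OF ab(2) h(1) Q] _ Q]) (auto simp: module_epi_def)
    fix x assume "x \<in> carrier Q"
    then show "g x = compose (carrier Q) f (compose (carrier Q) h b) x"
      using h(2)[of "b x"] ab(2,4) by (simp add: compose_def module_hom_closed)
  qed
qed

lemma injective_iso:
  assumes P: "injective R P" and iso: "module_iso R P Q" and Q: "left_module R Q"
  shows "injective R Q"
  unfolding injective_def
proof (intro conjI allI impI ballI)
  have lm: "left_module R P" using P by (simp add: injective_def fg_module_def)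
  obtain a b where ab: "a \<in> module_hom R P Q" "b \<in> module_hom R Q P"
    "\<And>x. x \<in> carrier P \<Longrightarrow> b (a x) = x" "\<And>x. x \<in> carrier Q \<Longrightarrow> a (b x) = x"
    using module_isoE[OF iso lm] by blast
  show "fg_module R Q" using P iso Q fg_module_iso by (auto simp: injective_def)
  fix X Y :: "'a fmod" and f g
  assume XY: "fg_module R X \<and> fg_module R Y" and f: "f \<in> module_mono R X Y" and g: "g \<in> module_hom R X Q"
  have X: "left_module R X" "left_module R Y" using XY by (auto simp: fg_module_def)
  obtain h where h: "h \<in> module_hom R Y P" "\<And>x. x \<in> carrier X \<Longrightarrow> h (f x) = compose (carrier X) b g x"
    using injective_extend[OF P _ _ f module_hom_compose[OF g ab(2) X(1)]] XY by blast
  have fh: "f \<in> module_hom R X Y" using f by (auto simp: module_mono_def)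
  show "\<exists>h\<in>module_hom R Y Q. g = compose (carrier X) h f"
  proof (intro bexI[OF _ module_hom_compose[OF h(1) ab(1) X(2)]] module_hom_ext[OF g])
    show "compose (carrier X) (compose (carrier Y) a h) f \<in> module_hom R X Q"
      by (intro module_hom_compose[OF fh module_hom_compose[OF h(1) ab(1) X(2)] X(1)])
    fix x assume x: "x \<in> carrier X"
    then show "g x = compose (carrier X) (compose (carrier Y) a h) f x"
      using h(2)[of x] ab(4)[of "g x"] module_hom_closed[OF g x] module_hom_closed[OF fh x]
      by (simp add: compose_def)
  qed
qed

lemma image_inverse:
  assumes "\<And>y. y \<in> A \<Longrightarrow> f (g y) = y" "H \<subseteq> A"
  shows "f ` g ` H = H"
  using assms by (simp add: image_image subset_iff)

lemma hom_inverse_Int: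
  assumes "\<And>y. y \<in> carrier N \<Longrightarrow> f (g y) = y" "A \<subseteq> carrier N" "B \<subseteq> carrier N"
  shows "g ` A \<inter> g ` B = g ` (A \<inter> B)"
proof -
  have "y = z" if "y \<in> A" "z \<in> B" "g y = g z" for y z
    using assms that by (metis subsetD)
  then show ?thesis by blast
qed

lemma indecomposable_iso:
  assumes M: "indecomposable R M" and iso: "module_iso R M N" and N: "left_module R N"
  shows "indecomposable R N"
  unfolding indecomposable_def
proof (intro conjI allI impI N)
  have lm: "left_module R M" using M by (simp add: indecomposable_def)
  interpret M: left_module R M by fact
  interpret N: left_module R N by fact
  obtain f g where fg: "f \<in> module_hom R M N" "g \<in> module_hom R N M"
    "\<And>x. x \<in> carrier M \<Longrightarrow> g (f x) = x" "\<And>x. x \<in> carrier N \<Longrightarrow> f (g x) = x"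
    using module_isoE[OF iso lm] by blast
  note z = module_hom_zero[OF fg(1) lm N] module_hom_zero[OF fg(2) N lm]
  show "carrier N \<noteq> {\<zero>\<^bsub>N\<^esub>}"
  proof
    assume *: "carrier N = {\<zero>\<^bsub>N\<^esub>}"
    have "x = \<zero>\<^bsub>M\<^esub>" if "x \<in> carrier M" for x
      using module_hom_closed[OF fg(1) that] fg(3)[OF that] * z by auto
    then have "carrier M = {\<zero>\<^bsub>M\<^esub>}" using M.M.zero_closed by blast
    then show False using M by (simp add: indecomposable_def)
  qed
  fix A B assume AB: "submodule A R N \<and> submodule B R N \<and> A \<inter> B = {\<zero>\<^bsub>N\<^esub>} \<and> A <+>\<^bsub>N\<^esub> B = carrier N"
  then have sub: "A \<subseteq> carrier N" "B \<subseteq> carrier N" using submodule_subset by auto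
  have "g ` A \<inter> g ` B = {\<zero>\<^bsub>M\<^esub>}"
    using hom_inverse_Int[of N f g, OF fg(4) sub] AB z by simp
  moreover have "g ` A <+>\<^bsub>M\<^esub> g ` B = carrier M"
  proof
    show "g ` A <+>\<^bsub>M\<^esub> g ` B \<subseteq> carrier M"
      using sub module_hom_closed[OF fg(2)] by (auto simp: set_add_def set_mult_def)
    show "carrier M \<subseteq> g ` A <+>\<^bsub>M\<^esub> g ` B"
    proof
      fix x assume x: "x \<in> carrier M"
      then have "f x \<in> A <+>\<^bsub>N\<^esub> B" using AB module_hom_closed[OF fg(1)] by blast
      then obtain a b where ab: "a \<in> A" "b \<in> B" "f x = a \<oplus>\<^bsub>N\<^esub> b" by (auto simp: set_add_def set_mult_def)
      then have "x = g a \<oplus>\<^bsub>M\<^esub> g b" using fg(3)[OF x] sub module_hom_add[OF fg(2), of a b] by auto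
      then show "x \<in> g ` A <+>\<^bsub>M\<^esub> g ` B" using ab by (auto simp: set_add_def set_mult_def)
    qed
  qed
  moreover have "submodule (g ` A) R M" "submodule (g ` B) R M"
    using image_submodule[OF fg(2) N lm] AB by auto
  ultimately have "g ` A = {\<zero>\<^bsub>M\<^esub>} \<or> g ` B = {\<zero>\<^bsub>M\<^esub>}"
    using M unfolding indecomposable_def by blast
  moreover have "H = {\<zero>\<^bsub>N\<^esub>}" if "g ` H = {\<zero>\<^bsub>M\<^esub>}" "H \<subseteq> carrier N" for H
  proof -
    have "f ` g ` H = H" using that(2) fg(4) by (intro image_inverse)
    then show ?thesis using that(1) z by simp
  qed
  ultimately show "A = {\<zero>\<^bsub>N\<^esub>} \<or> B = {\<zero>\<^bsub>N\<^esub>}" using sub by blast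
qed

lemma uniserial_iso:
  assumes M: "uniserial R M" and iso: "module_iso R M N" and N: "left_module R N"
  shows "uniserial R N"
  unfolding uniserial_def
proof (intro conjI allI impI N)
  have lm: "left_module R M" using M by (simp add: uniserial_def)
  obtain f g where fg: "f \<in> module_hom R M N" "g \<in> module_hom R N M"
    "\<And>x. x \<in> carrier M \<Longrightarrow> g (f x) = x" "\<And>x. x \<in> carrier N \<Longrightarrow> f (g x) = x"
    using module_isoE[OF iso lm] by blast
  fix A B assume AB: "submodule A R N \<and> submodule B R N"
  then have "g ` A \<subseteq> g ` B \<or> g ` B \<subseteq> g ` A"
    using M image_submodule[OF fg(2) N lm] unfolding uniserial_def by blast
  then show "A \<subseteq> B \<or> B \<subseteq> A"
  proof -
    have "f ` g ` A = A" "f ` g ` B = B"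
      by (rule image_inverse[of "carrier N" f g, OF fg(4)], assumption, use AB submodule_subset in blast)+
    moreover have "f ` g ` A \<subseteq> f ` g ` B \<or> f ` g ` B \<subseteq> f ` g ` A"
      using \<open>g ` A \<subseteq> g ` B \<or> g ` B \<subseteq> g ` A\<close> image_mono by metis
    ultimately show ?thesis by simp
  qed
qed

lemma composition_series_iso:
  assumes iso: "module_iso R M N" and lm: "left_module R M" and N: "left_module R N"
    and S: "composition_series R M k S"
  shows "\<exists>S'. composition_series R N k S'"
proof -
  interpret M: left_module R M by fact
  interpret N: left_module R N by fact
  obtain f g where fg: "f \<in> module_hom R M N" "g \<in> module_hom R N M"
    "\<And>x. x \<in> carrier M \<Longrightarrow> g (f x) = x" "\<And>x. x \<in> carrier N \<Longrightarrow> f (g x) = x"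
    using module_isoE[OF iso lm] by blast
  note z = module_hom_zero[OF fg(1) lm N] module_hom_zero[OF fg(2) N lm]
  have sub: "submodule (S i) R M" if "i \<le> k" for i using S that by (simp add: composition_series_def)
  have sub': "submodule (f ` S i) R N" if "i \<le> k" for i
    using image_submodule[OF fg(1) lm N sub[OF that]] .
  have gf: "g ` f ` H = H" if "H \<subseteq> carrier M" for H
    using fg(3) that by (rule image_inverse)
  have fg': "f ` g ` H = H" if "H \<subseteq> carrier N" for H
    using fg(4) that by (rule image_inverse)
  have "maximal_submodule R (sub_module N (f ` S (Suc i))) (f ` S i)" if i: "i < k" for i
  proof -
    have mx: "maximal_submodule R (sub_module M (S (Suc i))) (S i)"
      using S i by (simp add: composition_series_def)
    have 1: "submodule (S i) R M \<and> S i \<subseteq> S (Suc i)" "S i \<noteq> S (Suc i)"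
      using mx M.submodule_sub_module_iff[OF sub[of "Suc i"]] i by (auto simp: maximal_submodule_def)
    have "S i \<subseteq> carrier M" "S (Suc i) \<subseteq> carrier M" using submodule_subset[OF sub[of i]] submodule_subset[OF sub[of "Suc i"]] i by auto
    then have e: "g ` f ` S i = S i" "g ` f ` S (Suc i) = S (Suc i)" by (simp_all only: gf)
    show ?thesis unfolding maximal_submodule_def
    proof (intro conjI allI impI)
      show "submodule (f ` S i) R (sub_module N (f ` S (Suc i)))"
        using N.submodule_sub_module_iff[OF sub'[of "Suc i"]] sub'[of i] i 1 by auto
      show "f ` S i \<noteq> carrier (sub_module N (f ` S (Suc i)))"
      proof
        assume "f ` S i = carrier (sub_module N (f ` S (Suc i)))"
        then have "g ` f ` S i = g ` f ` S (Suc i)" by simp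
        then show False using 1(2) unfolding e by blast
      qed
      fix L assume L: "submodule L R (sub_module N (f ` S (Suc i))) \<and> f ` S i \<subseteq> L"
      then have L': "submodule L R N" "L \<subseteq> f ` S (Suc i)"
        using N.submodule_sub_module_iff[OF sub'[of "Suc i"]] i by auto
      have "g ` L \<subseteq> S (Suc i)" "S i \<subseteq> g ` L"
        using image_mono[OF L'(2), of g] image_mono[of "f ` S i" L g] L e by (simp_all del: image_subset_iff)
      moreover have "submodule (g ` L) R M" using image_submodule[OF fg(2) N lm L'(1)] .
      ultimately have "g ` L = S i \<or> g ` L = S (Suc i)"
        using mx M.submodule_sub_module_iff[OF sub[of "Suc i"]] i by (auto simp: maximal_submodule_def)
      then show "L = f ` S i \<or> L = carrier (sub_module N (f ` S (Suc i)))"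
        using fg'[OF submodule_subset[OF L'(1)]] by auto
    qed
  qed
  moreover have "f ` S 0 = {\<zero>\<^bsub>N\<^esub>}" using S z by (simp add: composition_series_def)
  moreover have "f ` S k = carrier N"
  proof -
    have "f ` g ` carrier N = carrier N" by (rule fg') simp
    moreover have "g ` carrier N \<subseteq> carrier M" "f ` carrier M \<subseteq> carrier N"
      by (auto intro: module_hom_closed[OF fg(1)] module_hom_closed[OF fg(2)])
    ultimately have "f ` carrier M = carrier N" by (metis image_mono subset_antisym)
    then show ?thesis using S by (simp add: composition_series_def)
  qed
  ultimately show ?thesis using sub' unfolding composition_series_def by (intro exI[of _ "\<lambda>i. f ` S i"]) auto
qed

text \<open>Isomorphic modules have composition series of the same lengths, so both
  \<open>THE\<close> descriptions range over the same predicate.\<close>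

lemma module_length_iso:
  assumes iso: "module_iso R M N" and lm: "left_module R M" and N: "left_module R N"
  shows "module_length R M = module_length R N"
  unfolding module_length_def
  using composition_series_iso[OF iso lm N] composition_series_iso[OF module_iso_sym[OF iso lm] N lm]
  by (intro arg_cong[of _ _ The] ext) blast

section \<open>Coordinate modules\<close>

lemma regular_module_simps [simp]:
  "carrier (regular_module R) = carrier R" "zero (regular_module R) = zero R"
  "add (regular_module R) = add R" "smult (regular_module R) = mult R"
  by (simp_all add: regular_module_def)

lemma (in ring) regular_left_module: "left_module R (regular_module R)"
proof (intro left_module.intro left_module_axioms.intro ring_axioms)
  show "abelian_group (regular_module R)"
    by (rule abelian_groupI) (auto simp: a_ac intro: l_neg)
qed (auto simp: l_distr r_distr m_assoc)

lemma finsum_regular_module: "finsum (regular_module R) f I = finsum R f I"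
  by (simp add: finsum_def finprod_def comp_def)

abbreviation left_ideal :: "'a set \<Rightarrow> ('a, 'r) ring_scheme \<Rightarrow> bool" where
  "left_ideal U R \<equiv> submodule U R (regular_module R)"

context left_module
begin

lemma finsum_smult:
  assumes "finite I" "\<And>i. i \<in> I \<Longrightarrow> f i \<in> carrier R" "x \<in> carrier M"
  shows "(\<Oplus>i\<in>I. f i) \<odot>\<^bsub>M\<^esub> x = (\<Oplus>\<^bsub>M\<^esub>i\<in>I. f i \<odot>\<^bsub>M\<^esub> x)"
  using assms(1,2)
proof (induction I)
  case empty then show ?case using assms(3) by (simp add: smult_zero_left)
next
  case (insert i I)
  then have "f \<in> I \<rightarrow> carrier R" "f i \<in> carrier R" "(\<lambda>i. f i \<odot>\<^bsub>M\<^esub> x) \<in> I \<rightarrow> carrier M" using assms(3) by auto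
  then show ?case using insert assms(3)
    by (simp add: R.finsum_insert M.finsum_insert smult_l_distr R.finsum_closed)
qed

end

text \<open>Tuples \<open>(x\<^sub>0, \<dots>, x\<^sub>m\<^sub>-\<^sub>1)\<close> with \<open>x\<^sub>i\<close> in a left ideal \<open>U i\<close>, each wrapped in a
  singleton so that the module lives in \<open>'a fmod\<close>.\<close>

definition fbox :: "('a, 'r) ring_scheme \<Rightarrow> nat \<Rightarrow> (nat \<Rightarrow> 'a set) \<Rightarrow> 'a fmod" where
  "fbox R m U = \<lparr>carrier = (\<lambda>x. {x}) ` Pi\<^sub>E {..<m} U, mult = undefined, one = undefined,
    zero = {\<lambda>i\<in>{..<m}. \<zero>\<^bsub>R\<^esub>},
    add = (\<lambda>X Y. {\<lambda>i\<in>{..<m}. the_elem X i \<oplus>\<^bsub>R\<^esub> the_elem Y i}),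
    smult = (\<lambda>a X. {\<lambda>i\<in>{..<m}. a \<otimes>\<^bsub>R\<^esub> the_elem X i})\<rparr>"

definition vec :: "nat \<Rightarrow> (nat \<Rightarrow> 'a) \<Rightarrow> (nat \<Rightarrow> 'a) set" where
  "vec m x = {\<lambda>i\<in>{..<m}. x i}"

lemma vec_nth [simp]: "i < m \<Longrightarrow> the_elem (vec m x) i = x i"
  by (simp add: vec_def)

lemma vec_cong: "(\<And>i. i < m \<Longrightarrow> x i = y i) \<Longrightarrow> vec m x = vec m y"
  by (auto simp: vec_def)

lemma vec_eq_iff: "vec m x = vec m y \<longleftrightarrow> (\<forall>i<m. x i = y i)"
  by (metis vec_cong vec_nth)

lemma fbox_carrier_iff: "X \<in> carrier (fbox R m U) \<longleftrightarrow> X = vec m (the_elem X) \<and> (\<forall>i<m. the_elem X i \<in> U i)"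
proof
  assume "X \<in> carrier (fbox R m U)"
  then obtain x where x: "x \<in> Pi\<^sub>E {..<m} U" "X = {x}" by (auto simp: fbox_def)
  then have "restrict x {..<m} = x" by (auto simp: PiE_def extensional_restrict)
  then show "X = vec m (the_elem X) \<and> (\<forall>i<m. the_elem X i \<in> U i)"
    using x by (auto simp: vec_def)
next
  assume *: "X = vec m (the_elem X) \<and> (\<forall>i<m. the_elem X i \<in> U i)"
  then have "restrict (the_elem X) {..<m} \<in> Pi\<^sub>E {..<m} U" by auto
  then have "vec m (the_elem X) \<in> carrier (fbox R m U)" unfolding fbox_def vec_def by simp
  then show "X \<in> carrier (fbox R m U)" using * by simp
qed

lemma vec_in_fbox [intro]: "(\<And>i. i < m \<Longrightarrow> x i \<in> U i) \<Longrightarrow> vec m x \<in> carrier (fbox R m U)"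
  unfolding fbox_carrier_iff by (simp add: vec_eq_iff)

lemma fbox_nth: "\<lbrakk>X \<in> carrier (fbox R m U); i < m\<rbrakk> \<Longrightarrow> the_elem X i \<in> U i"
  by (simp add: fbox_carrier_iff)

lemma fbox_ext:
  "\<lbrakk>X \<in> carrier (fbox R m U); Y \<in> carrier (fbox R m U'); \<And>i. i < m \<Longrightarrow> the_elem X i = the_elem Y i\<rbrakk> \<Longrightarrow> X = Y"
  by (metis fbox_carrier_iff vec_cong)

lemma fbox_simps:
  "zero (fbox R m U) = vec m (\<lambda>i. \<zero>\<^bsub>R\<^esub>)"
  "add (fbox R m U) X Y = vec m (\<lambda>i. the_elem X i \<oplus>\<^bsub>R\<^esub> the_elem Y i)"
  "smult (fbox R m U) a X = vec m (\<lambda>i. a \<otimes>\<^bsub>R\<^esub> the_elem X i)"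
  by (simp_all add: fbox_def vec_def)

context ring
begin

lemma left_ideal_mult: "\<lbrakk>left_ideal U R; a \<in> carrier R; x \<in> U\<rbrakk> \<Longrightarrow> a \<otimes> x \<in> U"
  using submodule_smult[of U R "regular_module R" a x] by simp

lemma left_ideal_add: "\<lbrakk>left_ideal U R; x \<in> U; y \<in> U\<rbrakk> \<Longrightarrow> x \<oplus> y \<in> U"
  using submodule_add[of U R "regular_module R" x y] by simp

lemma left_ideal_zero: "left_ideal U R \<Longrightarrow> \<zero> \<in> U"
  using submodule_zero[of U R "regular_module R"] by simp

lemma left_ideal_in: "\<lbrakk>left_ideal U R; x \<in> U\<rbrakk> \<Longrightarrow> x \<in> carrier R"
  using submodule_in[of U R "regular_module R" x] by simp

definition lgen :: "'a \<Rightarrow> 'a set" where "lgen u = {r \<otimes> u | r. r \<in> carrier R}"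

lemma lgen_left_ideal: "u \<in> carrier R \<Longrightarrow> left_ideal (lgen u) R"
  using left_module.cyclic_submodule[OF regular_left_module, of u] by (simp add: lgen_def)

lemma lgen_self: "u \<in> carrier R \<Longrightarrow> u \<in> lgen u"
  unfolding lgen_def by (metis (mono_tags, lifting) l_one mem_Collect_eq one_closed)

lemma lgen_minimal: "\<lbrakk>left_ideal U R; u \<in> U\<rbrakk> \<Longrightarrow> lgen u \<subseteq> U"
  by (auto simp: lgen_def left_ideal_mult)

lemma lgen_zero: "lgen \<zero> = {\<zero>}"
  using lgen_self[of \<zero>] by (auto simp: lgen_def)

lemma zero_left_ideal: "left_ideal {\<zero>} R"
  using left_module.zero_submodule[OF regular_left_module] by simp

lemma fbox_in:
  "\<lbrakk>\<And>i. i < m \<Longrightarrow> left_ideal (U i) R; X \<in> carrier (fbox R m U); i < m\<rbrakk> \<Longrightarrow> the_elem X i \<in> carrier R"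
  by (meson fbox_nth left_ideal_in)

lemma fbox_left_module:
  assumes U: "\<And>i. i < m \<Longrightarrow> left_ideal (U i) R"
  shows "left_module R (fbox R m U)"
proof (intro left_module.intro left_module_axioms.intro ring_axioms)
  have c: "the_elem X i \<in> carrier R" if "X \<in> carrier (fbox R m U)" "i < m" for X i
    using U that by (rule fbox_in)
  note v = vec_in_fbox left_ideal_mult[OF U] left_ideal_add[OF U] left_ideal_zero[OF U] fbox_nth
  show "abelian_group (fbox R m U)"
  proof (rule abelian_groupI)
    fix X Y Z assume "X \<in> carrier (fbox R m U)" "Y \<in> carrier (fbox R m U)" "Z \<in> carrier (fbox R m U)"
    then show "X \<oplus>\<^bsub>fbox R m U\<^esub> Y \<oplus>\<^bsub>fbox R m U\<^esub> Z = X \<oplus>\<^bsub>fbox R m U\<^esub> (Y \<oplus>\<^bsub>fbox R m U\<^esub> Z)"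
      using c by (auto simp: fbox_simps a_assoc intro!: vec_cong)
  next
    fix X Y assume "X \<in> carrier (fbox R m U)" "Y \<in> carrier (fbox R m U)"
    then show "X \<oplus>\<^bsub>fbox R m U\<^esub> Y = Y \<oplus>\<^bsub>fbox R m U\<^esub> X"
      using c by (auto simp: fbox_simps a_comm intro!: vec_cong)
  next
    fix X assume X: "X \<in> carrier (fbox R m U)"
    then show "\<zero>\<^bsub>fbox R m U\<^esub> \<oplus>\<^bsub>fbox R m U\<^esub> X = X"
      using c by (intro fbox_ext[OF _ X, of _ U]) (auto simp: fbox_simps intro!: v)
    have "\<ominus> the_elem X i \<in> U i" if "i < m" for i
      using left_module.submodule_neg[OF regular_left_module U[OF that] fbox_nth[OF X that]]
        c[OF X that] left_module.neg_eq_smult[OF regular_left_module, of "the_elem X i"] l_minus[of \<one>]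
      by simp
    then show "\<exists>y\<in>carrier (fbox R m U). y \<oplus>\<^bsub>fbox R m U\<^esub> X = \<zero>\<^bsub>fbox R m U\<^esub>"
      using c[OF X] by (intro bexI[of _ "vec m (\<lambda>i. \<ominus> the_elem X i)"]) (auto simp: fbox_simps l_neg intro!: vec_cong)
  qed (auto simp: fbox_simps intro!: v)
  show "a \<odot>\<^bsub>fbox R m U\<^esub> X \<in> carrier (fbox R m U)" if "a \<in> carrier R" "X \<in> carrier (fbox R m U)" for a X
    using that by (auto simp: fbox_simps intro!: v)
  show "(a \<oplus> b) \<odot>\<^bsub>fbox R m U\<^esub> X = a \<odot>\<^bsub>fbox R m U\<^esub> X \<oplus>\<^bsub>fbox R m U\<^esub> b \<odot>\<^bsub>fbox R m U\<^esub> X"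
    "(a \<otimes> b) \<odot>\<^bsub>fbox R m U\<^esub> X = a \<odot>\<^bsub>fbox R m U\<^esub> (b \<odot>\<^bsub>fbox R m U\<^esub> X)"
    if "a \<in> carrier R" "b \<in> carrier R" "X \<in> carrier (fbox R m U)" for a b X
    using that c by (auto simp: fbox_simps l_distr m_assoc intro!: vec_cong)
  show "a \<odot>\<^bsub>fbox R m U\<^esub> (X \<oplus>\<^bsub>fbox R m U\<^esub> Y) = a \<odot>\<^bsub>fbox R m U\<^esub> X \<oplus>\<^bsub>fbox R m U\<^esub> a \<odot>\<^bsub>fbox R m U\<^esub> Y"
    if "a \<in> carrier R" "X \<in> carrier (fbox R m U)" "Y \<in> carrier (fbox R m U)" for a X Y
    using that c by (auto simp: fbox_simps r_distr intro!: vec_cong)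
  show "\<one> \<odot>\<^bsub>fbox R m U\<^esub> X = X" if X: "X \<in> carrier (fbox R m U)" for X
    using c[OF X] fbox_nth[OF X] by (intro fbox_ext[OF _ X, of _ U]) (auto simp: fbox_simps)
qed

text \<open>The inclusion of the \<open>i\<close>-th factor.\<close>

definition sg :: "nat \<Rightarrow> nat \<Rightarrow> 'a \<Rightarrow> (nat \<Rightarrow> 'a) set" where
  "sg m i a = vec m (\<lambda>k. if k = i then a else \<zero>)"

lemma sg_nth [simp]: "k < m \<Longrightarrow> the_elem (sg m i a) k = (if k = i then a else \<zero>)"
  by (simp add: sg_def)

lemma sg_in_fbox:
  "\<lbrakk>\<And>i. i < m \<Longrightarrow> left_ideal (U i) R; i < m \<Longrightarrow> a \<in> U i\<rbrakk> \<Longrightarrow> sg m i a \<in> carrier (fbox R m U)"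
  unfolding sg_def by (intro vec_in_fbox) (auto simp: left_ideal_zero)

lemma smult_sg: "\<lbrakk>r \<in> carrier R; a \<in> carrier R\<rbrakk> \<Longrightarrow> r \<odot>\<^bsub>fbox R m U\<^esub> sg m i a = sg m i (r \<otimes> a)"
  unfolding fbox_simps by (auto simp: sg_def intro!: vec_cong)

lemma coord_hom:
  assumes "\<And>i. i < m \<Longrightarrow> left_ideal (U i) R" "k < m"
  shows "(\<lambda>X\<in>carrier (fbox R m U). the_elem X k) \<in> module_hom R (fbox R m U) (regular_module R)"
  by (rule module_homI[OF _ _ _ fbox_left_module[OF assms(1)]])
    (use assms in \<open>auto simp: fbox_simps intro: left_ideal_in fbox_nth\<close>)

lemma finsum_nth:
  assumes U: "\<And>i. i < m \<Longrightarrow> left_ideal (U i) R" and k: "k < m"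
    and I: "finite I" "\<And>i. i \<in> I \<Longrightarrow> X i \<in> carrier (fbox R m U)"
  shows "the_elem (\<Oplus>\<^bsub>fbox R m U\<^esub>i\<in>I. X i) k = (\<Oplus>i\<in>I. the_elem (X i) k)"
proof -
  interpret F: left_module R "fbox R m U" by (rule fbox_left_module[OF U])
  have "(\<Oplus>\<^bsub>fbox R m U\<^esub>i\<in>I. X i) \<in> carrier (fbox R m U)" using I by (intro F.M.finsum_closed) auto
  then have "the_elem (\<Oplus>\<^bsub>fbox R m U\<^esub>i\<in>I. X i) k = (\<Oplus>i\<in>I. restrict (\<lambda>X. the_elem X k) (carrier (fbox R m U)) (X i))"
    using module_hom_finsum[OF coord_hom[OF U k] F.left_module_axioms regular_left_module I(1), of X] I(2)
    by (simp add: finsum_regular_module)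
  also have "\<dots> = (\<Oplus>i\<in>I. the_elem (X i) k)"
    using I fbox_in[OF U _ k] by (intro finsum_cong') auto
  finally show ?thesis .
qed

lemma finsum_single:
  assumes "finite I" "k \<in> I" "\<And>i. i \<in> I \<Longrightarrow> i \<noteq> k \<Longrightarrow> f i = \<zero>" "f k \<in> carrier R"
  shows "(\<Oplus>i\<in>I. f i) = f k"
proof -
  have "(\<Oplus>i\<in>I. f i) = (\<Oplus>i\<in>I. if k = i then f i else \<zero>)"
  proof (rule finsum_cong')
    show "(\<lambda>i. if k = i then f i else \<zero>) \<in> I \<rightarrow> carrier R" using assms(4) by auto
  qed (use assms(3) in auto)
  also have "\<dots> = f k"
  proof (rule add.finprod_singleton)
    show "f \<in> I \<rightarrow> carrier R"
    proof
      fix i assume "i \<in> I"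
      then show "f i \<in> carrier R" using assms(3,4) by (cases "i = k") auto
    qed
  qed (use assms in auto)
  finally show ?thesis .
qed

lemma fbox_expand:
  assumes U: "\<And>i. i < m \<Longrightarrow> left_ideal (U i) R" and X: "X \<in> carrier (fbox R m U)"
    and I: "I \<subseteq> {..<m}" "\<And>i. i < m \<Longrightarrow> i \<notin> I \<Longrightarrow> the_elem X i = \<zero>"
  shows "X = (\<Oplus>\<^bsub>fbox R m U\<^esub>i\<in>I. sg m i (the_elem X i))"
proof -
  interpret F: left_module R "fbox R m U" by (rule fbox_left_module[OF U])
  note c = fbox_in[OF U X]
  have fin: "finite I" using I(1) finite_subset by blast
  have s: "sg m i (the_elem X i) \<in> carrier (fbox R m U)" if "i \<in> I" for i
    using that I(1) fbox_nth[OF X] by (intro sg_in_fbox U) auto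
  show ?thesis
  proof (rule fbox_ext[OF X])
    show "(\<Oplus>\<^bsub>fbox R m U\<^esub>i\<in>I. sg m i (the_elem X i)) \<in> carrier (fbox R m U)"
      using s by (intro F.M.finsum_closed) auto
    fix k assume k: "k < m"
    have "the_elem (\<Oplus>\<^bsub>fbox R m U\<^esub>i\<in>I. sg m i (the_elem X i)) k = (\<Oplus>i\<in>I. if k = i then the_elem X i else \<zero>)"
      using finsum_nth[OF U k fin s] k by simp
    also have "\<dots> = the_elem X k"
    proof (cases "k \<in> I")
      case True
      then show ?thesis using fin c k by (subst finsum_single[of _ k]) auto
    next
      case False
      then have "(\<Oplus>i\<in>I. if k = i then the_elem X i else \<zero>) = (\<Oplus>i\<in>I. \<zero>)"
        by (intro finsum_cong') auto
      then show ?thesis using False I(2)[OF k] by simp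
    qed
    finally show "the_elem X k = the_elem (\<Oplus>\<^bsub>fbox R m U\<^esub>i\<in>I. sg m i (the_elem X i)) k" by simp
  qed
qed

lemma fbox_fg:
  assumes u: "\<And>i. i < m \<Longrightarrow> u i \<in> carrier R"
  shows "fg_module R (fbox R m (\<lambda>i. lgen (u i)))"
proof -
  let ?F = "fbox R m (\<lambda>i. lgen (u i))"
  have U: "\<And>i. i < m \<Longrightarrow> left_ideal (lgen (u i)) R" using u lgen_left_ideal by blast
  interpret F: left_module R ?F by (rule fbox_left_module[OF U])
  show ?thesis unfolding fg_module_def
  proof (intro conjI F.left_module_axioms exI[of _ "(\<lambda>i. sg m i (u i)) ` {..<m}"] allI impI)
    show "(\<lambda>i. sg m i (u i)) ` {..<m} \<subseteq> carrier ?F"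
      using u by (auto intro!: sg_in_fbox U lgen_self)
    fix N assume N: "submodule N R ?F \<and> (\<lambda>i. sg m i (u i)) ` {..<m} \<subseteq> N"
    have "X \<in> N" if X: "X \<in> carrier ?F" for X
    proof -
      have "sg m i (the_elem X i) \<in> N" if i: "i < m" for i
      proof -
        obtain r where r: "r \<in> carrier R" "the_elem X i = r \<otimes> u i"
          using fbox_nth[OF X i] by (auto simp: lgen_def)
        have "r \<odot>\<^bsub>?F\<^esub> sg m i (u i) \<in> N" using N i r(1) by (auto intro: submodule_smult)
        then show ?thesis using r u[OF i] by (simp add: smult_sg)
      qed
      then have s: "(\<Oplus>\<^bsub>?F\<^esub>i\<in>{..<m}. sg m i (the_elem X i)) \<in> N"
        by (intro F.submodule_finsum) (use N in auto)
      have e: "X = (\<Oplus>\<^bsub>?F\<^esub>i\<in>{..<m}. sg m i (the_elem X i))"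
        by (rule fbox_expand[OF U X]) auto
      from s show ?thesis by (rule iffD2[OF arg_cong[OF e, of "\<lambda>Z. Z \<in> N"]])
    qed
    moreover have "N \<subseteq> carrier ?F" using N by (intro submodule_subset) auto
    ultimately show "N = carrier ?F" by auto
  qed simp
qed

text \<open>Coordinates are ring elements, so letting them act on any family \<open>y\<close> in
  \<open>M\<close> gives a homomorphism with no relations to check.\<close>

lemma fbox_hom:
  assumes U: "\<And>i. i < m \<Longrightarrow> left_ideal (U i) R" and M: "left_module R M"
    and y: "\<And>i. i < m \<Longrightarrow> y i \<in> carrier M"
  defines "h \<equiv> (\<lambda>X\<in>carrier (fbox R m U). \<Oplus>\<^bsub>M\<^esub>i\<in>{..<m}. the_elem X i \<odot>\<^bsub>M\<^esub> y i)"
  shows "h \<in> module_hom R (fbox R m U) M"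
    "\<And>i a. \<lbrakk>i < m; a \<in> U i\<rbrakk> \<Longrightarrow> h (sg m i a) = a \<odot>\<^bsub>M\<^esub> y i"
proof -
  interpret M: left_module R M by fact
  have c: "the_elem X i \<in> carrier R" if "X \<in> carrier (fbox R m U)" "i < m" for X i
    using U that by (rule fbox_in)
  show hom: "h \<in> module_hom R (fbox R m U) M"
    unfolding h_def
  proof (rule module_homI[OF _ _ _ fbox_left_module[OF U]])
    fix X Y assume XY: "X \<in> carrier (fbox R m U)" "Y \<in> carrier (fbox R m U)"
    have "(\<Oplus>\<^bsub>M\<^esub>i\<in>{..<m}. the_elem (X \<oplus>\<^bsub>fbox R m U\<^esub> Y) i \<odot>\<^bsub>M\<^esub> y i)
      = (\<Oplus>\<^bsub>M\<^esub>i\<in>{..<m}. the_elem X i \<odot>\<^bsub>M\<^esub> y i \<oplus>\<^bsub>M\<^esub> the_elem Y i \<odot>\<^bsub>M\<^esub> y i)"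
      using XY y c by (intro M.M.finsum_cong') (auto simp: fbox_simps M.smult_l_distr)
    also have "\<dots> = (\<Oplus>\<^bsub>M\<^esub>i\<in>{..<m}. the_elem X i \<odot>\<^bsub>M\<^esub> y i) \<oplus>\<^bsub>M\<^esub> (\<Oplus>\<^bsub>M\<^esub>i\<in>{..<m}. the_elem Y i \<odot>\<^bsub>M\<^esub> y i)"
      using XY y c by (intro M.M.finsum_addf) auto
    finally show "(\<Oplus>\<^bsub>M\<^esub>i\<in>{..<m}. the_elem (X \<oplus>\<^bsub>fbox R m U\<^esub> Y) i \<odot>\<^bsub>M\<^esub> y i) = \<dots>" .
  next
    fix a X assume X: "X \<in> carrier (fbox R m U)" and a: "a \<in> carrier R"
    have "(\<Oplus>\<^bsub>M\<^esub>i\<in>{..<m}. the_elem (a \<odot>\<^bsub>fbox R m U\<^esub> X) i \<odot>\<^bsub>M\<^esub> y i)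
      = (\<Oplus>\<^bsub>M\<^esub>i\<in>{..<m}. a \<odot>\<^bsub>M\<^esub> (the_elem X i \<odot>\<^bsub>M\<^esub> y i))"
      using X a y c by (intro M.M.finsum_cong') (auto simp: fbox_simps M.smult_assoc)
    also have "\<dots> = a \<odot>\<^bsub>M\<^esub> (\<Oplus>\<^bsub>M\<^esub>i\<in>{..<m}. the_elem X i \<odot>\<^bsub>M\<^esub> y i)"
      using X a y c by (intro M.smult_finsum[symmetric]) auto
    finally show "(\<Oplus>\<^bsub>M\<^esub>i\<in>{..<m}. the_elem (a \<odot>\<^bsub>fbox R m U\<^esub> X) i \<odot>\<^bsub>M\<^esub> y i) = \<dots>" .
  qed (use c y in \<open>auto intro!: M.M.finsum_closed\<close>)
  fix i a assume i: "i < m" and a: "a \<in> U i"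
  have ac: "a \<in> carrier R" using left_ideal_in[OF U[OF i] a] .
  have "sg m i a \<in> carrier (fbox R m U)" using a by (intro sg_in_fbox U) auto
  then have "h (sg m i a) = (\<Oplus>\<^bsub>M\<^esub>k\<in>{..<m}. the_elem (sg m i a) k \<odot>\<^bsub>M\<^esub> y k)"
    by (simp add: h_def)
  also have "\<dots> = (\<Oplus>\<^bsub>M\<^esub>k\<in>{..<m}. if i = k then a \<odot>\<^bsub>M\<^esub> y k else \<zero>\<^bsub>M\<^esub>)"
    using i y ac by (intro M.M.finsum_cong') (auto simp: M.smult_zero_left)
  also have "\<dots> = a \<odot>\<^bsub>M\<^esub> y i" using i y ac by (subst M.M.add.finprod_singleton) auto
  finally show "h (sg m i a) = a \<odot>\<^bsub>M\<^esub> y i" .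
qed

lemma fbox_hom_eqI:
  assumes U: "\<And>i. i < m \<Longrightarrow> left_ideal (U i) R" and M: "left_module R M"
    and f: "f \<in> module_hom R (fbox R m U) M" and g: "g \<in> module_hom R (fbox R m U) M"
    and eq: "\<And>i a. \<lbrakk>i < m; a \<in> U i\<rbrakk> \<Longrightarrow> f (sg m i a) = g (sg m i a)"
  shows "f = g"
proof (rule module_hom_ext[OF f g])
  interpret M: left_module R M by fact
  fix X assume X: "X \<in> carrier (fbox R m U)"
  note F = fbox_left_module[OF U]
  have s: "sg m i (the_elem X i) \<in> carrier (fbox R m U)" if "i \<in> {..<m}" for i
    using that fbox_nth[OF X] by (intro sg_in_fbox U) auto
  have e: "X = (\<Oplus>\<^bsub>fbox R m U\<^esub>i\<in>{..<m}. sg m i (the_elem X i))" by (rule fbox_expand[OF U X]) auto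
  have "f X = (\<Oplus>\<^bsub>M\<^esub>i\<in>{..<m}. f (sg m i (the_elem X i)))"
    by (subst e, rule module_hom_finsum[OF f F M]) (use s in auto)
  also have "\<dots> = (\<Oplus>\<^bsub>M\<^esub>i\<in>{..<m}. g (sg m i (the_elem X i)))"
    using eq fbox_nth[OF X] module_hom_closed[OF g s] by (intro M.M.finsum_cong') auto
  also have "\<dots> = g X"
    by (subst (2) e, rule module_hom_finsum[OF g F M, symmetric]) (use s in auto)
  finally show "f X = g X" .
qed

text \<open>Lift the images of the elements \<open>sg m i (u i)\<close> and extend by
  \<open>fbox_hom\<close>. The result is a lift because \<open>a \<otimes> u i = a\<close> for every
  \<open>a\<close> in \<open>lgen (u i)\<close>.\<close>

lemma fbox_projective:
  assumes u: "\<And>i. i < m \<Longrightarrow> u i \<in> carrier R \<and> u i \<otimes> u i = u i"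
  shows "projective R (fbox R m (\<lambda>i. lgen (u i)))"
  unfolding projective_def
proof (intro conjI allI impI ballI)
  let ?F = "fbox R m (\<lambda>i. lgen (u i))"
  have U: "\<And>i. i < m \<Longrightarrow> left_ideal (lgen (u i)) R" using u lgen_left_ideal by blast
  show "fg_module R ?F" using u by (intro fbox_fg) auto
  note F = fbox_left_module[OF U]
  fix X Y :: "'a fmod" and f g
  assume XY: "fg_module R X \<and> fg_module R Y" and f: "f \<in> module_epi R X Y" and g: "g \<in> module_hom R ?F Y"
  then have lm: "left_module R X" "left_module R Y" by (auto simp: fg_module_def)
  interpret X: left_module R X by fact
  have f': "f \<in> module_hom R X Y" "f ` carrier X = carrier Y" using f by (auto simp: module_epi_def)
  have "\<exists>y. y \<in> carrier X \<and> f y = g (sg m i (u i))" if "i < m" for i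
  proof -
    have "sg m i (u i) \<in> carrier ?F" using u that by (intro sg_in_fbox U lgen_self) auto
    then have "g (sg m i (u i)) \<in> carrier Y" by (rule module_hom_closed[OF g])
    then show ?thesis using f'(2) by (metis imageE)
  qed
  then obtain y where y: "\<And>i. i < m \<Longrightarrow> y i \<in> carrier X \<and> f (y i) = g (sg m i (u i))" by metis
  define h where "h \<equiv> (\<lambda>Z\<in>carrier ?F. \<Oplus>\<^bsub>X\<^esub>i\<in>{..<m}. the_elem Z i \<odot>\<^bsub>X\<^esub> y i)"
  have h: "h \<in> module_hom R ?F X" "\<And>i a. \<lbrakk>i < m; a \<in> lgen (u i)\<rbrakk> \<Longrightarrow> h (sg m i a) = a \<odot>\<^bsub>X\<^esub> y i"
    unfolding h_def using fbox_hom[OF U lm(1), of m _ y] y by auto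
  have "g = compose (carrier ?F) f h"
  proof (rule fbox_hom_eqI[OF U lm(2) g module_hom_compose[OF h(1) f'(1) F]])
    fix i a assume i: "i < m" and a: "a \<in> lgen (u i)"
    obtain r where r: "r \<in> carrier R" "a = r \<otimes> u i" using a by (auto simp: lgen_def)
    have ac: "a \<in> carrier R" "a \<otimes> u i = a" using r u[OF i] by (auto simp: m_assoc)
    have s: "sg m i a \<in> carrier ?F" "sg m i (u i) \<in> carrier ?F"
      using a u i lgen_self by (auto intro!: sg_in_fbox U)
    have "compose (carrier ?F) f h (sg m i a) = f (a \<odot>\<^bsub>X\<^esub> y i)" using s h(2)[OF i a] by (simp add: compose_def)
    also have "\<dots> = a \<odot>\<^bsub>Y\<^esub> g (sg m i (u i))" using module_hom_smult[OF f'(1) ac(1)] y[OF i] by simp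
    also have "\<dots> = g (sg m i (a \<otimes> u i))" using module_hom_smult[OF g ac(1) s(2)] u[OF i] ac by (simp add: smult_sg)
    finally show "g (sg m i a) = compose (carrier ?F) f h (sg m i a)" using ac by simp
  qed auto
  then show "\<exists>h\<in>module_hom R ?F X. g = compose (carrier ?F) f h" using h(1) by blast
qed

text \<open>Split an epimorphism from \<open>R^m\<close> onto \<open>P\<close> and take the
  coordinates of the splitting. Statements about \<open>J P\<close> thereby become statements about
  values of functionals.\<close>

lemma dual_basis:
  assumes P: "projective R P"
  obtains m b f where "\<And>i. i < m \<Longrightarrow> b i \<in> carrier P"
    "\<And>i. i < m \<Longrightarrow> f i \<in> module_hom R P (regular_module R)"
    "\<And>p. p \<in> carrier P \<Longrightarrow> p = (\<Oplus>\<^bsub>P\<^esub>i\<in>{..<(m::nat)}. f i p \<odot>\<^bsub>P\<^esub> b i)"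
proof -
  have fg: "fg_module R P" using P by (simp add: projective_def)
  then interpret P: left_module R P by (simp add: fg_module_def)
  obtain S where S: "finite S" "S \<subseteq> carrier P" "\<And>N. submodule N R P \<Longrightarrow> S \<subseteq> N \<Longrightarrow> N = carrier P"
    using fg_moduleE[OF fg] by metis
  define m where "m = card S"
  obtain b where b: "bij_betw b {..<m} S"
    using ex_bij_betw_nat_finite[OF S(1)] by (auto simp: atLeast0LessThan m_def)
  then have bP: "b i \<in> carrier P" if "i < m" for i using that S(2) by (auto simp: bij_betw_def)
  let ?F = "fbox R m (\<lambda>i. lgen \<one>)"
  have U: "\<And>i. i < m \<Longrightarrow> left_ideal (lgen \<one>) R" using lgen_left_ideal by blast
  note F = fbox_left_module[OF U]
  define e where "e \<equiv> (\<lambda>Z\<in>carrier ?F. \<Oplus>\<^bsub>P\<^esub>i\<in>{..<m}. the_elem Z i \<odot>\<^bsub>P\<^esub> b i)"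
  have e: "e \<in> module_hom R ?F P" "\<And>i a. \<lbrakk>i < m; a \<in> lgen \<one>\<rbrakk> \<Longrightarrow> e (sg m i a) = a \<odot>\<^bsub>P\<^esub> b i"
    unfolding e_def using fbox_hom[OF U P.left_module_axioms, of m _ b] bP by auto
  have "e ` carrier ?F = carrier P"
  proof (rule S(3))
    show "submodule (e ` carrier ?F) R P"
      by (rule image_submodule[OF e(1) F P.left_module_axioms left_module.carrier_submodule[OF F]])
    show "S \<subseteq> e ` carrier ?F"
    proof
      fix x assume "x \<in> S"
      then obtain i where i: "i < m" "x = b i" using b by (auto simp: bij_betw_def)
      then have "x = e (sg m i \<one>)" using e(2)[OF i(1) lgen_self[OF one_closed]] bP by simp
      moreover have "sg m i \<one> \<in> carrier ?F" by (rule sg_in_fbox[OF U]) (auto intro: lgen_self)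
      ultimately show "x \<in> e ` carrier ?F" by blast
    qed
  qed
  then have epi: "e \<in> module_epi R ?F P" using e(1) by (simp add: module_epi_def)
  have Fg: "fg_module R ?F" by (rule fbox_fg) simp
  have id: "(\<lambda>x\<in>carrier P. x) \<in> module_hom R P P" by (rule module_homI[OF _ _ _ P.left_module_axioms]) auto
  obtain s where s: "s \<in> module_hom R P ?F" "\<And>x. x \<in> carrier P \<Longrightarrow> e (s x) = (\<lambda>x\<in>carrier P. x) x"
    using projective_lift[OF P Fg fg epi id] by blast
  show ?thesis
  proof (rule that[of m b "\<lambda>i. compose (carrier P) (\<lambda>X\<in>carrier ?F. the_elem X i) s"])
    show "b i \<in> carrier P" if "i < m" for i using bP that .
    show "compose (carrier P) (\<lambda>X\<in>carrier ?F. the_elem X i) s \<in> module_hom R P (regular_module R)" if "i < m" for i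
      by (rule module_hom_compose[OF s(1) coord_hom[OF U that] P.left_module_axioms]) 
    fix p assume p: "p \<in> carrier P"
    have sp: "s p \<in> carrier ?F" using s(1) p by (rule module_hom_closed)
    have "p = e (s p)" using s(2) p by simp
    also have "\<dots> = (\<Oplus>\<^bsub>P\<^esub>i\<in>{..<m}. the_elem (s p) i \<odot>\<^bsub>P\<^esub> b i)" using sp by (simp add: e_def)
    also have "\<dots> = (\<Oplus>\<^bsub>P\<^esub>i\<in>{..<m}. compose (carrier P) (\<lambda>X\<in>carrier ?F. the_elem X i) s p \<odot>\<^bsub>P\<^esub> b i)"
      using p sp bP fbox_nth[OF sp] left_ideal_in[OF U]
      by (intro P.M.finsum_cong') (auto simp: compose_def)
    finally show "p = (\<Oplus>\<^bsub>P\<^esub>i\<in>{..<m}. compose (carrier P) (\<lambda>X\<in>carrier ?F. the_elem X i) s p \<odot>\<^bsub>P\<^esub> b i)" .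
  qed
qed

end

section \<open>Rings with a complete set of local idempotents\<close>

text \<open>The idempotents are indexed by \<open>\<int>/n\<close>. The axioms are invariant under passing to the
  opposite ring.\<close>

locale idem_ring = ring R for R (structure) +
  fixes n :: nat and E :: "int \<Rightarrow> 'a" and J :: "'a set"
  assumes n_pos: "0 < n"
    and E_closed [simp, intro]: "E i \<in> carrier R"
    and E_mod: "E (i mod int n) = E i"
    and E_idem [simp]: "E i \<otimes> E i = E i"
    and E_orth: "i mod int n \<noteq> j mod int n \<Longrightarrow> E i \<otimes> E j = \<zero>"
    and E_sum: "(\<Oplus>i\<in>{..<n}. E (int i)) = \<one>"
    and J_ideal: "ideal J R"
    and E_notin_J: "E i \<notin> J"
    and E_off: "\<lbrakk>r \<in> carrier R; i mod int n \<noteq> j mod int n\<rbrakk> \<Longrightarrow> E i \<otimes> r \<otimes> E j \<in> J"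
    and E_unit: "\<lbrakk>r \<in> carrier R; E i \<otimes> r \<otimes> E i \<notin> J\<rbrakk> \<Longrightarrow>
      \<exists>c \<in> carrier R. c \<otimes> (E i \<otimes> r \<otimes> E i) = E i \<and> (E i \<otimes> r \<otimes> E i) \<otimes> c = E i"
begin

lemma E_cong: "i mod int n = j mod int n \<Longrightarrow> E i = E j"
  by (metis E_mod)

lemma E_absorb [simp]: "x \<in> carrier R \<Longrightarrow> E i \<otimes> (E i \<otimes> x) = E i \<otimes> x"
  by (simp add: m_assoc[symmetric])

lemma J_in: "x \<in> J \<Longrightarrow> x \<in> carrier R"
  using J_ideal ideal.Icarr by metis

lemma J_left: "\<lbrakk>a \<in> carrier R; x \<in> J\<rbrakk> \<Longrightarrow> a \<otimes> x \<in> J"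
  using J_ideal ideal.I_l_closed by metis

lemma J_right: "\<lbrakk>a \<in> carrier R; x \<in> J\<rbrakk> \<Longrightarrow> x \<otimes> a \<in> J"
  using J_ideal ideal.I_r_closed by metis

lemma J_add: "\<lbrakk>x \<in> J; y \<in> J\<rbrakk> \<Longrightarrow> x \<oplus> y \<in> J"
  using J_ideal additive_subgroup.a_closed ideal.axioms(1) by metis

lemma J_zero: "\<zero> \<in> J"
  using J_ideal additive_subgroup.zero_closed ideal.axioms(1) by metis

lemma J_left_ideal: "left_ideal J R"
  by (rule left_module.submoduleI'[OF regular_left_module]) (auto simp: J_in J_zero J_add J_left)

lemma E_nonzero: "E i \<noteq> \<zero>"
  using E_notin_J J_zero by metis

lemma E_in_set: "\<exists>k<n. E i = E (int k)"
  using n_pos E_mod[of i] by (intro exI[of _ "nat (i mod int n)"]) (auto simp: nat_less_iff)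

lemma split_module:
  assumes M: "left_module R M" and L: "submodule L R M" and x: "x \<in> carrier M"
    and E: "\<And>i. E i \<odot>\<^bsub>M\<^esub> x \<in> L"
  shows "x \<in> L"
proof -
  interpret M: left_module R M by fact
  have "x = (\<Oplus>i\<in>{..<n}. E (int i)) \<odot>\<^bsub>M\<^esub> x" using x by (simp add: E_sum)
  also have "\<dots> = (\<Oplus>\<^bsub>M\<^esub>i\<in>{..<n}. E (int i) \<odot>\<^bsub>M\<^esub> x)" using x by (intro M.finsum_smult) auto
  also have "\<dots> \<in> L" using E by (intro M.submodule_finsum[OF L]) auto
  finally show ?thesis .
qed

lemma split_left: "\<lbrakk>left_ideal L R; x \<in> carrier R; \<And>i. E i \<otimes> x \<in> L\<rbrakk> \<Longrightarrow> x \<in> L"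
  using split_module[OF regular_left_module, of L x] by simp

lemma split_right:
  assumes L: "left_ideal L R" and x: "x \<in> carrier R" and E: "\<And>i. x \<otimes> E i \<in> L"
  shows "x \<in> L"
proof -
  have "x = x \<otimes> (\<Oplus>i\<in>{..<n}. E (int i))" using x by (simp add: E_sum)
  also have "\<dots> = (\<Oplus>i\<in>{..<n}. x \<otimes> E (int i))" using x by (intro finsum_rdistr) auto
  also have "\<dots> = (\<Oplus>\<^bsub>regular_module R\<^esub>i\<in>{..<n}. x \<otimes> E (int i))" by (simp add: finsum_regular_module)
  also have "\<dots> \<in> L" using E by (intro left_module.submodule_finsum[OF regular_left_module L]) auto
  finally show ?thesis .
qed

text \<open>Some component \<open>E k \<otimes> y\<close> lies outside \<open>J\<close>. By
  \<open>E_off\<close> the index \<open>k\<close> is congruent to \<open>j\<close>, and then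
  \<open>E_unit\<close> applies in the local corner at \<open>j\<close>.\<close>

lemma left_inverse:
  assumes y: "y \<in> carrier R" "y \<otimes> E j = y" "y \<notin> J"
  obtains c where "c \<in> carrier R" "c \<otimes> y = E j"
proof -
  obtain k where k: "E k \<otimes> y \<notin> J" using split_left[OF J_left_ideal y(1)] y(3) by blast
  have "k mod int n = j mod int n"
    using E_off[of y k j] k y by (metis E_closed m_assoc)
  then have ek: "E k = E j" by (rule E_cong)
  then have "E j \<otimes> y \<otimes> E j \<notin> J" using k y by (metis E_closed m_assoc)
  then obtain c where c: "c \<in> carrier R" "c \<otimes> (E j \<otimes> y \<otimes> E j) = E j" using E_unit y by blast
  then have "(c \<otimes> E j) \<otimes> y = E j" using y by (metis E_closed m_assoc m_closed)
  then show ?thesis using that c by blast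
qed

lemma right_inverse:
  assumes y: "y \<in> carrier R" "E j \<otimes> y = y" "y \<notin> J"
  obtains c where "c \<in> carrier R" "y \<otimes> c = E j"
proof -
  obtain k where k: "y \<otimes> E k \<notin> J" using split_right[OF J_left_ideal y(1)] y(3) by blast
  have "k mod int n = j mod int n"
    using E_off[of y j k] k y by metis
  then have ek: "E k = E j" by (rule E_cong)
  then have "E j \<otimes> y \<otimes> E j \<notin> J" using k y by metis
  then obtain c where c: "c \<in> carrier R" "(E j \<otimes> y \<otimes> E j) \<otimes> c = E j" using E_unit y by blast
  then have "y \<otimes> (E j \<otimes> c) = E j" using y by (metis E_closed m_assoc m_closed)
  then show ?thesis using that c by blast
qed

text \<open>With \<open>u = E j \<otimes> (\<one> \<ominus> c) \<otimes> E j\<close> one has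
  \<open>E j = u \<oplus> E j \<otimes> c \<otimes> E j\<close>, so \<open>u\<close> is outside
  \<open>J\<close> and invertible in the corner. This is the invertibility of \<open>1 - c\<close>,
  restricted to elements fixed by one idempotent; it is used to conclude \<open>x = 0\<close> from
  \<open>x = c x\<close> with \<open>c\<close> in \<open>J\<close>.\<close>

lemma quasi_regular:
  assumes M: "left_module R M" and L: "submodule L R M" and x: "x \<in> carrier M" "E j \<odot>\<^bsub>M\<^esub> x = x"
    and c: "c \<in> J" and xc: "x \<ominus>\<^bsub>M\<^esub> c \<odot>\<^bsub>M\<^esub> x \<in> L"
  shows "x \<in> L"
proof -
  interpret M: left_module R M by fact
  note cc = J_in[OF c]
  define u where "u = E j \<otimes> (\<one> \<ominus> c) \<otimes> E j"
  have u: "u \<in> carrier R" "u \<otimes> E j = u" using cc by (auto simp: u_def m_assoc)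
  have e: "E j = u \<oplus> E j \<otimes> c \<otimes> E j"
    using cc by (simp add: u_def minus_eq r_distr l_distr r_minus l_minus a_assoc l_neg)
  have "u \<notin> J"
  proof
    assume "u \<in> J"
    then have "E j \<in> J" using e J_add J_left J_right c E_closed by metis
    then show False using E_notin_J by blast
  qed
  then obtain v where v: "v \<in> carrier R" "v \<otimes> u = E j" using left_inverse u by blast
  have "u \<odot>\<^bsub>M\<^esub> x = E j \<odot>\<^bsub>M\<^esub> (x \<ominus>\<^bsub>M\<^esub> c \<odot>\<^bsub>M\<^esub> x)"
    using x cc by (simp add: u_def M.smult_assoc M.smult_diff)
  then have "u \<odot>\<^bsub>M\<^esub> x \<in> L" using submodule_smult[OF L _ xc] by simp
  then have "v \<odot>\<^bsub>M\<^esub> (u \<odot>\<^bsub>M\<^esub> x) \<in> L" using submodule_smult[OF L v(1)] by blast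
  then show ?thesis using v u x by (simp add: M.smult_assoc[symmetric])
qed

text \<open>Nakayama's lemma. The hypothesis \<open>gen\<close> says that \<open>S\<close> lies in \<open>N + J S\<close>, without mentioning sums.\<close>

lemma nakayama:
  assumes M: "left_module R M" and "finite S" "S \<subseteq> carrier M" "\<And>s. s \<in> S \<Longrightarrow> \<exists>j. E j \<odot>\<^bsub>M\<^esub> s = s"
    and "submodule N R M"
    and gen: "\<And>L. \<lbrakk>submodule L R M; N \<subseteq> L; \<And>t c. \<lbrakk>t \<in> S; c \<in> J\<rbrakk> \<Longrightarrow> c \<odot>\<^bsub>M\<^esub> t \<in> L\<rbrakk> \<Longrightarrow> S \<subseteq> L"
  shows "S \<subseteq> N"
  using assms(2-)
proof (induction S arbitrary: N)
  case empty
  show ?case by simp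
next
  case (insert s S)
  interpret M: left_module R M by fact
  have s: "s \<in> carrier M" using insert.prems by auto
  \<comment> \<open>Enlarging \<open>N\<close> by \<open>R s\<close> lets the induction hypothesis
    deal with \<open>S\<close>; it then remains to absorb \<open>s\<close>.\<close>
  let ?Rs = "{r \<odot>\<^bsub>M\<^esub> s | r. r \<in> carrier R}"
  let ?N' = "N <+>\<^bsub>M\<^esub> ?Rs"
  have N': "submodule ?N' R M" by (rule M.submodule_sum[OF insert.prems(3) M.cyclic_submodule[OF s]])
  have NN': "N \<subseteq> ?N'"
  proof
    fix x assume x: "x \<in> N"
    then have "x = x \<oplus>\<^bsub>M\<^esub> \<zero> \<odot>\<^bsub>M\<^esub> s" using s submodule_in[OF insert.prems(3) x] by (simp add: M.smult_zero_left)
    then show "x \<in> ?N'" using x by (auto simp: set_add_def set_mult_def)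
  qed
  have "s = \<zero>\<^bsub>M\<^esub> \<oplus>\<^bsub>M\<^esub> \<one> \<odot>\<^bsub>M\<^esub> s" using s by simp
  then have sN': "s \<in> ?N'" using submodule_zero[OF insert.prems(3)] one_closed
    by (auto simp: set_add_def set_mult_def)
  have "S \<subseteq> ?N'"
  proof (rule insert.IH[OF _ _ N'])
    show "S \<subseteq> carrier M" "\<And>s. s \<in> S \<Longrightarrow> \<exists>j. E j \<odot>\<^bsub>M\<^esub> s = s" using insert.prems by auto
    fix L assume L: "submodule L R M" "?N' \<subseteq> L" "\<And>t c. t \<in> S \<Longrightarrow> c \<in> J \<Longrightarrow> c \<odot>\<^bsub>M\<^esub> t \<in> L"
    have "s \<in> L" using sN' L(2) by blast
    then have "insert s S \<subseteq> L"
      using L NN' J_in by (intro insert.prems(4)) (auto intro: submodule_smult)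
    then show "S \<subseteq> L" by blast
  qed
  let ?Js = "{c \<odot>\<^bsub>M\<^esub> s | c. c \<in> J}"
  have Js: "submodule ?Js R M"
  proof (rule M.submoduleI')
    show "?Js \<subseteq> carrier M" using s J_in by auto
    show "\<zero>\<^bsub>M\<^esub> \<in> ?Js" using M.smult_zero_left[OF s] J_zero by force
    fix x y assume "x \<in> ?Js" "y \<in> ?Js"
    then obtain c d where "c \<in> J" "d \<in> J" "x = c \<odot>\<^bsub>M\<^esub> s" "y = d \<odot>\<^bsub>M\<^esub> s" by auto
    then show "x \<oplus>\<^bsub>M\<^esub> y \<in> ?Js" using s J_in J_add M.smult_l_distr[of c d s] by force
  next
    fix a x assume "a \<in> carrier R" "x \<in> ?Js"
    then obtain c where "c \<in> J" "x = c \<odot>\<^bsub>M\<^esub> s" by auto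
    then show "a \<odot>\<^bsub>M\<^esub> x \<in> ?Js" using s J_in J_left M.smult_assoc[of a c s] \<open>a \<in> carrier R\<close> by force
  qed
  let ?L = "N <+>\<^bsub>M\<^esub> ?Js"
  have L: "submodule ?L R M" by (rule M.submodule_sum[OF insert.prems(3) Js])
  \<comment> \<open>Every \<open>t\<close> is \<open>v + r s\<close> with \<open>v\<close> in
    \<open>N\<close>, hence \<open>c t\<close> lies in \<open>N + J s\<close> because
    \<open>J\<close> is two-sided. So \<open>s = v + c s\<close>, the situation of
    \<open>quasi_regular\<close>.\<close>
  have "insert s S \<subseteq> ?L"
  proof (rule insert.prems(4)[OF L])
    show "N \<subseteq> ?L"
    proof
      fix x assume x: "x \<in> N"
      then have "x = x \<oplus>\<^bsub>M\<^esub> \<zero> \<odot>\<^bsub>M\<^esub> s" using s submodule_in[OF insert.prems(3) x] by (simp add: M.smult_zero_left)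
      then show "x \<in> ?L" using x J_zero by (auto simp: set_add_def set_mult_def)
    qed
    fix t c assume t: "t \<in> insert s S" and c: "c \<in> J"
    have "t \<in> ?N'" using t \<open>S \<subseteq> ?N'\<close> sN' by blast
    then obtain v r where vr: "v \<in> N" "r \<in> carrier R" "t = v \<oplus>\<^bsub>M\<^esub> r \<odot>\<^bsub>M\<^esub> s"
      by (auto simp: set_add_def set_mult_def)
    then have "c \<odot>\<^bsub>M\<^esub> t = c \<odot>\<^bsub>M\<^esub> v \<oplus>\<^bsub>M\<^esub> (c \<otimes> r) \<odot>\<^bsub>M\<^esub> s"
      using c J_in s submodule_in[OF insert.prems(3) vr(1)] by (simp add: M.smult_r_distr M.smult_assoc)
    moreover have "c \<odot>\<^bsub>M\<^esub> v \<in> N" using submodule_smult[OF insert.prems(3) J_in[OF c] vr(1)] .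
    moreover have "c \<otimes> r \<in> J" using c vr(2) by (rule J_right[rotated])
    ultimately show "c \<odot>\<^bsub>M\<^esub> t \<in> ?L" by (auto simp: set_add_def set_mult_def)
  qed
  then obtain v c where vc: "v \<in> N" "c \<in> J" "s = v \<oplus>\<^bsub>M\<^esub> c \<odot>\<^bsub>M\<^esub> s"
    by (auto simp: set_add_def set_mult_def)
  have vM: "v \<in> carrier M" "c \<odot>\<^bsub>M\<^esub> s \<in> carrier M"
    using submodule_in[OF insert.prems(3) vc(1)] J_in[OF vc(2)] s by auto
  have "s \<ominus>\<^bsub>M\<^esub> c \<odot>\<^bsub>M\<^esub> s = v \<oplus>\<^bsub>M\<^esub> c \<odot>\<^bsub>M\<^esub> s \<ominus>\<^bsub>M\<^esub> c \<odot>\<^bsub>M\<^esub> s"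
    using arg_cong[OF vc(3), of "\<lambda>z. z \<ominus>\<^bsub>M\<^esub> c \<odot>\<^bsub>M\<^esub> s"] .
  also have "\<dots> = v" using vM by (simp add: M.M.minus_eq M.M.a_assoc M.M.r_neg)
  finally have "s \<ominus>\<^bsub>M\<^esub> c \<odot>\<^bsub>M\<^esub> s \<in> N" using vc(1) by simp
  moreover obtain j where "E j \<odot>\<^bsub>M\<^esub> s = s" using insert.prems(2) by blast
  ultimately have sN: "s \<in> N" using quasi_regular[OF M insert.prems(3) s _ vc(2)] by blast
  have "?N' \<subseteq> N"
    using submodule_add[OF insert.prems(3)] submodule_smult[OF insert.prems(3) _ sN]
    by (auto simp: set_add_def set_mult_def)
  then show "insert s S \<subseteq> N" using sN \<open>S \<subseteq> ?N'\<close> by blast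
qed

end

section \<open>The opposite ring\<close>

lemma op_ring_simps [simp]:
  "carrier (op_ring R) = carrier R" "zero (op_ring R) = zero R" "one (op_ring R) = one R"
  "add (op_ring R) = add R" "mult (op_ring R) x y = mult R y x"
  by (simp_all add: op_ring_def)

lemma op_op_ring [simp]: "op_ring (op_ring R) = R"
  by (simp add: op_ring_def)

lemma finsum_op_ring: "finsum (op_ring R) f I = finsum R f I"
  by (simp add: finsum_def finprod_def comp_def)

lemma (in ring) ring_op: "ring (op_ring R)"
proof (rule ringI)
  show "abelian_group (op_ring R)" by (rule abelian_groupI) (auto simp: a_ac intro: l_neg)
  show "Group.monoid (op_ring R)" by (rule monoidI) (auto simp: m_assoc)
qed (auto simp: l_distr r_distr)

text \<open>All axioms are symmetric, \<open>E_off\<close> and \<open>E_orth\<close> after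
  exchanging \<open>i\<close> and \<open>j\<close>. Right-module versions of the results are
  obtained through this instance.\<close>

lemma (in idem_ring) idem_ring_op: "idem_ring (op_ring R) n E J"
proof -
  interpret O: ring "op_ring R" by (rule ring_op)
  have "ideal J (op_ring R)"
  proof (rule idealI[OF ring_op])
    show "subgroup J (add_monoid (op_ring R))"
      using additive_subgroup.a_subgroup[OF ideal.axioms(1)[OF J_ideal]] by (simp add: op_ring_def)
  qed (auto intro: J_left J_right)
  moreover have "\<exists>c\<in>carrier R. E i \<otimes> (r \<otimes> E i) \<otimes> c = E i \<and> c \<otimes> (E i \<otimes> (r \<otimes> E i)) = E i"
    if "r \<in> carrier R" "E i \<otimes> (r \<otimes> E i) \<notin> J" for i r
    using E_unit[of r i] that by (simp add: m_assoc) blast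
  moreover have "E j \<otimes> (r \<otimes> E i) \<in> J" if "r \<in> carrier R" "i mod int n \<noteq> j mod int n" for i j r
    using E_off[of r j i] that by (simp add: m_assoc)
  moreover have "E j \<otimes> E i = \<zero>" if "i mod int n \<noteq> j mod int n" for i j using E_orth that by metis
  ultimately show ?thesis
    by (intro idem_ring.intro idem_ring_axioms.intro ring_op)
      (auto simp: n_pos E_mod E_sum finsum_op_ring E_notin_J)
qed

section \<open>The arrow read off from a transpose\<close>

lemma minus_regular_module: "x \<ominus>\<^bsub>regular_module R\<^esub> y = x \<ominus>\<^bsub>R\<^esub> y"
  by (simp add: a_minus_def a_inv_def m_inv_def)

abbreviation functionals :: "('a, 'r) ring_scheme \<Rightarrow> ('a, 'm) module \<Rightarrow> ('m \<Rightarrow> 'a) set" where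
  "functionals R P \<equiv> module_hom R P (regular_module R)"

text \<open>Multiplying values on the right keeps left linearity; this is the scalar action on the
  dual.\<close>

lemma (in left_module) functional_lincomb:
  assumes f: "f \<in> functionals R M" and g: "g \<in> functionals R M" and b: "b \<in> carrier R"
  shows "(\<lambda>x\<in>carrier M. g x \<oplus> f x \<otimes> b) \<in> functionals R M"
proof (rule module_homI[OF _ _ _ left_module_axioms])
  note c = module_hom_closed[OF f, simplified] module_hom_closed[OF g, simplified]
  note a = module_hom_add[OF f, simplified] module_hom_add[OF g, simplified]
  note s = module_hom_smult[OF f, simplified] module_hom_smult[OF g, simplified]
  show "g x \<oplus> f x \<otimes> b \<in> carrier (regular_module R)" if "x \<in> carrier M" for x using that c b by simp
  show "g (x \<oplus>\<^bsub>M\<^esub> y) \<oplus> f (x \<oplus>\<^bsub>M\<^esub> y) \<otimes> b = (g x \<oplus> f x \<otimes> b) \<oplus>\<^bsub>regular_module R\<^esub> (g y \<oplus> f y \<otimes> b)"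
    if "x \<in> carrier M" "y \<in> carrier M" for x y
    using that c b by (simp add: a R.l_distr R.a_ac)
  show "g (r \<odot>\<^bsub>M\<^esub> x) \<oplus> f (r \<odot>\<^bsub>M\<^esub> x) \<otimes> b = r \<odot>\<^bsub>regular_module R\<^esub> (g x \<oplus> f x \<otimes> b)"
    if "r \<in> carrier R" "x \<in> carrier M" for r x
    using that c b by (simp add: s R.r_distr R.m_assoc)
qed

lemma (in left_module) functional_zero: "(\<lambda>x\<in>carrier M. \<zero>) \<in> functionals R M"
  by (rule module_homI[OF _ _ _ left_module_axioms]) auto

lemma (in left_module) functional_right_mult:
  assumes f: "f \<in> functionals R M" and b: "b \<in> carrier R"
  shows "(\<lambda>x\<in>carrier M. f x \<otimes> b) \<in> functionals R M"
proof -
  have "(\<lambda>x\<in>carrier M. (\<lambda>x\<in>carrier M. \<zero>) x \<oplus> f x \<otimes> b) = (\<lambda>x\<in>carrier M. f x \<otimes> b)"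
    using module_hom_closed[OF f] b by (auto intro!: restrict_ext)
  then show ?thesis using functional_lincomb[OF f functional_zero b] by simp
qed

lemma star_module_simps [simp]:
  "carrier (star_module R M) = functionals R M"
  "zero (star_module R M) = (\<lambda>x\<in>carrier M. zero R)"
  "add (star_module R M) f g = (\<lambda>x\<in>carrier M. f x \<oplus>\<^bsub>R\<^esub> g x)"
  "smult (star_module R M) a f = (\<lambda>x\<in>carrier M. f x \<otimes>\<^bsub>R\<^esub> a)"
  by (simp_all add: star_module_def)

lemma (in left_module) star_left_module: "left_module (op_ring R) (star_module R M)"
proof (intro left_module.intro left_module_axioms.intro R.ring_op)
  have c: "f x \<in> carrier R" if "f \<in> functionals R M" "x \<in> carrier M" for f x
    using module_hom_closed[OF that] by simp
  have r: "restrict f (carrier M) = f" if "f \<in> functionals R M" for f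
    using that by (auto simp: module_hom_def PiE_def extensional_restrict)
  have ad: "(\<lambda>x\<in>carrier M. f x \<oplus> g x) \<in> functionals R M" if "f \<in> functionals R M" "g \<in> functionals R M" for f g
  proof -
    have "(\<lambda>x\<in>carrier M. f x \<oplus> g x) = (\<lambda>x\<in>carrier M. f x \<oplus> g x \<otimes> \<one>)"
      using c[OF that(2)] by (auto intro!: restrict_ext)
    then show ?thesis using functional_lincomb[OF that(2,1) R.one_closed] by simp
  qed
  show "abelian_group (star_module R M)"
  proof (rule abelian_groupI)
    fix f assume f: "f \<in> carrier (star_module R M)"
    then have f': "f \<in> functionals R M" by simp
    show "\<zero>\<^bsub>star_module R M\<^esub> \<oplus>\<^bsub>star_module R M\<^esub> f = f"
      using c[OF f'] by (subst (2) r[OF f', symmetric]) (auto intro!: restrict_ext)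
    have "\<And>x. x \<in> carrier M \<Longrightarrow> f x \<otimes> \<ominus> \<one> \<oplus> f x = \<zero>"
      using c[OF f'] by (simp add: R.r_minus R.l_neg)
    then show "\<exists>g\<in>carrier (star_module R M). g \<oplus>\<^bsub>star_module R M\<^esub> f = \<zero>\<^bsub>star_module R M\<^esub>"
      using functional_right_mult[OF f', of "\<ominus> \<one>"]
      by (intro bexI[of _ "\<lambda>x\<in>carrier M. f x \<otimes> \<ominus> \<one>"]) (auto intro!: restrict_ext)
  qed (auto simp: ad functional_zero c R.a_assoc intro!: restrict_ext R.a_comm)
  show "a \<odot>\<^bsub>star_module R M\<^esub> f \<in> carrier (star_module R M)"
    if "a \<in> carrier (op_ring R)" "f \<in> carrier (star_module R M)" for a f
    using that by (auto intro: functional_right_mult)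
  show "\<one>\<^bsub>op_ring R\<^esub> \<odot>\<^bsub>star_module R M\<^esub> f = f" if "f \<in> carrier (star_module R M)" for f
  proof -
    have f: "f \<in> functionals R M" using that by simp
    show ?thesis using c[OF f] by (subst (2) r[OF f, symmetric]) (auto intro!: restrict_ext)
  qed
qed (auto intro!: restrict_ext simp: R.l_distr R.r_distr R.m_assoc
    module_hom_closed[where N = "regular_module R", simplified])

section \<open>Radicals of projectives, and the arrow\<close>

context idem_ring
begin

text \<open>For projective \<open>P\<close> this is \<open>J P\<close>, by a dual basis. Testing
  with functionals makes membership checkable without sums of products.\<close>

definition Jrad :: "('a, 'm) module \<Rightarrow> 'm set" where
  "Jrad P = {p \<in> carrier P. \<forall>g \<in> functionals R P. g p \<in> J}"

lemma functional_closed: "\<lbrakk>g \<in> functionals R P; p \<in> carrier P\<rbrakk> \<Longrightarrow> g p \<in> carrier R"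
  using module_hom_closed[of g R P "regular_module R" p] by simp

lemma functional_smult: "\<lbrakk>g \<in> functionals R P; r \<in> carrier R; p \<in> carrier P\<rbrakk> \<Longrightarrow> g (r \<odot>\<^bsub>P\<^esub> p) = r \<otimes> g p"
  using module_hom_smult[of g R P "regular_module R" r p] by simp

lemma functional_add: "\<lbrakk>g \<in> functionals R P; q \<in> carrier P; p \<in> carrier P\<rbrakk> \<Longrightarrow> g (q \<oplus>\<^bsub>P\<^esub> p) = g q \<oplus> g p"
  using module_hom_add[of g R P "regular_module R" q p] by simp

lemma functional_diff:
  assumes "g \<in> functionals R P" "left_module R P" "q \<in> carrier P" "p \<in> carrier P"
  shows "g (q \<ominus>\<^bsub>P\<^esub> p) = g q \<ominus> g p"
  using module_hom_diff[OF assms(1,2) regular_left_module assms(3,4)] by (simp add: minus_regular_module)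

lemma Jrad_submodule: "left_module R P \<Longrightarrow> submodule (Jrad P) R P"
proof -
  assume P: "left_module R P"
  then interpret P: left_module R P .
  have z: "g \<zero>\<^bsub>P\<^esub> = \<zero>" if "g \<in> functionals R P" for g
    using module_hom_zero[OF that P regular_left_module] by simp
  show ?thesis unfolding Jrad_def
    by (rule P.submoduleI') (auto simp: z J_zero functional_add J_add functional_smult J_left)
qed

lemma J_smult_Jrad:
  "\<lbrakk>left_module R P; c \<in> J; p \<in> carrier P\<rbrakk> \<Longrightarrow> c \<odot>\<^bsub>P\<^esub> p \<in> Jrad P"
  by (auto simp: Jrad_def functional_smult J_in functional_closed J_right
      intro: left_module.smult_closed)

lemma Jrad_component:
  "\<lbrakk>left_module R P; p \<in> carrier P; p \<notin> Jrad P\<rbrakk> \<Longrightarrow> \<exists>j. E j \<odot>\<^bsub>P\<^esub> p \<notin> Jrad P"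
  using split_module[OF _ Jrad_submodule, of P p] by blast

text \<open>A functional whose value at \<open>p\<close> is outside \<open>J\<close> can be
  corrected on the right by an inverse from the local corner. It then splits off the copy of
  \<open>R (E j)\<close> generated by \<open>p\<close>.\<close>

lemma local_functional:
  assumes P: "left_module R P" and p: "p \<in> carrier P" "E j \<odot>\<^bsub>P\<^esub> p = p" "p \<notin> Jrad P"
  obtains g where "g \<in> functionals R P" "g p = E j" "\<And>x. x \<in> carrier P \<Longrightarrow> g x \<otimes> E j = g x"
proof -
  interpret P: left_module R P by fact
  obtain f where f: "f \<in> functionals R P" "f p \<notin> J" using p by (auto simp: Jrad_def)
  have fp: "f p \<in> carrier R" "E j \<otimes> f p = f p"
    using functional_closed[OF f(1) p(1)] functional_smult[OF f(1) _ p(1), of "E j"] p(2) by auto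
  obtain c where c: "c \<in> carrier R" "f p \<otimes> c = E j" using right_inverse[OF fp f(2)] by blast
  show ?thesis
  proof (rule that[OF P.functional_right_mult[OF f(1), of "c \<otimes> E j"]])
    show "(\<lambda>x\<in>carrier P. f x \<otimes> (c \<otimes> E j)) p = E j" using p(1) c fp by (simp add: m_assoc[symmetric])
    show "(\<lambda>x\<in>carrier P. f x \<otimes> (c \<otimes> E j)) x \<otimes> E j = (\<lambda>x\<in>carrier P. f x \<otimes> (c \<otimes> E j)) x"
      if "x \<in> carrier P" for x
      using that c functional_closed[OF f(1) that] by (simp add: m_assoc)
  qed (use c in auto)
qed

text \<open>A kernel element outside \<open>Jrad P\<close> has a component \<open>q\<close> outside
  it, and \<open>q\<close> splits off: the kernel of the functional \<open>g\<close> is a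
  complement. As \<open>q\<close> maps to zero, this proper complement still maps onto
  \<open>M\<close>, against minimality of the cover.\<close>

lemma kernel_in_Jrad:
  assumes cov: "projective_cover R P M \<epsilon>" and M: "left_module R M" and p: "p \<in> carrier P" "\<epsilon> p = \<zero>\<^bsub>M\<^esub>"
  shows "p \<in> Jrad P"
proof (rule ccontr)
  assume n: "p \<notin> Jrad P"
  have P: "left_module R P" using cov by (simp add: projective_cover_def projective_def fg_module_def)
  interpret P: left_module R P by fact
  interpret M: left_module R M by fact
  have \<epsilon>: "\<epsilon> \<in> module_hom R P M" "\<epsilon> ` carrier P = carrier M"
    using cov by (auto simp: projective_cover_def module_epi_def)
  obtain j where j: "E j \<odot>\<^bsub>P\<^esub> p \<notin> Jrad P" using Jrad_component[OF P p(1) n] by blast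
  define q where "q = E j \<odot>\<^bsub>P\<^esub> p"
  have q: "q \<in> carrier P" "E j \<odot>\<^bsub>P\<^esub> q = q" "q \<notin> Jrad P"
    using p j by (auto simp: q_def P.smult_assoc[symmetric])
  have \<epsilon>q: "\<epsilon> q = \<zero>\<^bsub>M\<^esub>" using p module_hom_smult[OF \<epsilon>(1) E_closed p(1)] by (simp add: q_def M.smult_zero_right)
  obtain g where g: "g \<in> functionals R P" "g q = E j" "\<And>x. x \<in> carrier P \<Longrightarrow> g x \<otimes> E j = g x"
    using local_functional[OF P q] by blast
  let ?L = "a_kernel P (regular_module R) g"
  have L: "submodule ?L R P" using kernel_submodule[OF g(1) P regular_left_module] .
  have "carrier M \<subseteq> \<epsilon> ` ?L"
  proof
    fix y assume "y \<in> carrier M"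
    then obtain x where x: "x \<in> carrier P" "y = \<epsilon> x" using \<epsilon>(2) by auto
    have gx: "g x \<in> carrier R" using functional_closed[OF g(1) x(1)] .
    have "g (x \<ominus>\<^bsub>P\<^esub> g x \<odot>\<^bsub>P\<^esub> q) = g x \<ominus> g x \<otimes> E j"
      using functional_diff[OF g(1) P x(1)] functional_smult[OF g(1) gx q(1)] q gx g(2) by simp
    then have "x \<ominus>\<^bsub>P\<^esub> g x \<odot>\<^bsub>P\<^esub> q \<in> ?L" using x q gx g(3) by (simp add: a_kernel_def' minus_eq r_neg)
    moreover have "\<epsilon> (x \<ominus>\<^bsub>P\<^esub> g x \<odot>\<^bsub>P\<^esub> q) = y"
      using module_hom_diff[OF \<epsilon>(1) P M x(1)] module_hom_smult[OF \<epsilon>(1) gx q(1)] q gx x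
        module_hom_closed[OF \<epsilon>(1) x(1)] by (simp add: \<epsilon>q M.smult_zero_right M.M.minus_eq)
    ultimately show "y \<in> \<epsilon> ` ?L" by (metis imageI)
  qed
  moreover have "\<epsilon> ` ?L \<subseteq> carrier M" using \<epsilon>(2) by (auto simp: a_kernel_def')
  ultimately have "?L = carrier P" using cov L by (auto simp: projective_cover_def)
  then have "g q = \<zero>" using q(1) by (auto simp: a_kernel_def')
  then show False using g(2) E_nonzero by simp
qed

text \<open>By a dual basis \<open>p\<close> is a combination of the \<open>b i\<close> with
  coefficients \<open>f i p\<close> in \<open>J\<close>.\<close>

lemma Jrad_killed:
  assumes P: "projective R P" and N: "left_module R N" and h: "h \<in> module_hom R P N"
    and JN: "\<And>c x. \<lbrakk>c \<in> J; x \<in> carrier N\<rbrakk> \<Longrightarrow> c \<odot>\<^bsub>N\<^esub> x = \<zero>\<^bsub>N\<^esub>" and p: "p \<in> Jrad P"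
  shows "h p = \<zero>\<^bsub>N\<^esub>"
proof -
  have lm: "left_module R P" using P by (simp add: projective_def fg_module_def)
  interpret P: left_module R P by fact
  interpret N: left_module R N by fact
  obtain m b f where bf: "\<And>i. i < m \<Longrightarrow> b i \<in> carrier P" "\<And>i. i < m \<Longrightarrow> f i \<in> functionals R P"
    "\<And>p. p \<in> carrier P \<Longrightarrow> p = (\<Oplus>\<^bsub>P\<^esub>i\<in>{..<(m::nat)}. f i p \<odot>\<^bsub>P\<^esub> b i)"
    using dual_basis[OF P] by blast
  have pP: "p \<in> carrier P" and fp: "\<And>i. i < m \<Longrightarrow> f i p \<in> J" using p bf(2) by (auto simp: Jrad_def)
  have "h p = h (\<Oplus>\<^bsub>P\<^esub>i\<in>{..<m}. f i p \<odot>\<^bsub>P\<^esub> b i)" by (rule arg_cong[OF bf(3)[OF pP]])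
  also have "\<dots> = (\<Oplus>\<^bsub>N\<^esub>i\<in>{..<m}. h (f i p \<odot>\<^bsub>P\<^esub> b i))"
    using bf(1) fp J_in by (intro module_hom_finsum[OF h lm N]) auto
  also have "\<dots> = (\<Oplus>\<^bsub>N\<^esub>i\<in>{..<m}. \<zero>\<^bsub>N\<^esub>)"
    using bf(1) fp J_in JN module_hom_closed[OF h] by (intro N.M.finsum_cong') (auto simp: module_hom_smult[OF h])
  finally show ?thesis by simp
qed

lemma J_cyclic_submodule:
  assumes M: "left_module R M" and s: "s \<in> carrier M"
  shows "submodule {c \<odot>\<^bsub>M\<^esub> s | c. c \<in> J} R M"
proof -
  interpret M: left_module R M by fact
  let ?Js = "{c \<odot>\<^bsub>M\<^esub> s | c. c \<in> J}"
  show ?thesis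
  proof (rule M.submoduleI')
    show "?Js \<subseteq> carrier M" using s J_in by auto
    show "\<zero>\<^bsub>M\<^esub> \<in> ?Js" using M.smult_zero_left[OF s] J_zero by force
    fix x y assume "x \<in> ?Js" "y \<in> ?Js"
    then obtain c d where "c \<in> J" "d \<in> J" "x = c \<odot>\<^bsub>M\<^esub> s" "y = d \<odot>\<^bsub>M\<^esub> s" by auto
    then show "x \<oplus>\<^bsub>M\<^esub> y \<in> ?Js" using s J_in J_add M.smult_l_distr[of c d s] by force
  next
    fix a x assume "a \<in> carrier R" "x \<in> ?Js"
    then obtain c where "c \<in> J" "x = c \<odot>\<^bsub>M\<^esub> s" by auto
    then show "a \<odot>\<^bsub>M\<^esub> x \<in> ?Js" using s J_in J_left M.smult_assoc[of a c s] \<open>a \<in> carrier R\<close> by force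
  qed
qed

lemma annihilator_left_ideal:
  assumes M: "left_module R M" and L: "submodule L R M" and x: "x \<in> carrier M"
  shows "left_ideal {r \<in> carrier R. r \<odot>\<^bsub>M\<^esub> x \<in> L} R"
proof -
  interpret M: left_module R M by fact
  show ?thesis
    by (rule left_module.submoduleI'[OF regular_left_module])
      (auto simp: x M.smult_zero_left M.smult_l_distr M.smult_assoc
        intro: submodule_zero[OF L] submodule_add[OF L] submodule_smult[OF L])
qed

lemma J_smult_split:
  assumes M: "left_module R M" and L: "submodule L R M" and x: "x \<in> carrier M" and c: "c \<in> J"
    and E: "\<And>j. c \<odot>\<^bsub>M\<^esub> (E j \<odot>\<^bsub>M\<^esub> x) \<in> L"
  shows "c \<odot>\<^bsub>M\<^esub> x \<in> L"
proof -
  interpret M: left_module R M by fact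
  have "c \<in> {r \<in> carrier R. r \<odot>\<^bsub>M\<^esub> x \<in> L}"
    by (rule split_right[OF annihilator_left_ideal[OF M L x]]) (use E x J_in[OF c] in \<open>auto simp: M.smult_assoc\<close>)
  then show ?thesis by simp
qed


text \<open>In the minimal presentation, simplicity of \<open>X\<close> makes \<open>P1\<close>
  cyclic at \<open>l\<close>, so the radical of \<open>P0\<close> is cyclic, generated by
  \<open>y\<close>. This in turn makes \<open>P0\<close> cyclic at \<open>i\<close>, and
  \<open>a\<close> is the coordinate of \<open>y\<close>. Left generation by \<open>a\<close> is
  cyclicity of the radical; right generation is exactness of the dual sequence at
  \<open>Hom(P1, R)\<close>. That \<open>M\<close> has only one top factor is derived, not
  assumed.\<close>

lemma transpose_arrow:
  fixes M :: "('a, 'm) module" and X :: "('a, 'x) module"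
  assumes M: "left_module R M" and JM: "\<And>c x. \<lbrakk>c \<in> J; x \<in> carrier M\<rbrakk> \<Longrightarrow> c \<odot>\<^bsub>M\<^esub> x = \<zero>\<^bsub>M\<^esub>"
    and EM: "\<And>j x. \<lbrakk>j mod int n \<noteq> i mod int n; x \<in> carrier M\<rbrakk> \<Longrightarrow> E j \<odot>\<^bsub>M\<^esub> x = \<zero>\<^bsub>M\<^esub>"
    and X: "left_module (op_ring R) X" and X0: "carrier X \<noteq> {\<zero>\<^bsub>X\<^esub>}"
    and JX: "\<And>c x. \<lbrakk>c \<in> J; x \<in> carrier X\<rbrakk> \<Longrightarrow> c \<odot>\<^bsub>X\<^esub> x = \<zero>\<^bsub>X\<^esub>"
    and EX: "\<And>j x. \<lbrakk>j mod int n \<noteq> l mod int n; x \<in> carrier X\<rbrakk> \<Longrightarrow> E j \<odot>\<^bsub>X\<^esub> x = \<zero>\<^bsub>X\<^esub>"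
    and simple: "\<And>x y. \<lbrakk>x \<in> carrier X; x \<noteq> \<zero>\<^bsub>X\<^esub>; y \<in> carrier X\<rbrakk> \<Longrightarrow> \<exists>b \<in> carrier R. y = b \<odot>\<^bsub>X\<^esub> x"
    and tr: "is_transpose R M X"
  obtains a where "a \<in> J" "E l \<otimes> a = a" "a \<otimes> E i = a"
    "\<And>x. x \<in> J \<Longrightarrow> \<exists>r \<in> carrier R. x \<otimes> E i = r \<otimes> a"
    "\<And>x. x \<in> J \<Longrightarrow> \<exists>r \<in> carrier R. E l \<otimes> x = a \<otimes> r"
proof -
  interpret M: left_module R M by fact
  interpret X: left_module "op_ring R" X by fact
  interpret O: idem_ring "op_ring R" n E J by (rule idem_ring_op)
  obtain P0 P1 :: "'a fmod" and \<epsilon> d \<pi> where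
    c0: "projective_cover R P0 M \<epsilon>" and c1: "projective_cover R P1 (sub_module P0 (a_kernel P0 M \<epsilon>)) d"
    and \<pi>e: "\<pi> \<in> module_epi (op_ring R) (star_module R P1) X"
    and ker\<pi>: "a_kernel (star_module R P1) X \<pi> = (\<lambda>f. compose (carrier P1) f d) ` carrier (star_module R P0)"
    using tr unfolding is_transpose_def by blast
  have pr: "projective R P0" "projective R P1" using c0 c1 by (auto simp: projective_cover_def)
  then have P0: "left_module R P0" and P1: "left_module R P1" by (auto simp: projective_def fg_module_def)
  interpret P0: left_module R P0 by fact
  interpret P1: left_module R P1 by fact
  have \<epsilon>: "\<epsilon> \<in> module_hom R P0 M" "\<epsilon> ` carrier P0 = carrier M"
    and sup0: "\<And>L. \<lbrakk>submodule L R P0; \<epsilon> ` L = carrier M\<rbrakk> \<Longrightarrow> L = carrier P0"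
    using c0 by (auto simp: projective_cover_def module_epi_def)
  have \<pi>: "\<pi> \<in> module_hom (op_ring R) (star_module R P1) X" "\<pi> ` functionals R P1 = carrier X"
    using \<pi>e by (auto simp: module_epi_def)
  \<comment> \<open>One inclusion is minimality of the cover, the other holds because
    \<open>J\<close> kills \<open>M\<close>.\<close>
  have K: "a_kernel P0 M \<epsilon> = Jrad P0"
    using kernel_in_Jrad[OF c0 M] Jrad_killed[OF pr(1) M \<epsilon>(1) JM] by (auto simp: a_kernel_def' Jrad_def)
  have inK: "p \<in> Jrad P0 \<longleftrightarrow> p \<in> carrier P0 \<and> \<epsilon> p = \<zero>\<^bsub>M\<^esub>" for p
    using K by (auto simp: a_kernel_def')
  note KS = Jrad_submodule[OF P0]
  have KM: "left_module R (sub_module P0 (Jrad P0))" by (rule P0.sub_module_left_module[OF KS])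
  have c1': "projective_cover R P1 (sub_module P0 (Jrad P0)) d" using c1 unfolding K .
  then have dK: "d \<in> module_hom R P1 (sub_module P0 (Jrad P0))" "d ` carrier P1 = Jrad P0"
    by (auto simp: projective_cover_def module_epi_def)
  have dr: "d p \<in> Jrad P0" if "p \<in> carrier P1" for p using dK(2) that by blast
  then have dc: "d p \<in> carrier P0" if "p \<in> carrier P1" for p using that by (auto simp: Jrad_def)
  have ds: "d (r \<odot>\<^bsub>P1\<^esub> p) = r \<odot>\<^bsub>P0\<^esub> d p" if "r \<in> carrier R" "p \<in> carrier P1" for r p
    using module_hom_smult[OF dK(1) that] by simp
  \<comment> \<open>By a dual basis \<open>g\<close> is the sum of the \<open>f i\<close> acted on
    by \<open>g (b i)\<close>, and these scalars lie in \<open>J\<close>, which kills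
    \<open>X\<close>.\<close>
  have \<pi>J: "\<pi> g = \<zero>\<^bsub>X\<^esub>" if g: "g \<in> functionals R P1" "\<And>p. p \<in> carrier P1 \<Longrightarrow> g p \<in> J" for g
  proof -
    interpret S: left_module "op_ring R" "star_module R P1" by (rule P1.star_left_module)
    obtain m b f where bf: "\<And>i. i < m \<Longrightarrow> b i \<in> carrier P1" "\<And>i. i < m \<Longrightarrow> f i \<in> functionals R P1"
      "\<And>p. p \<in> carrier P1 \<Longrightarrow> p = (\<Oplus>\<^bsub>P1\<^esub>i\<in>{..<(m::nat)}. f i p \<odot>\<^bsub>P1\<^esub> b i)"
      using dual_basis[OF pr(2)] by blast
    define t where "t i = g (b i) \<odot>\<^bsub>star_module R P1\<^esub> f i" for i
    have gb: "g (b i) \<in> J" "g (b i) \<in> carrier R" if "i < m" for i using g(2) bf(1) that J_in by auto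
    have t: "t i \<in> carrier (star_module R P1)" if "i < m" for i
      unfolding t_def using gb bf(2) that by (intro S.smult_closed) auto
    have sum: "(\<Oplus>\<^bsub>star_module R P1\<^esub>i\<in>{..<m}. t i) \<in> functionals R P1"
      using S.M.finsum_closed[of t "{..<m}"] t by (auto simp: Pi_iff)
    have "g = (\<Oplus>\<^bsub>star_module R P1\<^esub>i\<in>{..<m}. t i)"
    proof (rule module_hom_ext[OF g(1) sum])
      fix p assume p: "p \<in> carrier P1"
      have fb: "f i p \<in> carrier R" if "i < m" for i using functional_closed[OF bf(2)[OF that] p] .
      have ev: "(\<lambda>h\<in>carrier (star_module R P1). h p) \<in>
          module_hom (op_ring R) (star_module R P1) (regular_module (op_ring R))"
        by (rule module_homI[OF _ _ _ S.left_module_axioms])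
          (use p in \<open>auto simp: functional_closed intro: P1.functional_right_mult\<close>)
      have "(\<Oplus>\<^bsub>star_module R P1\<^esub>i\<in>{..<m}. t i) p = (\<lambda>h\<in>carrier (star_module R P1). h p) (\<Oplus>\<^bsub>star_module R P1\<^esub>i\<in>{..<m}. t i)"
        using sum by simp
      also have "\<dots> = (\<Oplus>i\<in>{..<m}. (\<lambda>h\<in>carrier (star_module R P1). h p) (t i))"
        using module_hom_finsum[OF ev S.left_module_axioms ring.regular_left_module[OF ring_op], of "{..<m}" t] t
        by (simp add: finsum_regular_module finsum_op_ring)
      also have "\<dots> = (\<Oplus>i\<in>{..<m}. f i p \<otimes> g (b i))"
        using t p gb functional_closed[OF bf(2) p] by (intro finsum_cong') (auto simp: t_def)
      also have "\<dots> = (\<Oplus>i\<in>{..<m}. g (f i p \<odot>\<^bsub>P1\<^esub> b i))"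
        using fb bf(1) by (intro finsum_cong') (auto simp: functional_closed[OF g(1)] functional_smult[OF g(1)])
      also have "\<dots> = g (\<Oplus>\<^bsub>P1\<^esub>i\<in>{..<m}. f i p \<odot>\<^bsub>P1\<^esub> b i)"
        using module_hom_finsum[OF g(1) P1 regular_left_module, of "{..<m}" "\<lambda>i. f i p \<odot>\<^bsub>P1\<^esub> b i"] bf(1) fb
        by (simp add: finsum_regular_module)
      also have "\<dots> = g p" by (rule arg_cong[OF bf(3)[OF p], symmetric])
      finally show "g p = (\<Oplus>\<^bsub>star_module R P1\<^esub>i\<in>{..<m}. t i) p" by simp
    qed
    then have "\<pi> g = \<pi> (\<Oplus>\<^bsub>star_module R P1\<^esub>i\<in>{..<m}. t i)" by simp
    also have "\<dots> = (\<Oplus>\<^bsub>X\<^esub>i\<in>{..<m}. \<pi> (t i))"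
      using t by (intro module_hom_finsum[OF \<pi>(1) S.left_module_axioms X]) auto
    also have "\<dots> = (\<Oplus>\<^bsub>X\<^esub>i\<in>{..<m}. \<zero>\<^bsub>X\<^esub>)"
    proof (rule X.M.finsum_cong')
      fix i assume "i \<in> {..<m}"
      then have i: "i < m" by simp
      have "\<pi> (t i) = g (b i) \<odot>\<^bsub>X\<^esub> \<pi> (f i)"
        unfolding t_def using gb[OF i] bf(2)[OF i] by (intro module_hom_smult[OF \<pi>(1)]) auto
      then show "\<pi> (t i) = \<zero>\<^bsub>X\<^esub>" using JX[OF gb(1)[OF i]] module_hom_closed[OF \<pi>(1)] bf(2)[OF i] by simp
    qed auto
    finally show ?thesis by simp
  qed
  have Jval: "\<exists>h \<in> functionals R P0. \<forall>p \<in> carrier P1. g p = h (d p)"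
    if g: "g \<in> functionals R P1" "\<pi> g = \<zero>\<^bsub>X\<^esub>" for g
  proof -
    have "g \<in> (\<lambda>f. compose (carrier P1) f d) ` carrier (star_module R P0)"
      using g ker\<pi> by (auto simp: a_kernel_def')
    then show ?thesis by (auto simp: compose_def)
  qed
  \<comment> \<open>Converse of the previous fact: an element of the kernel of \<open>\<pi>\<close>
    factors through \<open>d\<close>, whose image is the radical of \<open>P0\<close>. So
    \<open>\<pi>\<close> kills exactly the functionals with values in \<open>J\<close>.\<close>
  have \<pi>J': "g p \<in> J" if "g \<in> functionals R P1" "\<pi> g = \<zero>\<^bsub>X\<^esub>" "p \<in> carrier P1" for g p
    using Jval[OF that(1,2)] that(3) dr[OF that(3)] by (auto simp: Jrad_def)
  obtain \<xi> where \<xi>: "\<xi> \<in> carrier X" "\<xi> \<noteq> \<zero>\<^bsub>X\<^esub>" using X0 X.M.zero_closed by blast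
  obtain \<phi> where \<phi>: "\<phi> \<in> functionals R P1" "\<pi> \<phi> \<noteq> \<zero>\<^bsub>X\<^esub>" "\<And>p. p \<in> carrier P1 \<Longrightarrow> \<phi> p \<otimes> E l = \<phi> p"
  proof -
    obtain j where j: "E j \<odot>\<^bsub>X\<^esub> \<xi> \<noteq> \<zero>\<^bsub>X\<^esub>"
      using O.split_module[OF X X.zero_submodule \<xi>(1)] \<xi>(2) by blast
    then have "E j = E l" using EX[of j \<xi>] \<xi>(1) E_cong by blast
    then have l: "E l \<odot>\<^bsub>X\<^esub> \<xi> \<noteq> \<zero>\<^bsub>X\<^esub>" using j by simp
    obtain g where g: "g \<in> functionals R P1" "\<xi> = \<pi> g" using \<pi>(2) \<xi>(1) by blast
    have "\<pi> (E l \<odot>\<^bsub>star_module R P1\<^esub> g) = E l \<odot>\<^bsub>X\<^esub> \<xi>"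
      using module_hom_smult[OF \<pi>(1), of "E l" g] g by simp
    then show ?thesis
      using l P1.functional_right_mult[OF g(1) E_closed, of l] functional_closed[OF g(1)]
      by (intro that[of "\<lambda>x\<in>carrier P1. g x \<otimes> E l"]) (auto simp: m_assoc)
  qed
  obtain p0 where p0: "p0 \<in> carrier P1" "E l \<odot>\<^bsub>P1\<^esub> p0 = p0" "\<phi> p0 = E l"
  proof -
    obtain p where p: "p \<in> carrier P1" "\<phi> p \<notin> J" using \<pi>J[OF \<phi>(1)] \<phi>(2) by blast
    obtain c where c: "c \<in> carrier R" "c \<otimes> \<phi> p = E l"
      using left_inverse[of "\<phi> p" l] functional_closed[OF \<phi>(1) p(1)] \<phi>(3)[OF p(1)] p(2) by blast
    have "\<phi> ((E l \<otimes> c) \<odot>\<^bsub>P1\<^esub> p) = (E l \<otimes> c) \<otimes> \<phi> p"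
      using c p by (intro functional_smult[OF \<phi>(1)]) auto
    also have "\<dots> = E l" using c functional_closed[OF \<phi>(1) p(1)] by (simp add: m_assoc)
    finally show ?thesis using c p
      by (intro that[of "(E l \<otimes> c) \<odot>\<^bsub>P1\<^esub> p"]) (auto simp: P1.smult_assoc[symmetric] m_assoc[symmetric])
  qed
  \<comment> \<open>Otherwise a component \<open>q\<close> of \<open>z\<close> supports a functional
    \<open>g\<close> with \<open>g q = E j\<close>. Simplicity of \<open>X\<close> makes
    \<open>\<pi> g\<close> a multiple of \<open>\<pi> \<phi>\<close>, so \<open>g - \<phi> b\<close>
    is killed by \<open>\<pi>\<close> and has values in \<open>J\<close>; but its value at
    \<open>q\<close> is \<open>E j\<close>.\<close>
  have ker\<phi>: "z \<in> Jrad P1" if z: "z \<in> carrier P1" "\<phi> z = \<zero>" for z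
  proof (rule ccontr)
    assume "z \<notin> Jrad P1"
    then obtain j where j: "E j \<odot>\<^bsub>P1\<^esub> z \<notin> Jrad P1" using Jrad_component[OF P1 z(1)] by blast
    define q where "q = E j \<odot>\<^bsub>P1\<^esub> z"
    have q: "q \<in> carrier P1" "E j \<odot>\<^bsub>P1\<^esub> q = q" "q \<notin> Jrad P1"
      using z j by (auto simp: q_def P1.smult_assoc[symmetric])
    have \<phi>q: "\<phi> q = \<zero>" using functional_smult[OF \<phi>(1) E_closed z(1)] z(2) by (simp add: q_def)
    obtain g where g: "g \<in> functionals R P1" "g q = E j" "\<And>x. x \<in> carrier P1 \<Longrightarrow> g x \<otimes> E j = g x"
      using local_functional[OF P1 q] by blast
    have gX: "\<pi> g \<in> carrier X" "\<pi> \<phi> \<in> carrier X" using \<pi>(2) g(1) \<phi>(1) by auto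
    obtain b where b: "b \<in> carrier R" "\<pi> g = b \<odot>\<^bsub>X\<^esub> \<pi> \<phi>" using simple[OF gX(2) \<phi>(2) gX(1)] by blast
    define h where "h = (\<lambda>x\<in>carrier P1. g x \<oplus> \<phi> x \<otimes> (\<ominus> b))"
    have h: "h \<in> functionals R P1" unfolding h_def using b by (intro P1.functional_lincomb \<phi> g) auto
    have "h = g \<oplus>\<^bsub>star_module R P1\<^esub> ((\<ominus> b) \<odot>\<^bsub>star_module R P1\<^esub> \<phi>)"
      by (auto simp: h_def)
    then have "\<pi> h = \<pi> g \<oplus>\<^bsub>X\<^esub> (\<ominus> b) \<odot>\<^bsub>X\<^esub> \<pi> \<phi>"
      using module_hom_add[OF \<pi>(1), of g "(\<ominus> b) \<odot>\<^bsub>star_module R P1\<^esub> \<phi>"]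
        module_hom_smult[OF \<pi>(1), of "\<ominus> b" \<phi>] g(1) \<phi>(1) b(1) P1.functional_right_mult[OF \<phi>(1), of "\<ominus> b"]
      by simp
    also have "\<dots> = \<zero>\<^bsub>X\<^esub>"
      using b gX X.smult_l_distr[of b "\<ominus> b" "\<pi> \<phi>"] X.smult_zero_left[of "\<pi> \<phi>"] by (simp add: r_neg)
    finally have "h q \<in> J" using \<pi>J'[OF h _ q(1)] by simp
    then have "E j \<in> J" using q(1) g(2) \<phi>q b(1) by (simp add: h_def)
    then show False using E_notin_J by simp
  qed
  let ?Rp = "{r \<odot>\<^bsub>P1\<^esub> p0 | r. r \<in> carrier R}"
  note Rp = P1.cyclic_submodule[OF p0(1)]
  have P1_gen: "carrier P1 \<subseteq> ?Rp"
  proof -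
    obtain m b f where bf: "\<And>i. i < m \<Longrightarrow> b i \<in> carrier P1" "\<And>i. i < m \<Longrightarrow> f i \<in> functionals R P1"
      "\<And>p. p \<in> carrier P1 \<Longrightarrow> p = (\<Oplus>\<^bsub>P1\<^esub>i\<in>{..<(m::nat)}. f i p \<odot>\<^bsub>P1\<^esub> b i)"
      using dual_basis[OF pr(2)] by blast
    \<comment> \<open>\<open>nakayama\<close> wants generators fixed by idempotents, so the dual
      basis is cut by all of them.\<close>
    let ?S = "(\<lambda>(j, i). E (int j) \<odot>\<^bsub>P1\<^esub> b i) ` ({..<n} \<times> {..<m})"
    have S: "E j \<odot>\<^bsub>P1\<^esub> b i \<in> ?S" if "i < m" for i j
      using E_in_set[of j] that by force
    have SR: "?S \<subseteq> ?Rp"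
    proof (rule nakayama[OF P1 _ _ _ Rp])
      show "?S \<subseteq> carrier P1" using bf(1) by auto
      show "\<exists>j. E j \<odot>\<^bsub>P1\<^esub> s = s" if s: "s \<in> ?S" for s
      proof -
        obtain j i where "i < m" "s = E (int j) \<odot>\<^bsub>P1\<^esub> b i" using s by auto
        then show ?thesis using bf(1) by (intro exI[of _ "int j"]) (simp add: P1.smult_assoc[symmetric])
      qed
      fix L assume L: "submodule L R P1" "?Rp \<subseteq> L" "\<And>t c. t \<in> ?S \<Longrightarrow> c \<in> J \<Longrightarrow> c \<odot>\<^bsub>P1\<^esub> t \<in> L"
      have Jb: "c \<odot>\<^bsub>P1\<^esub> b i \<in> L" if "c \<in> J" "i < m" for c i
        by (rule J_smult_split[OF P1 L(1) bf(1)[OF that(2)] that(1)]) (use L(3)[OF S[OF that(2)] that(1)] in blast)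
      have "p \<in> L" if p: "p \<in> carrier P1" for p
      proof -
        have \<phi>p: "\<phi> p \<in> carrier R" using functional_closed[OF \<phi>(1) p] .
        define z where "z = p \<ominus>\<^bsub>P1\<^esub> \<phi> p \<odot>\<^bsub>P1\<^esub> p0"
        have z: "z \<in> carrier P1" using p \<phi>p p0 by (simp add: z_def)
        have "\<phi> z = \<zero>" unfolding z_def
          using functional_diff[OF \<phi>(1) P1 p] functional_smult[OF \<phi>(1) \<phi>p p0(1)] p0 \<phi>(3)[OF p] \<phi>p
          by (simp add: minus_eq r_neg)
        then have zJ: "z \<in> Jrad P1" by (rule ker\<phi>[OF z])
        have "(\<Oplus>\<^bsub>P1\<^esub>i\<in>{..<m}. f i z \<odot>\<^bsub>P1\<^esub> b i) \<in> L"
          using zJ bf(2) by (intro P1.submodule_finsum[OF L(1)] Jb) (auto simp: Jrad_def)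
        then have "z \<in> L" by (rule iffD2[OF arg_cong[OF bf(3)[OF z], of "\<lambda>z. z \<in> L"]])
        moreover have "\<phi> p \<odot>\<^bsub>P1\<^esub> p0 \<in> L" using L(2) \<phi>p by blast
        ultimately have "z \<oplus>\<^bsub>P1\<^esub> \<phi> p \<odot>\<^bsub>P1\<^esub> p0 \<in> L" by (rule submodule_add[OF L(1)])
        then show ?thesis using p \<phi>p p0 by (simp add: z_def P1.M.minus_eq P1.M.a_assoc P1.M.l_neg)
      qed
      then show "?S \<subseteq> L" using bf(1) by auto
    qed auto
    have bR: "b i \<in> ?Rp" if "i < m" for i
      by (rule split_module[OF P1 Rp bf(1)[OF that]], rule subsetD[OF SR S[OF that]])
    show ?thesis
    proof
      fix p assume p: "p \<in> carrier P1"
      have "(\<Oplus>\<^bsub>P1\<^esub>i\<in>{..<m}. f i p \<odot>\<^bsub>P1\<^esub> b i) \<in> ?Rp"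
        using functional_closed[OF bf(2) p] bR
        by (intro P1.submodule_finsum[OF Rp] submodule_smult[OF Rp]) auto
      then show "p \<in> ?Rp" by (rule iffD2[OF arg_cong[OF bf(3)[OF p], of "\<lambda>z. z \<in> ?Rp"]])
    qed
  qed
  define y where "y = d p0"
  have y: "y \<in> Jrad P0" "y \<in> carrier P0" "E l \<odot>\<^bsub>P0\<^esub> y = y"
    using dr[OF p0(1)] dc[OF p0(1)] ds[OF E_closed[of l] p0(1)] p0(2) by (simp_all add: y_def)
  have K_gen: "\<exists>r \<in> carrier R. p = r \<odot>\<^bsub>P0\<^esub> y" if p: "p \<in> Jrad P0" for p
  proof -
    obtain q where q: "q \<in> carrier P1" "p = d q" using p dK(2) by blast
    then obtain r where "r \<in> carrier R" "q = r \<odot>\<^bsub>P1\<^esub> p0" using P1_gen by blast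
    then show ?thesis using q ds p0(1) by (auto simp: y_def)
  qed
  \<comment> \<open>Minimality of the cover \<open>d\<close> would put \<open>p0\<close> into the
    radical of \<open>P1\<close>, although \<open>\<phi> p0\<close> is an idempotent outside
    \<open>J\<close>.\<close>
  have y0: "y \<noteq> \<zero>\<^bsub>P0\<^esub>"
  proof
    assume "y = \<zero>\<^bsub>P0\<^esub>"
    then have "p0 \<in> Jrad P1" using kernel_in_Jrad[OF c1' KM p0(1)] by (simp add: y_def)
    then show False using \<phi>(1) p0(3) E_notin_J by (auto simp: Jrad_def)
  qed
  have inM: "E j = E i" if "p \<in> carrier P0" "E j \<odot>\<^bsub>P0\<^esub> p \<notin> Jrad P0" for j p
  proof (rule ccontr)
    assume "E j \<noteq> E i"
    then have "\<epsilon> (E j \<odot>\<^bsub>P0\<^esub> p) = \<zero>\<^bsub>M\<^esub>"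
      using EM[of j "\<epsilon> p"] E_cong module_hom_closed[OF \<epsilon>(1) that(1)] module_hom_smult[OF \<epsilon>(1) E_closed that(1)]
      by metis
    then show False using that inK by auto
  qed
  obtain x where x: "x \<in> carrier P0" "E i \<odot>\<^bsub>P0\<^esub> x = x" "x \<notin> Jrad P0"
  proof -
    have "\<exists>x. x \<in> carrier P0 \<and> x \<notin> Jrad P0"
    proof (rule ccontr)
      assume "\<not> ?thesis"
      then have "\<epsilon> p = \<zero>\<^bsub>M\<^esub>" if "p \<in> carrier P0" for p using that inK by blast
      then have "\<epsilon> ` {\<zero>\<^bsub>P0\<^esub>} = carrier M" using \<epsilon>(2) P0.M.zero_closed by (auto simp: image_iff)
      then have "{\<zero>\<^bsub>P0\<^esub>} = carrier P0" by (rule sup0[OF P0.zero_submodule])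
      then show False using y(2) y0 by blast
    qed
    then obtain x' where x': "x' \<in> carrier P0" "x' \<notin> Jrad P0" by blast
    then obtain j where j: "E j \<odot>\<^bsub>P0\<^esub> x' \<notin> Jrad P0" using Jrad_component[OF P0] by blast
    then have "E j = E i" by (rule inM[OF x'(1)])
    then show ?thesis using that[of "E i \<odot>\<^bsub>P0\<^esub> x'"] j x'(1) by (simp add: P0.smult_assoc[symmetric])
  qed
  obtain f where f: "f \<in> functionals R P0" "f x = E i" "\<And>p. p \<in> carrier P0 \<Longrightarrow> f p \<otimes> E i = f p"
    using local_functional[OF P0 x] by blast
  \<comment> \<open>A second top factor at \<open>i\<close> is excluded. With dual functionals
    \<open>f\<close>, \<open>g\<close> for \<open>x\<close>, \<open>z\<close>, cyclicity of the
    radical writes each \<open>b\<close> in \<open>J E i\<close> as a multiple of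
    \<open>\<alpha>\<close> by a scalar killing \<open>\<beta>\<close>, and vice versa. Applied to
    \<open>b = \<alpha>\<close>, the scalar is either in \<open>J\<close>, whence
    \<open>\<alpha> = 0\<close>, or invertible, whence \<open>\<beta> = 0\<close>. Either way
    \<open>J E i = 0\<close>, and then \<open>y\<close> lies in \<open>J y\<close>.\<close>
  have no_other: False if z: "z \<in> carrier P0" "E i \<odot>\<^bsub>P0\<^esub> z = z" "z \<notin> Jrad P0" "f z = \<zero>" for z
  proof -
    obtain g0 where g0: "g0 \<in> functionals R P0" "g0 z = E i" "\<And>p. p \<in> carrier P0 \<Longrightarrow> g0 p \<otimes> E i = g0 p"
      using local_functional[OF P0 z(1,2,3)] by blast
    have g0x: "g0 x \<in> carrier R" "E i \<otimes> g0 x = g0 x" 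
      using functional_closed[OF g0(1) x(1)] functional_smult[OF g0(1) E_closed x(1), of i] x(2) by auto
    define g where "g = (\<lambda>p\<in>carrier P0. g0 p \<oplus> f p \<otimes> (\<ominus> g0 x))"
    have g: "g \<in> functionals R P0" unfolding g_def using g0x by (intro P0.functional_lincomb f g0) auto
    have gx: "g x = \<zero>" using x(1) g0x f(2) by (simp add: g_def r_minus r_neg)
    have gz: "g z = E i" using z(1,4) g0(2) g0x by (simp add: g_def)
    have gE: "g p \<otimes> E i = g p" if "p \<in> carrier P0" for p
      using that g0(3)[OF that] g0(3)[OF x(1)] g0x functional_closed[OF f(1) that] functional_closed[OF g0(1) that]
      by (simp add: g_def l_distr m_assoc l_minus)
    define \<alpha> \<beta> where "\<alpha> = f y" and "\<beta> = g y"
    have \<alpha>: "\<alpha> \<in> J" "\<alpha> \<in> carrier R" "\<alpha> \<otimes> E i = \<alpha>" "E l \<otimes> \<alpha> = \<alpha>"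
      using y f functional_smult[OF f(1) E_closed y(2), of l] functional_closed[OF f(1) y(2)]
      by (auto simp: \<alpha>_def Jrad_def)
    have \<beta>: "\<beta> \<in> J" "\<beta> \<in> carrier R" "\<beta> \<otimes> E i = \<beta>" "E l \<otimes> \<beta> = \<beta>"
      using y g gE functional_smult[OF g E_closed y(2), of l] functional_closed[OF g y(2)]
      by (auto simp: \<beta>_def Jrad_def)
    have xr: "\<exists>r \<in> carrier R. b = r \<otimes> \<alpha> \<and> r \<otimes> \<beta> = \<zero>" if b: "b \<in> J" "b \<otimes> E i = b" for b
    proof -
      obtain r where r: "r \<in> carrier R" "b \<odot>\<^bsub>P0\<^esub> x = r \<odot>\<^bsub>P0\<^esub> y" using K_gen J_smult_Jrad[OF P0 b(1) x(1)] by blast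
      have "b \<otimes> f x = r \<otimes> \<alpha>" "b \<otimes> g x = r \<otimes> \<beta>"
        using r functional_smult[OF f(1) J_in[OF b(1)] x(1)] functional_smult[OF f(1) r(1) y(2)]
          functional_smult[OF g J_in[OF b(1)] x(1)] functional_smult[OF g r(1) y(2)] by (auto simp: \<alpha>_def \<beta>_def)
      then show ?thesis using r(1) f(2) gx b J_in by (intro bexI[of _ r]) auto
    qed
    have zr: "\<exists>r \<in> carrier R. b = r \<otimes> \<beta> \<and> r \<otimes> \<alpha> = \<zero>" if b: "b \<in> J" "b \<otimes> E i = b" for b
    proof -
      obtain r where r: "r \<in> carrier R" "b \<odot>\<^bsub>P0\<^esub> z = r \<odot>\<^bsub>P0\<^esub> y" using K_gen J_smult_Jrad[OF P0 b(1) z(1)] by blast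
      have "b \<otimes> f z = r \<otimes> \<alpha>" "b \<otimes> g z = r \<otimes> \<beta>"
        using r functional_smult[OF f(1) J_in[OF b(1)] z(1)] functional_smult[OF f(1) r(1) y(2)]
          functional_smult[OF g J_in[OF b(1)] z(1)] functional_smult[OF g r(1) y(2)] by (auto simp: \<alpha>_def \<beta>_def)
      then show ?thesis using r(1) z(4) gz b J_in by (intro bexI[of _ r]) auto
    qed
    have JE: "b = \<zero>" if b: "b \<in> J" "b \<otimes> E i = b" for b
    proof -
      obtain r where r: "r \<in> carrier R" "\<alpha> = r \<otimes> \<alpha>" "r \<otimes> \<beta> = \<zero>" using xr[OF \<alpha>(1,3)] by blast
      define s where "s = E l \<otimes> r \<otimes> E l"
      have s: "s \<in> carrier R" "s \<otimes> E l = s" "s \<otimes> \<alpha> = \<alpha>" "s \<otimes> \<beta> = \<zero>"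
        using r \<alpha> \<beta> by (auto simp: s_def m_assoc)
      show ?thesis
      proof (cases "s \<in> J")
        case True
        have "\<alpha> \<in> {\<zero>}"
        proof (rule quasi_regular[OF regular_left_module _ _ _ True, of _ \<alpha> l])
          show "\<alpha> \<ominus>\<^bsub>regular_module R\<^esub> s \<odot>\<^bsub>regular_module R\<^esub> \<alpha> \<in> {\<zero>}"
            using s \<alpha> by (simp add: minus_regular_module minus_eq r_neg)
        qed (use \<alpha> zero_left_ideal in auto)
        then show ?thesis using xr[OF b] by auto
      next
        case False
        then obtain c where c: "c \<in> carrier R" "c \<otimes> s = E l" using left_inverse[OF s(1,2)] by blast
        have "\<beta> = (c \<otimes> s) \<otimes> \<beta>" using c \<beta> by simp
        also have "\<dots> = \<zero>" using c(1) s \<beta>(2) by (simp add: m_assoc)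
        finally show ?thesis using zr[OF b] by auto
      qed
    qed
    obtain m b h where bh: "\<And>i. i < m \<Longrightarrow> b i \<in> carrier P0" "\<And>i. i < m \<Longrightarrow> h i \<in> functionals R P0"
      "\<And>p. p \<in> carrier P0 \<Longrightarrow> p = (\<Oplus>\<^bsub>P0\<^esub>i\<in>{..<(m::nat)}. h i p \<odot>\<^bsub>P0\<^esub> b i)"
      using dual_basis[OF pr(1)] by blast
    note Jy = J_cyclic_submodule[OF P0 y(2)]
    let ?Jy = "{c \<odot>\<^bsub>P0\<^esub> y | c. c \<in> J}"
    have "c \<odot>\<^bsub>P0\<^esub> b k \<in> ?Jy" if c: "c \<in> J" and k: "k < m" for c k
    proof (rule J_smult_split[OF P0 Jy bh(1)[OF k] c])
      fix j
      show "c \<odot>\<^bsub>P0\<^esub> (E j \<odot>\<^bsub>P0\<^esub> b k) \<in> ?Jy"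
      proof (cases "E j \<odot>\<^bsub>P0\<^esub> b k \<in> Jrad P0")
        case True
        then obtain r where r: "r \<in> carrier R" "E j \<odot>\<^bsub>P0\<^esub> b k = r \<odot>\<^bsub>P0\<^esub> y" using K_gen by blast
        then have "c \<odot>\<^bsub>P0\<^esub> (E j \<odot>\<^bsub>P0\<^esub> b k) = (c \<otimes> r) \<odot>\<^bsub>P0\<^esub> y" using J_in[OF c] y by (simp add: P0.smult_assoc)
        then show ?thesis using J_right[OF r(1) c] by blast
      next
        case False
        then have "E j = E i" by (rule inM[OF bh(1)[OF k]])
        moreover have "c \<otimes> E i = \<zero>" using J_in[OF c] by (intro JE J_right c) (auto simp: m_assoc)
        ultimately have "c \<odot>\<^bsub>P0\<^esub> (E j \<odot>\<^bsub>P0\<^esub> b k) = \<zero>\<^bsub>P0\<^esub>"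
          using bh(1)[OF k] J_in[OF c] by (simp add: P0.smult_assoc[symmetric] P0.smult_zero_left)
        then show ?thesis using submodule_zero[OF Jy] by simp
      qed
    qed
    then have "(\<Oplus>\<^bsub>P0\<^esub>i\<in>{..<m}. h i y \<odot>\<^bsub>P0\<^esub> b i) \<in> ?Jy"
      using y(1) bh(2) by (intro P0.submodule_finsum[OF Jy]) (auto simp: Jrad_def)
    then have "y \<in> ?Jy" by (rule iffD2[OF arg_cong[OF bh(3)[OF y(2)], of "\<lambda>z. z \<in> ?Jy"]])
    then obtain c where c: "c \<in> J" "y = c \<odot>\<^bsub>P0\<^esub> y" by blast
    have "y \<ominus>\<^bsub>P0\<^esub> c \<odot>\<^bsub>P0\<^esub> y \<in> {\<zero>\<^bsub>P0\<^esub>}" unfolding c(2)[symmetric] using y(2) by (simp add: P0.M.minus_eq P0.M.r_neg)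
    then have "y \<in> {\<zero>\<^bsub>P0\<^esub>}" by (rule quasi_regular[OF P0 P0.zero_submodule y(2,3) c(1)])
    then show False using y0 by blast
  qed
  let ?Rx = "{r \<odot>\<^bsub>P0\<^esub> x | r. r \<in> carrier R}"
  note Rx = P0.cyclic_submodule[OF x(1)]
  have "carrier M \<subseteq> \<epsilon> ` ?Rx"
  proof
    fix u assume "u \<in> carrier M"
    then obtain p where p: "p \<in> carrier P0" "u = \<epsilon> p" using \<epsilon>(2) by blast
    have fp: "f p \<in> carrier R" using functional_closed[OF f(1) p(1)] .
    define z where "z = p \<ominus>\<^bsub>P0\<^esub> f p \<odot>\<^bsub>P0\<^esub> x"
    have z: "z \<in> carrier P0" using p fp x by (simp add: z_def)
    have fz: "f z = \<zero>" unfolding z_def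
      using functional_diff[OF f(1) P0 p(1)] functional_smult[OF f(1) fp x(1)] x f(2) f(3)[OF p(1)] fp
      by (simp add: minus_eq r_neg)
    have "z \<in> Jrad P0"
    proof (rule ccontr)
      assume "z \<notin> Jrad P0"
      then obtain j where j: "E j \<odot>\<^bsub>P0\<^esub> z \<notin> Jrad P0" using Jrad_component[OF P0 z] by blast
      then have "E j = E i" by (rule inM[OF z])
      then show False using j z fz no_other[of "E i \<odot>\<^bsub>P0\<^esub> z"] functional_smult[OF f(1) E_closed z]
        by (simp add: P0.smult_assoc[symmetric])
    qed
    then have "\<epsilon> z = \<zero>\<^bsub>M\<^esub>" using inK by blast
    moreover have "p = z \<oplus>\<^bsub>P0\<^esub> f p \<odot>\<^bsub>P0\<^esub> x"
      using p fp x by (simp add: z_def P0.M.minus_eq P0.M.a_assoc P0.M.l_neg)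
    ultimately have "u = \<epsilon> (f p \<odot>\<^bsub>P0\<^esub> x)"
      using module_hom_add[OF \<epsilon>(1) z, of "f p \<odot>\<^bsub>P0\<^esub> x"] fp x module_hom_closed[OF \<epsilon>(1), of "f p \<odot>\<^bsub>P0\<^esub> x"] p(2)
      by simp
    then show "u \<in> \<epsilon> ` ?Rx" using fp by blast
  qed
  moreover have "\<epsilon> ` ?Rx \<subseteq> carrier M" using module_hom_closed[OF \<epsilon>(1)] x(1) by auto
  ultimately have P0_gen: "?Rx = carrier P0" by (intro sup0[OF Rx] subset_antisym)
  have fx: "p = f p \<odot>\<^bsub>P0\<^esub> x" if "p \<in> carrier P0" for p
  proof -
    have "p \<in> ?Rx" unfolding P0_gen by (rule that)
    then obtain r where r: "r \<in> carrier R" "p = r \<odot>\<^bsub>P0\<^esub> x" by blast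
    have "f p \<odot>\<^bsub>P0\<^esub> x = (r \<otimes> E i) \<odot>\<^bsub>P0\<^esub> x" using functional_smult[OF f(1) r(1) x(1)] r f(2) by simp
    also have "\<dots> = p" using r x by (simp add: P0.smult_assoc)
    finally show ?thesis by simp
  qed
  \<comment> \<open>Under \<open>P0 = R x\<close>, with \<open>x\<close> corresponding to
    \<open>E i\<close>, this is the generator of the radical seen inside
    \<open>R (E i)\<close>.\<close>
  define a where "a = f y"
  have a: "a \<in> J" "a \<in> carrier R" "a \<otimes> E i = a" "E l \<otimes> a = a"
    using y f functional_smult[OF f(1) E_closed y(2), of l] functional_closed[OF f(1) y(2)]
    by (auto simp: a_def Jrad_def)
  show ?thesis
  proof (rule that[OF a(1,4,3)])
    fix b assume b: "b \<in> J"
    have bE: "b \<otimes> E i \<in> J" using b by (intro J_right) auto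
    obtain r where r: "r \<in> carrier R" "(b \<otimes> E i) \<odot>\<^bsub>P0\<^esub> x = r \<odot>\<^bsub>P0\<^esub> y"
      using K_gen J_smult_Jrad[OF P0 bE x(1)] by blast
    have "(b \<otimes> E i) \<otimes> f x = r \<otimes> a"
      using functional_smult[OF f(1) J_in[OF bE] x(1)] functional_smult[OF f(1) r(1) y(2)] r(2)
      by (simp add: a_def)
    then show "\<exists>r \<in> carrier R. b \<otimes> E i = r \<otimes> a" using r(1) f(2) J_in[OF b] by (auto simp: m_assoc)
  next
    fix b assume b: "b \<in> J"
    \<comment> \<open>A functional with values in \<open>J\<close>, hence killed by
      \<open>\<pi>\<close> and factoring through \<open>d\<close>; its value at \<open>p0\<close>
      exhibits the right multiple of \<open>a\<close>.\<close>
    define \<psi> where "\<psi> = (\<lambda>p\<in>carrier P1. \<phi> p \<otimes> b)"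
    have \<psi>: "\<psi> \<in> functionals R P1" unfolding \<psi>_def by (rule P1.functional_right_mult[OF \<phi>(1) J_in[OF b]])
    have "\<pi> \<psi> = \<zero>\<^bsub>X\<^esub>" by (rule \<pi>J[OF \<psi>]) (auto simp: \<psi>_def intro!: J_left b functional_closed[OF \<phi>(1)])
    then obtain h where h: "h \<in> functionals R P0" "\<And>p. p \<in> carrier P1 \<Longrightarrow> \<psi> p = h (d p)"
      using Jval[OF \<psi>] by blast
    have "E l \<otimes> b = h y" using h(2)[OF p0(1)] p0 by (simp add: \<psi>_def y_def)
    also have "\<dots> = h (a \<odot>\<^bsub>P0\<^esub> x)" using fx[OF y(2)] by (simp add: a_def)
    also have "\<dots> = a \<otimes> h x" using functional_smult[OF h(1) a(2) x(1)] .
    finally show "\<exists>r \<in> carrier R. E l \<otimes> b = a \<otimes> r" using functional_closed[OF h(1) x(1)] by blast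
  qed
qed

end

section \<open>Arrows and paths\<close>

text \<open>Only left generation is required here. When \<open>P 1\<close> is simple, paths are
  already needed for an auxiliary arrow about which the right-hand condition is not known.\<close>

locale left_arrow_ring = idem_ring +
  fixes A :: "int \<Rightarrow> 'a"
  assumes A_J: "A i \<in> J"
    and A_mod: "A (i mod int n) = A i"
    and E_A: "E (i - 1) \<otimes> A i = A i"
    and A_E: "A i \<otimes> E i = A i"
    and J_E: "x \<in> J \<Longrightarrow> \<exists>r \<in> carrier R. x \<otimes> E i = r \<otimes> A i"
begin

lemma A_closed [simp, intro]: "A i \<in> carrier R"
  using A_J J_in by blast

text \<open>The path of length \<open>s\<close> ending in \<open>i\<close>; it generates \<open>J\<^sup>s e\<^sub>i\<close>.\<close>

primrec path :: "int \<Rightarrow> nat \<Rightarrow> 'a" where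
  "path i 0 = E i"
| "path i (Suc s) = A (i - int s) \<otimes> path i s"

lemma path_closed [simp, intro]: "path i s \<in> carrier R"
  by (induction s) auto

lemma A_cong: "i mod int n = j mod int n \<Longrightarrow> A i = A j"
  by (metis A_mod)

lemma path_cong: "i mod int n = j mod int n \<Longrightarrow> path i s = path j s"
  by (induction s) (auto intro: E_cong arg_cong2[of _ _ _ _ "(\<otimes>)"] A_cong mod_diff_cong)

lemma path_E [simp]: "path i s \<otimes> E i = path i s"
  by (induction s) (auto simp: m_assoc)

lemma E_path [simp]: "E (i - int s) \<otimes> path i s = path i s"
proof (cases s)
  case (Suc t)
  have "E (i - int s) \<otimes> A (i - int t) = A (i - int t)"
    using E_A[of "i - int t"] Suc by (simp add: algebra_simps)
  then show ?thesis using Suc by (simp add: m_assoc[symmetric])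
qed simp

lemma E_path_cong: "l mod int n = (i - int s) mod int n \<Longrightarrow> E l \<otimes> path i s = path i s"
  using E_path[of i s] E_cong by metis

lemma path_add: "path i (s + t) = path (i - int s) t \<otimes> path i s"
proof (induction t)
  case (Suc t)
  have "path i (s + Suc t) = A (i - int (s + t)) \<otimes> (path (i - int s) t \<otimes> path i s)"
    using Suc by simp
  also have "\<dots> = path (i - int s) (Suc t) \<otimes> path i s" by (simp add: m_assoc algebra_simps)
  finally show ?case .
qed simp

lemma J_path: "x \<in> J \<Longrightarrow> \<exists>r \<in> carrier R. x \<otimes> path i s = r \<otimes> path i (Suc s)"
proof -
  assume x: "x \<in> J"
  obtain r where r: "r \<in> carrier R" "x \<otimes> E (i - int s) = r \<otimes> A (i - int s)" using J_E[OF x] by blast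
  have "x \<otimes> path i s = (x \<otimes> E (i - int s)) \<otimes> path i s" using J_in[OF x] by (simp add: m_assoc)
  also have "\<dots> = r \<otimes> path i (Suc s)" using r by (simp add: m_assoc)
  finally show ?thesis using r(1) by blast
qed

text \<open>The coefficient is moved past one arrow at a time with \<open>J_E\<close>. This is the
  substitute for commutation when a path has to act through an arbitrary element.\<close>

lemma path_commute_right:
  "r \<in> carrier R \<Longrightarrow> \<exists>r' \<in> carrier R. path i s \<otimes> r \<otimes> E i = r' \<otimes> path i s"
proof (induction s)
  case 0
  then show ?case by (intro bexI[of _ "E i \<otimes> r"]) (auto simp: m_assoc)
next
  case (Suc s)
  then obtain r' where r': "r' \<in> carrier R" "path i s \<otimes> r \<otimes> E i = r' \<otimes> path i s" by blast
  have "A (i - int s) \<otimes> r' \<in> J" using r' by (intro J_right A_J)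
  then obtain t where t: "t \<in> carrier R" "A (i - int s) \<otimes> r' \<otimes> E (i - int s) = t \<otimes> A (i - int s)"
    using J_E by blast
  have "path i (Suc s) \<otimes> r \<otimes> E i = A (i - int s) \<otimes> (path i s \<otimes> r \<otimes> E i)"
    using Suc.prems by (simp add: m_assoc)
  also have "\<dots> = A (i - int s) \<otimes> r' \<otimes> E (i - int s) \<otimes> path i s" unfolding r'(2) using r'(1) by (simp add: m_assoc)
  also have "\<dots> = t \<otimes> path i (Suc s)" unfolding t(2) using t(1) by (simp add: m_assoc)
  finally show ?case using t(1) by blast
qed

lemma path_quasi_regular: "\<lbrakk>c \<in> J; c \<otimes> path i s = path i s\<rbrakk> \<Longrightarrow> path i s = \<zero>"
  using quasi_regular[OF regular_left_module zero_left_ideal, of "path i s" "i - int s" c]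
  by (simp add: minus_regular_module minus_eq r_neg)

lemma path_zero_add: "path i s = \<zero> \<Longrightarrow> path i (s + t) = \<zero>"
  by (simp add: path_add)

lemma path_zero_mono: "\<lbrakk>path i s = \<zero>; s \<le> t\<rbrakk> \<Longrightarrow> path i t = \<zero>"
  using path_zero_add[of i s "t - s"] by simp

lemma lgen_path_mono: "s \<le> t \<Longrightarrow> lgen (path i t) \<subseteq> lgen (path i s)"
proof (rule lgen_minimal[OF lgen_left_ideal])
  assume "s \<le> t"
  then have "path i t = path (i - int s) (t - s) \<otimes> path i s" using path_add[of i s "t - s"] by simp
  then show "path i t \<in> lgen (path i s)" by (auto simp: lgen_def)
qed auto

lemma lgen_E_iff: "x \<in> lgen (E i) \<longleftrightarrow> x \<in> carrier R \<and> x \<otimes> E i = x"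
proof
  assume "x \<in> carrier R \<and> x \<otimes> E i = x"
  then have "x = x \<otimes> E i" "x \<in> carrier R" by simp_all
  then show "x \<in> lgen (E i)" unfolding lgen_def by blast
qed (auto simp: lgen_def m_assoc)

end

locale left_nak_ring = left_arrow_ring +
  assumes path_nilpotent: "\<exists>s. path i s = \<zero>"
begin

text \<open>This will turn out to be the composition length of \<open>R (E i)\<close>.\<close>

definition len :: "int \<Rightarrow> nat" where "len i = (LEAST s. path i s = \<zero>)"

lemma path_zero_iff: "path i s = \<zero> \<longleftrightarrow> len i \<le> s"
proof
  show "path i s = \<zero> \<Longrightarrow> len i \<le> s" unfolding len_def by (rule Least_le)
  have "path i (len i) = \<zero>" unfolding len_def using path_nilpotent by (rule LeastI_ex)
  then show "len i \<le> s \<Longrightarrow> path i s = \<zero>" by (rule path_zero_mono)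
qed

lemma path_len [simp]: "path i (len i) = \<zero>"
  by (simp add: path_zero_iff)

lemma len_pos: "0 < len i"
  using path_zero_iff[of i 0] E_nonzero[of i] by (cases "len i") auto

lemma len_cong: "i mod int n = j mod int n \<Longrightarrow> len i = len j"
proof -
  assume "i mod int n = j mod int n"
  then have "path i s = path j s" for s by (rule path_cong)
  then show ?thesis by (simp add: len_def)
qed

text \<open>A path of this length has the vanishing path of length \<open>len (i - int s)\<close> as
  left factor. The case \<open>s = 1\<close> is the growth bound of a Kupisch series.\<close>

lemma len_sub: "len i \<le> s + len (i - int s)"
proof -
  have "path i (s + len (i - int s)) = \<zero>" by (simp add: path_add)
  then show ?thesis by (simp only: path_zero_iff)
qed

lemma len_step: "len (i + 1) \<le> len i + 1"
  using len_sub[of "i + 1" 1] by simp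

text \<open>Take \<open>s\<close> largest with \<open>x\<close> in \<open>R (path i s)\<close>. The
  coefficient is then outside \<open>J\<close> and invertible from the left, so \<open>x\<close> and
  \<open>path i s\<close> generate the same left ideal.\<close>

lemma order_of:
  assumes x: "x \<in> lgen (E i)" "x \<noteq> \<zero>"
  obtains s r c where "s < len i" "r \<in> carrier R" "x = r \<otimes> path i s" "c \<in> carrier R" "c \<otimes> x = path i s"
proof -
  define s where "s = (GREATEST s. x \<in> lgen (path i s))"
  have ex: "x \<in> lgen (path i 0)" using x by simp
  have bd: "t < len i" if "x \<in> lgen (path i t)" for t
  proof (rule ccontr)
    assume "\<not> t < len i"
    then have "path i t = \<zero>" by (simp add: path_zero_iff)
    then show False using that x(2) by (simp add: lgen_zero)
  qed
  have s: "x \<in> lgen (path i s)" unfolding s_def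
    using GreatestI_nat[of "\<lambda>s. x \<in> lgen (path i s)", OF ex, of "len i"] bd less_imp_le by blast
  have s': "x \<notin> lgen (path i (Suc s))"
    using Greatest_le_nat[of "\<lambda>s. x \<in> lgen (path i s)" "Suc s" "len i"] bd less_imp_le s_def
    by (metis Suc_n_not_le_n)
  obtain r where r: "r \<in> carrier R" "x = r \<otimes> path i s" using s by (auto simp: lgen_def)
  have "r \<otimes> E (i - int s) \<notin> J"
  proof
    assume "r \<otimes> E (i - int s) \<in> J"
    then obtain t where "t \<in> carrier R" "r \<otimes> E (i - int s) \<otimes> path i s = t \<otimes> path i (Suc s)" using J_path by blast
    then have "x \<in> lgen (path i (Suc s))" using r by (auto simp: m_assoc lgen_def)
    then show False using s' by blast
  qed
  then obtain c where c: "c \<in> carrier R" "c \<otimes> (r \<otimes> E (i - int s)) = E (i - int s)"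
    using left_inverse[of "r \<otimes> E (i - int s)" "i - int s"] r by (auto simp: m_assoc)
  have "c \<otimes> x = c \<otimes> (r \<otimes> E (i - int s)) \<otimes> path i s" using c(1) r by (simp add: m_assoc)
  also have "\<dots> = path i s" unfolding c(2) by simp
  finally show ?thesis using that[OF bd[OF s] r c(1)] by blast
qed

text \<open>For different residues \<open>E_off\<close> would put
  \<open>E (i - int s) \<otimes> c \<otimes> E l\<close> into \<open>J\<close>, and
  \<open>path i s\<close> would be a \<open>J\<close>-multiple of itself.\<close>

lemma order_index:
  assumes x: "x \<in> carrier R" "E l \<otimes> x = x" and r: "r \<in> carrier R" "x = r \<otimes> path i s"
    and c: "c \<in> carrier R" "c \<otimes> x = path i s" and s: "s < len i"
  shows "l mod int n = (i - int s) mod int n"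
proof (rule ccontr)
  assume "\<not> ?thesis"
  then have "E (i - int s) \<otimes> c \<otimes> E l \<in> J" using E_off[OF c(1), of "i - int s" l] by metis
  then have J: "E (i - int s) \<otimes> c \<otimes> E l \<otimes> r \<in> J" using r(1) by (rule J_right[rotated])
  have "E (i - int s) \<otimes> c \<otimes> E l \<otimes> r \<otimes> path i s = E (i - int s) \<otimes> (c \<otimes> (E l \<otimes> x))"
    using r c x by (simp add: m_assoc)
  also have "\<dots> = path i s" using x c by simp
  finally have "path i s = \<zero>" using path_quasi_regular[OF J] by simp
  then show False using s by (simp add: path_zero_iff)
qed

text \<open>Take the shortest path in \<open>U\<close>. By \<open>order_of\<close> every element of
  \<open>U\<close> brings the path of its own order into \<open>U\<close>.\<close>

lemma left_ideal_in_projective: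
  assumes U: "left_ideal U R" "U \<subseteq> lgen (E i)"
  obtains s where "s \<le> len i" "U = lgen (path i s)"
proof -
  define s where "s = (LEAST s. path i s \<in> U)"
  have ex: "path i (len i) \<in> U" using left_ideal_zero[OF U(1)] by simp
  have s: "path i s \<in> U" "s \<le> len i" unfolding s_def
    using LeastI[of "\<lambda>s. path i s \<in> U", OF ex] Least_le[of "\<lambda>s. path i s \<in> U", OF ex] by auto
  have "U \<subseteq> lgen (path i s)"
  proof
    fix x assume x: "x \<in> U"
    show "x \<in> lgen (path i s)"
    proof (cases "x = \<zero>")
      case True
      then show ?thesis using left_ideal_zero[OF lgen_left_ideal] by simp
    next
      case False
      obtain t r c where t: "r \<in> carrier R" "x = r \<otimes> path i t" "c \<in> carrier R" "c \<otimes> x = path i t"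
        using order_of[OF subsetD[OF U(2) x] False] by metis
      have "path i t \<in> U" using left_ideal_mult[OF U(1) t(3) x] t(4) by simp
      then have "s \<le> t" unfolding s_def by (rule Least_le)
      moreover have "x \<in> lgen (path i t)" using t by (auto simp: lgen_def)
      ultimately show ?thesis using lgen_path_mono by blast
    qed
  qed
  then show ?thesis using that[OF s(2)] lgen_minimal[OF U(1) s(1)] by blast
qed

text \<open>If \<open>r\<close> has order \<open>t\<close>, then \<open>r \<otimes> path i s\<close>
  and \<open>path i (s + t)\<close> generate the same left ideal, and the latter vanishes only from
  \<open>len i\<close> on.\<close>

lemma annihilator_path:
  assumes r: "r \<in> lgen (E (i - int s))" "r \<otimes> path i s = \<zero>"
  shows "r \<in> lgen (path (i - int s) (len i - s))"
proof (cases "r = \<zero>")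
  case True
  then show ?thesis using left_ideal_zero[OF lgen_left_ideal] by simp
next
  case False
  obtain t b c where t: "b \<in> carrier R" "r = b \<otimes> path (i - int s) t" "c \<in> carrier R" "c \<otimes> r = path (i - int s) t"
    using order_of[OF r(1) False] by metis
  have "path i (s + t) = c \<otimes> (r \<otimes> path i s)"
    using t r(1) by (simp add: path_add m_assoc[symmetric] lgen_E_iff)
  then have "len i \<le> s + t" using r(2) t(3) by (simp add: path_zero_iff)
  then have "lgen (path (i - int s) t) \<subseteq> lgen (path (i - int s) (len i - s))" by (intro lgen_path_mono) simp
  then show ?thesis using t by (auto simp: lgen_def)
qed

lemma path_annihilator: "s \<le> len i \<Longrightarrow> path (i - int s) (len i - s) \<otimes> path i s = \<zero>"
  using path_add[of i s "len i - s"] by simp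

text \<open>After a step that does not rise, the sequence stays strictly below the line of slope one
  through its value at \<open>j\<close>, since no later step rises by more than one.\<close>

lemma len_rise: "\<lbrakk>len (j + 1) \<le> len j; 0 < d\<rbrakk> \<Longrightarrow> len (j + int d) < len j + d"
proof (induction d)
  case (Suc d)
  then show ?case
  proof (cases "d = 0")
    case False
    then have "len (j + int d) < len j + d" using Suc by simp
    then show ?thesis using len_step[of "j + int d"] by (simp add: algebra_simps)
  qed simp
qed simp

end

locale nak_ring = left_nak_ring +
  assumes E_J: "x \<in> J \<Longrightarrow> \<exists>r \<in> carrier R. E (i - 1) \<otimes> x = A i \<otimes> r"
begin

lemma path_commute_left:
  "r \<in> carrier R \<Longrightarrow> \<exists>r' \<in> carrier R. E (i - int s) \<otimes> r \<otimes> path i s = path i s \<otimes> r'"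
proof (induction s arbitrary: r)
  case 0
  then show ?case by (intro bexI[of _ "r \<otimes> E i"]) (auto simp: m_assoc)
next
  case (Suc s)
  have "r \<otimes> A (i - int s) \<in> J" using Suc.prems by (intro J_left A_J)
  then obtain t where t: "t \<in> carrier R" "E (i - int (Suc s)) \<otimes> (r \<otimes> A (i - int s)) = A (i - int s) \<otimes> t"
    using E_J[of _ "i - int s"] by (metis add.commute diff_diff_add of_nat_Suc)
  obtain r' where r': "r' \<in> carrier R" "E (i - int s) \<otimes> t \<otimes> path i s = path i s \<otimes> r'" using Suc.IH[OF t(1)] by blast
  have "E (i - int (Suc s)) \<otimes> r \<otimes> path i (Suc s) = (E (i - int (Suc s)) \<otimes> (r \<otimes> A (i - int s))) \<otimes> path i s"
    using Suc.prems by (simp add: m_assoc)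
  also have "\<dots> = (A (i - int s) \<otimes> E (i - int s)) \<otimes> t \<otimes> path i s" unfolding t(2) A_E ..
  also have "\<dots> = A (i - int s) \<otimes> (E (i - int s) \<otimes> t \<otimes> path i s)" using t(1) by (simp add: m_assoc)
  also have "\<dots> = path i (Suc s) \<otimes> r'" unfolding r'(2) using r'(1) by (simp add: m_assoc)
  finally show ?case using r'(1) by blast
qed

text \<open>The core of injectivity. \<open>v\<close> generates the same left ideal as some
  \<open>path j t\<close>, and the annihilator condition gives
  \<open>len j \<le> t + (len k - s)\<close>. If \<open>t < s\<close>, then \<open>k\<close> is
  congruent to \<open>j + (s - t)\<close> and \<open>len_rise\<close> contradicts this bound. So
  \<open>s \<le> t\<close>, and the path ending in \<open>j\<close> runs through
  \<open>k\<close>.\<close>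

lemma factor_through_path:
  assumes j: "len (j + 1) \<le> len j" and s: "s \<le> len k"
    and v: "v \<in> carrier R" "E (k - int s) \<otimes> v = v" "v \<otimes> E j = v"
    and ann: "path (k - int s) (len k - s) \<otimes> v = \<zero>"
  obtains z where "z \<in> carrier R" "v = path k s \<otimes> z"
proof (cases "v = \<zero>")
  case True
  then show ?thesis using that[of \<zero>] by simp
next
  case False
  obtain t b c where t: "t < len j" "b \<in> carrier R" "v = b \<otimes> path j t" "c \<in> carrier R" "c \<otimes> v = path j t"
    using order_of[OF iffD2[OF lgen_E_iff conjI[OF v(1,3)]] False] by metis
  define l q where "l = k - int s" and "q = len k - s"
  have idx: "l mod int n = (j - int t) mod int n"
    using order_index[OF v(1,2) t(2-5) t(1)] by (simp add: l_def)
  have "path j (t + q) = \<zero>"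
  proof -
    \<comment> \<open>Moving \<open>path l q\<close> past \<open>c\<close> lets it meet
      \<open>v\<close>, which it kills.\<close>
    obtain c' where c': "c' \<in> carrier R" "path l q \<otimes> c \<otimes> E l = c' \<otimes> path l q"
      using path_commute_right[OF t(4)] by blast
    have "path j (t + q) = path l q \<otimes> (c \<otimes> v)" unfolding t(5) path_add using path_cong[OF idx] by simp
    also have "\<dots> = path l q \<otimes> c \<otimes> E l \<otimes> v" using v t(4) by (simp add: m_assoc l_def)
    also have "\<dots> = c' \<otimes> (path l q \<otimes> v)" unfolding c'(2) using c'(1) v by (simp add: m_assoc)
    also have "\<dots> = \<zero>" using ann c'(1) by (simp add: l_def q_def)
    finally show ?thesis .
  qed
  then have len: "len j \<le> t + q" by (simp add: path_zero_iff)
  have "s \<le> t"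
  proof (rule ccontr)
    assume st: "\<not> s \<le> t"
    then have "k mod int n = (j + int (s - t)) mod int n"
      using mod_add_cong[OF idx refl[of "int s mod int n"]] by (simp add: l_def of_nat_diff algebra_simps)
    then have "len k = len (j + int (s - t))" by (rule len_cong)
    then have "len k < len j + (s - t)" using len_rise[OF j, of "s - t"] st by simp
    then show False using len st s by (simp add: q_def)
  qed
  have k: "k mod int n = (j - int (t - s)) mod int n"
    using mod_add_cong[OF idx refl[of "int s mod int n"]] \<open>s \<le> t\<close> by (simp add: l_def of_nat_diff algebra_simps)
  have pj: "path j t = path k s \<otimes> path j (t - s)"
    using path_add[of j "t - s" s] \<open>s \<le> t\<close> path_cong[OF k] by simp
  \<comment> \<open>The coefficient \<open>b\<close> must end up to the right of the path; this is
    where right generation by the arrows enters.\<close>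
  obtain r' where r': "r' \<in> carrier R" "E (k - int s) \<otimes> b \<otimes> path k s = path k s \<otimes> r'"
    using path_commute_left[OF t(2)] by blast
  have "v = E (k - int s) \<otimes> (b \<otimes> (path k s \<otimes> path j (t - s)))" using v(2) t(3) pj by simp
  also have "\<dots> = (E (k - int s) \<otimes> b \<otimes> path k s) \<otimes> path j (t - s)" using t(2) by (simp add: m_assoc)
  also have "\<dots> = path k s \<otimes> (r' \<otimes> path j (t - s))" unfolding r'(2) using r'(1) by (simp add: m_assoc)
  finally show ?thesis using that r'(1) by blast
qed

end

section \<open>Baer's criterion and submodules of the indecomposable projectives\<close>

abbreviation ideal_module :: "('a, 'r) ring_scheme \<Rightarrow> 'a set \<Rightarrow> ('a, 'a) module" where
  "ideal_module R U \<equiv> sub_module (regular_module R) U"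

lemma (in ring) ideal_module_left_module: "left_ideal U R \<Longrightarrow> left_module R (ideal_module R U)"
  by (rule left_module.sub_module_left_module[OF regular_left_module])

context idem_ring
begin

text \<open>Baer's extension by one element. Since \<open>y\<close> is fixed by \<open>E k\<close>,
  only left ideals inside \<open>R (E k)\<close> are tested, and these are the ones classified by
  paths.\<close>

lemma extend_hom_step:
  assumes Y: "left_module R Y" and I: "left_module R I" and D: "submodule D R Y"
    and \<phi>: "\<phi> \<in> module_hom R (sub_module Y D) I" and y: "y \<in> carrier Y" "E k \<odot>\<^bsub>Y\<^esub> y = y"
    and baer: "\<And>U h. \<lbrakk>left_ideal U R; U \<subseteq> lgen (E k); h \<in> module_hom R (ideal_module R U) I\<rbrakk> \<Longrightarrow>
      \<exists>z \<in> carrier I. \<forall>u \<in> U. h u = u \<odot>\<^bsub>I\<^esub> z"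
  obtains D' \<phi>' where "submodule D' R Y" "D \<subseteq> D'" "y \<in> D'" "\<phi>' \<in> module_hom R (sub_module Y D') I"
    "\<And>x. x \<in> D \<Longrightarrow> \<phi>' x = \<phi> x"
proof -
  interpret Y: left_module R Y by fact
  interpret I: left_module R I by fact
  have DM: "left_module R (sub_module Y D)" by (rule Y.sub_module_left_module[OF D])
  note DY = submodule_in[OF D]
  have \<phi>c: "\<phi> d \<in> carrier I" if "d \<in> D" for d using module_hom_closed[OF \<phi>] that by simp
  have \<phi>a: "\<phi> (d \<oplus>\<^bsub>Y\<^esub> d') = \<phi> d \<oplus>\<^bsub>I\<^esub> \<phi> d'" if "d \<in> D" "d' \<in> D" for d d'
    using module_hom_add[OF \<phi>, of d d'] that by simp
  have \<phi>s: "\<phi> (a \<odot>\<^bsub>Y\<^esub> d) = a \<odot>\<^bsub>I\<^esub> \<phi> d" if "a \<in> carrier R" "d \<in> D" for a d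
    using module_hom_smult[OF \<phi>, of a d] that by simp
  define U where "U = {a \<in> lgen (E k). a \<odot>\<^bsub>Y\<^esub> y \<in> D}"
  note lE = lgen_left_ideal[OF E_closed[of k]]
  have U: "left_ideal U R" unfolding U_def
    by (rule left_module.submoduleI'[OF regular_left_module])
      (use y(1) left_ideal_in[OF lE] in \<open>auto simp: Y.smult_zero_left Y.smult_l_distr Y.smult_assoc
        left_ideal_zero[OF lE] left_ideal_add[OF lE] left_ideal_mult[OF lE]
        submodule_zero[OF D] submodule_add[OF D] submodule_smult[OF D]\<close>)
  have Uc: "u \<in> carrier R" if "u \<in> U" for u using left_ideal_in[OF U that] .
  define h where "h = (\<lambda>a\<in>U. \<phi> (a \<odot>\<^bsub>Y\<^esub> y))"
  have "(\<lambda>a\<in>carrier (ideal_module R U). \<phi> (a \<odot>\<^bsub>Y\<^esub> y)) \<in> module_hom R (ideal_module R U) I"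
  proof (rule module_homI[OF _ _ _ ideal_module_left_module[OF U]])
    fix a b assume "a \<in> carrier (ideal_module R U)" "b \<in> carrier (ideal_module R U)"
    then have ab: "a \<in> U" "b \<in> U" by simp_all
    then have "a \<odot>\<^bsub>Y\<^esub> y \<in> D" "b \<odot>\<^bsub>Y\<^esub> y \<in> D" by (simp_all add: U_def)
    then show "\<phi> ((a \<oplus>\<^bsub>ideal_module R U\<^esub> b) \<odot>\<^bsub>Y\<^esub> y) = \<phi> (a \<odot>\<^bsub>Y\<^esub> y) \<oplus>\<^bsub>I\<^esub> \<phi> (b \<odot>\<^bsub>Y\<^esub> y)"
      using ab Uc y(1) by (simp add: Y.smult_l_distr \<phi>a)
  next
    fix r a assume "r \<in> carrier R" "a \<in> carrier (ideal_module R U)"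
    then have ra: "r \<in> carrier R" "a \<in> U" by simp_all
    then have "a \<odot>\<^bsub>Y\<^esub> y \<in> D" by (simp add: U_def)
    then show "\<phi> ((r \<odot>\<^bsub>ideal_module R U\<^esub> a) \<odot>\<^bsub>Y\<^esub> y) = r \<odot>\<^bsub>I\<^esub> \<phi> (a \<odot>\<^bsub>Y\<^esub> y)"
      using ra Uc y(1) by (simp add: Y.smult_assoc \<phi>s)
  qed (simp add: U_def \<phi>c)
  then have "h \<in> module_hom R (ideal_module R U) I" by (simp add: h_def)
  then obtain z where z: "z \<in> carrier I" "\<forall>u \<in> U. h u = u \<odot>\<^bsub>I\<^esub> z"
    using baer[OF U, of h] by (auto simp: U_def)
  have Uz: "\<phi> (u \<odot>\<^bsub>Y\<^esub> y) = u \<odot>\<^bsub>I\<^esub> z" if "u \<in> U" for u using z(2) that by (simp add: h_def)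
  \<comment> \<open>With \<open>w\<close> in place of \<open>z\<close>, the product
    \<open>a w\<close> depends only on \<open>a \<otimes> E k\<close>, so arbitrary coefficients of
    \<open>y\<close> may be used.\<close>
  define w where "w = E k \<odot>\<^bsub>I\<^esub> z"
  have w: "w \<in> carrier I" using z(1) by (simp add: w_def)
  let ?Ry = "{r \<odot>\<^bsub>Y\<^esub> y | r. r \<in> carrier R}"
  define D' where "D' = D <+>\<^bsub>Y\<^esub> ?Ry"
  have D': "submodule D' R Y" unfolding D'_def by (rule Y.submodule_sum[OF D Y.cyclic_submodule[OF y(1)]])
  have D'_iff: "x \<in> D' \<longleftrightarrow> (\<exists>d \<in> D. \<exists>a \<in> carrier R. x = d \<oplus>\<^bsub>Y\<^esub> a \<odot>\<^bsub>Y\<^esub> y)" for x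
    unfolding D'_def set_add_def set_mult_def by auto
  have uniq: "\<phi> d \<oplus>\<^bsub>I\<^esub> a \<odot>\<^bsub>I\<^esub> w = \<phi> d' \<oplus>\<^bsub>I\<^esub> a' \<odot>\<^bsub>I\<^esub> w"
    if d: "d \<in> D" "d' \<in> D" and a: "a \<in> carrier R" "a' \<in> carrier R"
      and eq: "d \<oplus>\<^bsub>Y\<^esub> a \<odot>\<^bsub>Y\<^esub> y = d' \<oplus>\<^bsub>Y\<^esub> a' \<odot>\<^bsub>Y\<^esub> y" for d d' a a'
  proof -
    define b where "b = (a \<ominus> a') \<otimes> E k"
    have bc: "b \<in> carrier R" using a by (simp add: b_def)
    have "b \<odot>\<^bsub>Y\<^esub> y = a \<odot>\<^bsub>Y\<^esub> y \<ominus>\<^bsub>Y\<^esub> a' \<odot>\<^bsub>Y\<^esub> y"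
      using a y by (simp add: b_def Y.smult_assoc Y.smult_diff)
    then have "d \<oplus>\<^bsub>Y\<^esub> b \<odot>\<^bsub>Y\<^esub> y = (d \<oplus>\<^bsub>Y\<^esub> a \<odot>\<^bsub>Y\<^esub> y) \<ominus>\<^bsub>Y\<^esub> a' \<odot>\<^bsub>Y\<^esub> y"
      using d a y(1) DY by (simp add: Y.M.minus_eq Y.M.a_assoc)
    also have "\<dots> = d'"
      unfolding eq using d a y(1) DY by (simp add: Y.M.minus_eq Y.M.a_assoc Y.M.r_neg)
    finally have dy: "d \<oplus>\<^bsub>Y\<^esub> b \<odot>\<^bsub>Y\<^esub> y = d'" .
    have "b \<odot>\<^bsub>Y\<^esub> y = d' \<ominus>\<^bsub>Y\<^esub> d"
      unfolding dy[symmetric] using DY[OF d(1)] bc y(1)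
      by (simp add: Y.M.minus_eq Y.M.a_comm[of d] Y.M.a_assoc Y.M.r_neg)
    then have bD: "b \<odot>\<^bsub>Y\<^esub> y \<in> D" using d by (simp add: Y.submodule_diff[OF D])
    then have "b \<in> U" using a by (auto simp: U_def lgen_def b_def)
    then have "\<phi> (b \<odot>\<^bsub>Y\<^esub> y) = b \<odot>\<^bsub>I\<^esub> z" by (rule Uz)
    also have "\<dots> = a \<odot>\<^bsub>I\<^esub> w \<ominus>\<^bsub>I\<^esub> a' \<odot>\<^bsub>I\<^esub> w"
      using a z(1) by (simp add: b_def w_def I.smult_assoc I.smult_diff)
    finally have "\<phi> d' = \<phi> d \<oplus>\<^bsub>I\<^esub> (a \<odot>\<^bsub>I\<^esub> w \<ominus>\<^bsub>I\<^esub> a' \<odot>\<^bsub>I\<^esub> w)" using \<phi>a[OF d(1) bD] dy by simp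
    then show ?thesis using \<phi>c[OF d(1)] w a by (simp add: I.M.minus_eq I.M.a_assoc I.M.l_neg)
  qed
  define F where "F x = (SOME v. \<exists>d \<in> D. \<exists>a \<in> carrier R. x = d \<oplus>\<^bsub>Y\<^esub> a \<odot>\<^bsub>Y\<^esub> y \<and> v = \<phi> d \<oplus>\<^bsub>I\<^esub> a \<odot>\<^bsub>I\<^esub> w)" for x
  have F: "F (d \<oplus>\<^bsub>Y\<^esub> a \<odot>\<^bsub>Y\<^esub> y) = \<phi> d \<oplus>\<^bsub>I\<^esub> a \<odot>\<^bsub>I\<^esub> w" if "d \<in> D" "a \<in> carrier R" for d a
    unfolding F_def
  proof (rule someI2[of _ "\<phi> d \<oplus>\<^bsub>I\<^esub> a \<odot>\<^bsub>I\<^esub> w"])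
    show "\<exists>da\<in>D. \<exists>aa\<in>carrier R. d \<oplus>\<^bsub>Y\<^esub> a \<odot>\<^bsub>Y\<^esub> y = da \<oplus>\<^bsub>Y\<^esub> aa \<odot>\<^bsub>Y\<^esub> y \<and>
        \<phi> d \<oplus>\<^bsub>I\<^esub> a \<odot>\<^bsub>I\<^esub> w = \<phi> da \<oplus>\<^bsub>I\<^esub> aa \<odot>\<^bsub>I\<^esub> w" using that by blast
    fix v assume "\<exists>da\<in>D. \<exists>aa\<in>carrier R. d \<oplus>\<^bsub>Y\<^esub> a \<odot>\<^bsub>Y\<^esub> y = da \<oplus>\<^bsub>Y\<^esub> aa \<odot>\<^bsub>Y\<^esub> y \<and>
        v = \<phi> da \<oplus>\<^bsub>I\<^esub> aa \<odot>\<^bsub>I\<^esub> w"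
    then show "v = \<phi> d \<oplus>\<^bsub>I\<^esub> a \<odot>\<^bsub>I\<^esub> w" using uniq that by metis
  qed
  have hom: "(\<lambda>x\<in>carrier (sub_module Y D'). F x) \<in> module_hom R (sub_module Y D') I"
  proof (rule module_homI[OF _ _ _ Y.sub_module_left_module[OF D']])
    fix x assume "x \<in> carrier (sub_module Y D')"
    then obtain d a where "d \<in> D" "a \<in> carrier R" "x = d \<oplus>\<^bsub>Y\<^esub> a \<odot>\<^bsub>Y\<^esub> y" using D'_iff by auto
    then show "F x \<in> carrier I" using F \<phi>c w by simp
  next
    fix x x' assume "x \<in> carrier (sub_module Y D')" "x' \<in> carrier (sub_module Y D')"
    then obtain d a d' a' where *: "d \<in> D" "a \<in> carrier R" "x = d \<oplus>\<^bsub>Y\<^esub> a \<odot>\<^bsub>Y\<^esub> y"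
      "d' \<in> D" "a' \<in> carrier R" "x' = d' \<oplus>\<^bsub>Y\<^esub> a' \<odot>\<^bsub>Y\<^esub> y" using D'_iff by auto
    then have "x \<oplus>\<^bsub>Y\<^esub> x' = (d \<oplus>\<^bsub>Y\<^esub> d') \<oplus>\<^bsub>Y\<^esub> (a \<oplus> a') \<odot>\<^bsub>Y\<^esub> y"
      using DY y(1) by (simp add: Y.smult_l_distr Y.M.a_ac)
    then have "F (x \<oplus>\<^bsub>Y\<^esub> x') = \<phi> (d \<oplus>\<^bsub>Y\<^esub> d') \<oplus>\<^bsub>I\<^esub> (a \<oplus> a') \<odot>\<^bsub>I\<^esub> w"
      using F[of "d \<oplus>\<^bsub>Y\<^esub> d'" "a \<oplus> a'"] * submodule_add[OF D] by simp
    also have "\<dots> = F x \<oplus>\<^bsub>I\<^esub> F x'" using * F \<phi>a \<phi>c w by (simp add: I.smult_l_distr I.M.a_ac)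
    finally show "F (x \<oplus>\<^bsub>sub_module Y D'\<^esub> x') = F x \<oplus>\<^bsub>I\<^esub> F x'" by simp
  next
    fix r x assume "r \<in> carrier R" "x \<in> carrier (sub_module Y D')"
    then obtain d a where *: "r \<in> carrier R" "d \<in> D" "a \<in> carrier R" "x = d \<oplus>\<^bsub>Y\<^esub> a \<odot>\<^bsub>Y\<^esub> y" using D'_iff by auto
    then have "r \<odot>\<^bsub>Y\<^esub> x = (r \<odot>\<^bsub>Y\<^esub> d) \<oplus>\<^bsub>Y\<^esub> (r \<otimes> a) \<odot>\<^bsub>Y\<^esub> y"
      using DY y(1) by (simp add: Y.smult_r_distr Y.smult_assoc)
    then have "F (r \<odot>\<^bsub>Y\<^esub> x) = r \<odot>\<^bsub>I\<^esub> F x"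
      using F[of "r \<odot>\<^bsub>Y\<^esub> d" "r \<otimes> a"] F[of d a] * submodule_smult[OF D] \<phi>c w
      by (simp add: \<phi>s I.smult_r_distr I.smult_assoc)
    then show "F (r \<odot>\<^bsub>sub_module Y D'\<^esub> x) = r \<odot>\<^bsub>I\<^esub> F x" by simp
  qed
  have in1: "d \<in> D'" "F d = \<phi> d" if d: "d \<in> D" for d
  proof -
    have e: "d = d \<oplus>\<^bsub>Y\<^esub> \<zero> \<odot>\<^bsub>Y\<^esub> y" using DY[OF d] y(1) by (simp add: Y.smult_zero_left)
    then show "d \<in> D'" using d D'_iff by blast
    have "F d = F (d \<oplus>\<^bsub>Y\<^esub> \<zero> \<odot>\<^bsub>Y\<^esub> y)" by (rule arg_cong[OF e])
    also have "\<dots> = \<phi> d" using F[OF d zero_closed] \<phi>c[OF d] w by (simp add: I.smult_zero_left)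
    finally show "F d = \<phi> d" .
  qed
  have "y = \<zero>\<^bsub>Y\<^esub> \<oplus>\<^bsub>Y\<^esub> \<one> \<odot>\<^bsub>Y\<^esub> y" using y(1) by simp
  then have "y \<in> D'" using D'_iff submodule_zero[OF D] by blast
  then show ?thesis using in1 hom by (intro that[OF D' _ _ hom]) auto
qed

text \<open>Injectivity is tested on finitely generated modules only, so finitely many one-element
  extensions take the place of Zorn's lemma.\<close>

lemma extend_hom_finite:
  assumes Y: "left_module R Y" and I: "left_module R I"
    and baer: "\<And>k U h. \<lbrakk>left_ideal U R; U \<subseteq> lgen (E k); h \<in> module_hom R (ideal_module R U) I\<rbrakk> \<Longrightarrow>
      \<exists>z \<in> carrier I. \<forall>u \<in> U. h u = u \<odot>\<^bsub>I\<^esub> z"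
    and "finite T" "T \<subseteq> carrier Y" "\<And>t. t \<in> T \<Longrightarrow> \<exists>k. E k \<odot>\<^bsub>Y\<^esub> t = t"
    and "submodule D R Y" "\<phi> \<in> module_hom R (sub_module Y D) I"
  shows "\<exists>D' \<phi>'. submodule D' R Y \<and> D \<subseteq> D' \<and> T \<subseteq> D' \<and> \<phi>' \<in> module_hom R (sub_module Y D') I \<and>
    (\<forall>x \<in> D. \<phi>' x = \<phi> x)"
  using assms(4-)
proof (induction T arbitrary: D \<phi>)
  case empty
  then show ?case by (intro exI[of _ D] exI[of _ \<phi>]) auto
next
  case (insert t T)
  obtain k where k: "E k \<odot>\<^bsub>Y\<^esub> t = t" using insert.prems(2) by blast
  have t: "t \<in> carrier Y" using insert.prems(1) by simp
  obtain D1 \<phi>1 where 1: "submodule D1 R Y" "D \<subseteq> D1" "t \<in> D1" "\<phi>1 \<in> module_hom R (sub_module Y D1) I"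
    "\<And>x. x \<in> D \<Longrightarrow> \<phi>1 x = \<phi> x"
  proof (rule extend_hom_step[OF Y I insert.prems(3,4) t k])
    fix U h assume "left_ideal U R" "U \<subseteq> lgen (E k)" "h \<in> module_hom R (ideal_module R U) I"
    then show "\<exists>z \<in> carrier I. \<forall>u \<in> U. h u = u \<odot>\<^bsub>I\<^esub> z" by (rule baer)
  qed (rule that; assumption)
  have "\<exists>D' \<phi>'. submodule D' R Y \<and> D1 \<subseteq> D' \<and> T \<subseteq> D' \<and> \<phi>' \<in> module_hom R (sub_module Y D') I \<and>
    (\<forall>x \<in> D1. \<phi>' x = \<phi>1 x)"
    using insert.prems 1 by (intro insert.IH) auto
  then obtain D' \<phi>' where 2: "submodule D' R Y" "D1 \<subseteq> D'" "T \<subseteq> D'" "\<phi>' \<in> module_hom R (sub_module Y D') I"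
    "\<forall>x \<in> D1. \<phi>' x = \<phi>1 x" by blast
  then show ?case using 1 by (intro exI[of _ D'] exI[of _ \<phi>']) auto
qed

lemma baer_injective:
  assumes I: "fg_module R I"
    and baer: "\<And>k U h. \<lbrakk>left_ideal U R; U \<subseteq> lgen (E k); h \<in> module_hom R (ideal_module R U) I\<rbrakk> \<Longrightarrow>
      \<exists>z \<in> carrier I. \<forall>u \<in> U. h u = u \<odot>\<^bsub>I\<^esub> z"
  shows "injective R I"
  unfolding injective_def
proof (intro conjI I allI impI ballI)
  fix X Y :: "'a fmod" and f g
  assume XY: "fg_module R X \<and> fg_module R Y" and f: "f \<in> module_mono R X Y" and g: "g \<in> module_hom R X I"
  have lm: "left_module R X" "left_module R Y" "left_module R I" using XY I by (auto simp: fg_module_def)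
  interpret X: left_module R X by fact
  interpret Y: left_module R Y by fact
  have fh: "f \<in> module_hom R X Y" "inj_on f (carrier X)" using f by (auto simp: module_mono_def)
  define D where "D = f ` carrier X"
  have D: "submodule D R Y" unfolding D_def by (rule image_submodule[OF fh(1) lm(1,2) X.carrier_submodule])
  have inv: "the_inv_into (carrier X) f (f x) = x" if "x \<in> carrier X" for x
    using fh(2) that by (rule the_inv_into_f_f)
  have \<phi>: "(\<lambda>y\<in>carrier (sub_module Y D). g (the_inv_into (carrier X) f y)) \<in> module_hom R (sub_module Y D) I"
  proof (rule module_homI[OF _ _ _ Y.sub_module_left_module[OF D]])
    fix a b assume "a \<in> carrier (sub_module Y D)" "b \<in> carrier (sub_module Y D)"
    then obtain u v where "u \<in> carrier X" "v \<in> carrier X" "a = f u" "b = f v" by (auto simp: D_def)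
    then show "g (the_inv_into (carrier X) f (a \<oplus>\<^bsub>sub_module Y D\<^esub> b)) =
      g (the_inv_into (carrier X) f a) \<oplus>\<^bsub>I\<^esub> g (the_inv_into (carrier X) f b)"
      by (simp add: module_hom_add[OF fh(1), symmetric] inv module_hom_add[OF g])
  next
    fix r a assume "r \<in> carrier R" "a \<in> carrier (sub_module Y D)"
    then obtain u where "r \<in> carrier R" "u \<in> carrier X" "a = f u" by (auto simp: D_def)
    then show "g (the_inv_into (carrier X) f (r \<odot>\<^bsub>sub_module Y D\<^esub> a)) = r \<odot>\<^bsub>I\<^esub> g (the_inv_into (carrier X) f a)"
      by (simp add: module_hom_smult[OF fh(1), symmetric] inv module_hom_smult[OF g])
  qed (auto simp: D_def inv module_hom_closed[OF g])
  obtain S where S: "finite S" "S \<subseteq> carrier Y" "\<And>N. submodule N R Y \<Longrightarrow> S \<subseteq> N \<Longrightarrow> N = carrier Y"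
    using fg_moduleE[of R Y] XY by metis
  \<comment> \<open>Generators are cut by the idempotents to fit the one-element step.\<close>
  define T where "T = (\<lambda>(j, s). E (int j) \<odot>\<^bsub>Y\<^esub> s) ` ({..<n} \<times> S)"
  have T: "E j \<odot>\<^bsub>Y\<^esub> s \<in> T" if s: "s \<in> S" for s j
    using E_in_set[of j] s by (force simp: T_def)
  have Tc: "\<exists>k. E k \<odot>\<^bsub>Y\<^esub> t = t" "t \<in> carrier Y" if t: "t \<in> T" for t
  proof -
    obtain j s where "s \<in> S" "t = E (int j) \<odot>\<^bsub>Y\<^esub> s" using t by (auto simp: T_def)
    moreover have "s \<in> carrier Y" using calculation S(2) by blast
    ultimately show "t \<in> carrier Y" "\<exists>k. E k \<odot>\<^bsub>Y\<^esub> t = t"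
      by (simp, intro exI[of _ "int j"], simp add: Y.smult_assoc[symmetric])
  qed
  have fT: "finite T" using S(1) by (simp add: T_def)
  have TY: "T \<subseteq> carrier Y" using Tc(2) by blast
  have "\<exists>D' \<phi>'. submodule D' R Y \<and> D \<subseteq> D' \<and> T \<subseteq> D' \<and> \<phi>' \<in> module_hom R (sub_module Y D') I \<and>
    (\<forall>x \<in> D. \<phi>' x = (\<lambda>y\<in>carrier (sub_module Y D). g (the_inv_into (carrier X) f y)) x)"
    by (rule extend_hom_finite[OF lm(2,3) _ fT TY Tc(1) D \<phi>]) (rule baer)
  then obtain D' \<phi>' where D': "submodule D' R Y" "D \<subseteq> D'" "T \<subseteq> D'"
    "\<phi>' \<in> module_hom R (sub_module Y D') I"
    "\<forall>x \<in> D. \<phi>' x = (\<lambda>y\<in>carrier (sub_module Y D). g (the_inv_into (carrier X) f y)) x"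
    by blast
  have "S \<subseteq> D'"
  proof
    fix s assume s: "s \<in> S"
    show "s \<in> D'" by (rule split_module[OF lm(2) D'(1)]) (use s S(2) T[OF s] D'(3) in auto)
  qed
  then have "D' = carrier Y" by (rule S(3)[OF D'(1)])
  then have h: "\<phi>' \<in> module_hom R Y I" using D'(4) by simp
  show "\<exists>h\<in>module_hom R Y I. g = compose (carrier X) h f"
  proof (intro bexI[OF _ h] module_hom_ext[OF g module_hom_compose[OF fh(1) h lm(1)]])
    fix x assume x: "x \<in> carrier X"
    then have "f x \<in> D" by (simp add: D_def)
    then show "g x = compose (carrier X) \<phi>' f x" using D'(5) x inv by (simp add: compose_def)
  qed
qed

end

section \<open>Direct summands of tuple modules\<close>

context ring
begin

lemma fbox_op_nth [simp]:
  "i < m \<Longrightarrow> the_elem \<zero>\<^bsub>fbox R m U\<^esub> i = \<zero>"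
  "i < m \<Longrightarrow> the_elem (X \<oplus>\<^bsub>fbox R m U\<^esub> Y) i = the_elem X i \<oplus> the_elem Y i"
  "i < m \<Longrightarrow> the_elem (a \<odot>\<^bsub>fbox R m U\<^esub> X) i = a \<otimes> the_elem X i"
  by (simp_all add: fbox_simps)

lemma sg_add: "\<lbrakk>a \<in> carrier R; b \<in> carrier R\<rbrakk> \<Longrightarrow> sg m i (a \<oplus> b) = sg m i a \<oplus>\<^bsub>fbox R m U\<^esub> sg m i b"
  unfolding fbox_simps by (auto simp: sg_def intro!: vec_cong)

definition coord_part :: "nat \<Rightarrow> (nat \<Rightarrow> 'a set) \<Rightarrow> nat \<Rightarrow> (nat \<Rightarrow> 'a) set set" where
  "coord_part m U k = {X \<in> carrier (fbox R m U). \<forall>i<m. i \<noteq> k \<longrightarrow> the_elem X i = \<zero>}"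

lemma coord_part_submodule:
  assumes U: "\<And>i. i < m \<Longrightarrow> left_ideal (U i) R"
  shows "submodule (coord_part m U k) R (fbox R m U)"
proof -
  interpret F: left_module R "fbox R m U" by (rule fbox_left_module[OF U])
  show ?thesis unfolding coord_part_def
    by (rule F.submoduleI') auto
qed

lemma coord_part_iso:
  assumes U: "\<And>i. i < m \<Longrightarrow> left_ideal (U i) R" and k: "k < m"
  shows "module_iso R (sub_module (fbox R m U) (coord_part m U k)) (ideal_module R (U k))"
proof -
  have F: "left_module R (fbox R m U)" by (rule fbox_left_module[OF U])
  note C = left_module.sub_module_left_module[OF F coord_part_submodule[OF U]]
  have f: "(\<lambda>X\<in>carrier (sub_module (fbox R m U) (coord_part m U k)). the_elem X k)
      \<in> module_hom R (sub_module (fbox R m U) (coord_part m U k)) (ideal_module R (U k))"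
    by (rule module_homI[OF _ _ _ C]) (use k in \<open>auto simp: coord_part_def fbox_nth\<close>)
  have s: "sg m k a \<in> coord_part m U k" if "a \<in> U k" for a
    using that by (auto simp: coord_part_def intro!: sg_in_fbox U)
  note c = left_ideal_in[OF U[OF k]]
  have g: "(\<lambda>a\<in>carrier (ideal_module R (U k)). sg m k a)
      \<in> module_hom R (ideal_module R (U k)) (sub_module (fbox R m U) (coord_part m U k))"
    by (rule module_homI[OF _ _ _ ideal_module_left_module[OF U[OF k]]])
      (simp_all add: s smult_sg c sg_add[of _ _ _ _ U])
  show ?thesis
  proof (rule module_isoI[OF f g])
    fix X assume X: "X \<in> carrier (sub_module (fbox R m U) (coord_part m U k))"
    then have X': "X \<in> carrier (fbox R m U)" "\<And>i. i < m \<Longrightarrow> i \<noteq> k \<Longrightarrow> the_elem X i = \<zero>" by (auto simp: coord_part_def)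
    have a: "the_elem X k \<in> U k" using fbox_nth[OF X'(1) k] .
    have "sg m k (the_elem X k) = X"
      by (rule fbox_ext[OF _ X'(1), of _ U]) (use s[OF a] X'(2) in \<open>auto simp: coord_part_def\<close>)
    then show "(\<lambda>a\<in>carrier (ideal_module R (U k)). sg m k a)
      ((\<lambda>X\<in>carrier (sub_module (fbox R m U) (coord_part m U k)). the_elem X k) X) = X"
      using X a by simp
  next
    fix a assume "a \<in> carrier (ideal_module R (U k))"
    then show "(\<lambda>X\<in>carrier (sub_module (fbox R m U) (coord_part m U k)). the_elem X k)
      ((\<lambda>a\<in>carrier (ideal_module R (U k)). sg m k a) a) = a"
      using s k by simp
  qed
qed

text \<open>Coordinates outside \<open>I\<close> carry the zero ideal; they must be left out because
  an indecomposable summand is nonzero.\<close>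

lemma fbox_decomposition:
  assumes U: "\<And>i. i < m \<Longrightarrow> left_ideal (U i) R" and I: "I \<subseteq> {..<m}"
    and U0: "\<And>i. i < m \<Longrightarrow> i \<notin> I \<Longrightarrow> U i = {\<zero>}"
  shows "direct_decomposition R (fbox R m U) I (coord_part m U)"
  unfolding direct_decomposition_def
proof (intro conjI ballI)
  interpret F: left_module R "fbox R m U" by (rule fbox_left_module[OF U])
  show fin: "finite I" using I finite_subset by blast
  show "submodule (coord_part m U i) R (fbox R m U)" for i by (rule coord_part_submodule[OF U])
  fix X assume X: "X \<in> carrier (fbox R m U)"
  have s: "sg m i a \<in> coord_part m U i" if "i < m" "a \<in> U i" for i a
    using that by (auto simp: coord_part_def intro!: sg_in_fbox U)
  show "\<exists>!f. f \<in> Pi\<^sub>E I (coord_part m U) \<and> X = (\<Oplus>\<^bsub>fbox R m U\<^esub>i\<in>I. f i)"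
  proof (rule ex1I[of _ "\<lambda>i\<in>I. sg m i (the_elem X i)"], intro conjI)
    show "(\<lambda>i\<in>I. sg m i (the_elem X i)) \<in> Pi\<^sub>E I (coord_part m U)" using I fbox_nth[OF X] s by auto
    have "X = (\<Oplus>\<^bsub>fbox R m U\<^esub>i\<in>I. sg m i (the_elem X i))"
      by (rule fbox_expand[OF U X I]) (use U0 fbox_nth[OF X] in auto)
    also have "\<dots> = (\<Oplus>\<^bsub>fbox R m U\<^esub>i\<in>I. (\<lambda>i\<in>I. sg m i (the_elem X i)) i)"
      using I fbox_nth[OF X] by (intro F.M.finsum_cong') (auto intro!: sg_in_fbox U)
    finally show "X = (\<Oplus>\<^bsub>fbox R m U\<^esub>i\<in>I. (\<lambda>i\<in>I. sg m i (the_elem X i)) i)" .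
  next
    fix f assume f: "f \<in> Pi\<^sub>E I (coord_part m U) \<and> X = (\<Oplus>\<^bsub>fbox R m U\<^esub>i\<in>I. f i)"
    have fc: "f i \<in> carrier (fbox R m U)" "\<And>k. k < m \<Longrightarrow> k \<noteq> i \<Longrightarrow> the_elem (f i) k = \<zero>" if "i \<in> I" for i
      using f that by (auto simp: coord_part_def PiE_iff)
    have "f k = sg m k (the_elem X k)" if k: "k \<in> I" for k
    proof (rule fbox_ext[OF fc(1)[OF k]])
      have km: "k < m" using k I by auto
      show "sg m k (the_elem X k) \<in> carrier (fbox R m U)" using fbox_nth[OF X km] by (intro sg_in_fbox U) auto
      have "the_elem X k = (\<Oplus>i\<in>I. the_elem (f i) k)"
        using finsum_nth[OF U km fin fc(1)] f by simp
      also have "\<dots> = the_elem (f k) k"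
        using fc km k fbox_in[OF U fc(1)[OF k] km] by (intro finsum_single[OF fin k]) auto
      finally show "the_elem (f k) i = the_elem (sg m k (the_elem X k)) i" if "i < m" for i
        using that fc(2)[OF k that] by auto
    qed
    then show "f = (\<lambda>i\<in>I. sg m i (the_elem X i))"
      using f by (intro ext) (simp add: PiE_def extensional_def)
  qed
qed

lemma ideal_module_fg: "u \<in> carrier R \<Longrightarrow> fg_module R (ideal_module R (lgen u))"
  unfolding fg_module_def
proof (intro conjI exI[of _ "{u}"] allI impI)
  assume u: "u \<in> carrier R"
  note L = lgen_left_ideal[OF u]
  show "left_module R (ideal_module R (lgen u))" by (rule ideal_module_left_module[OF L])
  show "{u} \<subseteq> carrier (ideal_module R (lgen u))" using lgen_self[OF u] by simp
  fix N assume N: "submodule N R (ideal_module R (lgen u)) \<and> {u} \<subseteq> N"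
  then have "left_ideal N R" "N \<subseteq> lgen u"
    using left_module.submodule_sub_module_iff[OF regular_left_module L] by auto
  then show "N = carrier (ideal_module R (lgen u))" using lgen_minimal[of N u] N by auto
qed simp

lemma ideal_module_projective:
  assumes u: "u \<in> carrier R" "u \<otimes> u = u"
  shows "projective R (ideal_module R (lgen u))"
proof (rule projective_iso)
  let ?F = "fbox R 1 (\<lambda>_. lgen u)"
  have U: "left_ideal (lgen u) R" using u lgen_left_ideal by blast
  show "projective R ?F" using u by (intro fbox_projective) auto
  have "coord_part 1 (\<lambda>_. lgen u) 0 = carrier ?F" by (auto simp: coord_part_def)
  moreover have "module_iso R (sub_module ?F (coord_part 1 (\<lambda>_. lgen u) 0)) (ideal_module R (lgen u))"
    by (rule coord_part_iso[of 1 "\<lambda>_. lgen u" 0, OF U]) simp_all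
  ultimately show "module_iso R ?F (ideal_module R (lgen u))" by simp
  show "left_module R (ideal_module R (lgen u))" by (rule ideal_module_left_module[OF U])
qed

end

section \<open>Submodules and length of the indecomposable projectives\<close>

context left_nak_ring
begin

lemma submodule_ideal_module_iff:
  "left_ideal U R \<Longrightarrow> submodule L R (ideal_module R U) \<longleftrightarrow> left_ideal L R \<and> L \<subseteq> U"
  by (rule left_module.submodule_sub_module_iff[OF regular_left_module])

lemma left_ideals_comparable:
  assumes "left_ideal V R" "V \<subseteq> lgen (E i)" "left_ideal W R" "W \<subseteq> lgen (E i)"
  shows "V \<subseteq> W \<or> W \<subseteq> V"
proof -
  obtain s where s: "V = lgen (path i s)" by (rule left_ideal_in_projective[OF assms(1,2)])
  obtain t where t: "W = lgen (path i t)" by (rule left_ideal_in_projective[OF assms(3,4)])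
  show ?thesis unfolding s t using lgen_path_mono[of s t i] lgen_path_mono[of t s i] by linarith
qed

text \<open>Two submodules are comparable, so if they meet in zero the smaller one is zero.\<close>

lemma ideal_indecomposable:
  assumes V: "left_ideal V R" "V \<subseteq> lgen (E i)" "V \<noteq> {\<zero>}"
  shows "indecomposable R (ideal_module R V)"
  unfolding indecomposable_def
proof (intro conjI allI impI)
  show "left_module R (ideal_module R V)" by (rule ideal_module_left_module[OF V(1)])
  show "carrier (ideal_module R V) \<noteq> {\<zero>\<^bsub>ideal_module R V\<^esub>}" using V(3) by simp
  fix A' B assume AB: "submodule A' R (ideal_module R V) \<and> submodule B R (ideal_module R V) \<and>
    A' \<inter> B = {\<zero>\<^bsub>ideal_module R V\<^esub>} \<and> A' <+>\<^bsub>ideal_module R V\<^esub> B = carrier (ideal_module R V)"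
  then have "A' \<subseteq> B \<or> B \<subseteq> A'"
    using submodule_ideal_module_iff[OF V(1)] V(2) by (intro left_ideals_comparable[of _ i]) auto
  then show "A' = {\<zero>\<^bsub>ideal_module R V\<^esub>} \<or> B = {\<zero>\<^bsub>ideal_module R V\<^esub>}" using AB by blast
qed

lemma path_notin_next: "s < len i \<Longrightarrow> path i s \<notin> lgen (path i (Suc s))"
proof
  assume s: "s < len i" and "path i s \<in> lgen (path i (Suc s))"
  then obtain r where r: "r \<in> carrier R" "path i s = r \<otimes> path i (Suc s)" by (auto simp: lgen_def)
  then have "(r \<otimes> A (i - int s)) \<otimes> path i s = path i s" by (simp add: m_assoc)
  then have "path i s = \<zero>" using r(1) by (intro path_quasi_regular[of "r \<otimes> A (i - int s)"] J_left A_J)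
  then show False using s by (simp add: path_zero_iff)
qed

text \<open>The submodules of \<open>R (path i s)\<close> form one descending chain of path ideals,
  and \<open>path_notin_next\<close> makes its first step strict.\<close>

lemma maximal_in_path:
  assumes s: "s < len i"
  shows "maximal_submodule R (ideal_module R (lgen (path i s))) L \<longleftrightarrow> L = lgen (path i (Suc s))"
proof -
  note V = lgen_left_ideal[OF path_closed]
  have sub: "lgen (path i s) \<subseteq> lgen (E i)" using lgen_path_mono[of 0 s i] by simp
  have ne: "lgen (path i (Suc s)) \<noteq> lgen (path i s)" using path_notin_next[OF s] lgen_self by blast
  have below: "L \<subseteq> lgen (path i (Suc s))" if L: "left_ideal L R" "L \<subseteq> lgen (path i s)" "L \<noteq> lgen (path i s)" for L
  proof -
    obtain t where t: "L = lgen (path i t)" by (rule left_ideal_in_projective[OF L(1)]) (use L(2) sub in auto)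
    have "\<not> t \<le> s" using lgen_path_mono[of t s i] L t by blast
    then show ?thesis unfolding t by (intro lgen_path_mono) simp
  qed
  have le: "lgen (path i (Suc s)) \<subseteq> lgen (path i s)" by (rule lgen_path_mono) simp
  show ?thesis
  proof
    assume mx: "maximal_submodule R (ideal_module R (lgen (path i s))) L"
    then have L: "left_ideal L R" "L \<subseteq> lgen (path i s)" "L \<noteq> lgen (path i s)"
      using submodule_ideal_module_iff[OF V] by (auto simp: maximal_submodule_def)
    have "submodule (lgen (path i (Suc s))) R (ideal_module R (lgen (path i s)))"
      using submodule_ideal_module_iff[OF V] V le by blast
    then have "lgen (path i (Suc s)) = L \<or> lgen (path i (Suc s)) = lgen (path i s)"
      using mx below[OF L] by (simp add: maximal_submodule_def)
    then show "L = lgen (path i (Suc s))" using ne by blast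
  next
    assume L: "L = lgen (path i (Suc s))"
    show "maximal_submodule R (ideal_module R (lgen (path i s))) L"
      unfolding maximal_submodule_def L
    proof (intro conjI allI impI)
      fix L' assume L': "submodule L' R (ideal_module R (lgen (path i s))) \<and> lgen (path i (Suc s)) \<subseteq> L'"
      then show "L' = lgen (path i (Suc s)) \<or> L' = carrier (ideal_module R (lgen (path i s)))"
        using below[of L'] submodule_ideal_module_iff[OF V] by auto
    next
      show "submodule (lgen (path i (Suc s))) R (ideal_module R (lgen (path i s)))"
        using submodule_ideal_module_iff[OF V] V le by blast
    qed (use ne in simp)
  qed
qed

text \<open>Each path ideal has a unique maximal submodule, so any composition series read from the
  top is forced to follow the path ideals; this also gives the uniqueness that \<open>THE\<close>
  demands.\<close>

lemma module_length_projective: "module_length R (ideal_module R (lgen (E i))) = len i"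
  unfolding module_length_def
proof (rule the_equality)
  note V = lgen_left_ideal[OF path_closed]
  have sub: "submodule (lgen (path i s)) R (ideal_module R (lgen (E i)))" for s
    using submodule_ideal_module_iff[OF lgen_left_ideal[OF E_closed]] V lgen_path_mono[of 0 s i] by simp
  let ?N = "\<lambda>s. lgen (path i (len i - s))"
  have mx: "maximal_submodule R (sub_module (ideal_module R (lgen (E i))) (?N (Suc s))) (?N s)" if "s < len i" for s
  proof -
    have "Suc (len i - Suc s) = len i - s" "len i - Suc s < len i" using that by auto
    then show ?thesis using maximal_in_path[of "len i - Suc s" i "?N s"] by (metis partial_object.update_convs(1) partial_object.surjective)
  qed
  show "\<exists>N. composition_series R (ideal_module R (lgen (E i))) (len i) N"
    using mx sub by (intro exI[of _ ?N]) (auto simp: composition_series_def lgen_zero)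
next
  fix k assume "\<exists>N. composition_series R (ideal_module R (lgen (E i))) k N"
  then obtain N where N: "N 0 = {\<zero>}" "N k = lgen (E i)"
    "\<And>s. s < k \<Longrightarrow> maximal_submodule R (ideal_module R (N (Suc s))) (N s)"
    by (auto simp: composition_series_def)
  have step: "N (k - s) = lgen (path i s)" if "s \<le> k" "s \<le> len i" for s
    using that
  proof (induction s)
    case 0
    then show ?case using N(2) by simp
  next
    case (Suc s)
    then have "maximal_submodule R (ideal_module R (lgen (path i s))) (N (k - Suc s))"
      using N(3)[of "k - Suc s"] by (simp add: Suc_diff_Suc)
    then show ?case using maximal_in_path[of s i] Suc.prems by simp
  qed
  show "k = len i"
  proof (rule ccontr)
    assume "k \<noteq> len i"
    then consider "k < len i" | "len i < k" by linarith
    then show False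
    proof cases
      case 1
      then have "lgen (path i k) = {\<zero>}" using step[of k] N(1) by simp
      then show False using lgen_self[OF path_closed, of i k] 1 by (simp add: path_zero_iff)
    next
      case 2
      then have z: "N (k - len i) = {\<zero>}" using step[of "len i"] by (simp add: lgen_zero)
      have mx: "maximal_submodule R (ideal_module R {\<zero>}) (N (k - Suc (len i)))"
        using N(3)[of "k - Suc (len i)"] 2 z by (simp add: Suc_diff_Suc)
      then have "N (k - Suc (len i)) \<subseteq> {\<zero>}" "\<zero> \<in> N (k - Suc (len i))" "N (k - Suc (len i)) \<noteq> {\<zero>}"
        using submodule_ideal_module_iff[OF zero_left_ideal] left_ideal_zero by (auto simp: maximal_submodule_def)
      then show False by blast
    qed
  qed
qed

end

context nak_ring
begin

text \<open>A test ideal is \<open>R (path k s)\<close>, so \<open>h\<close> is determined by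
  \<open>v = h (path k s)\<close>. As \<open>v\<close> inherits the annihilator of the path,
  \<open>factor_through_path\<close> turns \<open>h\<close> into right multiplication by an
  element.\<close>

lemma projective_injective:
  assumes j: "len (j + 1) \<le> len j"
  shows "injective R (ideal_module R (lgen (E j)))"
proof (rule baer_injective)
  note P = lgen_left_ideal[OF E_closed]
  show "fg_module R (ideal_module R (lgen (E j)))" by (rule ideal_module_fg) simp
  fix k U h assume U: "left_ideal U R" "U \<subseteq> lgen (E k)"
    and h: "h \<in> module_hom R (ideal_module R U) (ideal_module R (lgen (E j)))"
  obtain s where s: "s \<le> len k" "U = lgen (path k s)" by (rule left_ideal_in_projective[OF U])
  have pU: "path k s \<in> U" using lgen_self s(2) by simp
  have hs: "h (r \<otimes> u) = r \<otimes> h u" if "r \<in> carrier R" "u \<in> U" for r u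
    using module_hom_smult[OF h, of r u] that by simp
  define v where "v = h (path k s)"
  have v: "v \<in> carrier R" "v \<otimes> E j = v"
    using module_hom_closed[OF h, of "path k s"] pU by (auto simp: v_def lgen_E_iff)
  have Ev: "E (k - int s) \<otimes> v = v" using hs[OF E_closed pU, of "k - int s"] by (simp add: v_def)
  have "path (k - int s) (len k - s) \<otimes> v = h (path (k - int s) (len k - s) \<otimes> path k s)"
    using hs[OF path_closed pU] by (simp add: v_def)
  also have "\<dots> = h \<zero>" using path_annihilator[OF s(1)] by simp
  also have "\<dots> = \<zero>"
    using module_hom_zero[OF h ideal_module_left_module[OF U(1)] ideal_module_left_module[OF P]] by simp
  finally obtain z where z: "z \<in> carrier R" "v = path k s \<otimes> z"
    using factor_through_path[OF j s(1) v(1) Ev v(2)] by blast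
  show "\<exists>z \<in> carrier (ideal_module R (lgen (E j))). \<forall>u \<in> U. h u = u \<odot>\<^bsub>ideal_module R (lgen (E j))\<^esub> z"
  proof (intro bexI[of _ "z \<otimes> E j"] ballI)
    fix u assume "u \<in> U"
    then obtain r where r: "r \<in> carrier R" "u = r \<otimes> path k s" using s(2) by (auto simp: lgen_def)
    have "h u = r \<otimes> (v \<otimes> E j)" using hs[OF r(1) pU] r(2) v by (simp add: v_def)
    also have "\<dots> = u \<otimes> (z \<otimes> E j)" using r z by (simp add: m_assoc)
    finally show "h u = u \<odot>\<^bsub>ideal_module R (lgen (E j))\<^esub> (z \<otimes> E j)" by simp
  qed (use z(1) in \<open>auto simp: lgen_def\<close>)
qed

end

section \<open>A tilting module forces the arithmetic condition\<close>

lemma power_module_simps [simp]: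
  "carrier (power_module M m) = {..<m} \<rightarrow>\<^sub>E carrier M"
  "zero (power_module M m) = (\<lambda>i\<in>{..<m}. zero M)"
  "add (power_module M m) x y = (\<lambda>i\<in>{..<m}. x i \<oplus>\<^bsub>M\<^esub> y i)"
  "smult (power_module M m) a x = (\<lambda>i\<in>{..<m}. a \<odot>\<^bsub>M\<^esub> x i)"
  by (simp_all add: power_module_def)

lemma restrict_eqI: "\<lbrakk>f \<in> extensional A; \<And>x. x \<in> A \<Longrightarrow> g x = f x\<rbrakk> \<Longrightarrow> restrict g A = f"
  by (metis extensionalityI restrict_apply' restrict_extensional)

lemma (in left_module) power_left_module: "left_module R (power_module M m)"
proof (intro left_module.intro left_module_axioms.intro R.ring_axioms)
  show "abelian_group (power_module M m)"
  proof (rule abelian_groupI)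
    fix x assume x: "x \<in> carrier (power_module M m)"
    then have xi: "x i \<in> carrier M" if "i < m" for i using that by (auto simp: PiE_iff)
    show "\<zero>\<^bsub>power_module M m\<^esub> \<oplus>\<^bsub>power_module M m\<^esub> x = x"
      using x xi by (auto simp: PiE_iff intro!: restrict_eqI)
    show "\<exists>y\<in>carrier (power_module M m). y \<oplus>\<^bsub>power_module M m\<^esub> x = \<zero>\<^bsub>power_module M m\<^esub>"
      using xi by (intro bexI[of _ "\<lambda>i\<in>{..<m}. \<ominus>\<^bsub>M\<^esub> x i"]) (auto simp: M.l_neg intro!: restrict_ext)
  qed (auto simp: PiE_iff M.a_ac intro!: restrict_ext)
  show "\<one> \<odot>\<^bsub>power_module M m\<^esub> x = x" if "x \<in> carrier (power_module M m)" for x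
    using that by (auto simp: PiE_iff intro!: restrict_eqI)
qed (auto simp: PiE_iff smult_l_distr smult_r_distr smult_assoc intro!: restrict_ext)

context nak_ring
begin

abbreviation proj :: "int \<Rightarrow> ('a, 'a) module" where
  "proj i \<equiv> ideal_module R (lgen (E i))"

lemma proj_left_module: "left_module R (proj i)"
  by (rule ideal_module_left_module[OF lgen_left_ideal]) simp

text \<open>\<open>A (j + 1)\<close> is the path of length one ending in \<open>j + 1\<close>. By
  \<open>annihilator_path\<close> the kernel is generated by the path of length
  \<open>len (j + 1) - 1 = len j\<close> ending in \<open>j\<close>, which vanishes.\<close>

lemma arrow_mono:
  assumes j: "len (j + 1) = len j + 1"
  shows "(\<lambda>r\<in>carrier (proj j). r \<otimes> A (j + 1)) \<in> module_mono R (proj j) (proj (j + 1))"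
proof -
  note P = proj_left_module
  have f: "(\<lambda>r\<in>carrier (proj j). r \<otimes> A (j + 1)) \<in> module_hom R (proj j) (proj (j + 1))"
    by (rule module_homI[OF _ _ _ P])
      (auto simp: lgen_E_iff A_E m_assoc l_distr)
  have A1: "A (j + 1) = path (j + 1) 1" using A_E[of "j + 1"] by simp
  have "inj_on (\<lambda>r\<in>carrier (proj j). r \<otimes> A (j + 1)) (carrier (proj j))"
  proof (rule inj_on_module_hom[OF f P P])
    fix r assume r: "r \<in> carrier (proj j)" "(\<lambda>r\<in>carrier (proj j). r \<otimes> A (j + 1)) r = \<zero>\<^bsub>proj (j + 1)\<^esub>"
    then have "r \<in> lgen (path (j + 1 - int 1) (len (j + 1) - 1))"
      unfolding A1 by (intro annihilator_path) auto
    then have "r \<in> lgen (path j (len j))" using j by simp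
    then show "r = \<zero>\<^bsub>proj j\<^esub>" by (simp add: lgen_zero)
  qed
  then show ?thesis using f by (simp add: module_mono_def)
qed

text \<open>The homomorphism sending \<open>E j\<close> to \<open>x\<close> extends along the
  inclusion given by the arrow; \<open>y\<close> is the value of the extension at
  \<open>E (j + 1)\<close>.\<close>

lemma extend_along_arrow:
  assumes inj: "injective R N" and j: "len (j + 1) = len j + 1" and x: "x \<in> carrier N" "E j \<odot>\<^bsub>N\<^esub> x = x"
  shows "\<exists>y \<in> carrier N. x = A (j + 1) \<odot>\<^bsub>N\<^esub> y"
proof -
  have N: "left_module R N" using inj by (simp add: injective_def fg_module_def)
  interpret N: left_module R N by fact
  have g: "(\<lambda>r\<in>carrier (proj j). r \<odot>\<^bsub>N\<^esub> x) \<in> module_hom R (proj j) N"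
    by (rule module_homI[OF _ _ _ proj_left_module])
      (use x in \<open>auto simp: lgen_E_iff N.smult_l_distr N.smult_assoc\<close>)
  obtain h where h: "h \<in> module_hom R (proj (j + 1)) N"
    "\<And>r. r \<in> carrier (proj j) \<Longrightarrow> h ((\<lambda>r\<in>carrier (proj j). r \<otimes> A (j + 1)) r) = (\<lambda>r\<in>carrier (proj j). r \<odot>\<^bsub>N\<^esub> x) r"
    using injective_extend[OF inj ideal_module_fg[OF E_closed] ideal_module_fg[OF E_closed] arrow_mono[OF j] g] by metis
  have EE: "E i \<in> lgen (E i)" for i by (rule lgen_self) simp
  have "x = h (A (j + 1))" using h(2)[of "E j"] EE E_A[of "j + 1"] x by simp
  also have "\<dots> = h (A (j + 1) \<otimes> E (j + 1))" by (simp add: A_E)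
  also have "\<dots> = A (j + 1) \<odot>\<^bsub>N\<^esub> h (E (j + 1))"
    using module_hom_smult[OF h(1), of "A (j + 1)" "E (j + 1)"] EE by simp
  finally show ?thesis using module_hom_closed[OF h(1), of "E (j + 1)"] EE by auto
qed

text \<open>Divisibility of \<open>E j\<close> by an arrow would put it into
  \<open>J\<close>.\<close>

lemma rise_not_injective:
  assumes j: "len (j + 1) = len j + 1"
  shows "\<not> injective R (proj j)"
proof
  assume "injective R (proj j)"
  then obtain y where "y \<in> carrier (proj j)" "E j = A (j + 1) \<odot>\<^bsub>proj j\<^esub> y"
    using extend_along_arrow[of "proj j" j "E j"] j lgen_self[of "E j"] by auto
  then have "E j \<in> J" using J_right[OF _ A_J[of "j + 1"], of y] by (simp add: lgen_E_iff)
  then show False using E_notin_J by blast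
qed

lemma injective_proj_iff: "injective R (proj j) \<longleftrightarrow> len (j + 1) \<le> len j"
  using projective_injective[of j] rise_not_injective[of j] len_step[of j] by linarith

text \<open>The consequence of injectivity that survives passage to powers, summands, sums and
  quotients, hence to everything generated by projective-injectives and to
  \<open>add T\<close>.\<close>

definition arrow_divisible :: "int \<Rightarrow> ('a, 'm) module \<Rightarrow> bool" where
  "arrow_divisible i M \<longleftrightarrow>
    (\<forall>x \<in> carrier M. E i \<odot>\<^bsub>M\<^esub> x = x \<longrightarrow> (\<exists>y \<in> carrier M. x = A (i + 1) \<odot>\<^bsub>M\<^esub> y))"

lemma arrow_divisible_epi:
  assumes d: "arrow_divisible i M" and MN: "left_module R M" "left_module R N" and f: "f \<in> module_epi R M N"
  shows "arrow_divisible i N"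
  unfolding arrow_divisible_def
proof (intro ballI impI)
  interpret M: left_module R M by fact
  have f': "f \<in> module_hom R M N" "f ` carrier M = carrier N" using f by (auto simp: module_epi_def)
  fix x assume x: "x \<in> carrier N" "E i \<odot>\<^bsub>N\<^esub> x = x"
  obtain q where q: "q \<in> carrier M" "x = f q" using f'(2) x(1) by (metis imageE)
  have "E i \<odot>\<^bsub>M\<^esub> (E i \<odot>\<^bsub>M\<^esub> q) = E i \<odot>\<^bsub>M\<^esub> q" using q(1) by (simp add: M.smult_assoc[symmetric])
  then obtain y where y: "y \<in> carrier M" "E i \<odot>\<^bsub>M\<^esub> q = A (i + 1) \<odot>\<^bsub>M\<^esub> y"
    using d q(1) unfolding arrow_divisible_def by (metis E_closed M.smult_closed)
  have "x = f (E i \<odot>\<^bsub>M\<^esub> q)" using x(2) q module_hom_smult[OF f'(1) E_closed q(1)] by simp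
  also have "\<dots> = A (i + 1) \<odot>\<^bsub>N\<^esub> f y" unfolding y(2) by (rule module_hom_smult[OF f'(1) A_closed y(1)])
  finally show "\<exists>y \<in> carrier N. x = A (i + 1) \<odot>\<^bsub>N\<^esub> y" using module_hom_closed[OF f'(1) y(1)] by blast
qed

lemma arrow_divisible_power:
  assumes d: "arrow_divisible i M"
  shows "arrow_divisible i (power_module M m)"
  unfolding arrow_divisible_def
proof (intro ballI impI)
  fix x assume x: "x \<in> carrier (power_module M m)" "E i \<odot>\<^bsub>power_module M m\<^esub> x = x"
  have "\<exists>y \<in> carrier M. x k = A (i + 1) \<odot>\<^bsub>M\<^esub> y" if k: "k < m" for k
  proof -
    have "x k \<in> carrier M" using x(1) k by (auto simp: PiE_iff)
    moreover have "E i \<odot>\<^bsub>M\<^esub> x k = x k" using fun_cong[OF x(2), of k] k by simp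
    ultimately show ?thesis using d by (auto simp: arrow_divisible_def)
  qed
  then obtain y where y: "\<And>k. k < m \<Longrightarrow> y k \<in> carrier M \<and> x k = A (i + 1) \<odot>\<^bsub>M\<^esub> y k" by metis
  have "(\<lambda>k\<in>{..<m}. A (i + 1) \<odot>\<^bsub>M\<^esub> (\<lambda>k\<in>{..<m}. y k) k) = x"
    using x(1) y by (intro restrict_eqI) (auto simp: PiE_iff)
  then have "x = A (i + 1) \<odot>\<^bsub>power_module M m\<^esub> (\<lambda>k\<in>{..<m}. y k)" by simp
  then show "\<exists>y \<in> carrier (power_module M m). x = A (i + 1) \<odot>\<^bsub>power_module M m\<^esub> y"
    using y by (intro bexI[of _ "\<lambda>k\<in>{..<m}. y k"]) auto
qed

lemma arrow_divisible_summand: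
  assumes d: "arrow_divisible i M" and M: "left_module R M" and S: "direct_summand R M S"
  shows "arrow_divisible i (sub_module M S)"
  unfolding arrow_divisible_def
proof (intro ballI impI)
  interpret M: left_module R M by fact
  obtain B where B: "submodule B R M" "S \<inter> B = {\<zero>\<^bsub>M\<^esub>}" "S <+>\<^bsub>M\<^esub> B = carrier M" and SS: "submodule S R M"
    using S by (auto simp: direct_summand_def)
  note SM = submodule_in[OF SS] and BM = submodule_in[OF B(1)]
  fix x assume "x \<in> carrier (sub_module M S)" "E i \<odot>\<^bsub>sub_module M S\<^esub> x = x"
  then have x: "x \<in> S" "E i \<odot>\<^bsub>M\<^esub> x = x" by simp_all
  then obtain y where y: "y \<in> carrier M" "x = A (i + 1) \<odot>\<^bsub>M\<^esub> y" using d SM by (auto simp: arrow_divisible_def)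
  then have "y \<in> S <+>\<^bsub>M\<^esub> B" using B(3) by simp
  then obtain s b where sb: "s \<in> S" "b \<in> B" "y = s \<oplus>\<^bsub>M\<^esub> b" by (auto simp: set_add_def set_mult_def)
  have "x = A (i + 1) \<odot>\<^bsub>M\<^esub> s \<oplus>\<^bsub>M\<^esub> A (i + 1) \<odot>\<^bsub>M\<^esub> b"
    using y(2) sb SM BM by (simp add: M.smult_r_distr)
  then have e: "x \<ominus>\<^bsub>M\<^esub> A (i + 1) \<odot>\<^bsub>M\<^esub> s = A (i + 1) \<odot>\<^bsub>M\<^esub> b"
    using SM[OF sb(1)] BM[OF sb(2)] M.M.a_comm[of "A (i + 1) \<odot>\<^bsub>M\<^esub> s" "A (i + 1) \<odot>\<^bsub>M\<^esub> b"]
    by (simp add: M.M.minus_eq M.M.a_assoc M.M.r_neg)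
  have "x \<ominus>\<^bsub>M\<^esub> A (i + 1) \<odot>\<^bsub>M\<^esub> s \<in> S" by (rule M.submodule_diff[OF SS x(1) submodule_smult[OF SS A_closed sb(1)]])
  moreover have "A (i + 1) \<odot>\<^bsub>M\<^esub> b \<in> B" by (rule submodule_smult[OF B(1) A_closed sb(2)])
  ultimately have "x \<ominus>\<^bsub>M\<^esub> A (i + 1) \<odot>\<^bsub>M\<^esub> s = \<zero>\<^bsub>M\<^esub>" using B(2) e by auto
  moreover have "x = (x \<ominus>\<^bsub>M\<^esub> A (i + 1) \<odot>\<^bsub>M\<^esub> s) \<oplus>\<^bsub>M\<^esub> A (i + 1) \<odot>\<^bsub>M\<^esub> s"
    using SM[OF x(1)] SM[OF sb(1)] by (simp add: M.M.minus_eq M.M.a_assoc M.M.l_neg)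
  ultimately have "x = A (i + 1) \<odot>\<^bsub>M\<^esub> s" using SM[OF sb(1)] by simp
  then show "\<exists>y \<in> carrier (sub_module M S). x = A (i + 1) \<odot>\<^bsub>sub_module M S\<^esub> y" using sb(1) by auto
qed

lemma arrow_divisible_sum:
  assumes Q: "left_module R Q" and dec: "direct_decomposition R Q I N"
    and d: "\<And>k. k \<in> I \<Longrightarrow> arrow_divisible i (sub_module Q (N k))"
  shows "arrow_divisible i Q"
  unfolding arrow_divisible_def
proof (intro ballI impI)
  interpret Q: left_module R Q by fact
  have fin: "finite I" and sub: "\<And>k. k \<in> I \<Longrightarrow> submodule (N k) R Q"
    using dec by (auto simp: direct_decomposition_def)
  fix x assume x: "x \<in> carrier Q" "E i \<odot>\<^bsub>Q\<^esub> x = x"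
  obtain f where f: "f \<in> Pi\<^sub>E I N" "x = (\<Oplus>\<^bsub>Q\<^esub>k\<in>I. f k)"
    using dec x(1) unfolding direct_decomposition_def by metis
  have fN: "f k \<in> N k" "f k \<in> carrier Q" if "k \<in> I" for k
    using f(1) that submodule_in[OF sub[OF that]] by (auto simp: PiE_iff)
  have "\<exists>y \<in> N k. E i \<odot>\<^bsub>Q\<^esub> f k = A (i + 1) \<odot>\<^bsub>Q\<^esub> y" if k: "k \<in> I" for k
  proof -
    have "E i \<odot>\<^bsub>Q\<^esub> (E i \<odot>\<^bsub>Q\<^esub> f k) = E i \<odot>\<^bsub>Q\<^esub> f k" using fN[OF k] by (simp add: Q.smult_assoc[symmetric])
    moreover have "E i \<odot>\<^bsub>Q\<^esub> f k \<in> N k" by (rule submodule_smult[OF sub[OF k] E_closed fN(1)[OF k]])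
    ultimately show ?thesis using d[OF k] by (auto simp: arrow_divisible_def)
  qed
  then obtain y where y: "\<And>k. k \<in> I \<Longrightarrow> y k \<in> N k \<and> E i \<odot>\<^bsub>Q\<^esub> f k = A (i + 1) \<odot>\<^bsub>Q\<^esub> y k" by metis
  have yQ: "y k \<in> carrier Q" if "k \<in> I" for k using y[OF that] submodule_in[OF sub[OF that]] by blast
  have "x = E i \<odot>\<^bsub>Q\<^esub> (\<Oplus>\<^bsub>Q\<^esub>k\<in>I. f k)" using x(2) f(2) by simp
  also have "\<dots> = (\<Oplus>\<^bsub>Q\<^esub>k\<in>I. E i \<odot>\<^bsub>Q\<^esub> f k)" using fN fin by (intro Q.smult_finsum) auto
  also have "\<dots> = (\<Oplus>\<^bsub>Q\<^esub>k\<in>I. A (i + 1) \<odot>\<^bsub>Q\<^esub> y k)" using y yQ by (intro Q.M.finsum_cong') auto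
  also have "\<dots> = A (i + 1) \<odot>\<^bsub>Q\<^esub> (\<Oplus>\<^bsub>Q\<^esub>k\<in>I. y k)" using yQ fin by (intro Q.smult_finsum[symmetric]) auto
  finally show "\<exists>y \<in> carrier Q. x = A (i + 1) \<odot>\<^bsub>Q\<^esub> y" using yQ by (auto intro!: Q.M.finsum_closed)
qed

text \<open>Such a \<open>z\<close> is killed by all of \<open>J\<close>, because
  \<open>J E j\<close> consists of left multiples of \<open>A j\<close>. So the simple module at
  \<open>j\<close> occurs in the socle, a property that passes to larger modules.\<close>

definition has_killed :: "int \<Rightarrow> ('a, 'm) module \<Rightarrow> bool" where
  "has_killed j M \<longleftrightarrow> (\<exists>z \<in> carrier M. z \<noteq> \<zero>\<^bsub>M\<^esub> \<and> E j \<odot>\<^bsub>M\<^esub> z = z \<and> A j \<odot>\<^bsub>M\<^esub> z = \<zero>\<^bsub>M\<^esub>)"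

lemma has_killed_mono:
  assumes "has_killed j M" and MN: "left_module R M" "left_module R N" and f: "f \<in> module_mono R M N"
  shows "has_killed j N"
proof -
  interpret M: left_module R M by fact
  have f': "f \<in> module_hom R M N" "inj_on f (carrier M)" using f by (auto simp: module_mono_def)
  obtain z where z: "z \<in> carrier M" "z \<noteq> \<zero>\<^bsub>M\<^esub>" "E j \<odot>\<^bsub>M\<^esub> z = z" "A j \<odot>\<^bsub>M\<^esub> z = \<zero>\<^bsub>M\<^esub>"
    using assms(1) by (auto simp: has_killed_def)
  have f0: "f \<zero>\<^bsub>M\<^esub> = \<zero>\<^bsub>N\<^esub>" by (rule module_hom_zero[OF f'(1) MN])
  have "f z \<noteq> \<zero>\<^bsub>N\<^esub>" using f'(2) z(1,2) f0 by (metis M.M.zero_closed inj_onD)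
  moreover have "E j \<odot>\<^bsub>N\<^esub> f z = f z" "A j \<odot>\<^bsub>N\<^esub> f z = \<zero>\<^bsub>N\<^esub>"
    using z f0 module_hom_smult[OF f'(1) E_closed z(1)] module_hom_smult[OF f'(1) A_closed z(1)] by metis+
  ultimately show ?thesis using module_hom_closed[OF f'(1) z(1)] by (auto simp: has_killed_def)
qed

lemma has_killed_power:
  assumes "has_killed j (power_module M m)"
  shows "has_killed j M"
proof -
  obtain z where z: "z \<in> {..<m} \<rightarrow>\<^sub>E carrier M" "z \<noteq> (\<lambda>i\<in>{..<m}. \<zero>\<^bsub>M\<^esub>)"
    "(\<lambda>i\<in>{..<m}. E j \<odot>\<^bsub>M\<^esub> z i) = z" "(\<lambda>i\<in>{..<m}. A j \<odot>\<^bsub>M\<^esub> z i) = (\<lambda>i\<in>{..<m}. \<zero>\<^bsub>M\<^esub>)"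
    using assms by (auto simp: has_killed_def)
  have "\<exists>k<m. z k \<noteq> \<zero>\<^bsub>M\<^esub>"
  proof (rule ccontr)
    assume "\<not> ?thesis"
    then have "(\<lambda>i\<in>{..<m}. \<zero>\<^bsub>M\<^esub>) = z" using z(1) by (intro restrict_eqI) (auto simp: PiE_iff)
    then show False using z(2) by simp
  qed
  then obtain k where k: "k < m" "z k \<noteq> \<zero>\<^bsub>M\<^esub>" by blast
  then show ?thesis unfolding has_killed_def
    using z(1) fun_cong[OF z(3), of k] fun_cong[OF z(4), of k] by (intro bexI[of _ "z k"]) (auto simp: PiE_iff)
qed

lemma has_killed_sum:
  assumes Q: "left_module R Q" and dec: "direct_decomposition R Q I N" and h: "has_killed j Q"
  shows "\<exists>k \<in> I. has_killed j (sub_module Q (N k))"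
proof -
  interpret Q: left_module R Q by fact
  have fin: "finite I" and sub: "\<And>k. k \<in> I \<Longrightarrow> submodule (N k) R Q"
    and uniq: "\<And>x f g. \<lbrakk>x \<in> carrier Q; f \<in> Pi\<^sub>E I N; g \<in> Pi\<^sub>E I N; x = (\<Oplus>\<^bsub>Q\<^esub>i\<in>I. f i); x = (\<Oplus>\<^bsub>Q\<^esub>i\<in>I. g i)\<rbrakk> \<Longrightarrow> f = g"
    using dec unfolding direct_decomposition_def by blast+
  obtain z where z: "z \<in> carrier Q" "z \<noteq> \<zero>\<^bsub>Q\<^esub>" "E j \<odot>\<^bsub>Q\<^esub> z = z" "A j \<odot>\<^bsub>Q\<^esub> z = \<zero>\<^bsub>Q\<^esub>"
    using h by (auto simp: has_killed_def)
  obtain f where f: "f \<in> Pi\<^sub>E I N" "z = (\<Oplus>\<^bsub>Q\<^esub>k\<in>I. f k)"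
    using dec z(1) unfolding direct_decomposition_def by metis
  have fN: "f k \<in> N k" "f k \<in> carrier Q" if "k \<in> I" for k
    using f(1) that submodule_in[OF sub[OF that]] by (auto simp: PiE_iff)
  have act: "a \<odot>\<^bsub>Q\<^esub> z = (\<Oplus>\<^bsub>Q\<^esub>k\<in>I. (\<lambda>k\<in>I. a \<odot>\<^bsub>Q\<^esub> f k) k)" if a: "a \<in> carrier R" for a
  proof -
    have "a \<odot>\<^bsub>Q\<^esub> z = (\<Oplus>\<^bsub>Q\<^esub>k\<in>I. a \<odot>\<^bsub>Q\<^esub> f k)" unfolding f(2) using fN fin a by (intro Q.smult_finsum) auto
    also have "\<dots> = (\<Oplus>\<^bsub>Q\<^esub>k\<in>I. (\<lambda>k\<in>I. a \<odot>\<^bsub>Q\<^esub> f k) k)" using fN a by (intro Q.M.finsum_cong') auto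
    finally show ?thesis .
  qed
  have ain: "(\<lambda>k\<in>I. a \<odot>\<^bsub>Q\<^esub> f k) \<in> Pi\<^sub>E I N" if "a \<in> carrier R" for a
    using submodule_smult[OF sub that fN(1)] by auto
  \<comment> \<open>Uniqueness of the decomposition turns the equations for \<open>z\<close> into
    equations for its components.\<close>
  have "(\<lambda>k\<in>I. E j \<odot>\<^bsub>Q\<^esub> f k) = f"
    by (rule uniq[OF z(1) ain[OF E_closed] f(1) _ f(2)]) (use act[OF E_closed] z(3) in simp)
  then have Ef: "E j \<odot>\<^bsub>Q\<^esub> f k = f k" if "k \<in> I" for k using that by (metis restrict_apply')
  have "(\<lambda>k\<in>I. A j \<odot>\<^bsub>Q\<^esub> f k) = (\<lambda>k\<in>I. \<zero>\<^bsub>Q\<^esub>)"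
  proof (rule uniq[OF Q.M.zero_closed ain[OF A_closed]])
    show "(\<lambda>k\<in>I. \<zero>\<^bsub>Q\<^esub>) \<in> Pi\<^sub>E I N" using submodule_zero[OF sub] by auto
    show "\<zero>\<^bsub>Q\<^esub> = (\<Oplus>\<^bsub>Q\<^esub>k\<in>I. (\<lambda>k\<in>I. A j \<odot>\<^bsub>Q\<^esub> f k) k)" using act[OF A_closed] z(4) by simp
    have "(\<Oplus>\<^bsub>Q\<^esub>k\<in>I. (\<lambda>k\<in>I. \<zero>\<^bsub>Q\<^esub>) k) = (\<Oplus>\<^bsub>Q\<^esub>k\<in>I. \<zero>\<^bsub>Q\<^esub>)" by (intro Q.M.finsum_cong') auto
    then show "\<zero>\<^bsub>Q\<^esub> = (\<Oplus>\<^bsub>Q\<^esub>k\<in>I. (\<lambda>k\<in>I. \<zero>\<^bsub>Q\<^esub>) k)" by simp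
  qed
  then have Af: "A j \<odot>\<^bsub>Q\<^esub> f k = \<zero>\<^bsub>Q\<^esub>" if "k \<in> I" for k using that by (metis restrict_apply')
  have "\<exists>k \<in> I. f k \<noteq> \<zero>\<^bsub>Q\<^esub>"
  proof (rule ccontr)
    assume "\<not> ?thesis"
    then have "(\<Oplus>\<^bsub>Q\<^esub>k\<in>I. f k) = (\<Oplus>\<^bsub>Q\<^esub>k\<in>I. \<zero>\<^bsub>Q\<^esub>)" by (intro Q.M.finsum_cong') auto
    then show False using f(2) z(2) by simp
  qed
  then obtain k where "k \<in> I" "f k \<noteq> \<zero>\<^bsub>Q\<^esub>" by blast
  then show ?thesis using fN(1) Ef Af by (intro bexI[of _ k]) (auto simp: has_killed_def)
qed

text \<open>If \<open>z\<close> has order \<open>s\<close>, the next longer path is a multiple of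
  \<open>A j \<otimes> z\<close> and vanishes. So \<open>s = len k - 1\<close>, and
  \<open>order_index\<close> locates \<open>j\<close>.\<close>

lemma has_killed_proj:
  assumes "has_killed j (proj k)"
  shows "j mod int n = (k - int (len k) + 1) mod int n"
proof -
  obtain z where z: "z \<in> lgen (E k)" "z \<noteq> \<zero>" "E j \<otimes> z = z" "A j \<otimes> z = \<zero>"
    using assms by (auto simp: has_killed_def)
  have zc: "z \<in> carrier R" using z(1) by (simp add: lgen_E_iff)
  obtain s r c where s: "s < len k" "r \<in> carrier R" "z = r \<otimes> path k s" "c \<in> carrier R" "c \<otimes> z = path k s"
    using order_of[OF z(1,2)] by metis
  have idx: "j mod int n = (k - int s) mod int n" by (rule order_index[OF zc z(3) s(2-5) s(1)])
  have "A (k - int s) \<otimes> c \<in> J" using s(4) by (intro J_right A_J)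
  then obtain r' where r': "r' \<in> carrier R" "A (k - int s) \<otimes> c \<otimes> E j = r' \<otimes> A j" using J_E by blast
  have "path k (Suc s) = A (k - int s) \<otimes> (c \<otimes> (E j \<otimes> z))" using s(5) z(3) by simp
  also have "\<dots> = (A (k - int s) \<otimes> c \<otimes> E j) \<otimes> z" using s(4) zc by (simp add: m_assoc)
  also have "\<dots> = r' \<otimes> (A j \<otimes> z)" unfolding r'(2) using r'(1) zc by (simp add: m_assoc)
  also have "\<dots> = \<zero>" using z(4) r'(1) by simp
  finally have "len k \<le> Suc s" by (simp only: path_zero_iff)
  then have "k - int s = k - int (len k) + 1" using s(1) by simp
  then show ?thesis using idx by (simp only:)
qed

lemma add_category_divisible:
  assumes T: "left_module R T" "arrow_divisible i T" and M: "M \<in> add_category R T"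
  shows "arrow_divisible i M"
proof -
  obtain m S where mS: "direct_summand R (power_module T m) S" "module_iso R M (sub_module (power_module T m) S)"
    and lm: "left_module R M"
    using M by (auto simp: add_category_def)
  have pm: "left_module R (power_module T m)" by (rule left_module.power_left_module[OF T(1)])
  have S: "submodule S R (power_module T m)" using mS(1) by (simp add: direct_summand_def)
  note SM = left_module.sub_module_left_module[OF pm S]
  obtain f where "f \<in> module_epi R (sub_module (power_module T m) S) M"
    using module_iso_sym[OF mS(2) lm] by (auto simp: module_iso_def module_epi_def bij_betw_def)
  then show ?thesis
    using arrow_divisible_epi[OF arrow_divisible_summand[OF arrow_divisible_power[OF T(2)] pm mS(1)] SM lm] by blast
qed

lemma add_category_killed:
  assumes T: "left_module R T" and M: "M \<in> add_category R T" "has_killed j M"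
  shows "has_killed j T"
proof -
  obtain m S where mS: "direct_summand R (power_module T m) S" "module_iso R M (sub_module (power_module T m) S)"
    and lm: "left_module R M"
    using M by (auto simp: add_category_def)
  have pm: "left_module R (power_module T m)" by (rule left_module.power_left_module[OF T(1)])
  have S: "submodule S R (power_module T m)" using mS(1) by (simp add: direct_summand_def)
  note SM = left_module.sub_module_left_module[OF pm S]
  obtain f where "f \<in> module_mono R M (sub_module (power_module T m) S)"
    using mS(2) by (auto simp: module_iso_def module_mono_def bij_betw_def)
  then have "has_killed j (sub_module (power_module T m) S)" by (rule has_killed_mono[OF M(2) lm SM])
  then have "has_killed j (power_module T m)" using submodule_in[OF S] by (auto simp: has_killed_def)
  then show ?thesis by (rule has_killed_power)
qed

lemma tilting_implies_condition:
  fixes T :: "'a fmod"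
  assumes complete: "\<And>X :: 'a fmod. \<lbrakk>projective R X; indecomposable R X\<rbrakk> \<Longrightarrow> \<exists>i. module_iso R X (proj i)"
    and tilt: "tilting_module R T" and TC: "T \<in> C_subcategory R" and i: "len (i + 1) = len i + 1"
  shows "\<exists>k. len (k + 1) \<le> len k \<and> i mod int n = (k - int (len k)) mod int n"
proof -
  have T: "left_module R T" using tilt by (simp add: tilting_module_def fg_module_def)
  obtain Q :: "'a fmod" and g1 m1 g2 m2 where Q: "projinj_sum R Q"
    and g1: "g1 \<in> module_epi R (power_module Q m1) T" and g2: "g2 \<in> module_mono R T (power_module Q m2)"
    using TC by (auto simp: C_subcategory_def Gen_def Cogen_def)
  have QM: "left_module R Q" using Q by (simp add: projinj_sum_def)
  obtain I N where IN: "direct_decomposition R Q I N"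
    "\<And>k. k \<in> I \<Longrightarrow> indecomposable R (sub_module Q (N k)) \<and> projective R (sub_module Q (N k)) \<and>
      injective R (sub_module Q (N k))"
    using Q by (auto simp: projinj_sum_def)
  note pQ = left_module.power_left_module[OF QM]
  have "arrow_divisible i (sub_module Q (N k))" if "k \<in> I" for k
    using IN(2)[OF that] extend_along_arrow[of "sub_module Q (N k)", OF _ i] unfolding arrow_divisible_def by blast
  then have "arrow_divisible i Q" by (rule arrow_divisible_sum[OF QM IN(1)])
  then have dT: "arrow_divisible i T" by (intro arrow_divisible_epi[OF arrow_divisible_power pQ T g1])
  obtain T0 T1 :: "'a fmod" and f g where T01: "T0 \<in> add_category R T" "T1 \<in> add_category R T"
    and f: "f \<in> module_mono R (regular_module R) T0" and g: "g \<in> module_epi R T0 T1"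
    and ex: "f ` carrier R = a_kernel T0 T1 g"
    using tilt by (auto simp: tilting_module_def)
  have T0: "left_module R T0" and T1: "left_module R T1" using T01 by (auto simp: add_category_def)
  interpret T0: left_module R T0 by fact
  have fh: "f \<in> module_hom R (regular_module R) T0" "inj_on f (carrier R)" using f by (auto simp: module_mono_def)
  have gh: "g \<in> module_hom R T0 T1" using g by (simp add: module_epi_def)
  have fc: "f r \<in> carrier T0" if "r \<in> carrier R" for r using module_hom_closed[OF fh(1)] that by simp
  have fs: "f (a \<otimes> r) = a \<odot>\<^bsub>T0\<^esub> f r" if "a \<in> carrier R" "r \<in> carrier R" for a r
    using module_hom_smult[OF fh(1), of a r] that by simp
  have "E i \<odot>\<^bsub>T0\<^esub> f (E i) = f (E i)" using fs[of "E i" "E i"] by simp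
  then obtain y0 where y0: "y0 \<in> carrier T0" "f (E i) = A (i + 1) \<odot>\<^bsub>T0\<^esub> y0"
    using add_category_divisible[OF T dT T01(1)] fc[OF E_closed] by (metis arrow_divisible_def)
  define y where "y = E (i + 1) \<odot>\<^bsub>T0\<^esub> y0"
  have y: "y \<in> carrier T0" "f (E i) = A (i + 1) \<odot>\<^bsub>T0\<^esub> y" "E (i + 1) \<odot>\<^bsub>T0\<^esub> y = y"
    using y0 A_E[of "i + 1"] by (simp_all add: y_def T0.smult_assoc[symmetric])
  have "has_killed (i + 1) T1"
  proof (cases "g y = \<zero>\<^bsub>T1\<^esub>")
    case True
    \<comment> \<open>Exactness would bring \<open>y\<close> back into the ring and make
      \<open>E i\<close> a multiple of an arrow, hence an element of \<open>J\<close>.\<close>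
    then have "y \<in> f ` carrier R" unfolding ex using y(1) by (simp add: a_kernel_def')
    then obtain b where b: "b \<in> carrier R" "y = f b" by blast
    then have "f (E i) = f (A (i + 1) \<otimes> b)" using y(2) fs[OF A_closed b(1)] by simp
    then have "E i = A (i + 1) \<otimes> b" using fh(2) b(1) by (auto dest: inj_onD)
    then have "E i \<in> J" using J_right[OF b(1) A_J] by simp
    then show ?thesis using E_notin_J by blast
  next
    case False
    have "f (E i) \<in> a_kernel T0 T1 g" unfolding ex[symmetric] by simp
    then have "A (i + 1) \<odot>\<^bsub>T1\<^esub> g y = \<zero>\<^bsub>T1\<^esub>"
      using module_hom_smult[OF gh A_closed y(1), of "i + 1"] y(2) by (simp add: a_kernel_def')
    moreover have "E (i + 1) \<odot>\<^bsub>T1\<^esub> g y = g y" using module_hom_smult[OF gh E_closed y(1), of "i + 1"] y(3) by simp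
    ultimately show ?thesis using False module_hom_closed[OF gh y(1)] unfolding has_killed_def by blast
  qed
  then have "has_killed (i + 1) T" by (rule add_category_killed[OF T T01(2)])
  then have "has_killed (i + 1) (power_module Q m2)" by (rule has_killed_mono[OF _ T pQ g2])
  then have "has_killed (i + 1) Q" by (rule has_killed_power)
  then obtain k where k: "k \<in> I" "has_killed (i + 1) (sub_module Q (N k))" using has_killed_sum[OF QM IN(1)] by blast
  note Nk = IN(2)[OF k(1)]
  have Nl: "left_module R (sub_module Q (N k))" using Nk by (simp add: indecomposable_def)
  \<comment> \<open>\<open>complete\<close> speaks about modules of type \<open>'a fmod\<close>, so
    the summand is first copied there.\<close>
  obtain X :: "'a fmod" where X: "fg_module R X" "module_iso R (sub_module Q (N k)) X"
    using fg_module_iso_fmod[of R "sub_module Q (N k)"] Nk by (auto simp: projective_def)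
  note Xl = fg_left_module[OF X(1)]
  obtain l where l: "module_iso R X (proj l)"
    using complete[of X] projective_iso[OF _ X(2) Xl] indecomposable_iso[OF _ X(2) Xl] Nk by blast
  have iso: "module_iso R (sub_module Q (N k)) (proj l)" by (rule module_iso_trans[OF X(2) l Nl])
  have "injective R (proj l)" using injective_iso[OF _ iso proj_left_module] Nk by blast
  then have len: "len (l + 1) \<le> len l" by (simp only: injective_proj_iff)
  obtain h where "h \<in> module_mono R (sub_module Q (N k)) (proj l)"
    using iso by (auto simp: module_iso_def module_mono_def bij_betw_def)
  then have "has_killed (i + 1) (proj l)" by (rule has_killed_mono[OF k(2) Nl proj_left_module])
  then have "(i + 1) mod int n = (l - int (len l) + 1) mod int n" by (rule has_killed_proj)
  then have "i mod int n = (l - int (len l)) mod int n"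
    using mod_diff_cong[of "i + 1" "int n" "l - int (len l) + 1" 1 1] by simp
  then show ?thesis using len by blast
qed

end

section \<open>The tilting module built from the condition\<close>

text \<open>A retract of a power of \<open>T\<close> is a summand of it: the complement of the image
  of \<open>s\<close> is the kernel of \<open>r\<close>.\<close>

lemma add_categoryI:
  assumes T: "left_module R T" and M: "left_module R M"
    and s: "s \<in> module_hom R M (power_module T m)" and r: "r \<in> module_hom R (power_module T m) M"
    and rs: "\<And>x. x \<in> carrier M \<Longrightarrow> r (s x) = x"
  shows "M \<in> add_category R T"
proof -
  interpret M: left_module R M by fact
  interpret P: left_module R "power_module T m" by (rule left_module.power_left_module[OF T])
  note P = P.left_module_axioms
  define S where "S = s ` carrier M"
  define B where "B = a_kernel (power_module T m) M r"
  have S: "submodule S R (power_module T m)" unfolding S_def by (rule image_submodule[OF s M P M.carrier_submodule])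
  have B: "submodule B R (power_module T m)" unfolding B_def by (rule kernel_submodule[OF r P M])
  note sc = module_hom_closed[OF s] and rc = module_hom_closed[OF r]
  have "S \<inter> B \<subseteq> {\<zero>\<^bsub>power_module T m\<^esub>}"
  proof
    fix y assume y: "y \<in> S \<inter> B"
    then obtain x where x: "x \<in> carrier M" "y = s x" by (auto simp: S_def)
    then have "x = \<zero>\<^bsub>M\<^esub>" using y rs by (simp add: B_def a_kernel_def')
    then show "y \<in> {\<zero>\<^bsub>power_module T m\<^esub>}" using x module_hom_zero[OF s M P] by simp
  qed
  then have int: "S \<inter> B = {\<zero>\<^bsub>power_module T m\<^esub>}" using submodule_zero[OF S] submodule_zero[OF B] by blast
  have "carrier (power_module T m) \<subseteq> S <+>\<^bsub>power_module T m\<^esub> B"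
  proof
    fix y assume y: "y \<in> carrier (power_module T m)"
    have sr: "s (r y) \<in> carrier (power_module T m)" using sc rc y by blast
    have "r (y \<ominus>\<^bsub>power_module T m\<^esub> s (r y)) = \<zero>\<^bsub>M\<^esub>"
      using module_hom_diff[OF r P M y sr] rs[OF rc[OF y]] rc[OF y] by (simp add: M.M.minus_eq M.M.r_neg)
    then have "y \<ominus>\<^bsub>power_module T m\<^esub> s (r y) \<in> B" using y sr by (simp add: B_def a_kernel_def' del: power_module_simps)
    moreover have "s (r y) \<in> S" using rc[OF y] by (simp add: S_def)
    moreover have "y = s (r y) \<oplus>\<^bsub>power_module T m\<^esub> (y \<ominus>\<^bsub>power_module T m\<^esub> s (r y))"
      using y sr P.M.a_comm[OF sr, of "y \<ominus>\<^bsub>power_module T m\<^esub> s (r y)"]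
      by (simp add: P.M.minus_eq P.M.a_assoc P.M.l_neg del: power_module_simps)
    ultimately show "y \<in> S <+>\<^bsub>power_module T m\<^esub> B"
      unfolding set_add_def set_mult_def by (auto simp del: power_module_simps)
  qed
  moreover have "S <+>\<^bsub>power_module T m\<^esub> B \<subseteq> carrier (power_module T m)"
    by (rule submodule_subset[OF P.submodule_sum[OF S B]])
  ultimately have "direct_summand R (power_module T m) S"
    unfolding direct_summand_def using S B int by (intro conjI exI[of _ B]) auto
  moreover have "module_iso R M (sub_module (power_module T m) S)"
  proof (rule module_isoI)
    show "s \<in> module_hom R M (sub_module (power_module T m) S)"
      using s by (auto simp: module_hom_def S_def simp del: power_module_simps)
    have "(\<lambda>y\<in>carrier (sub_module (power_module T m) S). r y) \<in> module_hom R (sub_module (power_module T m) S) M"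
      by (rule module_homI[OF _ _ _ P.sub_module_left_module[OF S]])
        (use rc module_hom_add[OF r] module_hom_smult[OF r] submodule_in[OF S]
          in \<open>auto simp del: power_module_simps\<close>)
    then show "(\<lambda>y\<in>S. r y) \<in> module_hom R (sub_module (power_module T m) S) M" by simp
    show "(\<lambda>y\<in>S. r y) (s x) = x" if "x \<in> carrier M" for x using that rs by (simp add: S_def)
    show "s ((\<lambda>y\<in>S. r y) y) = y" if "y \<in> carrier (sub_module (power_module T m) S)" for y
      using that rs by (auto simp: S_def)
  qed
  ultimately show ?thesis using M unfolding add_category_def by blast
qed

lemma (in ring) diag_hom:
  assumes U: "\<And>i. i < m \<Longrightarrow> left_ideal (U i) R" and w: "\<And>i. i < m \<Longrightarrow> w i \<in> carrier R"
    and V: "\<And>i x. \<lbrakk>i < m; x \<in> U i\<rbrakk> \<Longrightarrow> x \<otimes> w i \<in> V i"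
  shows "(\<lambda>X\<in>carrier (fbox R m U). vec m (\<lambda>i. the_elem X i \<otimes> w i)) \<in> module_hom R (fbox R m U) (fbox R m V)"
proof (rule module_homI[OF _ _ _ fbox_left_module[OF U]])
  have c: "the_elem X i \<in> carrier R" if "X \<in> carrier (fbox R m U)" "i < m" for X i
    using U that by (rule fbox_in)
  show "vec m (\<lambda>i. the_elem X i \<otimes> w i) \<in> carrier (fbox R m V)" if "X \<in> carrier (fbox R m U)" for X
    by (rule vec_in_fbox, rule V) (use fbox_nth[OF that] in auto)
  show "vec m (\<lambda>i. the_elem (X \<oplus>\<^bsub>fbox R m U\<^esub> Y) i \<otimes> w i) =
      vec m (\<lambda>i. the_elem X i \<otimes> w i) \<oplus>\<^bsub>fbox R m V\<^esub> vec m (\<lambda>i. the_elem Y i \<otimes> w i)"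
    if "X \<in> carrier (fbox R m U)" "Y \<in> carrier (fbox R m U)" for X Y
    unfolding fbox_simps by (rule vec_cong) (use c that w in \<open>simp add: l_distr\<close>)
  show "vec m (\<lambda>i. the_elem (a \<odot>\<^bsub>fbox R m U\<^esub> X) i \<otimes> w i) = a \<odot>\<^bsub>fbox R m V\<^esub> vec m (\<lambda>i. the_elem X i \<otimes> w i)"
    if "a \<in> carrier R" "X \<in> carrier (fbox R m U)" for a X
    unfolding fbox_simps by (rule vec_cong) (use c that w in \<open>simp add: m_assoc\<close>)
qed

lemma (in ring) fbox_zero_carrier:
  assumes "\<And>i. i < m \<Longrightarrow> U i = {\<zero>}"
  shows "carrier (fbox R m U) = {\<zero>\<^bsub>fbox R m U\<^esub>}"
proof -
  have "X = \<zero>\<^bsub>fbox R m U\<^esub>" if X: "X \<in> carrier (fbox R m U)" for X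
    using assms fbox_nth[OF X] by (intro fbox_ext[OF X, of _ U]) (auto simp: fbox_simps)
  moreover have "\<zero>\<^bsub>fbox R m U\<^esub> \<in> carrier (fbox R m U)" using assms by (auto simp: fbox_simps)
  ultimately show ?thesis by blast
qed

section \<open>Injective envelopes of the indecomposable projectives\<close>

context nak_ring
begin

definition inj_label :: "int \<Rightarrow> bool" where
  "inj_label j \<longleftrightarrow> len (j + 1) \<le> len j"

lemma inj_label_cong: "i mod int n = j mod int n \<Longrightarrow> inj_label i = inj_label j"
  using len_cong[of i j] len_cong[of "i + 1" "j + 1"] mod_add_cong[of i "int n" j 1 1]
  by (simp add: inj_label_def)

text \<open>Along the rising labels from \<open>i\<close> on, each projective embeds into the next
  by an arrow. The run ends at \<open>hull i\<close>, the label of the injective envelope of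
  \<open>R (E i)\<close>.\<close>

definition rise :: "int \<Rightarrow> nat" where "rise i = (LEAST d. inj_label (i + int d))"

definition hull :: "int \<Rightarrow> int" where "hull i = i + int (rise i)"

text \<open>If the lengths kept rising, one turn around the \<open>n\<close> labels would give
  \<open>len i = len i + n\<close>.\<close>

lemma inj_label_hull: "inj_label (hull i)"
proof -
  have "\<exists>d. inj_label (i + int d)"
  proof (rule ccontr)
    assume no: "\<not> ?thesis"
    have "len (i + int d) = len i + d" for d
    proof (induction d)
      case (Suc d)
      have "\<not> inj_label (i + int d)" using no by blast
      then show ?case using Suc len_step[of "i + int d"] by (simp add: inj_label_def algebra_simps)
    qed simp
    moreover have "len (i + int n) = len i" by (rule len_cong) simp
    ultimately show False using n_pos by simp
  qed
  then show ?thesis unfolding hull_def rise_def by (rule LeastI_ex)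
qed

lemma not_inj_label_below: "d < rise i \<Longrightarrow> \<not> inj_label (i + int d)"
  unfolding rise_def by (rule not_less_Least)

lemma len_hull: "len (hull i) = len i + rise i"
proof -
  have "len (i + int d) = len i + d" if "d \<le> rise i" for d
    using that
  proof (induction d)
    case (Suc d)
    then have "\<not> inj_label (i + int d)" by (intro not_inj_label_below) simp
    then show ?case using Suc len_step[of "i + int d"] by (simp add: inj_label_def algebra_simps)
  qed simp
  then show ?thesis by (simp add: hull_def)
qed

lemma rise_zero_iff: "rise i = 0 \<longleftrightarrow> inj_label i"
  using inj_label_hull[of i] not_inj_label_below[of 0 i] by (auto simp: hull_def)

text \<open>Right multiplication by it is the inclusion of \<open>R (E i)\<close> into
  \<open>R (E (hull i))\<close>.\<close>

definition emb :: "int \<Rightarrow> 'a" where "emb i = path (hull i) (rise i)"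

lemma emb_closed [simp, intro]: "emb i \<in> carrier R"
  by (simp add: emb_def)

lemma emb_E [simp]: "E i \<otimes> emb i = emb i" "emb i \<otimes> E (hull i) = emb i"
proof -
  have "hull i - int (rise i) = i" by (simp add: hull_def)
  then show "E i \<otimes> emb i = emb i" using E_path[of "hull i" "rise i"] by (simp only: emb_def)
qed (simp add: emb_def)

lemma emb_inj_label: "inj_label i \<Longrightarrow> emb i = E i \<and> hull i = i"
  using rise_zero_iff[of i] by (simp add: emb_def hull_def)

lemma emb_cancel: "\<lbrakk>r \<in> lgen (E i); r \<otimes> emb i = \<zero>\<rbrakk> \<Longrightarrow> r = \<zero>"
  using annihilator_path[of r "hull i" "rise i"] by (simp add: emb_def len_hull) (simp add: hull_def lgen_zero)

text \<open>The annihilator condition of \<open>factor_through_path\<close> is automatic: the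
  annihilating path is the one of length \<open>len i\<close> ending in \<open>i\<close>, which is
  zero.\<close>

lemma factor_through_emb:
  assumes j: "inj_label j" and v: "v \<in> carrier R" "E i \<otimes> v = v" "v \<otimes> E j = v"
  obtains z where "z \<in> carrier R" "v = emb i \<otimes> z"
proof (rule factor_through_path[of j "rise i" "hull i" v])
  have h: "hull i - int (rise i) = i" by (simp add: hull_def)
  show "len (j + 1) \<le> len j" using j by (simp add: inj_label_def)
  show "path (hull i - int (rise i)) (len (hull i) - rise i) \<otimes> v = \<zero>"
    unfolding h len_hull using v by simp
  show "E (hull i - int (rise i)) \<otimes> v = v" unfolding h by (rule v(2))
qed (use that v in \<open>auto simp: emb_def len_hull\<close>)

text \<open>The image of the generator has order exactly \<open>t\<close>, which compares the tops.
  It is killed by whatever kills the generator, which bounds the length; the reverse bound comes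
  from the inverse isomorphism.\<close>

lemma ideal_iso_invariants:
  assumes iso: "module_iso R (ideal_module R (lgen (path j s))) (ideal_module R (lgen (path k t)))"
    and s: "s < len j" and t: "t < len k"
  shows "(j - int s) mod int n = (k - int t) mod int n \<and> len k - t \<le> len j - s"
proof -
  note V = lgen_left_ideal[OF path_closed]
  note L = ideal_module_left_module[OF V]
  obtain f g where fg: "f \<in> module_hom R (ideal_module R (lgen (path j s))) (ideal_module R (lgen (path k t)))"
    "g \<in> module_hom R (ideal_module R (lgen (path k t))) (ideal_module R (lgen (path j s)))"
    "\<And>x. x \<in> lgen (path j s) \<Longrightarrow> g (f x) = x" "\<And>x. x \<in> lgen (path k t) \<Longrightarrow> f (g x) = x"
    using module_isoE[OF iso L] by auto
  have self: "path j s \<in> lgen (path j s)" "path k t \<in> lgen (path k t)" by (auto intro: lgen_self)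
  have fs: "f (r \<otimes> path j s) = r \<otimes> f (path j s)" if "r \<in> carrier R" for r
    using module_hom_smult[OF fg(1), of r "path j s"] that self by simp
  define x where "x = f (path j s)"
  have xW: "x \<in> lgen (path k t)" using module_hom_closed[OF fg(1), of "path j s"] self by (simp add: x_def)
  then have xE: "x \<in> lgen (E k)" using lgen_path_mono[of 0 t k] by auto
  then have xc: "x \<in> carrier R" by (simp add: lgen_E_iff)
  have x0: "x \<noteq> \<zero>"
  proof
    assume "x = \<zero>"
    then have "g x = \<zero>" using module_hom_zero[OF fg(2) L L] by simp
    then show False using fg(3)[OF self(1)] s by (simp add: x_def path_zero_iff)
  qed
  have Ex: "E (j - int s) \<otimes> x = x" using fs[OF E_closed, of "j - int s"] by (simp add: x_def)
  obtain u r c where u: "u < len k" "r \<in> carrier R" "x = r \<otimes> path k u" "c \<in> carrier R" "c \<otimes> x = path k u"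
    using order_of[OF xE x0] by metis
  have idx: "(j - int s) mod int n = (k - int u) mod int n" by (rule order_index[OF xc Ex u(2-5) u(1)])
  have "g (path k t) \<in> lgen (path j s)" using module_hom_closed[OF fg(2), of "path k t"] self by simp
  then obtain r' where r': "r' \<in> carrier R" "g (path k t) = r' \<otimes> path j s" by (auto simp: lgen_def)
  have pk: "path k t = r' \<otimes> x" using fg(4)[OF self(2)] fs[OF r'(1)] r'(2) by (simp add: x_def)
  have "path k t \<in> lgen (path k u)"
    using r'(1) u(2) unfolding pk u(3) by (auto simp: lgen_def m_assoc[symmetric])
  then have "u \<le> t" using path_notin_next[OF t] lgen_path_mono[of "Suc t" u k] by (meson not_less_eq_eq subsetD)
  moreover have "path k u \<in> lgen (path k t)" using left_ideal_mult[OF V u(4) xW] u(5) by simp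
  then have "t \<le> u" using path_notin_next[OF u(1)] lgen_path_mono[of "Suc u" t k] by (meson not_less_eq_eq subsetD)
  ultimately have ut: "u = t" by simp
  define q where "q = len j - s"
  obtain c' where c': "c' \<in> carrier R" "path (j - int s) q \<otimes> c \<otimes> E (j - int s) = c' \<otimes> path (j - int s) q"
    using path_commute_right[OF u(4)] by blast
  have ann: "path (j - int s) q \<otimes> x = \<zero>"
    using fs[OF path_closed, of "j - int s" q] path_annihilator[of s j] s module_hom_zero[OF fg(1) L L]
    by (simp add: x_def q_def)
  have "path k (u + q) = path (j - int s) q \<otimes> (c \<otimes> (E (j - int s) \<otimes> x))"
    unfolding path_add Ex u(5) using path_cong[OF idx] by simp
  also have "\<dots> = (path (j - int s) q \<otimes> c \<otimes> E (j - int s)) \<otimes> x" using u(4) xc by (simp add: m_assoc)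
  also have "\<dots> = c' \<otimes> (path (j - int s) q \<otimes> x)" unfolding c'(2) using c'(1) xc by (simp add: m_assoc)
  also have "\<dots> = \<zero>" using ann c'(1) by simp
  finally have "len k \<le> u + q" by (simp only: path_zero_iff)
  then show ?thesis using idx ut by (simp add: q_def)
qed

lemma proj_iso_cong:
  assumes "module_iso R (proj i) (proj j)" shows "i mod int n = j mod int n"
  using ideal_iso_invariants[of i 0 j 0] assms len_pos[of i] len_pos[of j] by simp

text \<open>The coordinate belonging to the label \<open>j\<close> in tuples indexed by
  \<open>{..<n}\<close>.\<close>

definition ix :: "int \<Rightarrow> nat" where "ix j = nat (j mod int n)"

lemma ix_less [simp]: "ix j < n"
  using n_pos by (simp add: ix_def nat_less_iff)

lemma ix_cong: "int (ix j) mod int n = j mod int n"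
  using n_pos by (simp add: ix_def)

end

locale nak_ring_condition = nak_ring +
  assumes condition: "\<not> inj_label i \<Longrightarrow> \<exists>k. inj_label k \<and> i mod int n = (k - int (len k)) mod int n"
begin

text \<open>For non-injective \<open>i\<close>, a projective-injective whose socle is at
  \<open>i + 1\<close>. At injective labels it is \<open>i\<close> itself, so that every summand of
  the tilting module lies in the projective at its target.\<close>

definition target :: "int \<Rightarrow> int" where
  "target i = (if inj_label i then i else SOME k. inj_label k \<and> i mod int n = (k - int (len k)) mod int n)"

lemma target: "inj_label (target i)"
  "\<not> inj_label i \<Longrightarrow> i mod int n = (target i - int (len (target i))) mod int n"
  using someI_ex[OF condition[of i]] by (auto simp: target_def)

text \<open>Otherwise the target, congruent to \<open>i + int (len (target i))\<close>, would lie
  before the end of the rising run and could not be injective.\<close>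

lemma rise_le_target: "\<not> inj_label i \<Longrightarrow> rise i \<le> len (target i)"
proof (rule ccontr)
  assume i: "\<not> inj_label i" and "\<not> rise i \<le> len (target i)"
  then have "\<not> inj_label (i + int (len (target i)))" by (intro not_inj_label_below) simp
  moreover have "(i + int (len (target i))) mod int n = target i mod int n"
    using mod_add_cong[OF target(2)[OF i] refl[of "int (len (target i)) mod int n"]] by simp
  ultimately show False using target(1)[of i] inj_label_cong by blast
qed

text \<open>\<open>R cok\<^sub>i\<close> is the cokernel of the injective envelope \<open>P\<^sub>i \<rightarrow> P\<^bsub>hull i\<^esub>\<close>, realised inside
  the projective-injective \<open>P\<^bsub>target i\<^esub>\<close>.\<close>

definition cok :: "int \<Rightarrow> 'a" where
  "cok i = (if inj_label i then \<zero> else path (target i) (len (target i) - rise i))"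

lemma cok_closed [simp, intro]: "cok i \<in> carrier R"
  by (simp add: cok_def)

text \<open>\<open>target i - int (len (target i))\<close> is congruent to \<open>i\<close>, and
  adding \<open>rise i\<close> leads to \<open>hull i\<close>.\<close>

lemma target_start:
  assumes "\<not> inj_label i"
  shows "(target i - int (len (target i) - rise i)) mod int n = hull i mod int n"
proof -
  have e: "target i - int (len (target i) - rise i) = (target i - int (len (target i))) + int (rise i)"
    using rise_le_target[OF assms] by simp
  show ?thesis unfolding e hull_def
    using mod_add_cong[OF target(2)[OF assms] refl[of "int (rise i) mod int n"]] by simp
qed

lemma cok_E [simp]: "E (hull i) \<otimes> cok i = cok i" "cok i \<otimes> E (target i) = cok i"
proof -
  show "E (hull i) \<otimes> cok i = cok i"
    using E_path_cong[OF target_start[of i, symmetric]] by (simp add: cok_def)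
qed (simp add: cok_def)

text \<open>The annihilator of a path is generated by the path that completes it to a vanishing one.
  For \<open>cok i\<close> this has length \<open>rise i\<close> and ends in \<open>hull i\<close>,
  so it is \<open>emb i\<close>.\<close>

lemma cok_kernel:
  assumes r: "r \<in> lgen (E (hull i))"
  shows "r \<otimes> cok i = \<zero> \<longleftrightarrow> r \<in> lgen (emb i)"
proof (cases "inj_label i")
  case True
  then show ?thesis using r emb_inj_label[OF True] by (simp add: cok_def lgen_E_iff)
next
  case False
  define k s where "k = target i" and "s = len k - rise i"
  have rs: "rise i \<le> len k" using rise_le_target[OF False] by (simp add: k_def)
  have st: "(k - int s) mod int n = hull i mod int n" using target_start[OF False] by (simp add: k_def s_def)
  have c: "cok i = path k s" using False by (simp add: cok_def k_def s_def)
  have em: "emb i = path (k - int s) (len k - s)"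
    unfolding emb_def using path_cong[OF st] rs by (simp add: s_def)
  show ?thesis
  proof
    assume "r \<otimes> cok i = \<zero>"
    then show "r \<in> lgen (emb i)"
      unfolding em using r c E_cong[OF st] by (intro annihilator_path) simp_all
  next
    assume "r \<in> lgen (emb i)"
    then obtain b where "b \<in> carrier R" "r = b \<otimes> emb i" by (auto simp: lgen_def)
    moreover have "emb i \<otimes> cok i = \<zero>" unfolding em c by (rule path_annihilator) (simp add: s_def)
    ultimately show "r \<otimes> cok i = \<zero>" by (simp add: m_assoc)
  qed
qed

definition tilt :: "int \<Rightarrow> 'a" where "tilt i = (if inj_label i then E i else cok i)"

lemma tilt_closed [simp, intro]: "tilt i \<in> carrier R"
  by (simp add: tilt_def)

lemma tilt_E [simp]: "E (hull i) \<otimes> tilt i = tilt i" "tilt i \<otimes> E (target i) = tilt i"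
proof -
  show "E (hull i) \<otimes> tilt i = tilt i" using emb_inj_label[of i] by (simp add: tilt_def)
  have "inj_label i \<Longrightarrow> target i = i" by (simp add: target_def)
  then show "tilt i \<otimes> E (target i) = tilt i" by (simp add: tilt_def)
qed

text \<open>The form in which \<open>ideal_iso_invariants\<close> applies: a path ideal with its top
  at \<open>hull i\<close> and known length.\<close>

lemma tilt_path:
  obtains j s where "tilt i = path j s" "s < len j" "(j - int s) mod int n = hull i mod int n"
    "len j - s = (if inj_label i then len i else rise i)"
proof (cases "inj_label i")
  case True
  then show ?thesis using emb_inj_label[OF True] len_pos[of i] by (intro that[of i 0]) (auto simp: tilt_def)
next
  case False
  then have "0 < rise i" "rise i \<le> len (target i)" using rise_zero_iff[of i] rise_le_target by auto
  then show ?thesis using False target_start[OF False]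
    by (intro that[of "target i" "len (target i) - rise i"]) (auto simp: tilt_def cok_def)
qed

lemma tilt_nonzero: "tilt i \<noteq> \<zero>"
proof -
  obtain j s where "tilt i = path j s" "s < len j" using tilt_path[of i] by metis
  then show ?thesis by (simp add: path_zero_iff)
qed

text \<open>Tops give equal hulls, hence equal \<open>len + rise\<close> by \<open>len_hull\<close>;
  the lengths of the summands are also equal. An injective and a non-injective label cannot match,
  as the two equations would force some \<open>len\<close> to be zero. So the rises agree, and
  subtracting them from the hulls recovers the labels.\<close>

lemma tilt_iso_cong:
  assumes iso: "module_iso R (ideal_module R (lgen (tilt i))) (ideal_module R (lgen (tilt k)))"
  shows "i mod int n = k mod int n"
proof -
  obtain j s where j: "tilt i = path j s" "s < len j" "(j - int s) mod int n = hull i mod int n"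
    "len j - s = (if inj_label i then len i else rise i)" using tilt_path[of i] by metis
  obtain l t where l: "tilt k = path l t" "t < len l" "(l - int t) mod int n = hull k mod int n"
    "len l - t = (if inj_label k then len k else rise k)" using tilt_path[of k] by metis
  have iso': "module_iso R (ideal_module R (lgen (path l t))) (ideal_module R (lgen (path j s)))"
    using module_iso_sym[OF iso ideal_module_left_module[OF lgen_left_ideal]] j l by simp
  have inv: "(j - int s) mod int n = (l - int t) mod int n \<and> len l - t \<le> len j - s"
    by (rule ideal_iso_invariants[OF iso[unfolded j(1) l(1)] j(2) l(2)])
  have inv': "len j - s \<le> len l - t" using ideal_iso_invariants[OF iso' l(2) j(2)] by blast
  have hull: "hull i mod int n = hull k mod int n" using inv j(3) l(3) by metis
  have len: "len j - s = len l - t" using inv inv' by simp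
  have lenh: "len i + rise i = len k + rise k" using len_cong[OF hull] by (simp only: len_hull)
  have "rise i = rise k"
    using lenh len[unfolded j(4) l(4)] len_pos[of i] len_pos[of k] rise_zero_iff[of i] rise_zero_iff[of k]
    by (cases "inj_label i"; cases "inj_label k") simp_all
  then show ?thesis
    using mod_diff_cong[OF hull refl[of "int (rise i) mod int n"]] by (simp add: hull_def)
qed

end

lemma zero_hom:
  assumes "left_module R M" "left_module R N"
  shows "(\<lambda>x\<in>carrier M. \<zero>\<^bsub>N\<^esub>) \<in> module_hom R M N"
proof -
  interpret N: left_module R N by fact
  show ?thesis by (rule module_homI[OF _ _ _ assms(1)]) (auto simp: N.smult_zero_right)
qed

lemma module_epiI: "\<lbrakk>f \<in> module_hom R M N; carrier N \<subseteq> f ` carrier M\<rbrakk> \<Longrightarrow> f \<in> module_epi R M N"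
  using module_hom_closed[of f R M N] by (auto simp: module_epi_def)

section \<open>The tilting module and its membership in the subcategory\<close>

context nak_ring_condition
begin

abbreviation tilt_mod :: "'a fmod" where
  "tilt_mod \<equiv> fbox R n (\<lambda>i. lgen (tilt (int i)))"

text \<open>One envelope for each label, with repetitions. The sum of all sequences from
  \<open>R (E i)\<close> through its envelope to the cokernel is the sequence from \<open>R\<close>
  through \<open>hull_mod\<close> to \<open>cok_mod\<close> required of a tilting module.\<close>

abbreviation hull_mod :: "'a fmod" where
  "hull_mod \<equiv> fbox R n (\<lambda>i. lgen (E (hull (int i))))"

abbreviation cok_mod :: "'a fmod" where
  "cok_mod \<equiv> fbox R n (\<lambda>i. lgen (cok (int i)))"

abbreviation projinj_mod :: "'a fmod" where
  "projinj_mod \<equiv> fbox R n (\<lambda>i. lgen (if inj_label (int i) then E (int i) else \<zero>))"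

text \<open>Zero at injective labels, where the summand of \<open>tilt_mod\<close> is already
  projective.\<close>

abbreviation rest_mod :: "'a fmod" where
  "rest_mod \<equiv> fbox R n (\<lambda>i. lgen (if inj_label (int i) then \<zero> else E (int i)))"

lemma box_left_modules:
  "left_module R tilt_mod" "left_module R hull_mod" "left_module R cok_mod"
  "left_module R projinj_mod" "left_module R rest_mod"
  by (rule fbox_left_module, rule lgen_left_ideal, simp)+

lemma tilt_ix: "inj_label z \<Longrightarrow> tilt (int (ix z)) = E z"
  using inj_label_cong[OF ix_cong] E_cong[OF ix_cong] by (simp add: tilt_def)

lemma tilt_in_target: "lgen (tilt i) \<subseteq> lgen (E (target i))"
proof
  fix x assume "x \<in> lgen (tilt i)"
  then obtain r where "r \<in> carrier R" "x = r \<otimes> tilt i" by (auto simp: lgen_def)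
  then show "x \<in> lgen (E (target i))" by (simp add: lgen_E_iff m_assoc)
qed

lemma cok_in_tilt: "lgen (cok i) \<subseteq> lgen (tilt i)"
proof (cases "inj_label i")
  case True
  then show ?thesis
    using left_ideal_zero[OF lgen_left_ideal[OF tilt_closed]] by (simp add: cok_def lgen_zero)
qed (simp add: tilt_def)

lemma lgen_hull_mult: "\<lbrakk>E (hull i) \<otimes> u = u; u \<in> carrier R; x \<in> lgen u\<rbrakk> \<Longrightarrow> \<exists>r \<in> lgen (E (hull i)). x = r \<otimes> u"
proof -
  assume u: "E (hull i) \<otimes> u = u" "u \<in> carrier R" and "x \<in> lgen u"
  then obtain r where "r \<in> carrier R" "x = r \<otimes> u" by (auto simp: lgen_def)
  then show ?thesis using u by (intro bexI[of _ "r \<otimes> E (hull i)"]) (auto simp: lgen_E_iff m_assoc)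
qed

lemma tilt_mod_parts:
  "\<And>i. i < n \<Longrightarrow> module_iso R (sub_module tilt_mod (coord_part n (\<lambda>i. lgen (tilt (int i))) i)) (ideal_module R (lgen (tilt (int i))))"
  by (rule coord_part_iso[OF lgen_left_ideal[OF tilt_closed]])

lemma coord_part_left_module:
  "(\<And>i. i < m \<Longrightarrow> left_ideal (U i) R) \<Longrightarrow> left_module R (sub_module (fbox R m U) (coord_part m U k))"
  by (rule left_module.sub_module_left_module[OF fbox_left_module coord_part_submodule])

lemma lgen_tilt_indecomposable: "indecomposable R (ideal_module R (lgen (tilt i)))"
proof (rule ideal_indecomposable[OF lgen_left_ideal[OF tilt_closed] tilt_in_target])
  show "lgen (tilt i) \<noteq> {\<zero>}" using lgen_self[OF tilt_closed, of i] tilt_nonzero[of i] by blast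
qed

lemma int_mod_eqD: "\<lbrakk>int i mod int n = int k mod int n; i < n; k < n\<rbrakk> \<Longrightarrow> i = k"
  by simp

lemma tilt_mod_basic: "basic_module R tilt_mod"
  unfolding basic_module_def
proof (intro conjI exI[of _ "{..<n}"] exI[of _ "coord_part n (\<lambda>i. lgen (tilt (int i)))"] ballI impI)
  let ?U = "\<lambda>i. lgen (tilt (int i))"
  have U: "\<And>i. i < n \<Longrightarrow> left_ideal (?U i) R" by (intro lgen_left_ideal) simp
  note cl = coord_part_left_module[of n ?U, OF U]
  show "left_module R tilt_mod" by (rule box_left_modules)
  show "direct_decomposition R tilt_mod {..<n} (coord_part n ?U)"
    by (rule fbox_decomposition[OF U]) auto
  show "indecomposable R (sub_module tilt_mod (coord_part n ?U i))" if "i \<in> {..<n}" for i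
    using that module_iso_sym[OF tilt_mod_parts[of i] cl]
    by (intro indecomposable_iso[OF lgen_tilt_indecomposable _ cl]) auto
  fix i k assume i: "i \<in> {..<n}" and k: "k \<in> {..<n}" and ik: "i \<noteq> k"
  show "\<not> module_iso R (sub_module tilt_mod (coord_part n ?U i)) (sub_module tilt_mod (coord_part n ?U k))"
  proof
    assume iso: "module_iso R (sub_module tilt_mod (coord_part n ?U i)) (sub_module tilt_mod (coord_part n ?U k))"
    have 1: "module_iso R (ideal_module R (?U i)) (sub_module tilt_mod (coord_part n ?U i))"
      using i by (intro module_iso_sym[OF tilt_mod_parts cl]) auto
    have 2: "module_iso R (sub_module tilt_mod (coord_part n ?U k)) (ideal_module R (?U k))"
      using k by (intro tilt_mod_parts) auto
    have L: "left_module R (ideal_module R (?U i))" by (rule ideal_module_left_module[OF lgen_left_ideal]) simp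
    have "module_iso R (ideal_module R (?U i)) (ideal_module R (?U k))"
      by (rule module_iso_trans[OF 1 module_iso_trans[OF iso 2 cl] L])
    then have "int i mod int n = int k mod int n" by (rule tilt_iso_cong)
    then show False using int_mod_eqD i k ik by auto
  qed
qed

lemma projinj_mod_sum:
  assumes complete: "\<And>X :: 'a fmod. \<lbrakk>projective R X; indecomposable R X\<rbrakk> \<Longrightarrow> \<exists>i. module_iso R X (proj i)"
  shows "projinj_sum R projinj_mod"
  unfolding projinj_sum_def
proof (intro conjI exI[of _ "{i. i < n \<and> inj_label (int i)}"]
    exI[of _ "coord_part n (\<lambda>i. lgen (if inj_label (int i) then E (int i) else \<zero>))"] ballI impI allI)
  let ?I = "{i. i < n \<and> inj_label (int i)}"
  let ?U = "\<lambda>i. lgen (if inj_label (int i) then E (int i) else \<zero>)"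
  let ?N = "coord_part n ?U"
  have U: "\<And>i. i < n \<Longrightarrow> left_ideal (?U i) R" by (intro lgen_left_ideal) simp
  note cl = coord_part_left_module[of n ?U, OF U]
  have iso: "module_iso R (sub_module projinj_mod (?N i)) (proj (int i))" if "i \<in> ?I" for i
    using coord_part_iso[of n ?U i, OF U] that by simp
  then have osi: "module_iso R (proj (int i)) (sub_module projinj_mod (?N i))" if "i \<in> ?I" for i
    using that by (intro module_iso_sym[OF _ cl]) auto
  show "left_module R projinj_mod" by (rule box_left_modules)
  show "direct_decomposition R projinj_mod ?I ?N"
    by (rule fbox_decomposition[OF U]) (auto simp: lgen_zero)
  fix i assume i: "i \<in> ?I"
  have "indecomposable R (proj (int i))"
    using lgen_tilt_indecomposable[of "int i"] i by (simp add: tilt_def)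
  then show "indecomposable R (sub_module projinj_mod (?N i))" by (rule indecomposable_iso[OF _ osi[OF i] cl])
  show "projective R (sub_module projinj_mod (?N i))"
    by (rule projective_iso[OF ideal_module_projective osi[OF i] cl]) simp_all
  have "injective R (proj (int i))" using i by (simp only: injective_proj_iff) (simp add: inj_label_def)
  then show "injective R (sub_module projinj_mod (?N i))" by (rule injective_iso[OF _ osi[OF i] cl])
  fix k assume k: "k \<in> ?I" and ik: "i \<noteq> k"
  show "\<not> module_iso R (sub_module projinj_mod (?N i)) (sub_module projinj_mod (?N k))"
  proof
    assume h: "module_iso R (sub_module projinj_mod (?N i)) (sub_module projinj_mod (?N k))"
    have "module_iso R (proj (int i)) (proj (int k))"
      by (rule module_iso_trans[OF osi[OF i] module_iso_trans[OF h iso[OF k] cl] proj_left_module])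
    then show False using proj_iso_cong int_mod_eqD i k ik by blast
  qed
next
  let ?I = "{i. i < n \<and> inj_label (int i)}"
  let ?U = "\<lambda>i. lgen (if inj_label (int i) then E (int i) else \<zero>)"
  let ?N = "coord_part n ?U"
  have U: "\<And>i. i < n \<Longrightarrow> left_ideal (?U i) R" by (intro lgen_left_ideal) simp
  note cl = coord_part_left_module[of n ?U, OF U]
  fix X :: "'a fmod" assume X: "indecomposable R X \<and> projective R X \<and> injective R X"
  then have Xl: "left_module R X" by (simp add: indecomposable_def)
  obtain j where j: "module_iso R X (proj j)" using complete X by blast
  have "injective R (proj j)" by (rule injective_iso[OF _ j proj_left_module]) (use X in blast)
  then have "inj_label j" by (simp only: injective_proj_iff inj_label_def)
  then have ij: "inj_label (int (ix j))" using inj_label_cong[OF ix_cong] by blast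
  have "module_iso R (sub_module projinj_mod (?N (ix j))) (proj j)"
    using coord_part_iso[of n ?U "ix j", OF U] ij E_cong[OF ix_cong[of j]] by simp
  then have "module_iso R X (sub_module projinj_mod (?N (ix j)))"
    by (rule module_iso_trans[OF j module_iso_sym[OF _ cl] Xl])
  then show "\<exists>i\<in>?I. module_iso R X (sub_module projinj_mod (?N i))" using ij by (intro bexI[of _ "ix j"]) auto
qed

lemma tilt_mod_fg: "fg_module R tilt_mod"
  by (rule fbox_fg) simp

lemma projinj_nth:
  assumes "Y \<in> carrier (power_module projinj_mod n)" "i < n" "inj_label z"
  shows "the_elem (Y i) (ix z) \<in> lgen (E z)"
proof -
  have "Y i \<in> carrier projinj_mod" using assms by (auto simp: PiE_iff)
  then have "the_elem (Y i) (ix z) \<in> lgen (if inj_label (int (ix z)) then E (int (ix z)) else \<zero>)" by (rule fbox_nth) simp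
  then show ?thesis using assms(3) inj_label_cong[OF ix_cong, of z] E_cong[OF ix_cong, of z] by simp
qed

lemma sg_ix_projinj:
  assumes "inj_label z" "x \<in> lgen (E z)"
  shows "sg n (ix z) x \<in> carrier projinj_mod"
  using assms inj_label_cong[OF ix_cong, of z] E_cong[OF ix_cong, of z]
  by (intro sg_in_fbox lgen_left_ideal) auto

text \<open>The summand at \<open>i\<close> has its top at \<open>hull i\<close>, so the factor at
  \<open>hull i\<close> of the \<open>i\<close>-th copy of \<open>projinj_mod\<close> covers
  it.\<close>

lemma tilt_mod_Gen: "tilt_mod \<in> Gen R projinj_mod"
proof -
  let ?U = "\<lambda>i. lgen (tilt (int i))"
  define F where "F = (\<lambda>Y\<in>carrier (power_module projinj_mod n).
    vec n (\<lambda>i. the_elem (Y i) (ix (hull (int i))) \<otimes> tilt (int i)))"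
  have c: "the_elem (Y i) (ix (hull (int i))) \<in> carrier R" if "Y \<in> carrier (power_module projinj_mod n)" "i < n" for Y i
    using projinj_nth[OF that inj_label_hull, of "int i"] by (simp add: lgen_E_iff)
  have "F \<in> module_hom R (power_module projinj_mod n) tilt_mod" unfolding F_def
  proof (rule module_homI[OF _ _ _ left_module.power_left_module[OF box_left_modules(4)]])
    show "vec n (\<lambda>i. the_elem (Y i) (ix (hull (int i))) \<otimes> tilt (int i)) \<in> carrier tilt_mod"
      if "Y \<in> carrier (power_module projinj_mod n)" for Y
      using c[OF that] by (intro vec_in_fbox) (auto simp: lgen_def)
    show "vec n (\<lambda>i. the_elem ((X \<oplus>\<^bsub>power_module projinj_mod n\<^esub> Y) i) (ix (hull (int i))) \<otimes> tilt (int i)) =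
      vec n (\<lambda>i. the_elem (X i) (ix (hull (int i))) \<otimes> tilt (int i)) \<oplus>\<^bsub>tilt_mod\<^esub>
      vec n (\<lambda>i. the_elem (Y i) (ix (hull (int i))) \<otimes> tilt (int i))"
      if "X \<in> carrier (power_module projinj_mod n)" "Y \<in> carrier (power_module projinj_mod n)" for X Y
      unfolding fbox_simps by (rule vec_cong) (use c[OF that(1)] c[OF that(2)] in \<open>simp add: l_distr\<close>)
    show "vec n (\<lambda>i. the_elem ((a \<odot>\<^bsub>power_module projinj_mod n\<^esub> X) i) (ix (hull (int i))) \<otimes> tilt (int i)) =
      a \<odot>\<^bsub>tilt_mod\<^esub> vec n (\<lambda>i. the_elem (X i) (ix (hull (int i))) \<otimes> tilt (int i))"
      if "a \<in> carrier R" "X \<in> carrier (power_module projinj_mod n)" for a X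
      unfolding fbox_simps by (rule vec_cong) (use that(1) c[OF that(2)] in \<open>simp add: m_assoc\<close>)
  qed
  moreover have "carrier tilt_mod \<subseteq> F ` carrier (power_module projinj_mod n)"
  proof
    fix X assume X: "X \<in> carrier tilt_mod"
    have "\<exists>r \<in> lgen (E (hull (int i))). the_elem X i = r \<otimes> tilt (int i)" if "i < n" for i
      using fbox_nth[OF X that] by (intro lgen_hull_mult) auto
    then obtain r where r: "\<And>i. i < n \<Longrightarrow> r i \<in> lgen (E (hull (int i))) \<and> the_elem X i = r i \<otimes> tilt (int i)" by metis
    let ?Y = "\<lambda>i\<in>{..<n}. sg n (ix (hull (int i))) (r i)"
    have Y: "?Y \<in> carrier (power_module projinj_mod n)" using r sg_ix_projinj[OF inj_label_hull] by auto
    have "F ?Y \<in> carrier tilt_mod" using calculation Y by (rule module_hom_closed)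
    then have "X = F ?Y"
    proof (rule fbox_ext[OF X])
      fix i assume "i < n"
      then show "the_elem X i = the_elem (F ?Y) i" using Y r by (simp add: F_def del: power_module_simps)
    qed
    then show "X \<in> F ` carrier (power_module projinj_mod n)" using Y by blast
  qed
  ultimately have "F \<in> module_epi R (power_module projinj_mod n) tilt_mod"
    by (rule module_epiI)
  then show ?thesis using tilt_mod_fg by (auto simp: Gen_def)
qed

text \<open>The summand at \<open>i\<close> lies in the projective at \<open>target i\<close>; using
  the \<open>i\<close>-th copy of \<open>projinj_mod\<close> for it keeps summands with the same
  target apart.\<close>

lemma tilt_mod_Cogen: "tilt_mod \<in> Cogen R projinj_mod"
proof -
  let ?Q = "power_module projinj_mod n"
  define F where "F = (\<lambda>X\<in>carrier tilt_mod. \<lambda>i\<in>{..<n}. sg n (ix (target (int i))) (the_elem X i))"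
  note U = lgen_left_ideal[OF tilt_closed]
  have c: "the_elem X i \<in> carrier R" if "X \<in> carrier tilt_mod" "i < n" for X i
    using left_ideal_in[OF U fbox_nth[OF that]] .
  have t: "the_elem X i \<in> lgen (E (target (int i)))" if "X \<in> carrier tilt_mod" "i < n" for X i
    using fbox_nth[OF that] tilt_in_target by blast
  have hom: "F \<in> module_hom R tilt_mod ?Q" unfolding F_def
  proof (rule module_homI[OF _ _ _ box_left_modules(1)])
    show "(\<lambda>i\<in>{..<n}. sg n (ix (target (int i))) (the_elem X i)) \<in> carrier ?Q" if "X \<in> carrier tilt_mod" for X
      using sg_ix_projinj[OF target(1) t[OF that]] by auto
    show "(\<lambda>i\<in>{..<n}. sg n (ix (target (int i))) (the_elem (X \<oplus>\<^bsub>tilt_mod\<^esub> Y) i)) =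
        (\<lambda>i\<in>{..<n}. sg n (ix (target (int i))) (the_elem X i)) \<oplus>\<^bsub>?Q\<^esub>
        (\<lambda>i\<in>{..<n}. sg n (ix (target (int i))) (the_elem Y i))"
      if "X \<in> carrier tilt_mod" "Y \<in> carrier tilt_mod" for X Y
      unfolding power_module_simps
      by (rule restrict_ext) (use c[OF that(1)] c[OF that(2)] in \<open>simp add: sg_add[symmetric]\<close>)
    show "(\<lambda>i\<in>{..<n}. sg n (ix (target (int i))) (the_elem (a \<odot>\<^bsub>tilt_mod\<^esub> X) i)) =
        a \<odot>\<^bsub>?Q\<^esub> (\<lambda>i\<in>{..<n}. sg n (ix (target (int i))) (the_elem X i))"
      if "a \<in> carrier R" "X \<in> carrier tilt_mod" for a X
      unfolding power_module_simps
      by (rule restrict_ext) (use that(1) c[OF that(2)] in \<open>simp add: smult_sg\<close>)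
  qed
  have "inj_on F (carrier tilt_mod)"
  proof (rule inj_onI)
    fix X Y assume X: "X \<in> carrier tilt_mod" and Y: "Y \<in> carrier tilt_mod" and eq: "F X = F Y"
    show "X = Y"
    proof (rule fbox_ext[OF X Y])
      fix i assume i: "i < n"
      have "sg n (ix (target (int i))) (the_elem X i) = sg n (ix (target (int i))) (the_elem Y i)"
        using fun_cong[OF eq, of i] X Y i by (simp add: F_def)
      then have "the_elem (sg n (ix (target (int i))) (the_elem X i)) (ix (target (int i))) =
          the_elem (sg n (ix (target (int i))) (the_elem Y i)) (ix (target (int i)))" by (rule arg_cong)
      then show "the_elem X i = the_elem Y i" by simp
    qed
  qed
  then show ?thesis using hom tilt_mod_fg by (auto simp: Cogen_def module_mono_def simp del: power_module_simps)
qed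

text \<open>The projective resolution \<open>0 \<rightarrow> \<Oplus> P\<^sub>i \<rightarrow> \<Oplus> P\<^bsub>hull i\<^esub> \<rightarrow> T \<rightarrow> 0\<close> with \<open>i\<close> ranging over the
  non-injective labels on the left.\<close>

definition res :: "nat \<Rightarrow> 'a fmod" where
  "res k = (if k = 0 then hull_mod else if k = 1 then rest_mod else fbox R n (\<lambda>_. lgen \<zero>))"

definition res_emb :: "(nat \<Rightarrow> 'a) set \<Rightarrow> (nat \<Rightarrow> 'a) set" where
  "res_emb = (\<lambda>X\<in>carrier rest_mod. vec n (\<lambda>i. the_elem X i \<otimes> emb (int i)))"

definition res_d :: "nat \<Rightarrow> (nat \<Rightarrow> 'a) set \<Rightarrow> (nat \<Rightarrow> 'a) set" where
  "res_d k = (if k = 0 then res_emb else (\<lambda>X\<in>carrier (res (Suc k)). \<zero>\<^bsub>res k\<^esub>))"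

definition res_eps :: "(nat \<Rightarrow> 'a) set \<Rightarrow> (nat \<Rightarrow> 'a) set" where
  "res_eps = (\<lambda>X\<in>carrier hull_mod. vec n (\<lambda>i. the_elem X i \<otimes> tilt (int i)))"

lemma rest_nth: "\<lbrakk>X \<in> carrier rest_mod; i < n\<rbrakk> \<Longrightarrow> the_elem X i \<in> lgen (E (int i)) \<and> (inj_label (int i) \<longrightarrow> the_elem X i = \<zero>)"
  using fbox_nth[of X R n "\<lambda>i. lgen (if inj_label (int i) then \<zero> else E (int i))" i]
  by (cases "inj_label (int i)") (auto simp: lgen_zero lgen_E_iff)

lemma emb_image: "r \<in> lgen (E i) \<Longrightarrow> r \<otimes> emb i \<in> lgen (E (hull i))"
  by (simp add: lgen_E_iff m_assoc)

lemma res_emb_hom: "res_emb \<in> module_hom R rest_mod hull_mod"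
proof -
  have "x \<otimes> emb (int i) \<in> lgen (E (hull (int i)))"
    if "x \<in> lgen (if inj_label (int i) then \<zero> else E (int i))" for x i
  proof (rule emb_image)
    show "x \<in> lgen (E (int i))" using that left_ideal_zero[OF lgen_left_ideal[OF E_closed]]
      by (cases "inj_label (int i)") (auto simp: lgen_zero)
  qed
  then show ?thesis unfolding res_emb_def by (intro diag_hom lgen_left_ideal) auto
qed

lemma res_emb_inj: "inj_on res_emb (carrier rest_mod)"
proof (rule inj_on_module_hom[OF res_emb_hom box_left_modules(5,2)])
  fix X assume X: "X \<in> carrier rest_mod" and eq: "res_emb X = \<zero>\<^bsub>hull_mod\<^esub>"
  show "X = \<zero>\<^bsub>rest_mod\<^esub>"
  proof (rule fbox_ext[OF X])
    show "\<zero>\<^bsub>rest_mod\<^esub> \<in> carrier rest_mod" using submodule_zero[OF left_module.carrier_submodule[OF box_left_modules(5)]] .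
    fix i assume i: "i < n"
    have "the_elem (res_emb X) i = \<zero>" unfolding eq using i by simp
    then have "the_elem X i \<otimes> emb (int i) = \<zero>" using X i by (simp add: res_emb_def)
    then have "the_elem X i = \<zero>" using rest_nth[OF X i] emb_cancel by blast
    then show "the_elem X i = the_elem \<zero>\<^bsub>rest_mod\<^esub> i" using i by simp
  qed
qed

lemma res_eps_hom: "res_eps \<in> module_hom R hull_mod tilt_mod"
proof -
  have "x \<otimes> tilt i \<in> lgen (tilt i)" if "x \<in> lgen (E (hull i))" for x i
    using that by (auto simp: lgen_E_iff lgen_def[of "tilt i"])
  then show ?thesis unfolding res_eps_def by (intro diag_hom lgen_left_ideal) auto
qed

text \<open>Stated for a family \<open>w\<close> in order to serve both \<open>tilt\<close> and
  \<open>cok\<close>.\<close>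

lemma hull_cok_surj:
  assumes w: "\<And>i. E (hull i) \<otimes> w i = w i" "\<And>i. w i \<in> carrier R"
    and Y: "Y \<in> carrier (fbox R n (\<lambda>i. lgen (w (int i))))"
  shows "\<exists>X \<in> carrier hull_mod. Y = vec n (\<lambda>i. the_elem X i \<otimes> w (int i))"
proof -
  have "\<exists>r \<in> lgen (E (hull (int i))). the_elem Y i = r \<otimes> w (int i)" if "i < n" for i
    using fbox_nth[OF Y that] by (intro lgen_hull_mult w)
  then obtain r where r: "\<And>i. i < n \<Longrightarrow> r i \<in> lgen (E (hull (int i))) \<and> the_elem Y i = r i \<otimes> w (int i)" by metis
  show ?thesis
  proof (rule bexI[of _ "vec n r"])
    have "vec n (\<lambda>i. the_elem (vec n r) i \<otimes> w (int i)) = vec n (the_elem Y)" by (rule vec_cong) (simp add: r)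
    then show "Y = vec n (\<lambda>i. the_elem (vec n r) i \<otimes> w (int i))" using Y by (simp add: fbox_carrier_iff)
    show "vec n r \<in> carrier hull_mod" using r by (intro vec_in_fbox) auto
  qed
qed

lemma res_eps_epi: "res_eps \<in> module_epi R hull_mod tilt_mod"
proof -
  have "carrier tilt_mod \<subseteq> res_eps ` carrier hull_mod"
  proof
    fix Y assume "Y \<in> carrier tilt_mod"
    then obtain X where "X \<in> carrier hull_mod" "Y = vec n (\<lambda>i. the_elem X i \<otimes> tilt (int i))"
      using hull_cok_surj[of tilt Y] by auto
    then show "Y \<in> res_eps ` carrier hull_mod" by (intro image_eqI[of _ _ X]) (simp_all add: res_eps_def)
  qed
  then show ?thesis by (rule module_epiI[OF res_eps_hom])
qed

lemma res_exact_0: "res_emb ` carrier rest_mod = a_kernel hull_mod tilt_mod res_eps"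
proof
  show "res_emb ` carrier rest_mod \<subseteq> a_kernel hull_mod tilt_mod res_eps"
  proof
    fix Y assume "Y \<in> res_emb ` carrier rest_mod"
    then obtain X where X: "X \<in> carrier rest_mod" "Y = res_emb X" by blast
    have Y: "Y \<in> carrier hull_mod" using module_hom_closed[OF res_emb_hom X(1)] X(2) by simp
    have "the_elem X i \<otimes> emb (int i) \<otimes> tilt (int i) = \<zero>" if "i < n" for i
    proof (cases "inj_label (int i)")
      case True
      then show ?thesis using rest_nth[OF X(1) that] by simp
    next
      case False
      have x: "the_elem X i \<in> carrier R" "the_elem X i \<in> lgen (E (int i))"
        using rest_nth[OF X(1) that] by (auto simp: lgen_E_iff)
      have "the_elem X i \<otimes> emb (int i) \<in> lgen (emb (int i))" using x by (auto simp: lgen_def)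
      then show ?thesis using cok_kernel[OF emb_image[OF x(2)]] False by (simp add: tilt_def)
    qed
    then have "res_eps Y = \<zero>\<^bsub>tilt_mod\<^esub>" using X Y by (simp add: res_eps_def res_emb_def fbox_simps(1) vec_eq_iff)
    then show "Y \<in> a_kernel hull_mod tilt_mod res_eps" using Y by (simp add: a_kernel_def')
  qed
  show "a_kernel hull_mod tilt_mod res_eps \<subseteq> res_emb ` carrier rest_mod"
  proof
    fix Y assume "Y \<in> a_kernel hull_mod tilt_mod res_eps"
    then have Y: "Y \<in> carrier hull_mod" "res_eps Y = \<zero>\<^bsub>tilt_mod\<^esub>" unfolding a_kernel_def' by blast+
    have y0: "the_elem Y i \<otimes> tilt (int i) = \<zero>" if "i < n" for i
      using Y that by (simp add: res_eps_def fbox_simps(1) vec_eq_iff)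
    have "\<exists>r \<in> lgen (if inj_label (int i) then \<zero> else E (int i)). the_elem Y i = r \<otimes> emb (int i)" if i: "i < n" for i
    proof (cases "inj_label (int i)")
      case True
      \<comment> \<open>At an injective label \<open>hull i = i\<close> and
        \<open>tilt i = E i\<close>, so the map is the identity in this coordinate.\<close>
      have "the_elem Y i \<in> lgen (E (int i))" using fbox_nth[OF Y(1) i] emb_inj_label[OF True] by simp
      then have "the_elem Y i = \<zero>" using y0[OF i] True by (simp add: tilt_def lgen_E_iff)
      then show ?thesis using True by (simp add: lgen_zero)
    next
      case False
      then have "the_elem Y i \<in> lgen (emb (int i))"
        using cok_kernel[OF fbox_nth[OF Y(1) i]] y0[OF i] by (simp add: tilt_def)
      then obtain r where "r \<in> carrier R" "the_elem Y i = r \<otimes> emb (int i)" by (auto simp: lgen_def)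
      then show ?thesis using False
        by (intro bexI[of _ "r \<otimes> E (int i)"]) (auto simp: lgen_E_iff m_assoc)
    qed
    then obtain r where r: "\<And>i. i < n \<Longrightarrow> r i \<in> lgen (if inj_label (int i) then \<zero> else E (int i)) \<and>
        the_elem Y i = r i \<otimes> emb (int i)" by metis
    have X: "vec n r \<in> carrier rest_mod" using r by (intro vec_in_fbox) auto
    have "vec n (\<lambda>i. the_elem (vec n r) i \<otimes> emb (int i)) = vec n (the_elem Y)" by (rule vec_cong) (simp add: r)
    then have "Y = res_emb (vec n r)" using X Y(1) by (simp add: res_emb_def fbox_carrier_iff)
    then show "Y \<in> res_emb ` carrier rest_mod" using X by blast
  qed
qed

lemma res_projective: "projective R (res k)"
proof -
  have "projective R hull_mod" "projective R rest_mod" "projective R (fbox R n (\<lambda>_. lgen \<zero>) :: 'a fmod)"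
    by (rule fbox_projective, simp)+
  then show ?thesis by (simp add: res_def)
qed

lemma res_left_module: "left_module R (res k)"
  using res_projective by (auto simp: projective_def fg_module_def)

lemma res_zero: "2 \<le> k \<Longrightarrow> carrier (res k) = {\<zero>\<^bsub>res k\<^esub>}"
  unfolding res_def using fbox_zero_carrier[of n "\<lambda>_. lgen \<zero>"] by (simp add: lgen_zero)

lemma tilt_resolution: "projective_resolution R tilt_mod res res_d res_eps"
  unfolding projective_resolution_def
proof (intro conjI allI)
  show "projective R (res k)" for k by (rule res_projective)
  show "res_d k \<in> module_hom R (res (Suc k)) (res k)" for k
    using res_emb_hom zero_hom[OF res_left_module[of "Suc k"] res_left_module[of k]]
    by (cases "k = 0") (auto simp: res_d_def res_def)
  show "res_eps \<in> module_epi R (res 0) tilt_mod" using res_eps_epi by (simp add: res_def)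
  show "res_d 0 ` carrier (res 1) = a_kernel (res 0) tilt_mod res_eps"
    using res_exact_0 by (simp add: res_d_def res_def)
  fix k
  have z: "\<zero>\<^bsub>res k\<^esub> \<in> carrier (res k)" for k using submodule_zero[OF left_module.carrier_submodule[OF res_left_module]] .
  have im: "res_d (Suc k) ` carrier (res (Suc (Suc k))) = {\<zero>\<^bsub>res (Suc k)\<^esub>}"
    using res_zero[of "Suc (Suc k)"] by (simp add: res_d_def)
  have "a_kernel (res (Suc k)) (res k) (res_d k) = {\<zero>\<^bsub>res (Suc k)\<^esub>}"
  proof (cases "k = 0")
    case True
    note e0 = module_hom_zero[OF res_emb_hom box_left_modules(5,2)]
    have z1: "\<zero>\<^bsub>rest_mod\<^esub> \<in> carrier rest_mod" using z[of 1] by (simp add: res_def)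
    have "a_kernel rest_mod hull_mod res_emb = {\<zero>\<^bsub>rest_mod\<^esub>}"
    proof (intro equalityI subsetI)
      fix X assume "X \<in> a_kernel rest_mod hull_mod res_emb"
      then have "X \<in> carrier rest_mod" "res_emb X = \<zero>\<^bsub>hull_mod\<^esub>" by (simp_all add: a_kernel_def')
      then show "X \<in> {\<zero>\<^bsub>rest_mod\<^esub>}" using inj_onD[OF res_emb_inj _ _ z1] e0 by simp
    qed (use e0 z1 in \<open>simp add: a_kernel_def'\<close>)
    then show ?thesis using True by (simp add: res_d_def res_def)
  next
    case False
    then show ?thesis using res_zero[of "Suc k"] by (auto simp: a_kernel_def' res_d_def)
  qed
  then show "res_d (Suc k) ` carrier (res (Suc (Suc k))) = a_kernel (res (Suc k)) (res k) (res_d k)"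
    using im by simp
qed

text \<open>Coordinatewise, the coefficient in front of \<open>tilt\<close> lies between
  \<open>i\<close> and an injective label, where \<open>factor_through_emb\<close> applies. In other
  words, homomorphisms from \<open>R (E i)\<close> to the tilting module extend to the
  envelope.\<close>

lemma tilt_factor_emb:
  assumes X: "X \<in> carrier tilt_mod" "E i \<odot>\<^bsub>tilt_mod\<^esub> X = X"
  shows "\<exists>Y \<in> carrier tilt_mod. X = emb i \<odot>\<^bsub>tilt_mod\<^esub> Y"
proof -
  have "\<exists>y \<in> lgen (tilt (int k)). the_elem X k = emb i \<otimes> y" if k: "k < n" for k
  proof -
    obtain r where r: "r \<in> carrier R" "the_elem X k = r \<otimes> tilt (int k)" using fbox_nth[OF X(1) k] by (auto simp: lgen_def)
    define v where "v = E i \<otimes> r \<otimes> E (hull (int k))"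
    have v: "v \<in> carrier R" "E i \<otimes> v = v" "v \<otimes> E (hull (int k)) = v" using r by (auto simp: v_def m_assoc)
    have "the_elem X k = E i \<otimes> the_elem X k" using arg_cong[OF X(2), of "\<lambda>Z. the_elem Z k"] k by simp
    also have "\<dots> = v \<otimes> tilt (int k)" using r by (simp add: v_def m_assoc)
    finally have e: "the_elem X k = v \<otimes> tilt (int k)" .
    obtain z where "z \<in> carrier R" "v = emb i \<otimes> z" using factor_through_emb[OF inj_label_hull v] by blast
    then show ?thesis using e by (intro bexI[of _ "z \<otimes> tilt (int k)"]) (auto simp: m_assoc lgen_def)
  qed
  then obtain y where y: "\<And>k. k < n \<Longrightarrow> y k \<in> lgen (tilt (int k)) \<and> the_elem X k = emb i \<otimes> y k" by metis
  have Y: "vec n y \<in> carrier tilt_mod" using y by (intro vec_in_fbox) auto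
  have "X = emb i \<odot>\<^bsub>tilt_mod\<^esub> vec n y"
    by (rule fbox_ext[OF X(1) left_module.smult_closed[OF box_left_modules(1) emb_closed Y]]) (simp add: y)
  then show ?thesis using Y by blast
qed

text \<open>Every homomorphism out of \<open>rest_mod\<close> is a cocycle, and by
  \<open>tilt_factor_emb\<close> each one extends along \<open>res_emb\<close>, that is, it is a
  coboundary.\<close>

lemma tilt_ext_vanishes: "Ext_vanishes R 1 tilt_mod tilt_mod"
  unfolding Ext_vanishes_def
proof (intro exI conjI)
  show "projective_resolution R tilt_mod res res_d res_eps" by (rule tilt_resolution)
  note T = box_left_modules(1)
  interpret T: left_module R tilt_mod by (rule T)
  have r0: "res 0 = hull_mod" and r1: "res (Suc 0) = rest_mod" and d0: "res_d 0 = res_emb" by (simp_all add: res_def res_d_def)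
  have U: "\<And>i. i < n \<Longrightarrow> left_ideal (lgen (if inj_label (int i) then \<zero> else E (int i))) R" by (intro lgen_left_ideal) simp
  have H: "\<And>i. i < n \<Longrightarrow> left_ideal (lgen (E (hull (int i)))) R" by (intro lgen_left_ideal) simp
  have cob: "f \<in> (\<lambda>g. compose (carrier rest_mod) g res_emb) ` module_hom R hull_mod tilt_mod"
    if f: "f \<in> module_hom R rest_mod tilt_mod" for f
  proof -
    \<comment> \<open>At injective labels the factor of \<open>rest_mod\<close> is zero and any
      value will do.\<close>
    have "\<exists>Y \<in> carrier tilt_mod. \<not> inj_label (int i) \<longrightarrow> f (sg n i (E (int i))) = emb (int i) \<odot>\<^bsub>tilt_mod\<^esub> Y" if i: "i < n" for i
    proof (cases "inj_label (int i)")
      case False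
      have s: "sg n i (E (int i)) \<in> carrier rest_mod" using False by (intro sg_in_fbox U) (auto intro: lgen_self)
      have "E (int i) \<odot>\<^bsub>tilt_mod\<^esub> f (sg n i (E (int i))) = f (sg n i (E (int i)))"
        using module_hom_smult[OF f E_closed s, of "int i"] by (simp add: smult_sg)
      then show ?thesis using tilt_factor_emb[OF module_hom_closed[OF f s]] by blast
    qed (use T.M.zero_closed in blast)
    then obtain y where y: "\<And>i. i < n \<Longrightarrow> y i \<in> carrier tilt_mod \<and>
        (\<not> inj_label (int i) \<longrightarrow> f (sg n i (E (int i))) = emb (int i) \<odot>\<^bsub>tilt_mod\<^esub> y i)" by metis
    define h where "h \<equiv> (\<lambda>Z\<in>carrier hull_mod. \<Oplus>\<^bsub>tilt_mod\<^esub>i\<in>{..<n}. the_elem Z i \<odot>\<^bsub>tilt_mod\<^esub> y i)"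
    have h: "h \<in> module_hom R hull_mod tilt_mod"
      "\<And>i a. \<lbrakk>i < n; a \<in> lgen (E (hull (int i)))\<rbrakk> \<Longrightarrow> h (sg n i a) = a \<odot>\<^bsub>tilt_mod\<^esub> y i"
      unfolding h_def using fbox_hom[OF H T, of n _ y] y by auto
    have "f = compose (carrier rest_mod) h res_emb"
    proof (rule fbox_hom_eqI[OF U T f module_hom_compose[OF res_emb_hom h(1) box_left_modules(5)]])
      fix i a assume i: "i < n" and a: "a \<in> lgen (if inj_label (int i) then \<zero> else E (int i))"
      have s: "sg n i a \<in> carrier rest_mod" using a by (intro sg_in_fbox U) auto
      have aE: "a \<in> lgen (E (int i))" using rest_nth[OF s i] i by simp
      then have ac: "a \<in> carrier R" "a \<otimes> E (int i) = a" by (simp_all add: lgen_E_iff)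
      have "res_emb (sg n i a) = sg n i (a \<otimes> emb (int i))"
        using s unfolding res_emb_def sg_def by (auto intro!: vec_cong)
      then have e: "compose (carrier rest_mod) h res_emb (sg n i a) = (a \<otimes> emb (int i)) \<odot>\<^bsub>tilt_mod\<^esub> y i"
        using s h(2)[OF i emb_image[OF aE]] by (simp add: compose_def)
      show "f (sg n i a) = compose (carrier rest_mod) h res_emb (sg n i a)"
      proof (cases "inj_label (int i)")
        case True
        then have "a = \<zero>" using a by (simp add: lgen_zero)
        moreover have "sg n i \<zero> = \<zero>\<^bsub>rest_mod\<^esub>" by (simp add: sg_def fbox_simps(1))
        ultimately show ?thesis unfolding e using module_hom_zero[OF f box_left_modules(5) T] y[OF i]
          by (simp add: T.smult_zero_left)
      next
        case False
        have sE: "sg n i (E (int i)) \<in> carrier rest_mod" using False by (intro sg_in_fbox U) (auto intro: lgen_self)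
        have "f (sg n i a) = a \<odot>\<^bsub>tilt_mod\<^esub> f (sg n i (E (int i)))"
          using module_hom_smult[OF f ac(1) sE] ac by (simp add: smult_sg)
        then show ?thesis unfolding e using y[OF i] False ac(1) by (simp add: T.smult_assoc)
      qed
    qed
    then show ?thesis using h(1) by blast
  qed
  \<comment> \<open>\<open>res_d 1\<close> is the zero map.\<close>
  have coc: "compose (carrier (res 2)) f (res_d 1) = (\<lambda>x\<in>carrier (res 2). \<zero>\<^bsub>tilt_mod\<^esub>)"
    if f: "f \<in> module_hom R rest_mod tilt_mod" for f
    unfolding compose_def
    by (rule restrict_ext) (use module_hom_zero[OF f box_left_modules(5) T] in \<open>simp add: res_d_def r1 numeral_2_eq_2\<close>)
  show "Ext_cocycles R res res_d tilt_mod 1 = Ext_coboundaries R res res_d tilt_mod 1"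
  proof
    show "Ext_cocycles R res res_d tilt_mod 1 \<subseteq> Ext_coboundaries R res res_d tilt_mod 1"
      using cob by (auto simp: Ext_cocycles_def Ext_coboundaries_def r0 r1 d0)
    show "Ext_coboundaries R res res_d tilt_mod 1 \<subseteq> Ext_cocycles R res res_d tilt_mod 1"
    proof
      fix f assume "f \<in> Ext_coboundaries R res res_d tilt_mod 1"
      then obtain g where "g \<in> module_hom R hull_mod tilt_mod" "f = compose (carrier rest_mod) g res_emb"
        by (auto simp: Ext_coboundaries_def r0 r1 d0)
      then have f: "f \<in> module_hom R rest_mod tilt_mod" using module_hom_compose[OF res_emb_hom _ box_left_modules(5)] by blast
      then show "f \<in> Ext_cocycles R res res_d tilt_mod 1"
        using coc[OF f] by (simp add: Ext_cocycles_def r1 numeral_2_eq_2)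
    qed
  qed
qed

lemma tilt_projdim: "projdim_le R tilt_mod 1"
  unfolding projdim_le_def using tilt_resolution res_zero by (metis Suc_1 Suc_leI)

text \<open>\<open>hull i\<close> is an injective label, so \<open>R (E (hull i))\<close> is itself
  a factor of \<open>tilt_mod\<close>. One copy of \<open>tilt_mod\<close> for each \<open>i\<close>
  takes care of repetitions.\<close>

lemma hull_mod_add: "hull_mod \<in> add_category R tilt_mod"
proof (rule add_categoryI[OF box_left_modules(1,2)])
  let ?P = "power_module tilt_mod n"
  note U = lgen_left_ideal[OF tilt_closed] and H = lgen_left_ideal[OF E_closed]
  have P: "left_module R ?P" by (rule left_module.power_left_module[OF box_left_modules(1)])
  have sgt: "sg n (ix (hull i)) x \<in> carrier tilt_mod" if "x \<in> lgen (E (hull i))" for x i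
    using that tilt_ix[OF inj_label_hull, of i] by (intro sg_in_fbox U) auto
  have c: "the_elem X i \<in> carrier R" if "X \<in> carrier hull_mod" "i < n" for X i
    using left_ideal_in[OF H fbox_nth[OF that]] .
  have Yn: "the_elem (Y i) (ix (hull (int i))) \<in> lgen (E (hull (int i)))" if "Y \<in> carrier ?P" "i < n" for Y i
  proof -
    have "Y i \<in> carrier tilt_mod" using that by (auto simp: PiE_iff)
    then have "the_elem (Y i) (ix (hull (int i))) \<in> lgen (tilt (int (ix (hull (int i)))))" by (rule fbox_nth) simp
    then show ?thesis using tilt_ix[OF inj_label_hull, of "int i"] by simp
  qed
  then have Yc: "the_elem (Y i) (ix (hull (int i))) \<in> carrier R" if "Y \<in> carrier ?P" "i < n" for Y i
    using left_ideal_in[OF H] that by blast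
  show "(\<lambda>X\<in>carrier hull_mod. \<lambda>i\<in>{..<n}. sg n (ix (hull (int i))) (the_elem X i)) \<in> module_hom R hull_mod ?P"
  proof (rule module_homI[OF _ _ _ box_left_modules(2)])
    show "(\<lambda>i\<in>{..<n}. sg n (ix (hull (int i))) (the_elem X i)) \<in> carrier ?P" if "X \<in> carrier hull_mod" for X
      using sgt[OF fbox_nth[OF that]] by auto
    show "(\<lambda>i\<in>{..<n}. sg n (ix (hull (int i))) (the_elem (X \<oplus>\<^bsub>hull_mod\<^esub> Y) i)) =
        (\<lambda>i\<in>{..<n}. sg n (ix (hull (int i))) (the_elem X i)) \<oplus>\<^bsub>?P\<^esub> (\<lambda>i\<in>{..<n}. sg n (ix (hull (int i))) (the_elem Y i))"
      if "X \<in> carrier hull_mod" "Y \<in> carrier hull_mod" for X Y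
      unfolding power_module_simps
      by (rule restrict_ext) (use c[OF that(1)] c[OF that(2)] in \<open>simp add: sg_add[symmetric]\<close>)
    show "(\<lambda>i\<in>{..<n}. sg n (ix (hull (int i))) (the_elem (a \<odot>\<^bsub>hull_mod\<^esub> X) i)) =
        a \<odot>\<^bsub>?P\<^esub> (\<lambda>i\<in>{..<n}. sg n (ix (hull (int i))) (the_elem X i))"
      if "a \<in> carrier R" "X \<in> carrier hull_mod" for a X
      unfolding power_module_simps
      by (rule restrict_ext) (use that(1) c[OF that(2)] in \<open>simp add: smult_sg\<close>)
  qed
  show "(\<lambda>Y\<in>carrier ?P. vec n (\<lambda>i. the_elem (Y i) (ix (hull (int i))))) \<in> module_hom R ?P hull_mod"
  proof (rule module_homI[OF _ _ _ P])
    show "vec n (\<lambda>i. the_elem (Y i) (ix (hull (int i)))) \<in> carrier hull_mod" if "Y \<in> carrier ?P" for Y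
      using Yn[OF that] by (intro vec_in_fbox) auto
    show "vec n (\<lambda>i. the_elem ((X \<oplus>\<^bsub>?P\<^esub> Y) i) (ix (hull (int i)))) =
        vec n (\<lambda>i. the_elem (X i) (ix (hull (int i)))) \<oplus>\<^bsub>hull_mod\<^esub> vec n (\<lambda>i. the_elem (Y i) (ix (hull (int i))))" for X Y
      unfolding fbox_simps by (rule vec_cong) simp
    show "vec n (\<lambda>i. the_elem ((a \<odot>\<^bsub>?P\<^esub> X) i) (ix (hull (int i)))) =
        a \<odot>\<^bsub>hull_mod\<^esub> vec n (\<lambda>i. the_elem (X i) (ix (hull (int i))))" for a X
      unfolding fbox_simps by (rule vec_cong) simp
  qed
  fix X assume X: "X \<in> carrier hull_mod"
  have Y: "(\<lambda>i\<in>{..<n}. sg n (ix (hull (int i))) (the_elem X i)) \<in> carrier ?P" using sgt[OF fbox_nth[OF X]] by auto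
  have "vec n (\<lambda>i. the_elem ((\<lambda>i\<in>{..<n}. sg n (ix (hull (int i))) (the_elem X i)) i) (ix (hull (int i)))) = vec n (the_elem X)"
    by (rule vec_cong) simp
  then show "(\<lambda>Y\<in>carrier ?P. vec n (\<lambda>i. the_elem (Y i) (ix (hull (int i)))))
    ((\<lambda>X\<in>carrier hull_mod. \<lambda>i\<in>{..<n}. sg n (ix (hull (int i))) (the_elem X i)) X) = X"
    using X Y by (simp add: fbox_carrier_iff[of X] del: power_module_simps)
qed

text \<open>A single copy suffices: \<open>cok_mod\<close> is \<open>tilt_mod\<close> with the
  coordinates at injective labels removed.\<close>

lemma cok_mod_add: "cok_mod \<in> add_category R tilt_mod"
proof (rule add_categoryI[OF box_left_modules(1,3)])
  let ?P = "power_module tilt_mod 1"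
  let ?p = "\<lambda>X. vec n (\<lambda>i. if inj_label (int i) then \<zero> else the_elem X i)"
  have P: "left_module R ?P" by (rule left_module.power_left_module[OF box_left_modules(1)])
  have sub: "X \<in> carrier tilt_mod" if X: "X \<in> carrier cok_mod" for X
    using X cok_in_tilt by (auto simp: fbox_carrier_iff[of X])
  show "(\<lambda>X\<in>carrier cok_mod. \<lambda>i\<in>{..<1}. X) \<in> module_hom R cok_mod ?P"
    by (rule module_homI[OF _ _ _ box_left_modules(3)])
      (auto simp: sub fbox_simps(2,3) intro!: restrict_ext)
  have pc: "?p X \<in> carrier cok_mod" if X: "X \<in> carrier tilt_mod" for X
  proof (rule vec_in_fbox)
    fix i assume "i < n"
    then show "(if inj_label (int i) then \<zero> else the_elem X i) \<in> lgen (cok (int i))"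
      using fbox_nth[OF X, of i] by (auto simp: cok_def tilt_def lgen_zero)
  qed
  show "(\<lambda>Y\<in>carrier ?P. ?p (Y 0)) \<in> module_hom R ?P cok_mod"
  proof (rule module_homI[OF _ _ _ P])
    show "?p (Y 0) \<in> carrier cok_mod" if "Y \<in> carrier ?P" for Y using that by (intro pc) (auto simp: PiE_iff)
    show "?p ((X \<oplus>\<^bsub>?P\<^esub> Y) 0) = ?p (X 0) \<oplus>\<^bsub>cok_mod\<^esub> ?p (Y 0)" for X Y
      unfolding fbox_simps by (rule vec_cong) simp
    show "?p ((a \<odot>\<^bsub>?P\<^esub> X) 0) = a \<odot>\<^bsub>cok_mod\<^esub> ?p (X 0)" if "a \<in> carrier R" for a X
      unfolding fbox_simps by (rule vec_cong) (use that in simp)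
  qed
  fix X assume X: "X \<in> carrier cok_mod"
  have Y: "(\<lambda>i\<in>{..<1}. X) \<in> carrier ?P" using sub[OF X] by auto
  have "the_elem X i = \<zero>" if "i < n" "inj_label (int i)" for i
    using fbox_nth[OF X that(1)] that(2) by (simp add: cok_def lgen_zero)
  then have "?p X = vec n (the_elem X)" by (intro vec_cong) simp
  also have "\<dots> = X" using X by (simp add: fbox_carrier_iff[of X])
  finally have "?p X = X" .
  moreover have "(\<lambda>i\<in>{..<1::nat}. X) 0 = X" by (rule restrict_apply') simp
  ultimately show "(\<lambda>Y\<in>carrier ?P. ?p (Y 0)) ((\<lambda>X\<in>carrier cok_mod. \<lambda>i\<in>{..<1}. X) X) = X"
    using X Y by (simp only: restrict_apply' cong: if_cong)
qed

lemma sum_mult_E: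
  assumes b: "\<And>i. i < n \<Longrightarrow> b i \<in> carrier R" and k: "k < n"
  shows "(\<Oplus>i\<in>{..<n}. b i \<otimes> E (int i)) \<otimes> E (int k) = b k \<otimes> E (int k)"
proof -
  have "(\<Oplus>i\<in>{..<n}. b i \<otimes> E (int i)) \<otimes> E (int k) = (\<Oplus>i\<in>{..<n}. b i \<otimes> E (int i) \<otimes> E (int k))"
    using b by (intro finsum_ldistr) auto
  also have "\<dots> = b k \<otimes> E (int k) \<otimes> E (int k)"
    using b k E_orth by (intro finsum_single) (auto simp: m_assoc)
  finally show ?thesis using b k by (simp add: m_assoc)
qed

lemma tilt_mod_tilting: "tilting_module R tilt_mod"
  unfolding tilting_module_def
proof (intro conjI)
  show "fg_module R tilt_mod" by (rule tilt_mod_fg)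
  show "basic_module R tilt_mod" by (rule tilt_mod_basic)
  show "projdim_le R tilt_mod 1" by (rule tilt_projdim)
  show "Ext_vanishes R 1 tilt_mod tilt_mod" by (rule tilt_ext_vanishes)
  \<comment> \<open>Since \<open>E i \<otimes> emb i = emb i\<close>, the \<open>i\<close>-th
    coordinate sees only \<open>a \<otimes> E i\<close>; together the coordinates embed the whole
    ring.\<close>
  let ?f = "\<lambda>a\<in>carrier (regular_module R). vec n (\<lambda>i. a \<otimes> emb (int i))"
  let ?g = "\<lambda>X\<in>carrier hull_mod. vec n (\<lambda>i. the_elem X i \<otimes> cok (int i))"
  have ein: "a \<otimes> emb i \<in> lgen (E (hull i))" if "a \<in> carrier R" for a i
    using that by (simp add: lgen_E_iff m_assoc)
  have fc: "vec n (\<lambda>i. a \<otimes> emb (int i)) \<in> carrier hull_mod" if "a \<in> carrier R" for a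
    using ein[OF that] by (intro vec_in_fbox) auto
  have f: "?f \<in> module_hom R (regular_module R) hull_mod"
  proof (rule module_homI[OF _ _ _ regular_left_module])
    show "vec n (\<lambda>i. (a \<oplus>\<^bsub>regular_module R\<^esub> b) \<otimes> emb (int i)) =
        vec n (\<lambda>i. a \<otimes> emb (int i)) \<oplus>\<^bsub>hull_mod\<^esub> vec n (\<lambda>i. b \<otimes> emb (int i))"
      if "a \<in> carrier (regular_module R)" "b \<in> carrier (regular_module R)" for a b
      unfolding fbox_simps by (rule vec_cong) (use that in \<open>simp add: l_distr\<close>)
    show "vec n (\<lambda>i. (r \<odot>\<^bsub>regular_module R\<^esub> a) \<otimes> emb (int i)) =
        r \<odot>\<^bsub>hull_mod\<^esub> vec n (\<lambda>i. a \<otimes> emb (int i))"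
      if "r \<in> carrier R" "a \<in> carrier (regular_module R)" for r a
      unfolding fbox_simps by (rule vec_cong) (use that in \<open>simp add: m_assoc\<close>)
  qed (simp add: fc)
  have fm: "?f \<in> module_mono R (regular_module R) hull_mod"
  proof -
    have "inj_on ?f (carrier (regular_module R))"
    proof (rule inj_on_module_hom[OF f regular_left_module box_left_modules(2)])
      fix a assume a: "a \<in> carrier (regular_module R)" "?f a = \<zero>\<^bsub>hull_mod\<^esub>"
      have "a \<otimes> E j = \<zero>" for j
      proof -
        obtain i where i: "i < n" "E j = E (int i)" using E_in_set by blast
        have "a \<otimes> emb (int i) = \<zero>" using a i(1) by (simp add: fbox_simps(1) vec_eq_iff)
        then have "(a \<otimes> E (int i)) \<otimes> emb (int i) = \<zero>" using a(1) by (simp add: m_assoc)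
        moreover have "a \<otimes> E (int i) \<in> lgen (E (int i))" using a(1) by (simp add: lgen_E_iff m_assoc)
        ultimately have "a \<otimes> E (int i) = \<zero>" by (rule emb_cancel[rotated])
        then show ?thesis using i(2) by simp
      qed
      then have "a \<otimes> E j \<in> {\<zero>}" for j by simp
      then have "a \<in> {\<zero>}" by (rule split_right[OF zero_left_ideal a(1)[simplified]])
      then show "a = \<zero>\<^bsub>regular_module R\<^esub>" by simp
    qed
    then show ?thesis using f by (simp add: module_mono_def)
  qed
  have g: "?g \<in> module_hom R hull_mod cok_mod"
  proof (rule diag_hom)
    show "x \<otimes> cok (int i) \<in> lgen (cok (int i))" if "x \<in> lgen (E (hull (int i)))" for x i
      using that by (auto simp: lgen_E_iff lgen_def[of "cok (int i)"])
  qed (auto intro: lgen_left_ideal)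
  have ge: "?g \<in> module_epi R hull_mod cok_mod"
  proof -
    have "carrier cok_mod \<subseteq> ?g ` carrier hull_mod"
    proof
      fix Y assume "Y \<in> carrier cok_mod"
      then obtain X where "X \<in> carrier hull_mod" "Y = vec n (\<lambda>i. the_elem X i \<otimes> cok (int i))"
        using hull_cok_surj[of cok Y] by auto
      then show "Y \<in> ?g ` carrier hull_mod" by (intro image_eqI[of _ _ X]) simp_all
    qed
    then show ?thesis by (rule module_epiI[OF g])
  qed
  have ex: "?f ` carrier R = a_kernel hull_mod cok_mod ?g"
  proof
    show "?f ` carrier R \<subseteq> a_kernel hull_mod cok_mod ?g"
    proof
      fix Y assume "Y \<in> ?f ` carrier R"
      then obtain a where a: "a \<in> carrier R" "Y = vec n (\<lambda>i. a \<otimes> emb (int i))" by auto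
      have "a \<otimes> emb i \<otimes> cok i = \<zero>" for i
        using cok_kernel[OF ein[OF a(1)], of i] a(1) by (auto simp: lgen_def[of "emb i"])
      then show "Y \<in> a_kernel hull_mod cok_mod ?g"
        using a fc[OF a(1)] by (simp add: a_kernel_def' fbox_simps(1) vec_eq_iff)
    qed
    show "a_kernel hull_mod cok_mod ?g \<subseteq> ?f ` carrier R"
    proof
      fix Y assume "Y \<in> a_kernel hull_mod cok_mod ?g"
      then have Y: "Y \<in> carrier hull_mod" "?g Y = \<zero>\<^bsub>cok_mod\<^esub>" unfolding a_kernel_def' by blast+
      have "\<exists>r \<in> carrier R. the_elem Y i = r \<otimes> emb (int i)" if i: "i < n" for i
      proof -
        have "the_elem Y i \<otimes> cok (int i) = \<zero>" using Y i by (simp add: fbox_simps(1) vec_eq_iff)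
        then have "the_elem Y i \<in> lgen (emb (int i))" using cok_kernel[OF fbox_nth[OF Y(1) i]] by simp
        then show ?thesis by (auto simp: lgen_def)
      qed
      then obtain b where b: "\<And>i. i < n \<Longrightarrow> b i \<in> carrier R \<and> the_elem Y i = b i \<otimes> emb (int i)" by metis
      \<comment> \<open>Orthogonality assembles the coefficients into one ring element with
        \<open>a \<otimes> emb (int k) = b k \<otimes> emb (int k)\<close>.\<close>
      define a where "a = (\<Oplus>i\<in>{..<n}. b i \<otimes> E (int i))"
      have a: "a \<in> carrier R" using b by (auto simp: a_def intro!: finsum_closed)
      have "a \<otimes> emb (int k) = the_elem Y k" if k: "k < n" for k
      proof -
        have "a \<otimes> emb (int k) = (a \<otimes> E (int k)) \<otimes> emb (int k)" using a by (simp add: m_assoc)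
        also have "\<dots> = (b k \<otimes> E (int k)) \<otimes> emb (int k)" unfolding a_def using sum_mult_E[OF _ k, of b] b by simp
        also have "\<dots> = the_elem Y k" using b[OF k] by (simp add: m_assoc)
        finally show ?thesis .
      qed
      then have "vec n (\<lambda>i. a \<otimes> emb (int i)) = vec n (the_elem Y)" by (rule vec_cong)
      then have "Y = ?f a" using a Y(1) by (simp add: fbox_carrier_iff)
      then show "Y \<in> ?f ` carrier R" using a by blast
    qed
  qed
  show "\<exists>(T0 :: 'a fmod) \<in> add_category R tilt_mod. \<exists>(T1 :: 'a fmod) \<in> add_category R tilt_mod.
      \<exists>f\<in>module_mono R (regular_module R) T0. \<exists>g\<in>module_epi R T0 T1. f ` carrier R = a_kernel T0 T1 g"
    by (rule bexI[OF _ hull_mod_add], rule bexI[OF _ cok_mod_add], rule bexI[OF _ fm], rule bexI[OF _ ge], rule ex)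
qed

end

section \<open>The equivalence for all integer labels\<close>

context nak_ring
begin

theorem tilting_in_C_iff:
  assumes complete: "\<And>X :: 'a fmod. \<lbrakk>projective R X; indecomposable R X\<rbrakk> \<Longrightarrow> \<exists>i. module_iso R X (proj i)"
  shows "(\<exists>T :: 'a fmod. tilting_module R T \<and> T \<in> C_subcategory R) \<longleftrightarrow>
    (\<forall>i. \<not> inj_label i \<longrightarrow> (\<exists>k. inj_label k \<and> i mod int n = (k - int (len k)) mod int n))"
proof
  assume "\<exists>T :: 'a fmod. tilting_module R T \<and> T \<in> C_subcategory R"
  then obtain T :: "'a fmod" where T: "tilting_module R T" "T \<in> C_subcategory R" by blast
  show "\<forall>i. \<not> inj_label i \<longrightarrow> (\<exists>k. inj_label k \<and> i mod int n = (k - int (len k)) mod int n)"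
  proof (intro allI impI)
    fix i assume "\<not> inj_label i"
    then have "len (i + 1) = len i + 1" using len_step[of i] by (simp add: inj_label_def)
    then show "\<exists>k. inj_label k \<and> i mod int n = (k - int (len k)) mod int n"
      unfolding inj_label_def by (intro tilting_implies_condition[OF _ T] complete)
  qed
next
  assume c: "\<forall>i. \<not> inj_label i \<longrightarrow> (\<exists>k. inj_label k \<and> i mod int n = (k - int (len k)) mod int n)"
  interpret C: nak_ring_condition R n E J A by unfold_locales (use c in blast)
  have "C.tilt_mod \<in> C_subcategory R"
    using C.projinj_mod_sum complete C.tilt_mod_Gen C.tilt_mod_Cogen unfolding C_subcategory_def by blast
  then show "\<exists>T :: 'a fmod. tilting_module R T \<and> T \<in> C_subcategory R"
    using C.tilt_mod_tilting by blast
qed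

end

section \<open>Descending chains over an artinian ring\<close>

lemma (in ring) left_ideal_neg: "\<lbrakk>left_ideal U R; x \<in> U\<rbrakk> \<Longrightarrow> \<ominus> x \<in> U"
  using left_ideal_mult[of U "\<ominus> \<one>" x] left_ideal_in[of U x] by (simp add: l_minus)

lemma (in ring) ideal_left_idealI:
  assumes U: "left_ideal U R" and r: "\<And>a x. \<lbrakk>a \<in> carrier R; x \<in> U\<rbrakk> \<Longrightarrow> x \<otimes> a \<in> U"
  shows "ideal U R"
proof (rule idealI[OF ring_axioms])
  show "subgroup U (add_monoid R)"
    using left_ideal_neg[OF U] left_ideal_add[OF U] left_ideal_zero[OF U] left_ideal_in[OF U]
    by (intro subgroup.intro) (auto simp: a_inv_def[symmetric])
qed (use r left_ideal_mult[OF U] in auto)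

lemma antimono_chain: "\<lbrakk>\<And>i :: nat. N (Suc i) \<subseteq> N i; m \<le> i\<rbrakk> \<Longrightarrow> N i \<subseteq> N m"
  by (rule lift_Suc_antimono_le)

text \<open>A chain has two invariants: its trace on \<open>W\<close>, and the ideals of
  coefficients of \<open>x\<close> occurring modulo \<open>W\<close>. Once both are stationary, so
  is the trace on \<open>W + K x\<close>.\<close>

lemma dcc_add_generator:
  assumes K: "artinian_cring K" and M: "left_module K M" and W: "submodule W K M" and x: "x \<in> carrier M"
    and dccW: "\<forall>N. (\<forall>i :: nat. submodule (N i) K M) \<and> (\<forall>i. N (Suc i) \<subseteq> N i) \<longrightarrow>
      (\<exists>m. \<forall>i\<ge>m. N i \<inter> W = N m \<inter> W)"
    and N: "\<And>i :: nat. submodule (N i) K M" "\<And>i. N (Suc i) \<subseteq> N i"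
    and V: "V = W <+>\<^bsub>M\<^esub> {r \<odot>\<^bsub>M\<^esub> x | r. r \<in> carrier K}"
  shows "\<exists>m. \<forall>i\<ge>m. N i \<inter> V = N m \<inter> V"
proof -
  interpret M: left_module K M by fact
  interpret K: cring K using K by (simp add: artinian_cring_def)
  have WM: "w \<in> carrier M" if "w \<in> W" for w using submodule_in[OF W that] .
  have NM: "w \<in> carrier M" if "w \<in> N i" for w i using submodule_in[OF N(1) that] .
  have V_iff: "y \<in> V \<longleftrightarrow> (\<exists>w \<in> W. \<exists>r \<in> carrier K. y = w \<oplus>\<^bsub>M\<^esub> r \<odot>\<^bsub>M\<^esub> x)" for y
    unfolding V set_add_def set_mult_def by auto
  define I where "I i = {r \<in> carrier K. \<exists>w \<in> W. w \<oplus>\<^bsub>M\<^esub> r \<odot>\<^bsub>M\<^esub> x \<in> N i}" for i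
  have "left_ideal (I i) K" for i
  proof (rule left_module.submoduleI'[OF M.R.regular_left_module])
    have "\<zero>\<^bsub>M\<^esub> \<oplus>\<^bsub>M\<^esub> \<zero>\<^bsub>K\<^esub> \<odot>\<^bsub>M\<^esub> x \<in> N i" using submodule_zero[OF N(1)] x by (simp add: M.smult_zero_left)
    then show "\<zero>\<^bsub>regular_module K\<^esub> \<in> I i" using submodule_zero[OF W] by (auto simp: I_def)
  next
    fix r s assume "r \<in> I i" "s \<in> I i"
    then obtain v w where *: "r \<in> carrier K" "s \<in> carrier K" "v \<in> W" "w \<in> W"
      "v \<oplus>\<^bsub>M\<^esub> r \<odot>\<^bsub>M\<^esub> x \<in> N i" "w \<oplus>\<^bsub>M\<^esub> s \<odot>\<^bsub>M\<^esub> x \<in> N i" by (auto simp: I_def)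
    then have "(v \<oplus>\<^bsub>M\<^esub> w) \<oplus>\<^bsub>M\<^esub> (r \<oplus>\<^bsub>K\<^esub> s) \<odot>\<^bsub>M\<^esub> x = (v \<oplus>\<^bsub>M\<^esub> r \<odot>\<^bsub>M\<^esub> x) \<oplus>\<^bsub>M\<^esub> (w \<oplus>\<^bsub>M\<^esub> s \<odot>\<^bsub>M\<^esub> x)"
      using WM x by (simp add: M.smult_l_distr M.M.a_ac)
    also have "\<dots> \<in> N i" by (rule submodule_add[OF N(1) *(5,6)])
    finally show "r \<oplus>\<^bsub>regular_module K\<^esub> s \<in> I i" using * submodule_add[OF W] by (auto simp: I_def)
  next
    fix a r assume "a \<in> carrier K" "r \<in> I i"
    then obtain v where *: "a \<in> carrier K" "r \<in> carrier K" "v \<in> W" "v \<oplus>\<^bsub>M\<^esub> r \<odot>\<^bsub>M\<^esub> x \<in> N i" by (auto simp: I_def)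
    then have "a \<odot>\<^bsub>M\<^esub> v \<oplus>\<^bsub>M\<^esub> (a \<otimes>\<^bsub>K\<^esub> r) \<odot>\<^bsub>M\<^esub> x = a \<odot>\<^bsub>M\<^esub> (v \<oplus>\<^bsub>M\<^esub> r \<odot>\<^bsub>M\<^esub> x)"
      using WM x by (simp add: M.smult_r_distr M.smult_assoc)
    also have "\<dots> \<in> N i" by (rule submodule_smult[OF N(1) *(1,4)])
    finally show "a \<odot>\<^bsub>regular_module K\<^esub> r \<in> I i" using * submodule_smult[OF W] by (auto simp: I_def)
  qed (auto simp: I_def)
  note LI = this
  have "ideal (I i) K" for i
  proof (rule M.R.ideal_left_idealI[OF LI])
    fix a r assume "a \<in> carrier K" "r \<in> I i"
    then show "r \<otimes>\<^bsub>K\<^esub> a \<in> I i"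
      using M.R.left_ideal_mult[OF LI, of a r i] M.R.left_ideal_in[OF LI, of r i] by (simp add: K.m_comm)
  qed
  moreover have "I (Suc i) \<subseteq> I i" for i using N(2) by (auto simp: I_def)
  ultimately obtain m1 where m1: "\<And>i. i \<ge> m1 \<Longrightarrow> I i = I m1"
    using K unfolding artinian_cring_def by blast
  obtain m2 where m2: "\<And>i. i \<ge> m2 \<Longrightarrow> N i \<inter> W = N m2 \<inter> W" using dccW N by metis
  define m where "m = max m1 m2"
  have "N i \<inter> V = N m \<inter> V" if i: "i \<ge> m" for i
  proof
    show "N i \<inter> V \<subseteq> N m \<inter> V" using antimono_chain[of N, OF N(2) i] by blast
    show "N m \<inter> V \<subseteq> N i \<inter> V"
    proof
      fix y assume y: "y \<in> N m \<inter> V"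
      then obtain w r where wr: "w \<in> W" "r \<in> carrier K" "y = w \<oplus>\<^bsub>M\<^esub> r \<odot>\<^bsub>M\<^esub> x" using V_iff by auto
      then have "r \<in> I m" using y by (auto simp: I_def)
      then have "r \<in> I i" using m1[of m] m1[of i] i by (simp add: m_def)
      then obtain w' where w': "w' \<in> W" "w' \<oplus>\<^bsub>M\<^esub> r \<odot>\<^bsub>M\<^esub> x \<in> N i" by (auto simp: I_def)
      then have "w' \<oplus>\<^bsub>M\<^esub> r \<odot>\<^bsub>M\<^esub> x \<in> N m" using antimono_chain[of N, OF N(2) i] by blast
      \<comment> \<open>An element of \<open>N i\<close> with the same coefficient of
        \<open>x\<close> differs from \<open>y\<close> by an element of \<open>W\<close>, where the
        traces already agree.\<close>
      then have "y \<ominus>\<^bsub>M\<^esub> (w' \<oplus>\<^bsub>M\<^esub> r \<odot>\<^bsub>M\<^esub> x) \<in> N m" using y by (intro M.submodule_diff[OF N(1)]) auto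
      moreover have "y \<ominus>\<^bsub>M\<^esub> (w' \<oplus>\<^bsub>M\<^esub> r \<odot>\<^bsub>M\<^esub> x) = w \<ominus>\<^bsub>M\<^esub> w'"
      proof -
        have "r \<odot>\<^bsub>M\<^esub> x \<oplus>\<^bsub>M\<^esub> (\<ominus>\<^bsub>M\<^esub> (r \<odot>\<^bsub>M\<^esub> x) \<oplus>\<^bsub>M\<^esub> \<ominus>\<^bsub>M\<^esub> w') = \<ominus>\<^bsub>M\<^esub> w'"
          using WM[OF w'(1)] wr(2) x by (simp add: M.M.a_assoc[symmetric] M.M.r_neg)
        then show ?thesis unfolding wr(3)
          using WM[OF wr(1)] WM[OF w'(1)] wr(2) x
          by (simp add: M.M.minus_eq M.M.minus_add M.M.a_comm[of "\<ominus>\<^bsub>M\<^esub> w'"] M.M.a_assoc)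
      qed
      ultimately have "w \<ominus>\<^bsub>M\<^esub> w' \<in> N m" by simp
      moreover have "w \<ominus>\<^bsub>M\<^esub> w' \<in> W" by (rule M.submodule_diff[OF W wr(1) w'(1)])
      ultimately have "w \<ominus>\<^bsub>M\<^esub> w' \<in> N i" using m2[of m] m2[of i] i by (auto simp: m_def)
      then have "(w \<ominus>\<^bsub>M\<^esub> w') \<oplus>\<^bsub>M\<^esub> (w' \<oplus>\<^bsub>M\<^esub> r \<odot>\<^bsub>M\<^esub> x) \<in> N i" using w'(2) by (rule submodule_add[OF N(1)])
      moreover have "(w \<ominus>\<^bsub>M\<^esub> w') \<oplus>\<^bsub>M\<^esub> (w' \<oplus>\<^bsub>M\<^esub> r \<odot>\<^bsub>M\<^esub> x) = y"
      proof -
        have "\<ominus>\<^bsub>M\<^esub> w' \<oplus>\<^bsub>M\<^esub> (w' \<oplus>\<^bsub>M\<^esub> r \<odot>\<^bsub>M\<^esub> x) = r \<odot>\<^bsub>M\<^esub> x"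
          using WM[OF w'(1)] wr(2) x by (simp add: M.M.a_assoc[symmetric] M.M.l_neg)
        then show ?thesis unfolding wr(3) using WM[OF wr(1)] WM[OF w'(1)] wr(2) x
          by (simp add: M.M.minus_eq M.M.a_assoc)
      qed
      ultimately show "y \<in> N i \<inter> V" using y by simp
    qed
  qed
  then show ?thesis by blast
qed

text \<open>Induction on generators. The claim concerns the traces on \<open>W\<close> of chains of
  submodules of the fixed module \<open>M\<close>, so the chains stay the same when \<open>W\<close>
  grows.\<close>

lemma artinian_dcc:
  assumes K: "artinian_cring K" and fg: "fg_module K M"
    and N: "\<And>i :: nat. submodule (N i) K M" "\<And>i. N (Suc i) \<subseteq> N i"
  shows "\<exists>m. \<forall>i\<ge>m. N i = N m"
proof -
  have M: "left_module K M" using fg by (simp add: fg_module_def)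
  interpret M: left_module K M by fact
  obtain S where S: "finite S" "S \<subseteq> carrier M" "\<And>N. submodule N K M \<Longrightarrow> S \<subseteq> N \<Longrightarrow> N = carrier M"
    using fg_moduleE[OF fg] by metis
  have "\<exists>W. submodule W K M \<and> S \<subseteq> W \<and> (\<forall>N. (\<forall>i :: nat. submodule (N i) K M) \<and> (\<forall>i. N (Suc i) \<subseteq> N i) \<longrightarrow>
      (\<exists>m. \<forall>i\<ge>m. N i \<inter> W = N m \<inter> W))"
    using S(1,2)
  proof (induction S)
    case empty
    have "N i \<inter> {\<zero>\<^bsub>M\<^esub>} = N m \<inter> {\<zero>\<^bsub>M\<^esub>}" if "\<forall>i :: nat. submodule (N i) K M" for N i m
      using that submodule_zero by blast
    then show ?case using M.zero_submodule by (intro exI[of _ "{\<zero>\<^bsub>M\<^esub>}"]) auto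
  next
    case (insert x S)
    then obtain W where W: "submodule W K M" "S \<subseteq> W"
      "\<forall>N. (\<forall>i :: nat. submodule (N i) K M) \<and> (\<forall>i. N (Suc i) \<subseteq> N i) \<longrightarrow> (\<exists>m. \<forall>i\<ge>m. N i \<inter> W = N m \<inter> W)"
      by auto
    have x: "x \<in> carrier M" using insert.prems by simp
    define V where "V = W <+>\<^bsub>M\<^esub> {r \<odot>\<^bsub>M\<^esub> x | r. r \<in> carrier K}"
    have V: "submodule V K M" unfolding V_def by (rule M.submodule_sum[OF W(1) M.cyclic_submodule[OF x]])
    have "w \<in> V" if w: "w \<in> W" for w
    proof -
      have "w = w \<oplus>\<^bsub>M\<^esub> \<zero>\<^bsub>K\<^esub> \<odot>\<^bsub>M\<^esub> x" using x submodule_in[OF W(1) w] by (simp add: M.smult_zero_left)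
      then show ?thesis using w by (auto simp: V_def set_add_def set_mult_def)
    qed
    moreover have "x \<in> V"
    proof -
      have "x = \<zero>\<^bsub>M\<^esub> \<oplus>\<^bsub>M\<^esub> \<one>\<^bsub>K\<^esub> \<odot>\<^bsub>M\<^esub> x" using x by simp
      then show ?thesis using submodule_zero[OF W(1)] M.R.one_closed unfolding V_def set_add_def set_mult_def by auto
    qed
    moreover have "\<exists>m. \<forall>i\<ge>m. N i \<inter> V = N m \<inter> V"
      if "\<And>i :: nat. submodule (N i) K M" "\<And>i. N (Suc i) \<subseteq> N i" for N
      by (rule dcc_add_generator[where N = N, OF K M W(1) x W(3) _ _ V_def]) (rule that)+
    ultimately show ?case using V W(2) by (intro exI[of _ V]) auto
  qed
  then obtain W where W: "submodule W K M" "S \<subseteq> W" "\<exists>m. \<forall>i\<ge>m. N i \<inter> W = N m \<inter> W" using N by metis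
  have "W = carrier M" by (rule S(3)[OF W(1,2)])
  moreover have "N i \<inter> carrier M = N i" for i using submodule_subset[OF N(1)] by blast
  ultimately show ?thesis using W(3) by simp
qed

section \<open>Local idempotents from uniserial projectives\<close>

context ring
begin

text \<open>The condition says that no \<open>r \<otimes> E i\<close> generates
  \<open>R (E i)\<close>. For uniserial \<open>R (E i)\<close> the non-generators form its largest
  proper submodule.\<close>

definition rad_ideal :: "(int \<Rightarrow> 'a) \<Rightarrow> 'a set" where
  "rad_ideal E = {r \<in> carrier R. \<forall>i. \<forall>c \<in> carrier R. c \<otimes> (r \<otimes> E i) \<noteq> E i}"

text \<open>\<open>f\<close> and \<open>e \<ominus> f\<close> are orthogonal idempotents; if one is
  a left multiple of the other, multiplying on the right by itself makes it vanish.\<close>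

lemma lgen_comparable_idem:
  assumes e: "e \<in> carrier R" "e \<otimes> e = e" and f: "f \<in> carrier R" "f \<otimes> f = f" "e \<otimes> f = f" "f \<otimes> e = f"
    and cmp: "lgen f \<subseteq> lgen (e \<ominus> f) \<or> lgen (e \<ominus> f) \<subseteq> lgen f"
  shows "f = \<zero> \<or> f = e"
proof -
  have z: "(e \<ominus> f) \<otimes> f = \<zero>" "f \<otimes> (e \<ominus> f) = \<zero>" "(e \<ominus> f) \<otimes> (e \<ominus> f) = e \<ominus> f"
    using e f by (auto simp: minus_eq l_distr r_distr l_minus r_minus r_neg)
  from cmp show ?thesis
  proof
    assume "lgen f \<subseteq> lgen (e \<ominus> f)"
    then obtain r where r: "r \<in> carrier R" "f = r \<otimes> (e \<ominus> f)" using lgen_self[OF f(1)] by (auto simp: lgen_def)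
    have "f = r \<otimes> ((e \<ominus> f) \<otimes> f)" using r e f by (metis m_assoc minus_closed)
    then show ?thesis using z r by simp
  next
    assume "lgen (e \<ominus> f) \<subseteq> lgen f"
    then obtain r where r: "r \<in> carrier R" "e \<ominus> f = r \<otimes> f" using lgen_self[of "e \<ominus> f"] e f by (auto simp: lgen_def)
    have "e \<ominus> f = r \<otimes> (f \<otimes> (e \<ominus> f))" using r e f z(3) by (metis m_assoc minus_closed)
    then have "e \<ominus> f = \<zero>" using z r by simp
    then have "e = f" using e f by (metis add.inv_closed add.inv_equality minus_eq minus_minus)
    then show ?thesis by simp
  qed
qed

text \<open>Uniseriality makes the corners local and the non-generators additively closed; pairwise
  non-isomorphism puts the off-diagonal parts into the radical.\<close>

lemma idem_ring_uniserial:
  assumes n: "0 < n" and E: "\<And>i. E i \<in> carrier R" "\<And>i. E (i mod int n) = E i" "\<And>i. E i \<otimes> E i = E i"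
      "\<And>i. E i \<noteq> \<zero>"
    and orth: "\<And>i j. i mod int n \<noteq> j mod int n \<Longrightarrow> E i \<otimes> E j = \<zero>"
    and sum: "(\<Oplus>i\<in>{..<n}. E (int i)) = \<one>"
    and uni: "\<And>i U V. \<lbrakk>left_ideal U R; left_ideal V R; U \<subseteq> lgen (E i); V \<subseteq> lgen (E i)\<rbrakk> \<Longrightarrow> U \<subseteq> V \<or> V \<subseteq> U"
    and noniso: "\<And>i j. module_iso R (ideal_module R (lgen (E i))) (ideal_module R (lgen (E j))) \<Longrightarrow>
      i mod int n = j mod int n"
  shows "idem_ring R n E (rad_ideal E)"
proof -
  have lE: "x \<in> lgen (E i) \<longleftrightarrow> x \<in> carrier R \<and> x \<otimes> E i = x" for x i
  proof
    assume "x \<in> carrier R \<and> x \<otimes> E i = x"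
    then have "x = x \<otimes> E i" "x \<in> carrier R" by simp_all
    then show "x \<in> lgen (E i)" unfolding lgen_def by blast
  qed (use E in \<open>auto simp: lgen_def m_assoc\<close>)
  have sub: "lgen x \<subseteq> lgen (E i)" if "x \<in> carrier R" "x \<otimes> E i = x" for x i
    using that lE by (intro lgen_minimal lgen_left_ideal E) blast
  have cmp: "lgen x \<subseteq> lgen y \<or> lgen y \<subseteq> lgen x"
    if "x \<in> carrier R" "x \<otimes> E i = x" "y \<in> carrier R" "y \<otimes> E i = y" for x y i
    by (rule uni[OF lgen_left_ideal lgen_left_ideal sub sub]) (use that in auto)
  have Ec: "i mod int n = j mod int n \<Longrightarrow> E i = E j" for i j using E(2) by metis
  have EE: "E i \<otimes> (E i \<otimes> x) = E i \<otimes> x" if "x \<in> carrier R" for i x using that E by (simp add: m_assoc[symmetric])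
  \<comment> \<open>A left inverse is two-sided: \<open>b \<otimes> c'\<close> is an idempotent
    below \<open>E k\<close>, hence zero or \<open>E k\<close>, and zero would give
    \<open>E i = 0\<close>.\<close>
  have inv: "\<exists>c' \<in> carrier R. c' \<otimes> b = E i \<and> b \<otimes> c' = E k \<and> c' \<otimes> E k = c' \<and> E i \<otimes> c' = c'"
    if b: "b \<in> carrier R" "E k \<otimes> b = b" "b \<otimes> E i = b" and c: "c \<in> carrier R" "c \<otimes> b = E i" for b c i k
  proof -
    define c' where "c' = E i \<otimes> c \<otimes> E k"
    have c': "c' \<in> carrier R" "c' \<otimes> b = E i" "c' \<otimes> E k = c'" "E i \<otimes> c' = c'"
      using b c E EE by (auto simp: c'_def m_assoc)
    define f where "f = b \<otimes> c'"
    have f: "f \<in> carrier R" "f \<otimes> f = f" "E k \<otimes> f = f" "f \<otimes> E k = f"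
    proof -
      have "f \<otimes> f = b \<otimes> (c' \<otimes> b) \<otimes> c'" using b(1) c'(1) by (simp add: f_def m_assoc)
      then show "f \<otimes> f = f" unfolding c'(2) using b by (simp add: f_def)
      show "E k \<otimes> f = f" using b(1,2) c'(1) E(1) by (simp add: f_def m_assoc[symmetric])
      show "f \<otimes> E k = f" using b(1) c'(1,3) E(1) by (simp add: f_def m_assoc)
    qed (use b c' in \<open>simp add: f_def\<close>)
    have "f = \<zero> \<or> f = E k"
      by (rule lgen_comparable_idem[OF E(1,3) f cmp[of _ k]])
        (use f E in \<open>auto simp: minus_eq l_distr l_minus\<close>)
    moreover have "f \<noteq> \<zero>"
    proof
      assume "f = \<zero>"
      have "E i = (c' \<otimes> b) \<otimes> (c' \<otimes> b)" unfolding c'(2) by (simp add: E(3))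
      also have "\<dots> = c' \<otimes> f \<otimes> b" using b(1) c'(1) by (simp add: f_def m_assoc)
      finally show False using E(4) b c' \<open>f = \<zero>\<close> by simp
    qed
    ultimately show ?thesis using c' by (auto simp: f_def)
  qed
  \<comment> \<open>Right multiplications by \<open>c'\<close> and by \<open>b\<close> are then
    inverse isomorphisms between \<open>R (E i)\<close> and \<open>R (E k)\<close>.\<close>
  have off: "i mod int n = k mod int n"
    if b: "b \<in> carrier R" "E k \<otimes> b = b" "b \<otimes> E i = b" and c: "c \<in> carrier R" "c \<otimes> b = E i" for b c i k
  proof -
    obtain c' where c': "c' \<in> carrier R" "c' \<otimes> b = E i" "b \<otimes> c' = E k" "c' \<otimes> E k = c'" "E i \<otimes> c' = c'"
      using inv[OF b c] by blast
    have L: "left_module R (ideal_module R (lgen (E i)))" for i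
      by (rule ideal_module_left_module[OF lgen_left_ideal[OF E(1)]])
    have "module_iso R (ideal_module R (lgen (E i))) (ideal_module R (lgen (E k)))"
    proof (rule module_isoI)
      have "(\<lambda>r\<in>carrier (ideal_module R (lgen (E i))). r \<otimes> c') \<in>
          module_hom R (ideal_module R (lgen (E i))) (ideal_module R (lgen (E k)))"
        by (rule module_homI[OF _ _ _ L]) (use c' E(1) in \<open>auto simp: lE m_assoc l_distr\<close>)
      then show "(\<lambda>r\<in>lgen (E i). r \<otimes> c') \<in> module_hom R (ideal_module R (lgen (E i))) (ideal_module R (lgen (E k)))" by simp
      have "(\<lambda>r\<in>carrier (ideal_module R (lgen (E k))). r \<otimes> b) \<in>
          module_hom R (ideal_module R (lgen (E k))) (ideal_module R (lgen (E i)))"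
        by (rule module_homI[OF _ _ _ L]) (use b E(1) in \<open>auto simp: lE m_assoc l_distr\<close>)
      then show "(\<lambda>r\<in>lgen (E k). r \<otimes> b) \<in> module_hom R (ideal_module R (lgen (E k))) (ideal_module R (lgen (E i)))" by simp
      show "(\<lambda>r\<in>lgen (E k). r \<otimes> b) ((\<lambda>r\<in>lgen (E i). r \<otimes> c') x) = x" if "x \<in> carrier (ideal_module R (lgen (E i)))" for x
        using that c' b E(1) by (simp add: lE m_assoc)
      show "(\<lambda>r\<in>lgen (E i). r \<otimes> c') ((\<lambda>r\<in>lgen (E k). r \<otimes> b) x) = x" if "x \<in> carrier (ideal_module R (lgen (E k)))" for x
        using that c' b E(1) by (simp add: lE m_assoc)
    qed
    then show ?thesis by (rule noniso)
  qed
  define rad where "rad i = {x \<in> lgen (E i). \<forall>c \<in> carrier R. c \<otimes> x \<noteq> E i}" for i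
  have J_iff: "r \<in> rad_ideal E \<longleftrightarrow> r \<in> carrier R \<and> (\<forall>i. r \<otimes> E i \<in> rad i)" for r
    using E by (auto simp: rad_ideal_def rad_def lE m_assoc)
  have radL: "left_ideal (rad i) R" for i
  proof (rule left_module.submoduleI'[OF regular_left_module])
    show "rad i \<subseteq> carrier (regular_module R)" by (auto simp: rad_def lE)
    show "\<zero>\<^bsub>regular_module R\<^esub> \<in> rad i" using E(1) E(4)[of i] by (auto simp: rad_def lE)
    show "a \<odot>\<^bsub>regular_module R\<^esub> x \<in> rad i" if "a \<in> carrier R" "x \<in> rad i" for a x
    proof -
      have x: "x \<in> carrier R" "x \<otimes> E i = x" and nx: "\<And>c. c \<in> carrier R \<Longrightarrow> c \<otimes> x \<noteq> E i"
        using that(2) by (auto simp: rad_def lE)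
      have "c \<otimes> (a \<otimes> x) \<noteq> E i" if c: "c \<in> carrier R" for c
        using nx[of "c \<otimes> a"] c \<open>a \<in> carrier R\<close> x by (simp add: m_assoc)
      then show ?thesis using x \<open>a \<in> carrier R\<close> E(1) by (auto simp: rad_def lE m_assoc)
    qed
    fix x y assume xy: "x \<in> rad i" "y \<in> rad i"
    then have x: "x \<in> carrier R" "x \<otimes> E i = x" "\<And>c. c \<in> carrier R \<Longrightarrow> c \<otimes> x \<noteq> E i"
      and y: "y \<in> carrier R" "y \<otimes> E i = y" "\<And>c. c \<in> carrier R \<Longrightarrow> c \<otimes> y \<noteq> E i"
      by (auto simp: rad_def lE)
    \<comment> \<open>Of two elements of \<open>R (E i)\<close> one is a left multiple of the other,
      so the sum is a left multiple of a single non-generator.\<close>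
    have "c \<otimes> (x \<oplus> y) \<noteq> E i" if c: "c \<in> carrier R" for c
    proof -
      from cmp[OF x(1,2) y(1,2)] show ?thesis
      proof
        assume "lgen x \<subseteq> lgen y"
        then obtain t where t: "t \<in> carrier R" "x = t \<otimes> y" using lgen_self[OF x(1)] by (auto simp: lgen_def)
        have "c \<otimes> (x \<oplus> y) = (c \<otimes> (t \<oplus> \<one>)) \<otimes> y" using t y c by (simp add: m_assoc l_distr)
        then show ?thesis using y(3)[of "c \<otimes> (t \<oplus> \<one>)"] c t by simp
      next
        assume "lgen y \<subseteq> lgen x"
        then obtain t where t: "t \<in> carrier R" "y = t \<otimes> x" using lgen_self[OF y(1)] by (auto simp: lgen_def)
        have "c \<otimes> (x \<oplus> y) = (c \<otimes> (\<one> \<oplus> t)) \<otimes> x" using t x c by (simp add: m_assoc l_distr)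
        then show ?thesis using x(3)[of "c \<otimes> (\<one> \<oplus> t)"] c t by simp
      qed
    qed
    then show "x \<oplus>\<^bsub>regular_module R\<^esub> y \<in> rad i" using x y E(1) by (auto simp: rad_def lE l_distr)
  qed
  have JL: "left_ideal (rad_ideal E) R"
  proof (rule left_module.submoduleI'[OF regular_left_module])
    show "rad_ideal E \<subseteq> carrier (regular_module R)" by (auto simp: rad_ideal_def)
    show "\<zero>\<^bsub>regular_module R\<^esub> \<in> rad_ideal E" using left_ideal_zero[OF radL] E(1) by (simp add: J_iff)
    show "x \<oplus>\<^bsub>regular_module R\<^esub> y \<in> rad_ideal E" if "x \<in> rad_ideal E" "y \<in> rad_ideal E" for x y
      using that left_ideal_add[OF radL] E(1) by (simp add: J_iff l_distr)
    show "a \<odot>\<^bsub>regular_module R\<^esub> x \<in> rad_ideal E" if "a \<in> carrier R" "x \<in> rad_ideal E" for a x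
      using that left_ideal_mult[OF radL that(1)] E(1) by (simp add: J_iff m_assoc)
  qed
  \<comment> \<open>If \<open>c x b = E i\<close>, then \<open>b\<close> has a two-sided inverse
    \<open>d\<close>, and \<open>E k = b E i d = b c x b d = b c x\<close> makes \<open>x\<close> a
    generator after all.\<close>
  have rad_mult: "x \<otimes> b \<in> rad i" if x: "x \<in> rad k" and b: "b \<in> carrier R" "E k \<otimes> b = b" "b \<otimes> E i = b" for x b i k
  proof -
    have xc: "x \<in> carrier R" "x \<otimes> E k = x" "\<And>c. c \<in> carrier R \<Longrightarrow> c \<otimes> x \<noteq> E k" using x by (auto simp: rad_def lE)
    have "c \<otimes> (x \<otimes> b) \<noteq> E i" if c: "c \<in> carrier R" for c
    proof
      assume eq: "c \<otimes> (x \<otimes> b) = E i"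
      have "(c \<otimes> x) \<otimes> b = E i" using eq c xc b by (simp add: m_assoc)
      then have cx: "\<exists>c'. c' \<in> carrier R \<and> c' \<otimes> b = E i" using c xc by blast
      obtain d where d: "d \<in> carrier R" "d \<otimes> b = E i" "b \<otimes> d = E k" using inv[OF b] cx by blast
      have "E k = b \<otimes> (E i \<otimes> d)" using d b E(1) by (simp add: m_assoc[symmetric])
      also have "\<dots> = b \<otimes> (c \<otimes> (x \<otimes> (b \<otimes> d)))" unfolding eq[symmetric] using c xc(1) b(1) d(1) by (simp add: m_assoc)
      also have "\<dots> = (b \<otimes> c) \<otimes> x" unfolding d(3) using xc(1,2) b(1) c by (simp add: m_assoc)
      finally show False using xc(3)[of "b \<otimes> c"] b(1) c by simp
    qed
    then show ?thesis using xc b E(1) by (auto simp: rad_def lE m_assoc)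
  qed
  have "r \<otimes> s \<in> rad_ideal E" if s: "s \<in> carrier R" and r: "r \<in> rad_ideal E" for r s
  proof -
    have rc: "r \<in> carrier R" using r by (simp add: J_iff)
    have "r \<otimes> s \<otimes> E i \<in> rad i" for i
    proof -
      have "r \<otimes> s \<otimes> E i = r \<otimes> (\<Oplus>k\<in>{..<n}. E (int k)) \<otimes> (s \<otimes> E i)" using rc s E(1) sum by (simp add: m_assoc)
      also have "\<dots> = (\<Oplus>k\<in>{..<n}. r \<otimes> E (int k)) \<otimes> (s \<otimes> E i)" using rc E(1) by (subst finsum_rdistr) auto
      also have "\<dots> = (\<Oplus>k\<in>{..<n}. r \<otimes> E (int k) \<otimes> (s \<otimes> E i))" using rc s E(1) by (intro finsum_ldistr) auto
      also have "\<dots> = (\<Oplus>\<^bsub>regular_module R\<^esub>k\<in>{..<n}. r \<otimes> E (int k) \<otimes> (s \<otimes> E i))" by (simp add: finsum_regular_module)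
      also have "\<dots> \<in> rad i"
      proof (rule left_module.submodule_finsum[OF regular_left_module radL])
        fix k
        have "(r \<otimes> E (int k)) \<otimes> (E (int k) \<otimes> s \<otimes> E i) \<in> rad i"
          by (rule rad_mult[of _ "int k"]) (use r s E(1,3) EE in \<open>auto simp: J_iff m_assoc\<close>)
        moreover have "(r \<otimes> E (int k)) \<otimes> (E (int k) \<otimes> s \<otimes> E i) = r \<otimes> E (int k) \<otimes> (s \<otimes> E i)"
          using rc s E(1) EE by (simp add: m_assoc)
        ultimately show "r \<otimes> E (int k) \<otimes> (s \<otimes> E i) \<in> rad i" by simp
      qed simp
      finally show ?thesis .
    qed
    then show ?thesis using rc s by (simp add: J_iff)
  qed
  then have J: "ideal (rad_ideal E) R" by (intro ideal_left_idealI[OF JL])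
  show ?thesis
  proof (intro idem_ring.intro idem_ring_axioms.intro ring_axioms n E(1,2,3) orth sum J)
    show "E i \<notin> rad_ideal E" for i
      using E by (auto simp: rad_ideal_def intro!: exI[of _ i] bexI[of _ "E i"])
    fix r i j assume r: "r \<in> carrier R" and ij: "i mod int n \<noteq> j mod int n"
    have b: "E i \<otimes> r \<otimes> E j \<in> carrier R" "E i \<otimes> (E i \<otimes> r \<otimes> E j) = E i \<otimes> r \<otimes> E j" "E i \<otimes> r \<otimes> E j \<otimes> E j = E i \<otimes> r \<otimes> E j"
      using r E EE by (auto simp: m_assoc)
    have "c \<otimes> (E i \<otimes> r \<otimes> E j \<otimes> E k) \<noteq> E k" if c: "c \<in> carrier R" for c k
    proof (cases "j mod int n = k mod int n")
      case True
      then have "E k = E j" using Ec by metis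
      then show ?thesis using off[OF b c] ij b(3) by auto
    next
      case False
      have "E i \<otimes> r \<otimes> E j \<otimes> E k = \<zero>" using orth[OF False] r E(1) by (simp add: m_assoc)
      then show ?thesis using c E(4)[of k] by simp
    qed
    then show "E i \<otimes> r \<otimes> E j \<in> rad_ideal E" using b(1) by (auto simp: rad_ideal_def)
  next
    fix r i assume r: "r \<in> carrier R" and nJ: "E i \<otimes> r \<otimes> E i \<notin> rad_ideal E"
    have b: "E i \<otimes> r \<otimes> E i \<in> carrier R" "E i \<otimes> (E i \<otimes> r \<otimes> E i) = E i \<otimes> r \<otimes> E i" "E i \<otimes> r \<otimes> E i \<otimes> E i = E i \<otimes> r \<otimes> E i"
      using r E EE by (auto simp: m_assoc)
    obtain k c where k: "c \<in> carrier R" "c \<otimes> (E i \<otimes> r \<otimes> E i \<otimes> E k) = E k" using nJ b(1) by (auto simp: rad_ideal_def)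
    have "i mod int n = k mod int n"
    proof (rule ccontr)
      assume "i mod int n \<noteq> k mod int n"
      then have "E i \<otimes> r \<otimes> E i \<otimes> E k = \<zero>" using orth r E(1) by (simp add: m_assoc)
      then show False using k E(4)[of k] by simp
    qed
    then have "E k = E i" using Ec by metis
    then have "c \<otimes> (E i \<otimes> r \<otimes> E i) = E i" using k(2) b(3) by simp
    then show "\<exists>c\<in>carrier R. c \<otimes> (E i \<otimes> r \<otimes> E i) = E i \<and> E i \<otimes> r \<otimes> E i \<otimes> c = E i"
      using inv[OF b k(1)] by blast
  qed
qed

end

section \<open>Tops, duals and the arrows\<close>

context left_module
begin

text \<open>Scalars act on a coset through a union over representatives; once independence of the
  representative is shown, quotients are handled through the projection \<open>p\<close>
  alone.\<close>

lemma quot_map: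
  assumes N: "submodule N R M"
  defines "p \<equiv> \<lambda>x. N +>\<^bsub>M\<^esub> x"
  shows "carrier (quot_module M N) = p ` carrier M"
    and "\<And>x y. \<lbrakk>x \<in> carrier M; y \<in> carrier M\<rbrakk> \<Longrightarrow> p x \<oplus>\<^bsub>quot_module M N\<^esub> p y = p (x \<oplus>\<^bsub>M\<^esub> y)"
    and "\<And>a x. \<lbrakk>a \<in> carrier R; x \<in> carrier M\<rbrakk> \<Longrightarrow> a \<odot>\<^bsub>quot_module M N\<^esub> p x = p (a \<odot>\<^bsub>M\<^esub> x)"
    and "\<zero>\<^bsub>quot_module M N\<^esub> = p \<zero>\<^bsub>M\<^esub>"
    and "\<And>x y. \<lbrakk>x \<in> carrier M; y \<in> carrier M\<rbrakk> \<Longrightarrow> p x = p y \<longleftrightarrow> x \<ominus>\<^bsub>M\<^esub> y \<in> N"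
proof -
  note NM = submodule_in[OF N]
  have "additive_subgroup N M"
    using N by (intro additive_subgroup.intro) (simp add: submodule_def)
  then interpret N: abelian_subgroup N M
    by (rule abelian_subgroupI3) (rule M.abelian_group_axioms)
  have mem: "z \<in> p x \<longleftrightarrow> (\<exists>v \<in> N. z = v \<oplus>\<^bsub>M\<^esub> x)" for z x
    by (auto simp: p_def a_r_coset_def')
  show eq: "p x = p y \<longleftrightarrow> x \<ominus>\<^bsub>M\<^esub> y \<in> N" if xy: "x \<in> carrier M" "y \<in> carrier M" for x y
  proof
    assume "p x = p y"
    moreover have "x \<in> p x" unfolding mem using xy submodule_zero[OF N] by (intro bexI[of _ "\<zero>\<^bsub>M\<^esub>"]) auto
    ultimately have "x \<in> p y" by simp
    then obtain v where "v \<in> N" "x = v \<oplus>\<^bsub>M\<^esub> y" unfolding mem by blast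
    then show "x \<ominus>\<^bsub>M\<^esub> y \<in> N" using xy NM by (simp add: M.minus_eq M.a_assoc M.r_neg)
  next
    assume d: "x \<ominus>\<^bsub>M\<^esub> y \<in> N"
    have x: "x = (x \<ominus>\<^bsub>M\<^esub> y) \<oplus>\<^bsub>M\<^esub> y" using xy by (simp add: M.minus_eq M.a_assoc M.l_neg)
    then have "x \<in> p y" unfolding mem using d by blast
    then show "p x = p y" unfolding p_def using N.a_repr_independence'[of x y] xy by simp
  qed
  show "carrier (quot_module M N) = p ` carrier M" by (auto simp: quot_module_def A_RCOSETS_def' p_def)
  show "p x \<oplus>\<^bsub>quot_module M N\<^esub> p y = p (x \<oplus>\<^bsub>M\<^esub> y)" if "x \<in> carrier M" "y \<in> carrier M" for x y
    using N.a_rcos_sum[OF that] by (simp add: quot_module_def p_def)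
  show "\<zero>\<^bsub>quot_module M N\<^esub> = p \<zero>\<^bsub>M\<^esub>"
    using NM by (auto simp: quot_module_def set_eq_iff mem)
  show "a \<odot>\<^bsub>quot_module M N\<^esub> p x = p (a \<odot>\<^bsub>M\<^esub> x)" if a: "a \<in> carrier R" and x: "x \<in> carrier M" for a x
  proof -
    have "p (a \<odot>\<^bsub>M\<^esub> z) = p (a \<odot>\<^bsub>M\<^esub> x)" if z: "z \<in> p x" for z
    proof -
      obtain v where v: "v \<in> N" "z = v \<oplus>\<^bsub>M\<^esub> x" using z unfolding mem by blast
      have "a \<odot>\<^bsub>M\<^esub> z \<ominus>\<^bsub>M\<^esub> a \<odot>\<^bsub>M\<^esub> x = a \<odot>\<^bsub>M\<^esub> v"
        using v NM a x by (simp add: smult_r_distr M.minus_eq M.a_assoc M.r_neg)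
      then show ?thesis using eq[of "a \<odot>\<^bsub>M\<^esub> z" "a \<odot>\<^bsub>M\<^esub> x"] submodule_smult[OF N a v(1)] v NM a x by simp
    qed
    moreover have "x \<in> p x" unfolding mem using x submodule_zero[OF N] by (intro bexI[of _ "\<zero>\<^bsub>M\<^esub>"]) auto
    ultimately have "(\<Union>z\<in>p x. p (a \<odot>\<^bsub>M\<^esub> z)) = p (a \<odot>\<^bsub>M\<^esub> x)" by blast
    then show ?thesis by (simp add: quot_module_def p_def)
  qed
qed

lemma quot_left_module:
  assumes N: "submodule N R M"
  shows "left_module R (quot_module M N)"
proof -
  note q = quot_map[OF N]
  show ?thesis
  proof (intro left_module.intro left_module_axioms.intro R.ring_axioms)
    show "abelian_group (quot_module M N)"
    proof (rule abelian_groupI)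
      fix X assume "X \<in> carrier (quot_module M N)"
      then obtain x where "x \<in> carrier M" "X = N +>\<^bsub>M\<^esub> x" unfolding q(1) by blast
      then show "\<exists>Y\<in>carrier (quot_module M N). Y \<oplus>\<^bsub>quot_module M N\<^esub> X = \<zero>\<^bsub>quot_module M N\<^esub>"
        by (intro bexI[of _ "N +>\<^bsub>M\<^esub> (\<ominus>\<^bsub>M\<^esub> x)"]) (simp_all add: q(1,2,4) M.l_neg)
    qed (auto simp: q(1,2,4) M.a_ac)
  qed (auto simp: q(1,2,3) smult_l_distr smult_r_distr smult_assoc)
qed

end

context idem_ring
begin

text \<open>The top of \<open>R (E i)\<close>, described by annihilators because these pass to the
  dual and are what \<open>transpose_arrow\<close> asks for.\<close>

definition simple_at :: "int \<Rightarrow> ('a, 'x) module \<Rightarrow> bool" where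
  "simple_at i X \<longleftrightarrow> left_module R X \<and> carrier X \<noteq> {\<zero>\<^bsub>X\<^esub>} \<and>
    (\<forall>c \<in> J. \<forall>x \<in> carrier X. c \<odot>\<^bsub>X\<^esub> x = \<zero>\<^bsub>X\<^esub>) \<and>
    (\<forall>j. \<forall>x \<in> carrier X. j mod int n \<noteq> i mod int n \<longrightarrow> E j \<odot>\<^bsub>X\<^esub> x = \<zero>\<^bsub>X\<^esub>) \<and>
    (\<forall>x \<in> carrier X. \<forall>y \<in> carrier X. x \<noteq> \<zero>\<^bsub>X\<^esub> \<longrightarrow> (\<exists>b \<in> carrier R. y = b \<odot>\<^bsub>X\<^esub> x))"

text \<open>An element \<open>r x\<close> outside \<open>J x\<close> has
  \<open>r \<otimes> E i\<close> outside \<open>J\<close>, so a left inverse recovers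
  \<open>x\<close>. Hence \<open>J x\<close> is the unique maximal submodule and equals the
  radical.\<close>

lemma simple_at_cyclic_top:
  assumes M: "left_module R M" and x: "x \<in> carrier M" "E i \<odot>\<^bsub>M\<^esub> x = x" "x \<noteq> \<zero>\<^bsub>M\<^esub>"
    and gen: "\<And>y. y \<in> carrier M \<Longrightarrow> \<exists>r \<in> carrier R. y = r \<odot>\<^bsub>M\<^esub> x"
  shows "simple_at i (module_top R M)"
proof -
  interpret M: left_module R M by fact
  define W where "W = {c \<odot>\<^bsub>M\<^esub> x | c. c \<in> J}"
  have W: "submodule W R M" unfolding W_def by (rule J_cyclic_submodule[OF M x(1)])
  have xW: "x \<notin> W"
  proof
    assume "x \<in> W"
    then obtain c where c: "c \<in> J" "x = c \<odot>\<^bsub>M\<^esub> x" by (auto simp: W_def)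
    have "x \<ominus>\<^bsub>M\<^esub> c \<odot>\<^bsub>M\<^esub> x \<in> {\<zero>\<^bsub>M\<^esub>}" unfolding c(2)[symmetric] using x(1) by (simp add: M.M.minus_eq M.M.r_neg)
    then have "x \<in> {\<zero>\<^bsub>M\<^esub>}" by (rule quasi_regular[OF M M.zero_submodule x(1,2) c(1)])
    then show False using x(3) by blast
  qed
  have act: "\<exists>c \<in> carrier R. c \<odot>\<^bsub>M\<^esub> y = x" if y: "y \<in> carrier M" "y \<notin> W" for y
  proof -
    obtain r where r: "r \<in> carrier R" "y = r \<odot>\<^bsub>M\<^esub> x" using gen[OF y(1)] by blast
    have e: "(r \<otimes> E i) \<odot>\<^bsub>M\<^esub> x = y" using r x by (simp add: M.smult_assoc)
    then have "r \<otimes> E i \<notin> J" using y(2) by (auto simp: W_def)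
    then obtain c where c: "c \<in> carrier R" "c \<otimes> (r \<otimes> E i) = E i"
      using left_inverse[of "r \<otimes> E i" i] r(1) by (auto simp: m_assoc)
    have "c \<odot>\<^bsub>M\<^esub> y = (c \<otimes> (r \<otimes> E i)) \<odot>\<^bsub>M\<^esub> x" unfolding e[symmetric] using c(1) r(1) x(1) by (simp add: M.smult_assoc)
    then show ?thesis using c x(2) by auto
  qed
  have proper: "L \<subseteq> W" if L: "submodule L R M" "L \<noteq> carrier M" for L
  proof (rule ccontr)
    assume "\<not> L \<subseteq> W"
    then obtain y where y: "y \<in> L" "y \<notin> W" by blast
    then obtain c where "c \<in> carrier R" "c \<odot>\<^bsub>M\<^esub> y = x" using act submodule_in[OF L(1)] by blast
    then have xL: "x \<in> L" using submodule_smult[OF L(1) _ y(1)] by metis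
    have "z \<in> L" if "z \<in> carrier M" for z using gen[OF that] submodule_smult[OF L(1) _ xL] by blast
    then show False using L(2) submodule_subset[OF L(1)] by blast
  qed
  have WM: "W \<noteq> carrier M" using xW x(1) by blast
  have mx: "maximal_submodule R M L \<longleftrightarrow> L = W" for L
  proof
    assume L: "maximal_submodule R M L"
    then have "L \<subseteq> W" by (intro proper) (auto simp: maximal_submodule_def)
    then show "L = W" using L W WM unfolding maximal_submodule_def by blast
  next
    assume L: "L = W"
    show "maximal_submodule R M L" unfolding maximal_submodule_def L using W WM proper by blast
  qed
  have rad: "module_rad R M = W" using submodule_subset[OF W] by (auto simp: module_rad_def mx)
  note q = M.quot_map[OF W]
  let ?X = "quot_module M W" and ?p = "\<lambda>y. W +>\<^bsub>M\<^esub> y"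
  have zero_iff: "?p y = \<zero>\<^bsub>?X\<^esub> \<longleftrightarrow> y \<in> W" if "y \<in> carrier M" for y
  proof -
    have "y \<ominus>\<^bsub>M\<^esub> \<zero>\<^bsub>M\<^esub> = y" using that M.M.minus_equality[of "\<zero>\<^bsub>M\<^esub>" "\<zero>\<^bsub>M\<^esub>"] by (simp add: M.M.minus_eq)
    then show ?thesis using q(5)[OF that M.M.zero_closed] by (simp add: q(4))
  qed
  have Jy: "c \<odot>\<^bsub>M\<^esub> y \<in> W" if cy: "c \<in> J" "y \<in> carrier M" for c y
  proof -
    obtain r where r: "r \<in> carrier R" "y = r \<odot>\<^bsub>M\<^esub> x" using gen[OF cy(2)] by blast
    then have "c \<odot>\<^bsub>M\<^esub> y = (c \<otimes> r) \<odot>\<^bsub>M\<^esub> x" using J_in[OF cy(1)] x(1) by (simp add: M.smult_assoc)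
    then show ?thesis using J_right[OF r(1) cy(1)] by (auto simp: W_def)
  qed
  have "simple_at i ?X" unfolding simple_at_def
  proof (intro conjI ballI allI impI)
    show "left_module R ?X" by (rule M.quot_left_module[OF W])
    have "?p x \<in> carrier ?X" "?p x \<noteq> \<zero>\<^bsub>?X\<^esub>" using x(1) xW zero_iff[OF x(1)] by (auto simp: q(1))
    then show "carrier ?X \<noteq> {\<zero>\<^bsub>?X\<^esub>}" by blast
    show "c \<odot>\<^bsub>?X\<^esub> Y = \<zero>\<^bsub>?X\<^esub>" if c: "c \<in> J" and Y: "Y \<in> carrier ?X" for c Y
    proof -
      obtain y where y: "y \<in> carrier M" "Y = ?p y" using Y unfolding q(1) by blast
      then show ?thesis using Jy[OF c y(1)] J_in[OF c] zero_iff[of "c \<odot>\<^bsub>M\<^esub> y"] by (simp add: q(3))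
    qed
    show "E j \<odot>\<^bsub>?X\<^esub> Y = \<zero>\<^bsub>?X\<^esub>" if Y: "Y \<in> carrier ?X" and j: "j mod int n \<noteq> i mod int n" for j Y
    proof -
      obtain y where y: "y \<in> carrier M" "Y = ?p y" using Y unfolding q(1) by blast
      obtain r where r: "r \<in> carrier R" "y = r \<odot>\<^bsub>M\<^esub> x" using gen[OF y(1)] by blast
      have "E j \<odot>\<^bsub>M\<^esub> y = (E j \<otimes> r \<otimes> E i) \<odot>\<^bsub>M\<^esub> x" using r x by (simp add: M.smult_assoc)
      then have "E j \<odot>\<^bsub>M\<^esub> y \<in> W" using E_off[OF r(1) j] by (auto simp: W_def)
      then show ?thesis using y zero_iff[of "E j \<odot>\<^bsub>M\<^esub> y"] by (simp add: q(3))
    qed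
    show "\<exists>b\<in>carrier R. Z = b \<odot>\<^bsub>?X\<^esub> Y" if Y: "Y \<in> carrier ?X" and Z: "Z \<in> carrier ?X" and Y0: "Y \<noteq> \<zero>\<^bsub>?X\<^esub>" for Y Z
    proof -
      obtain y where y: "y \<in> carrier M" "Y = ?p y" using Y unfolding q(1) by blast
      obtain z where z: "z \<in> carrier M" "Z = ?p z" using Z unfolding q(1) by blast
      obtain c where c: "c \<in> carrier R" "c \<odot>\<^bsub>M\<^esub> y = x" using act[OF y(1)] Y0 y zero_iff by blast
      obtain r where r: "r \<in> carrier R" "z = r \<odot>\<^bsub>M\<^esub> x" using gen[OF z(1)] by blast
      have "(r \<otimes> c) \<odot>\<^bsub>?X\<^esub> Y = ?p ((r \<otimes> c) \<odot>\<^bsub>M\<^esub> y)" using r(1) c(1) y by (simp add: q(3))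
      also have "\<dots> = Z" using r c y(1) z(2) by (simp add: M.smult_assoc)
      finally show ?thesis using r(1) c(1) by (intro bexI[of _ "r \<otimes> c"]) simp_all
    qed
  qed
  then show ?thesis unfolding rad .
qed

end

lemma restrict_scalars_simps [simp]:
  "carrier (restrict_scalars \<phi> M) = carrier M" "zero (restrict_scalars \<phi> M) = zero M"
  "add (restrict_scalars \<phi> M) = add M" "smult (restrict_scalars \<phi> M) r x = smult M (\<phi> r) x"
  by (simp_all add: restrict_scalars_def)

lemma dual_module_simps [simp]:
  "carrier (dual_module K \<phi> D M) = module_hom K (restrict_scalars \<phi> M) D"
  "zero (dual_module K \<phi> D M) = (\<lambda>x\<in>carrier M. zero D)"
  "add (dual_module K \<phi> D M) f g = (\<lambda>x\<in>carrier M. f x \<oplus>\<^bsub>D\<^esub> g x)"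
  "smult (dual_module K \<phi> D M) a f = (\<lambda>x\<in>carrier M. f (a \<odot>\<^bsub>M\<^esub> x))"
  by (simp_all add: dual_module_def)

context artin_algebra
begin

lemma scalar_closed: "r \<in> carrier K \<Longrightarrow> \<phi> r \<in> carrier \<Lambda>"
  using structure_hom by (rule ring_hom_closed)

lemma restrict_scalars_left_module:
  assumes M: "left_module \<Lambda> M"
  shows "left_module K (restrict_scalars \<phi> M)"
proof -
  interpret M: left_module \<Lambda> M by fact
  interpret K: cring K using artinian by (simp add: artinian_cring_def)
  show ?thesis
  proof (intro left_module.intro left_module_axioms.intro K.ring_axioms)
    show "abelian_group (restrict_scalars \<phi> M)"
      by (rule abelian_groupI) (auto simp: M.M.a_ac intro: M.M.l_neg)
  qed (auto simp: scalar_closed ring_hom_add[OF structure_hom] ring_hom_mult[OF structure_hom]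
      ring_hom_one[OF structure_hom] M.smult_l_distr M.smult_r_distr M.smult_assoc)
qed

text \<open>\<open>\<Lambda>\<close> acts by precomposition, which reverses products; centrality of
  the scalars keeps the result linear over \<open>K\<close>.\<close>

lemma dual_left_module:
  assumes M: "left_module \<Lambda> M" and D: "left_module K D"
  shows "left_module (op_ring \<Lambda>) (dual_module K \<phi> D M)"
proof -
  interpret M: left_module \<Lambda> M by fact
  interpret D: left_module K D by fact
  note rM = restrict_scalars_left_module[OF M]
  let ?H = "module_hom K (restrict_scalars \<phi> M) D"
  have c: "f x \<in> carrier D" if "f \<in> ?H" "x \<in> carrier M" for f x using module_hom_closed[OF that(1), of x] that(2) by simp
  have fa: "f (x \<oplus>\<^bsub>M\<^esub> y) = f x \<oplus>\<^bsub>D\<^esub> f y" if "f \<in> ?H" "x \<in> carrier M" "y \<in> carrier M" for f x y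
    using module_hom_add[OF that(1), of x y] that by simp
  have fs: "f (\<phi> r \<odot>\<^bsub>M\<^esub> x) = r \<odot>\<^bsub>D\<^esub> f x" if "f \<in> ?H" "r \<in> carrier K" "x \<in> carrier M" for f r x
    using module_hom_smult[OF that(1), of r x] that by simp
  have homI: "(\<lambda>x\<in>carrier M. F x) \<in> ?H"
    if "\<And>x. x \<in> carrier M \<Longrightarrow> F x \<in> carrier D"
      "\<And>x y. \<lbrakk>x \<in> carrier M; y \<in> carrier M\<rbrakk> \<Longrightarrow> F (x \<oplus>\<^bsub>M\<^esub> y) = F x \<oplus>\<^bsub>D\<^esub> F y"
      "\<And>r x. \<lbrakk>r \<in> carrier K; x \<in> carrier M\<rbrakk> \<Longrightarrow> F (\<phi> r \<odot>\<^bsub>M\<^esub> x) = r \<odot>\<^bsub>D\<^esub> F x" for F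
    using module_homI[of "restrict_scalars \<phi> M" F D K, OF _ _ _ rM] that by simp
  have ext: "f \<in> extensional (carrier M)" if "f \<in> ?H" for f using that by (auto simp: module_hom_def PiE_iff)
  have ad: "(\<lambda>x\<in>carrier M. f x \<oplus>\<^bsub>D\<^esub> g x) \<in> ?H" if "f \<in> ?H" "g \<in> ?H" for f g
    by (rule homI) (simp_all add: c[OF that(1)] c[OF that(2)] fa[OF that(1)] fa[OF that(2)] fs[OF that(1)]
        fs[OF that(2)] D.M.a_ac D.smult_r_distr)
  have ze: "(\<lambda>x\<in>carrier M. \<zero>\<^bsub>D\<^esub>) \<in> ?H" by (rule homI) (auto simp: D.smult_zero_right)
  have sm: "(\<lambda>x\<in>carrier M. f (a \<odot>\<^bsub>M\<^esub> x)) \<in> ?H" if "f \<in> ?H" "a \<in> carrier \<Lambda>" for f a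
  proof (rule homI)
    fix r x assume rx: "r \<in> carrier K" "x \<in> carrier M"
    have "a \<odot>\<^bsub>M\<^esub> (\<phi> r \<odot>\<^bsub>M\<^esub> x) = \<phi> r \<odot>\<^bsub>M\<^esub> (a \<odot>\<^bsub>M\<^esub> x)"
      using rx that(2) scalar_closed central by (simp add: M.smult_assoc[symmetric])
    then show "f (a \<odot>\<^bsub>M\<^esub> (\<phi> r \<odot>\<^bsub>M\<^esub> x)) = r \<odot>\<^bsub>D\<^esub> f (a \<odot>\<^bsub>M\<^esub> x)" using fs that rx by simp
  qed (use that c fa in \<open>auto simp: M.smult_r_distr\<close>)
  show ?thesis
  proof (intro left_module.intro left_module_axioms.intro ring_op)
    show "abelian_group (dual_module K \<phi> D M)"
    proof (rule abelian_groupI)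
      fix f assume "f \<in> carrier (dual_module K \<phi> D M)"
      then have f: "f \<in> ?H" by simp
      show "\<zero>\<^bsub>dual_module K \<phi> D M\<^esub> \<oplus>\<^bsub>dual_module K \<phi> D M\<^esub> f = f"
        using ext[OF f] c[OF f] by (auto intro!: restrict_eqI)
      have "(\<lambda>x\<in>carrier M. \<ominus>\<^bsub>D\<^esub> f x) \<in> ?H"
        by (rule homI) (use c[OF f] fa[OF f] fs[OF f] in
            \<open>auto simp: D.M.minus_add D.neg_eq_smult D.smult_r_distr D.smult_assoc[symmetric] D.R.l_minus D.R.r_minus\<close>)
      then show "\<exists>g\<in>carrier (dual_module K \<phi> D M). g \<oplus>\<^bsub>dual_module K \<phi> D M\<^esub> f = \<zero>\<^bsub>dual_module K \<phi> D M\<^esub>"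
        using c[OF f] by (intro bexI[of _ "\<lambda>x\<in>carrier M. \<ominus>\<^bsub>D\<^esub> f x"]) (auto simp: D.M.l_neg intro!: restrict_ext)
    qed (auto simp: ad ze c D.M.a_ac intro!: restrict_ext)
    show "\<one>\<^bsub>op_ring \<Lambda>\<^esub> \<odot>\<^bsub>dual_module K \<phi> D M\<^esub> f = f" if "f \<in> carrier (dual_module K \<phi> D M)" for f
      using that ext[of f] by (auto intro!: restrict_eqI)
  qed (auto simp: sm c fa M.smult_l_distr M.smult_assoc intro!: restrict_ext)
qed

end

text \<open>The dual inherits the annihilators of \<open>X\<close>, so
  \<open>transpose_arrow\<close> applies over the opposite ring. Reading its conclusion back in
  \<open>\<Lambda>\<close> exchanges the sides.\<close>

lemma (in artin_algebra) translate_arrow: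
  fixes X :: "('a, 'x) module" and Y :: "('a, 'y) module"
  assumes IR: "idem_ring \<Lambda> n E J"
    and X: "idem_ring.simple_at \<Lambda> n E J i X" and Y: "idem_ring.simple_at \<Lambda> n E J l Y"
    and tr: "is_inverse_AR_translate K \<phi> \<Lambda> X Y"
  obtains a where "a \<in> J" "E i \<otimes>\<^bsub>\<Lambda>\<^esub> a = a" "a \<otimes>\<^bsub>\<Lambda>\<^esub> E l = a"
    "\<And>x. x \<in> J \<Longrightarrow> \<exists>r \<in> carrier \<Lambda>. x \<otimes>\<^bsub>\<Lambda>\<^esub> E l = r \<otimes>\<^bsub>\<Lambda>\<^esub> a"
    "\<And>x. x \<in> J \<Longrightarrow> \<exists>r \<in> carrier \<Lambda>. E i \<otimes>\<^bsub>\<Lambda>\<^esub> x = a \<otimes>\<^bsub>\<Lambda>\<^esub> r"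
proof -
  interpret I: idem_ring \<Lambda> n E J by fact
  interpret O: idem_ring "op_ring \<Lambda>" n E J by (rule I.idem_ring_op)
  obtain D :: "'k fmod" and \<iota> where D: "injective_envelope K (module_top K (regular_module K)) D \<iota>"
    and tp: "is_transpose (op_ring \<Lambda>) (dual_module K \<phi> D X) Y"
    using tr by (auto simp: is_inverse_AR_translate_def)
  have Dl: "left_module K D" using D by (simp add: injective_envelope_def injective_def fg_module_def)
  interpret D: left_module K D by fact
  have Xl: "left_module \<Lambda> X" and Yl: "left_module \<Lambda> Y" using X Y by (auto simp: I.simple_at_def)
  interpret X: left_module \<Lambda> X by fact
  have z: "f \<zero>\<^bsub>X\<^esub> = \<zero>\<^bsub>D\<^esub>" if "f \<in> module_hom K (restrict_scalars \<phi> X) D" for f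
    using module_hom_zero[OF that restrict_scalars_left_module[OF Xl] Dl] by simp
  show ?thesis
  proof (rule O.transpose_arrow[OF dual_left_module[OF Xl Dl] _ _ _ _ _ _ _ tp, of i l])
    show "c \<odot>\<^bsub>dual_module K \<phi> D X\<^esub> f = \<zero>\<^bsub>dual_module K \<phi> D X\<^esub>" if "c \<in> J" "f \<in> carrier (dual_module K \<phi> D X)" for c f
      using X that z[of f] by (auto simp: I.simple_at_def intro!: restrict_ext)
    show "E j \<odot>\<^bsub>dual_module K \<phi> D X\<^esub> f = \<zero>\<^bsub>dual_module K \<phi> D X\<^esub>"
      if "j mod int n \<noteq> i mod int n" "f \<in> carrier (dual_module K \<phi> D X)" for j f
      using X that z[of f] by (auto simp: I.simple_at_def intro!: restrict_ext)
    show "left_module (op_ring (op_ring \<Lambda>)) Y" using Yl by simp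
    show "carrier Y \<noteq> {\<zero>\<^bsub>Y\<^esub>}" using Y by (simp add: I.simple_at_def)
    show "c \<odot>\<^bsub>Y\<^esub> x = \<zero>\<^bsub>Y\<^esub>" if "c \<in> J" "x \<in> carrier Y" for c x
      using Y that by (simp add: I.simple_at_def)
    show "E j \<odot>\<^bsub>Y\<^esub> x = \<zero>\<^bsub>Y\<^esub>" if "j mod int n \<noteq> l mod int n" "x \<in> carrier Y" for j x
      using Y that by (simp add: I.simple_at_def)
    show "\<exists>b\<in>carrier (op_ring \<Lambda>). y = b \<odot>\<^bsub>Y\<^esub> x" if "x \<in> carrier Y" "x \<noteq> \<zero>\<^bsub>Y\<^esub>" "y \<in> carrier Y" for x y
      using Y that by (simp add: I.simple_at_def)
    fix a assume a: "a \<in> J" "E l \<otimes>\<^bsub>op_ring \<Lambda>\<^esub> a = a" "a \<otimes>\<^bsub>op_ring \<Lambda>\<^esub> E i = a"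
      "\<And>x. x \<in> J \<Longrightarrow> \<exists>r\<in>carrier (op_ring \<Lambda>). x \<otimes>\<^bsub>op_ring \<Lambda>\<^esub> E i = r \<otimes>\<^bsub>op_ring \<Lambda>\<^esub> a"
      "\<And>x. x \<in> J \<Longrightarrow> \<exists>r\<in>carrier (op_ring \<Lambda>). E l \<otimes>\<^bsub>op_ring \<Lambda>\<^esub> x = a \<otimes>\<^bsub>op_ring \<Lambda>\<^esub> r"
    show thesis
    proof (rule that[of a])
      show "a \<in> J" "E i \<otimes>\<^bsub>\<Lambda>\<^esub> a = a" "a \<otimes>\<^bsub>\<Lambda>\<^esub> E l = a" using a(1,2,3) by simp_all
      show "\<exists>r \<in> carrier \<Lambda>. x \<otimes>\<^bsub>\<Lambda>\<^esub> E l = r \<otimes>\<^bsub>\<Lambda>\<^esub> a" if "x \<in> J" for x using a(5)[OF that] by simp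
      show "\<exists>r \<in> carrier \<Lambda>. E i \<otimes>\<^bsub>\<Lambda>\<^esub> x = a \<otimes>\<^bsub>\<Lambda>\<^esub> r" if "x \<in> J" for x using a(4)[OF that] by simp
    qed
  qed
qed

section \<open>From a Kupisch series to arrows\<close>

text \<open>Decompose \<open>\<one>\<close> into components \<open>e i\<close>. For \<open>x\<close>
  in \<open>N j\<close>, both \<open>x\<close> itself and the family \<open>x \<otimes> e i\<close>
  decompose \<open>x\<close>, so uniqueness yields \<open>x \<otimes> e j = x\<close> and zero
  elsewhere.\<close>

lemma (in ring) decomposition_idempotents:
  assumes dec: "direct_decomposition R (regular_module R) I N"
  obtains e where "\<And>i. i \<in> I \<Longrightarrow> e i \<in> carrier R \<and> N i = lgen (e i) \<and> e i \<otimes> e i = e i"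
    "\<And>i j. \<lbrakk>i \<in> I; j \<in> I; i \<noteq> j\<rbrakk> \<Longrightarrow> e i \<otimes> e j = \<zero>" "(\<Oplus>i\<in>I. e i) = \<one>" "finite I"
proof -
  have fin: "finite I" and sub: "\<And>i. i \<in> I \<Longrightarrow> left_ideal (N i) R"
    and uniq: "\<And>x f g. \<lbrakk>x \<in> carrier R; f \<in> Pi\<^sub>E I N; g \<in> Pi\<^sub>E I N; x = (\<Oplus>i\<in>I. f i); x = (\<Oplus>i\<in>I. g i)\<rbrakk> \<Longrightarrow> f = g"
    using dec unfolding direct_decomposition_def finsum_regular_module regular_module_simps by blast+
  obtain e where e: "e \<in> Pi\<^sub>E I N" "\<one> = (\<Oplus>i\<in>I. e i)"
    using dec one_closed unfolding direct_decomposition_def finsum_regular_module regular_module_simps by metis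
  have eN: "e i \<in> N i" "e i \<in> carrier R" if "i \<in> I" for i
    using e(1) that left_ideal_in[OF sub[OF that]] by (auto simp: PiE_iff)
  have key: "x \<otimes> e i = (if i = j then x else \<zero>)" if j: "j \<in> I" and x: "x \<in> N j" and i: "i \<in> I" for i j x
  proof -
    have xc: "x \<in> carrier R" using left_ideal_in[OF sub[OF j] x] .
    have "(\<lambda>i\<in>I. x \<otimes> e i) = (\<lambda>i\<in>I. if i = j then x else \<zero>)"
    proof (rule uniq[OF xc])
      show "(\<lambda>i\<in>I. x \<otimes> e i) \<in> Pi\<^sub>E I N" using left_ideal_mult[OF sub xc] eN by auto
      show "(\<lambda>i\<in>I. if i = j then x else \<zero>) \<in> Pi\<^sub>E I N" using x left_ideal_zero[OF sub] by auto
      have "x = x \<otimes> (\<Oplus>i\<in>I. e i)" using r_one[OF xc] unfolding e(2) by simp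
      also have "\<dots> = (\<Oplus>i\<in>I. x \<otimes> e i)" using xc eN fin by (intro finsum_rdistr) auto
      also have "\<dots> = (\<Oplus>i\<in>I. (\<lambda>i\<in>I. x \<otimes> e i) i)" using xc eN by (intro finsum_cong') auto
      finally show "x = (\<Oplus>i\<in>I. (\<lambda>i\<in>I. x \<otimes> e i) i)" .
      have "(\<Oplus>i\<in>I. (\<lambda>i\<in>I. if i = j then x else \<zero>) i) = (\<lambda>i\<in>I. if i = j then x else \<zero>) j"
        using j xc fin by (intro finsum_single) auto
      then show "x = (\<Oplus>i\<in>I. (\<lambda>i\<in>I. if i = j then x else \<zero>) i)" using j by simp
    qed
    from fun_cong[OF this, of i] show ?thesis using i by simp
  qed
  show ?thesis
  proof (rule that[of e])
    fix i assume i: "i \<in> I"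
    have "N i \<subseteq> lgen (e i)"
    proof
      fix x assume x: "x \<in> N i"
      have "x = x \<otimes> e i" "x \<in> carrier R" using key[OF i x i] left_ideal_in[OF sub[OF i] x] by simp_all
      then show "x \<in> lgen (e i)" unfolding lgen_def by blast
    qed
    then show "e i \<in> carrier R \<and> N i = lgen (e i) \<and> e i \<otimes> e i = e i"
      using lgen_minimal[OF sub[OF i] eN(1)[OF i]] key[OF i eN(1)[OF i] i] eN(2)[OF i] by auto
  next
    fix i j assume ij: "i \<in> I" "j \<in> I" "i \<noteq> j"
    show "e i \<otimes> e j = \<zero>" using key[OF ij(1) eN(1)[OF ij(1)] ij(2)] ij(3) by simp
  qed (use e(2) fin in auto)
qed

text \<open>Cyclic submodules are comparable, so a finite set has an element generating all
  others.\<close>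

lemma uniserial_dominating:
  assumes U: "uniserial R M" and S: "finite S" "S \<noteq> {}" "S \<subseteq> carrier M"
  shows "\<exists>s \<in> S. \<forall>t \<in> S. \<exists>r \<in> carrier R. t = r \<odot>\<^bsub>M\<^esub> s"
proof -
  have M: "left_module R M" using U by (simp add: uniserial_def)
  interpret M: left_module R M by fact
  have self: "\<exists>r \<in> carrier R. t = r \<odot>\<^bsub>M\<^esub> t" if "t \<in> carrier M" for t
    using that by (intro bexI[of _ "\<one>\<^bsub>R\<^esub>"]) auto
  show ?thesis using S
  proof (induction S rule: finite_ne_induct)
    case (singleton s)
    then show ?case using self[of s] by auto
  next
    case (insert x S)
    then obtain s where s: "s \<in> S" "\<forall>t \<in> S. \<exists>r \<in> carrier R. t = r \<odot>\<^bsub>M\<^esub> s" by auto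
    have xs: "x \<in> carrier M" "s \<in> carrier M" using insert.prems s(1) by auto
    let ?C = "\<lambda>y. {r \<odot>\<^bsub>M\<^esub> y | r. r \<in> carrier R}"
    have "?C x \<subseteq> ?C s \<or> ?C s \<subseteq> ?C x"
      using U M.cyclic_submodule[OF xs(1)] M.cyclic_submodule[OF xs(2)] unfolding uniserial_def by blast
    then show ?case
    proof
      assume "?C x \<subseteq> ?C s"
      then have "\<exists>r \<in> carrier R. x = r \<odot>\<^bsub>M\<^esub> s" using self[OF xs(1)] by blast
      then show ?thesis using s by (intro bexI[of _ s]) auto
    next
      assume "?C s \<subseteq> ?C x"
      then obtain q where q: "q \<in> carrier R" "s = q \<odot>\<^bsub>M\<^esub> x" using self[OF xs(2)] by blast
      have "\<exists>r \<in> carrier R. t = r \<odot>\<^bsub>M\<^esub> x" if t: "t \<in> S" for t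
      proof -
        obtain r where "r \<in> carrier R" "t = r \<odot>\<^bsub>M\<^esub> s" using s(2) t by blast
        then show ?thesis using q xs(1) by (intro bexI[of _ "r \<otimes>\<^bsub>R\<^esub> q"]) (auto simp: M.smult_assoc)
      qed
      then show ?thesis using self[OF xs(1)] by (intro bexI[of _ x]) auto
    qed
  qed
qed

text \<open>This takes the place of a Krull-Schmidt argument. \<open>P\<close> is generated by one
  \<open>x\<close>, and in turn by one of the \<open>e i x\<close>, so it is a quotient of
  \<open>R (e i)\<close>. The quotient map splits, and indecomposability makes its kernel
  zero.\<close>

lemma (in ring) uniserial_projective_iso:
  assumes P: "projective R P" and U: "uniserial R P" and P0: "carrier P \<noteq> {\<zero>\<^bsub>P\<^esub>}"
    and I: "finite I" "(\<Oplus>i\<in>I. e i) = \<one>" "\<And>i. i \<in> I \<Longrightarrow> e i \<in> carrier R \<and> e i \<otimes> e i = e i"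
    and ind: "\<And>i. i \<in> I \<Longrightarrow> indecomposable R (ideal_module R (lgen (e i)))"
  shows "\<exists>i \<in> I. module_iso R (ideal_module R (lgen (e i))) P"
proof -
  have fg: "fg_module R P" using P by (simp add: projective_def)
  have lm: "left_module R P" by (rule fg_left_module[OF fg])
  interpret P: left_module R P by fact
  obtain S where S: "finite S" "S \<subseteq> carrier P" "\<And>N. submodule N R P \<Longrightarrow> S \<subseteq> N \<Longrightarrow> N = carrier P"
    using fg_moduleE[OF fg] by metis
  let ?C = "\<lambda>y. {r \<odot>\<^bsub>P\<^esub> y | r. r \<in> carrier R}"
  have "S \<noteq> {}" using S(3)[OF P.zero_submodule] P0 by auto
  then obtain x where x: "x \<in> S" "\<forall>t \<in> S. \<exists>r \<in> carrier R. t = r \<odot>\<^bsub>P\<^esub> x"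
    using uniserial_dominating[OF U S(1) _ S(2)] by blast
  have xc: "x \<in> carrier P" using x(1) S(2) by blast
  have Cx: "?C x = carrier P" using x(2) by (intro S(3)[OF P.cyclic_submodule[OF xc]]) blast
  have sumx: "x = (\<Oplus>\<^bsub>P\<^esub>i\<in>I. e i \<odot>\<^bsub>P\<^esub> x)"
    using P.finsum_smult[of I e x] I xc by simp
  have "I \<noteq> {}"
  proof
    assume "I = {}"
    then have "\<one> = \<zero>" using I(2) by simp
    then have "y = \<zero>\<^bsub>P\<^esub>" if "y \<in> carrier P" for y using P.smult_one[OF that] P.smult_zero_left[OF that] by simp
    then show False using P0 P.M.zero_closed by blast
  qed
  then have "\<exists>s \<in> (\<lambda>i. e i \<odot>\<^bsub>P\<^esub> x) ` I. \<forall>t \<in> (\<lambda>i. e i \<odot>\<^bsub>P\<^esub> x) ` I. \<exists>r \<in> carrier R. t = r \<odot>\<^bsub>P\<^esub> s"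
    using I xc by (intro uniserial_dominating[OF U]) auto
  then obtain i where i: "i \<in> I" "\<And>k. k \<in> I \<Longrightarrow> \<exists>r \<in> carrier R. e k \<odot>\<^bsub>P\<^esub> x = r \<odot>\<^bsub>P\<^esub> (e i \<odot>\<^bsub>P\<^esub> x)" by blast
  define y where "y = e i \<odot>\<^bsub>P\<^esub> x"
  have ei: "e i \<in> carrier R" "e i \<otimes> e i = e i" using I(3)[OF i(1)] by auto
  have y: "y \<in> carrier P" "e i \<odot>\<^bsub>P\<^esub> y = y" using ei xc by (auto simp: y_def P.smult_assoc[symmetric])
  have Cy: "submodule (?C y) R P" by (rule P.cyclic_submodule[OF y(1)])
  have "(\<Oplus>\<^bsub>P\<^esub>i\<in>I. e i \<odot>\<^bsub>P\<^esub> x) \<in> ?C y"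
    using i(2) by (intro P.submodule_finsum[OF Cy I(1)]) (auto simp: y_def)
  then have "x \<in> ?C y" using sumx by (simp only:)
  then obtain q where q: "q \<in> carrier R" "x = q \<odot>\<^bsub>P\<^esub> y" by blast
  have gen: "\<exists>r \<in> carrier R. z = r \<odot>\<^bsub>P\<^esub> y" if z: "z \<in> carrier P" for z
  proof -
    have "z \<in> ?C x" unfolding Cx by (rule z)
    then obtain r where "r \<in> carrier R" "z = r \<odot>\<^bsub>P\<^esub> x" by blast
    then show ?thesis using q y(1) by (intro bexI[of _ "r \<otimes> q"]) (simp_all add: P.smult_assoc)
  qed
  let ?L = "ideal_module R (lgen (e i))"
  have L: "left_module R ?L" by (rule ideal_module_left_module[OF lgen_left_ideal[OF ei(1)]])
  interpret L: left_module R ?L by fact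
  have lE: "r \<in> carrier R \<and> r \<otimes> e i = r" if "r \<in> lgen (e i)" for r using that ei by (auto simp: lgen_def m_assoc)
  define f where "f = (\<lambda>r\<in>carrier ?L. r \<odot>\<^bsub>P\<^esub> y)"
  have f: "f \<in> module_hom R ?L P" unfolding f_def
    by (rule module_homI[OF _ _ _ L]) (use lE y(1) in \<open>auto simp: P.smult_l_distr P.smult_assoc\<close>)
  have "carrier P \<subseteq> f ` carrier ?L"
  proof
    fix z assume "z \<in> carrier P"
    then obtain r where r: "r \<in> carrier R" "z = r \<odot>\<^bsub>P\<^esub> y" using gen by blast
    have "r \<otimes> e i \<in> lgen (e i)" using r(1) by (auto simp: lgen_def)
    moreover have "z = (r \<otimes> e i) \<odot>\<^bsub>P\<^esub> y" using r y ei(1) by (simp add: P.smult_assoc)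
    ultimately show "z \<in> f ` carrier ?L" by (intro image_eqI[of _ _ "r \<otimes> e i"]) (simp_all add: f_def)
  qed
  then have fe: "f \<in> module_epi R ?L P" by (rule module_epiI[OF f])
  have id: "(\<lambda>x\<in>carrier P. x) \<in> module_hom R P P" by (rule module_homI[OF _ _ _ lm]) auto
  obtain s where s: "s \<in> module_hom R P ?L" "\<And>x. x \<in> carrier P \<Longrightarrow> f (s x) = (\<lambda>x\<in>carrier P. x) x"
    using projective_lift[OF P ideal_module_fg[OF ei(1)] fg fe id] by blast
  have fs: "f (s x) = x" if "x \<in> carrier P" for x using s(2)[OF that] that by simp
  define A B where "A = a_kernel ?L P f" and "B = s ` carrier P"
  have A: "submodule A R ?L" unfolding A_def by (rule kernel_submodule[OF f L lm])
  have B: "submodule B R ?L" unfolding B_def by (rule image_submodule[OF s(1) lm L P.carrier_submodule])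
  have s0: "s \<zero>\<^bsub>P\<^esub> = \<zero>\<^bsub>?L\<^esub>" by (rule module_hom_zero[OF s(1) lm L])
  have AB: "A \<inter> B = {\<zero>\<^bsub>?L\<^esub>}"
  proof -
    have "z = \<zero>\<^bsub>?L\<^esub>" if z: "z \<in> A" "z \<in> B" for z
    proof -
      obtain p where p: "p \<in> carrier P" "z = s p" using z(2) by (auto simp: B_def)
      have "p = \<zero>\<^bsub>P\<^esub>" using z(1) fs[OF p(1)] p(2) by (simp add: A_def a_kernel_def')
      then show ?thesis using p(2) s0 by simp
    qed
    then show ?thesis using submodule_zero[OF A] submodule_zero[OF B] by blast
  qed
  have "carrier ?L \<subseteq> A <+>\<^bsub>?L\<^esub> B"
  proof
    fix r assume r: "r \<in> carrier ?L"
    have sr: "s (f r) \<in> carrier ?L" by (rule module_hom_closed[OF s(1) module_hom_closed[OF f r]])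
    have fr: "f r \<in> carrier P" by (rule module_hom_closed[OF f r])
    have d: "r \<ominus>\<^bsub>?L\<^esub> s (f r) \<in> carrier ?L" using r sr by (rule L.M.minus_closed)
    have "f (r \<ominus>\<^bsub>?L\<^esub> s (f r)) = \<zero>\<^bsub>P\<^esub>"
      using module_hom_diff[OF f L lm r sr] fs[OF fr] fr by (simp add: P.M.minus_eq P.M.r_neg)
    then have "r \<ominus>\<^bsub>?L\<^esub> s (f r) \<in> A" using d by (simp add: A_def a_kernel_def')
    moreover have "s (f r) \<in> B" using fr by (simp add: B_def)
    moreover have "r = (r \<ominus>\<^bsub>?L\<^esub> s (f r)) \<oplus>\<^bsub>?L\<^esub> s (f r)"
      unfolding L.M.minus_eq using L.M.a_assoc[OF r L.M.a_inv_closed[OF sr] sr] L.M.l_neg[OF sr] L.M.r_zero[OF r] by metis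
    ultimately show "r \<in> A <+>\<^bsub>?L\<^esub> B" unfolding set_add_def set_mult_def by auto
  qed
  then have AB': "A <+>\<^bsub>?L\<^esub> B = carrier ?L" using submodule_subset[OF L.submodule_sum[OF A B]] by blast
  have "A = {\<zero>\<^bsub>?L\<^esub>} \<or> B = {\<zero>\<^bsub>?L\<^esub>}" using ind[OF i(1)] A B AB AB' unfolding indecomposable_def by blast
  moreover have "B \<noteq> {\<zero>\<^bsub>?L\<^esub>}"
  proof
    assume B0: "B = {\<zero>\<^bsub>?L\<^esub>}"
    have "p = \<zero>\<^bsub>P\<^esub>" if p: "p \<in> carrier P" for p
    proof -
      have "s p = \<zero>\<^bsub>?L\<^esub>" using B0 p unfolding B_def by blast
      then show ?thesis using fs[OF p] module_hom_zero[OF f L lm] by simp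
    qed
    then show False using P0 P.M.zero_closed by blast
  qed
  ultimately have A0: "A = {\<zero>\<^bsub>?L\<^esub>}" by blast
  have "inj_on f (carrier ?L)"
    by (rule inj_on_module_hom[OF f L lm]) (use A0 in \<open>auto simp: A_def a_kernel_def'\<close>)
  then have "module_iso R ?L P" unfolding module_iso_def
    using f fe by (auto simp: bij_betw_def module_epi_def)
  then show ?thesis using i(1) by blast
qed

context artin_algebra
begin

lemma stabilises:
  assumes U: "\<And>s :: nat. U s \<subseteq> carrier \<Lambda>" "\<And>s. \<zero>\<^bsub>\<Lambda>\<^esub> \<in> U s" "\<And>s x y. \<lbrakk>x \<in> U s; y \<in> U s\<rbrakk> \<Longrightarrow> x \<oplus>\<^bsub>\<Lambda>\<^esub> y \<in> U s"
      "\<And>s r x. \<lbrakk>r \<in> carrier K; x \<in> U s\<rbrakk> \<Longrightarrow> \<phi> r \<otimes>\<^bsub>\<Lambda>\<^esub> x \<in> U s"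
    and desc: "\<And>s. U (Suc s) \<subseteq> U s"
  shows "\<exists>m. U m = U (Suc m)"
proof -
  note lm = restrict_scalars_left_module[OF regular_left_module]
  have sub: "submodule (U s) K (restrict_scalars \<phi> (regular_module \<Lambda>))" for s
    by (rule left_module.submoduleI'[OF lm]) (use U in auto)
  have "\<exists>m. \<forall>i\<ge>m. U i = U m" by (rule artinian_dcc[OF artinian fg_over_base]) (rule sub desc)+
  then obtain m where m: "\<forall>i\<ge>m. U i = U m" by blast
  then have "U m = U (Suc m)" by (metis le_SucI order_refl)
  then show ?thesis by blast
qed

end

text \<open>The left ideals of the paths form a descending chain of \<open>K\<close>-submodules.
  Where it stabilises, the path is a \<open>J\<close>-multiple of itself.\<close>

lemma (in artin_algebra) path_nilpotent:
  assumes "left_arrow_ring \<Lambda> n E J A"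
  shows "\<exists>s. left_arrow_ring.path \<Lambda> E A i s = \<zero>\<^bsub>\<Lambda>\<^esub>"
proof -
  interpret L: left_arrow_ring \<Lambda> n E J A by fact
  have lc: "lgen (L.path i s) \<subseteq> carrier \<Lambda>" for s by (auto simp: lgen_def)
  note LI = lgen_left_ideal[OF L.path_closed]
  have "\<exists>m. lgen (L.path i m) = lgen (L.path i (Suc m))"
    by (rule stabilises) (use lc left_ideal_zero[OF LI] left_ideal_add[OF LI] left_ideal_mult[OF LI] scalar_closed
        L.lgen_path_mono in \<open>auto simp del: L.path.simps\<close>)
  then obtain m where "L.path i m \<in> lgen (L.path i (Suc m))" using lgen_self[OF L.path_closed] by blast
  then obtain r where r: "r \<in> carrier \<Lambda>" "L.path i m = r \<otimes>\<^bsub>\<Lambda>\<^esub> L.path i (Suc m)" by (auto simp: lgen_def simp del: L.path.simps)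
  have "(r \<otimes>\<^bsub>\<Lambda>\<^esub> A (i - int m)) \<otimes>\<^bsub>\<Lambda>\<^esub> L.path i m = L.path i m"
    using r by (simp add: m_assoc)
  then have "L.path i m = \<zero>\<^bsub>\<Lambda>\<^esub>" using r(1) by (intro L.path_quasi_regular[of "r \<otimes>\<^bsub>\<Lambda>\<^esub> A (i - int m)"] L.J_left L.A_J)
  then show ?thesis by blast
qed

text \<open>The mirror image for the right ideals generated by the \<open>p k\<close>, which are
  \<open>K\<close>-submodules because the scalars are central; \<open>quasi_regular\<close> is taken
  over the opposite ring.\<close>

lemma (in artin_algebra) product_nilpotent:
  assumes IR: "idem_ring \<Lambda> n E J" and c: "\<And>k :: nat. c k \<in> J" "\<And>k. c k \<otimes>\<^bsub>\<Lambda>\<^esub> E i = c k"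
    and p: "p 0 = E i" "\<And>k. p (Suc k) = p k \<otimes>\<^bsub>\<Lambda>\<^esub> c k"
  shows "\<exists>m. p m = \<zero>\<^bsub>\<Lambda>\<^esub>"
proof -
  interpret I: idem_ring \<Lambda> n E J by fact
  interpret O: idem_ring "op_ring \<Lambda>" n E J by (rule I.idem_ring_op)
  have pc: "p k \<in> carrier \<Lambda> \<and> p k \<otimes>\<^bsub>\<Lambda>\<^esub> E i = p k" for k
    by (induction k) (use p c I.J_in in \<open>auto simp: m_assoc\<close>)
  define U where "U k = {p k \<otimes>\<^bsub>\<Lambda>\<^esub> r | r. r \<in> carrier \<Lambda>}" for k
  have "\<exists>m. U m = U (Suc m)"
  proof (rule stabilises)
    show "U s \<subseteq> carrier \<Lambda>" for s using pc by (auto simp: U_def)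
    have "\<zero>\<^bsub>\<Lambda>\<^esub> = p s \<otimes>\<^bsub>\<Lambda>\<^esub> \<zero>\<^bsub>\<Lambda>\<^esub>" for s using pc by simp
    then show "\<zero>\<^bsub>\<Lambda>\<^esub> \<in> U s" for s unfolding U_def by blast
    show "x \<oplus>\<^bsub>\<Lambda>\<^esub> y \<in> U s" if xy: "x \<in> U s" "y \<in> U s" for s x y
    proof -
      obtain a b where ab: "a \<in> carrier \<Lambda>" "b \<in> carrier \<Lambda>" "x = p s \<otimes>\<^bsub>\<Lambda>\<^esub> a" "y = p s \<otimes>\<^bsub>\<Lambda>\<^esub> b" using xy by (auto simp: U_def)
      then have "x \<oplus>\<^bsub>\<Lambda>\<^esub> y = p s \<otimes>\<^bsub>\<Lambda>\<^esub> (a \<oplus>\<^bsub>\<Lambda>\<^esub> b)" using pc by (simp add: r_distr)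
      then show ?thesis using ab by (auto simp: U_def)
    qed
    show "\<phi> r \<otimes>\<^bsub>\<Lambda>\<^esub> x \<in> U s" if rx: "r \<in> carrier K" "x \<in> U s" for s r x
    proof -
      obtain a where a: "a \<in> carrier \<Lambda>" "x = p s \<otimes>\<^bsub>\<Lambda>\<^esub> a" using rx by (auto simp: U_def)
      have "\<phi> r \<otimes>\<^bsub>\<Lambda>\<^esub> x = (\<phi> r \<otimes>\<^bsub>\<Lambda>\<^esub> p s) \<otimes>\<^bsub>\<Lambda>\<^esub> a" using a pc scalar_closed[OF rx(1)] by (simp add: m_assoc)
      also have "\<dots> = p s \<otimes>\<^bsub>\<Lambda>\<^esub> (\<phi> r \<otimes>\<^bsub>\<Lambda>\<^esub> a)"
        using central[OF rx(1), of "p s"] a pc scalar_closed[OF rx(1)] by (simp add: m_assoc)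
      finally show ?thesis using a scalar_closed[OF rx(1)] by (auto simp: U_def)
    qed
    show "U (Suc s) \<subseteq> U s" for s using pc c I.J_in by (auto simp: U_def p m_assoc)
  qed
  then obtain m where m: "U m = U (Suc m)" by blast
  have "p m \<in> U m" using pc[of m] unfolding U_def by (auto intro!: exI[of _ "\<one>\<^bsub>\<Lambda>\<^esub>"])
  then obtain r where r: "r \<in> carrier \<Lambda>" "p m = p m \<otimes>\<^bsub>\<Lambda>\<^esub> c m \<otimes>\<^bsub>\<Lambda>\<^esub> r" unfolding m by (auto simp: U_def p)
  have cr: "c m \<otimes>\<^bsub>\<Lambda>\<^esub> r \<otimes>\<^bsub>\<Lambda>\<^esub> E i \<in> J" using c r by (intro I.J_right) auto
  have pm: "p m \<otimes>\<^bsub>\<Lambda>\<^esub> (c m \<otimes>\<^bsub>\<Lambda>\<^esub> r \<otimes>\<^bsub>\<Lambda>\<^esub> E i) = p m"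
    using r pc[of m] I.J_in[OF c(1)] by (metis I.E_closed m_assoc m_closed)
  let ?M = "regular_module (op_ring \<Lambda>)"
  have lm: "left_module (op_ring \<Lambda>) ?M" by (rule ring.regular_left_module[OF ring_op])
  interpret M: left_module "op_ring \<Lambda>" ?M by fact
  have "p m \<ominus>\<^bsub>?M\<^esub> (c m \<otimes>\<^bsub>\<Lambda>\<^esub> r \<otimes>\<^bsub>\<Lambda>\<^esub> E i) \<odot>\<^bsub>?M\<^esub> p m = \<zero>\<^bsub>?M\<^esub>"
    using pm pc[of m] M.M.r_neg[of "p m"] by (simp add: M.M.minus_eq)
  then have e: "p m \<ominus>\<^bsub>?M\<^esub> (c m \<otimes>\<^bsub>\<Lambda>\<^esub> r \<otimes>\<^bsub>\<Lambda>\<^esub> E i) \<odot>\<^bsub>?M\<^esub> p m \<in> {\<zero>\<^bsub>?M\<^esub>}" by simp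
  have "p m \<in> {\<zero>\<^bsub>?M\<^esub>}"
    by (rule O.quasi_regular[OF lm M.zero_submodule _ _ cr e, of i]) (use pc[of m] in simp_all)
  then have "p m = \<zero>\<^bsub>\<Lambda>\<^esub>" by simp
  then show ?thesis by blast
qed

section \<open>The exceptional case of a simple first projective\<close>

context idem_ring
begin

text \<open>If no element generated the corner \<open>E i J E j\<close>, its elements could be factored indefinitely as
  \<open>u\<^sub>0 = c\<^sub>0 u\<^sub>1 = c\<^sub>0 c\<^sub>1 u\<^sub>2 = \<dots>\<close> with \<open>c\<^sub>k\<close> in \<open>J\<close>, against nilpotence.\<close>

lemma corner_generator:
  assumes nil: "\<And>c p. \<lbrakk>\<And>k :: nat. c k \<in> J; \<And>k. c k \<otimes> E i = c k; p 0 = E i; \<And>k. p (Suc k) = p k \<otimes> c k\<rbrakk> \<Longrightarrow>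
      \<exists>m. p m = \<zero>"
    and uni: "\<And>U V. \<lbrakk>left_ideal U R; left_ideal V R; U \<subseteq> lgen (E j); V \<subseteq> lgen (E j)\<rbrakk> \<Longrightarrow> U \<subseteq> V \<or> V \<subseteq> U"
  shows "\<exists>u \<in> J. E i \<otimes> u = u \<and> u \<otimes> E j = u \<and> (\<forall>x \<in> J. E i \<otimes> x \<otimes> E j \<in> lgen u)"
proof -
  define W where "W = {w \<in> J. E i \<otimes> w = w \<and> w \<otimes> E j = w}"
  have W: "w \<in> carrier R" "w \<in> J" "E i \<otimes> w = w" "w \<otimes> E j = w" if "w \<in> W" for w
    using that J_in by (auto simp: W_def)
  have cW: "E i \<otimes> x \<otimes> E j \<in> W" if "x \<in> J" for x
    using that J_in[OF that] by (auto simp: W_def m_assoc intro: J_left J_right)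
  have W0: "\<zero> \<in> W" using J_zero by (simp add: W_def)
  show ?thesis
  proof (cases "W = {\<zero>}")
    case True
    have "E i \<otimes> x \<otimes> E j \<in> lgen \<zero>" if "x \<in> J" for x
      using cW[OF that] True left_ideal_zero[OF lgen_left_ideal[OF zero_closed]] by simp
    then show ?thesis using J_zero by (intro bexI[of _ \<zero>]) auto
  next
    case False
    then obtain w0 where w0: "w0 \<in> W" "w0 \<noteq> \<zero>" using W0 by blast
    have "\<exists>u \<in> W. u \<noteq> \<zero> \<and> (\<forall>c \<in> J. \<forall>v \<in> W. u \<noteq> c \<otimes> v)"
    proof (rule ccontr)
      assume neg: "\<not> ?thesis"
      have "\<exists>v c. (v \<in> W \<and> v \<noteq> \<zero>) \<and> c \<in> J \<and> c \<otimes> E i = c \<and> u = c \<otimes> v" if u: "u \<in> W \<and> u \<noteq> \<zero>" for u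
      proof -
        obtain c v where cv: "c \<in> J" "v \<in> W" "u = c \<otimes> v" using neg u by blast
        have "v \<noteq> \<zero>" using cv u J_in[OF cv(1)] by auto
        moreover have "c \<otimes> E i \<in> J" using cv(1) by (intro J_right) auto
        moreover have "u = (c \<otimes> E i) \<otimes> v" using cv W[OF cv(2)] J_in[OF cv(1)] by (simp add: m_assoc)
        ultimately show ?thesis using cv(2) J_in[OF cv(1)] by (intro exI[of _ v] exI[of _ "c \<otimes> E i"]) (simp add: m_assoc)
      qed
      then obtain g h where gh: "\<And>u. u \<in> W \<and> u \<noteq> \<zero> \<Longrightarrow>
          (g u \<in> W \<and> g u \<noteq> \<zero>) \<and> h u \<in> J \<and> h u \<otimes> E i = h u \<and> u = h u \<otimes> g u" by metis
      define v where "v k = (g ^^ k) w0" for k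
      have v: "v k \<in> W \<and> v k \<noteq> \<zero>" for k by (induction k) (use w0 gh in \<open>auto simp: v_def\<close>)
      have vS: "v k = h (v k) \<otimes> v (Suc k)" for k using gh[OF v[of k]] by (simp add: v_def)
      define p where "p = rec_nat (E i) (\<lambda>k q. q \<otimes> h (v k))"
      have p: "p 0 = E i" "p (Suc k) = p k \<otimes> h (v k)" for k by (simp_all add: p_def)
      have hc: "h (v k) \<in> carrier R" for k using gh[OF v[of k]] J_in by blast
      have pc: "p k \<in> carrier R" for k by (induction k) (auto simp: p hc)
      have pv: "p k \<otimes> v k = w0" for k
      proof (induction k)
        case 0
        then show ?case using W[OF w0(1)] by (simp add: p v_def)
      next
        case (Suc k)
        have "p (Suc k) \<otimes> v (Suc k) = p k \<otimes> (h (v k) \<otimes> v (Suc k))"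
          using pc hc W(1) v by (simp add: p m_assoc)
        then show ?case using Suc vS[of k] by simp
      qed
      obtain m where "p m = \<zero>" using nil[of "\<lambda>k. h (v k)" p] gh[OF v] p by blast
      then show False using pv[of m] w0(2) W(1) v by simp
    qed
    then obtain u where u: "u \<in> W" "u \<noteq> \<zero>" "\<And>c v. \<lbrakk>c \<in> J; v \<in> W\<rbrakk> \<Longrightarrow> u \<noteq> c \<otimes> v" by blast
    have gen: "w \<in> lgen u" if w: "w \<in> W" for w
    proof -
      have sub: "lgen x \<subseteq> lgen (E j)" if "x \<in> W" for x
      proof (rule lgen_minimal[OF lgen_left_ideal[OF E_closed]])
        show "x \<in> lgen (E j)" using W(1,4)[OF that] by (metis (mono_tags, lifting) lgen_def mem_Collect_eq)
      qed
      from uni[OF lgen_left_ideal[OF W(1)[OF w]] lgen_left_ideal[OF W(1)[OF u(1)]] sub[OF w] sub[OF u(1)]]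
      show ?thesis
      proof
        assume "lgen w \<subseteq> lgen u"
        then show ?thesis using lgen_self[OF W(1)[OF w]] by blast
      next
        assume "lgen u \<subseteq> lgen w"
        then obtain r where r: "r \<in> carrier R" "u = r \<otimes> w" using lgen_self[OF W(1)[OF u(1)]] by (auto simp: lgen_def)
        \<comment> \<open>The choice of \<open>u\<close> keeps \<open>q\<close> out of
          \<open>J\<close>, so \<open>q\<close> can be inverted and \<open>w\<close> recovered from
          \<open>u\<close>.\<close>
        define q where "q = r \<otimes> E i"
        have q: "q \<in> carrier R" "q \<otimes> E i = q" using r by (simp_all add: q_def m_assoc)
        have uq: "u = q \<otimes> w" using r W[OF w] by (simp add: q_def m_assoc)
        have "q \<notin> J" using u(3)[OF _ w] uq by blast
        then obtain c where c: "c \<in> carrier R" "c \<otimes> q = E i" using left_inverse[OF q] by blast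
        have "w = c \<otimes> q \<otimes> w" unfolding c(2) using W[OF w] by simp
        also have "\<dots> = c \<otimes> u" unfolding uq using c(1) q W[OF w] by (simp add: m_assoc)
        finally show ?thesis using c(1) by (auto simp: lgen_def)
      qed
    qed
    show ?thesis using W[OF u(1)] gen cW by (intro bexI[of _ u]) blast+
  qed
qed

text \<open>When \<open>P\<^sub>1\<close> is simple the Kupisch series yields no arrow ending in 1. A generator \<open>u\<close> of \<open>E 0 J E 1\<close>
  would be one, and the length of \<open>P\<^sub>1\<close> then forces \<open>u = 0\<close>.\<close>

lemma nak_ring_simple_projective:
  fixes A :: "int \<Rightarrow> 'a"
  assumes A: "\<And>i. A i \<in> J" "\<And>i. A (i mod int n) = A i" "\<And>i. E (i - 1) \<otimes> A i = A i" "\<And>i. A i \<otimes> E i = A i"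
    and J_E: "\<And>i x. \<lbrakk>i mod int n \<noteq> 1 mod int n; x \<in> J\<rbrakk> \<Longrightarrow> \<exists>r \<in> carrier R. x \<otimes> E i = r \<otimes> A i"
    and E_J: "\<And>i x. \<lbrakk>i mod int n \<noteq> 1 mod int n; x \<in> J\<rbrakk> \<Longrightarrow> \<exists>r \<in> carrier R. E (i - 1) \<otimes> x = A i \<otimes> r"
    and A1: "A 1 = \<zero>"
    and nil: "\<And>c p. \<lbrakk>\<And>k :: nat. c k \<in> J; \<And>k. c k \<otimes> E 0 = c k; p 0 = E 0; \<And>k. p (Suc k) = p k \<otimes> c k\<rbrakk> \<Longrightarrow>
      \<exists>m. p m = \<zero>"
    and path_nil: "\<And>B i. left_arrow_ring R n E J B \<Longrightarrow> \<exists>s. left_arrow_ring.path R E B i s = \<zero>"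
    and uni: "\<And>U V. \<lbrakk>left_ideal U R; left_ideal V R; U \<subseteq> lgen (E 1); V \<subseteq> lgen (E 1)\<rbrakk> \<Longrightarrow> U \<subseteq> V \<or> V \<subseteq> U"
    and length: "module_length R (ideal_module R (lgen (E 1))) = 1"
  shows "nak_ring R n E J A"
proof -
  have "\<exists>u \<in> J. E 0 \<otimes> u = u \<and> u \<otimes> E 1 = u \<and> (\<forall>x \<in> J. E 0 \<otimes> x \<otimes> E 1 \<in> lgen u)"
    by (rule corner_generator) (fact nil, fact uni)
  then obtain u where u: "u \<in> J" "E 0 \<otimes> u = u" "u \<otimes> E 1 = u" "\<And>x. x \<in> J \<Longrightarrow> E 0 \<otimes> x \<otimes> E 1 \<in> lgen u" by blast
  note uc = J_in[OF u(1)] and lu = lgen_left_ideal[OF J_in[OF u(1)]]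
  have Ac: "A i \<in> carrier R" for i by (rule J_in[OF A(1)])
  \<comment> \<open>Walking back from 0, each step peels off the arrow at \<open>- int d\<close>.
    That arrow is a genuine one, since \<open>- int d\<close> is congruent to 1 only if
    \<open>n\<close> divides \<open>Suc d\<close>; the remaining factor is in \<open>J\<close> by
    \<open>E_off\<close>. After \<open>n\<close> labels all of \<open>J E 1\<close> is
    covered.\<close>
  have down: "x \<in> J \<Longrightarrow> E (- int d) \<otimes> x \<otimes> E 1 \<in> lgen u" if "d < n" for d x
    using that
  proof (induction d arbitrary: x)
    case 0
    then show ?case using u(4) by simp
  next
    case (Suc d)
    have ne: "(- int d) mod int n \<noteq> 1 mod int n"
    proof
      assume "(- int d) mod int n = 1 mod int n"
      then have "int n dvd - int d - 1" by (simp add: mod_eq_dvd_iff)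
      then have "n dvd Suc d" by (metis dvd_minus_iff minus_diff_eq add_uminus_conv_diff int_dvd_int_iff diff_minus_eq_add of_nat_Suc add.commute)
      then show False using Suc.prems by (auto dest: dvd_imp_le)
    qed
    obtain r where r: "r \<in> carrier R" "E (- int d - 1) \<otimes> x = A (- int d) \<otimes> r" using E_J[OF ne Suc.prems(1)] by blast
    note xc = J_in[OF Suc.prems(1)]
    have eq: "- int (Suc d) = - int d - 1" by simp
    have "E (- int (Suc d)) \<otimes> x \<otimes> E 1 = A (- int d) \<otimes> r \<otimes> E 1"
      unfolding eq r(2) ..
    also have "\<dots> = (A (- int d) \<otimes> E (- int d)) \<otimes> r \<otimes> E 1" unfolding A(4) ..
    also have "\<dots> = A (- int d) \<otimes> (E (- int d) \<otimes> (E (- int d) \<otimes> r \<otimes> E 1) \<otimes> E 1)"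
      using r(1) Ac by (simp add: m_assoc)
    finally show ?case
      using left_ideal_mult[OF lu Ac Suc.IH[OF E_off[OF r(1) ne]]] Suc.prems by simp
  qed
  have JE1: "x \<otimes> E 1 \<in> lgen u" if x: "x \<in> J" for x
  proof (rule split_left[OF lu])
    show "E i \<otimes> (x \<otimes> E 1) \<in> lgen u" for i
    proof -
      define d where "d = nat ((- i) mod int n)"
      have d: "d < n" "int d = (- i) mod int n" using n_pos by (simp_all add: d_def nat_less_iff)
      have "i mod int n = (- int d) mod int n" unfolding d(2) by (simp add: mod_minus_eq)
      then have "E i = E (- int d)" by (rule E_cong)
      then show ?thesis using down[OF d(1) x] J_in[OF x] by (simp add: m_assoc)
    qed
  qed (use J_in[OF x] in auto)
  \<comment> \<open>With \<open>u\<close> as the missing arrow into 1, left generation holds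
    everywhere and path lengths become available.\<close>
  define B where "B i = (if i mod int n = 1 mod int n then u else A i)" for i
  have E1: "E i = E 1" "E (i - 1) = E 0" if "i mod int n = 1 mod int n" for i
    using E_cong[OF that] E_cong[OF mod_diff_cong[OF that refl[of "1 mod int n"]]] by simp_all
  have "left_arrow_ring R n E J B"
  proof unfold_locales
    fix i
    show "B i \<in> J" "B (i mod int n) = B i" using A u by (simp_all add: B_def)
    show "E (i - 1) \<otimes> B i = B i" "B i \<otimes> E i = B i" using A u E1[of i] by (auto simp: B_def)
    fix x assume x: "x \<in> J"
    show "\<exists>r \<in> carrier R. x \<otimes> E i = r \<otimes> B i"
    proof (cases "i mod int n = 1 mod int n")
      case True
      then show ?thesis using JE1[OF x] E1[OF True] by (auto simp: B_def lgen_def)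
    qed (use J_E[OF _ x] in \<open>simp add: B_def\<close>)
  qed
  then interpret B: left_nak_ring R n E J B
    by (intro left_nak_ring.intro left_nak_ring_axioms.intro path_nil)
  \<comment> \<open>Length one means that the path of length one ending in 1, which is
    \<open>u\<close>, vanishes.\<close>
  have "B.len 1 = 1" using B.module_length_projective[of 1] length by simp
  then have "B.path 1 1 = \<zero>" using B.path_len[of 1] by metis
  then have u0: "u = \<zero>" using u by (simp add: B_def)
  have JE1: "x \<otimes> E 1 = \<zero>" if "x \<in> J" for x using JE1[OF that] by (simp add: u0 lgen_zero)
  \<comment> \<open>The mirror image: starting from \<open>J E 1 = 0\<close> and walking forward
    along the genuine arrows shows \<open>E 0 J = 0\<close>. So zero generates on both
    sides.\<close>
  have up: "x \<in> J \<Longrightarrow> E 0 \<otimes> x \<otimes> E (1 + int k) = \<zero>" if "k < n" for k x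
    using that
  proof (induction k arbitrary: x)
    case 0
    then show ?case using JE1 J_in[OF 0(1)] by (simp add: m_assoc)
  next
    case (Suc k)
    have ne: "(1 + int (Suc k)) mod int n \<noteq> 1 mod int n" "0 mod int n \<noteq> (1 + int k) mod int n"
    proof -
      have "\<not> n dvd Suc k" using Suc.prems by (auto dest: dvd_imp_le)
      then have "\<not> int n dvd 1 + int k" by (metis int_dvd_int_iff of_nat_Suc)
      then show "(1 + int (Suc k)) mod int n \<noteq> 1 mod int n" "0 mod int n \<noteq> (1 + int k) mod int n"
        by (auto simp: mod_eq_dvd_iff mod_eq_0_iff_dvd)
    qed
    note xc = J_in[OF Suc.prems(1)]
    obtain r where r: "r \<in> carrier R" "x \<otimes> E (1 + int (Suc k)) = r \<otimes> A (1 + int (Suc k))"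
      using J_E[OF ne(1) Suc.prems(1)] by blast
    have EA: "E (1 + int k) \<otimes> A (1 + int (Suc k)) = A (1 + int (Suc k))"
      using A(3)[of "1 + int (Suc k)"] by (simp add: algebra_simps)
    have "E 0 \<otimes> x \<otimes> E (1 + int (Suc k)) = E 0 \<otimes> (r \<otimes> (E (1 + int k) \<otimes> A (1 + int (Suc k))))"
      using xc by (simp only: m_assoc E_closed r(2) EA)
    also have "\<dots> = (E 0 \<otimes> (E 0 \<otimes> r \<otimes> E (1 + int k)) \<otimes> E (1 + int k)) \<otimes> A (1 + int (Suc k))"
      using r(1) Ac by (simp add: m_assoc)
    also have "\<dots> = \<zero>" using Suc.IH[OF E_off[OF r(1) ne(2)]] Suc.prems Ac by simp
    finally show ?case .
  qed
  have EJ0: "E 0 \<otimes> x = \<zero>" if x: "x \<in> J" for x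
  proof -
    have "E 0 \<otimes> x \<in> {\<zero>}"
    proof (rule split_right[OF zero_left_ideal])
      show "E 0 \<otimes> x \<otimes> E i \<in> {\<zero>}" for i
      proof -
        define k where "k = nat ((i - 1) mod int n)"
        have k: "k < n" "int k = (i - 1) mod int n" using n_pos by (simp_all add: k_def nat_less_iff)
        have "i mod int n = (1 + int k) mod int n" unfolding k(2) by (simp add: mod_simps)
        then have "E i = E (1 + int k)" by (rule E_cong)
        then show ?thesis using up[OF k(1) x] by simp
      qed
    qed (use J_in[OF x] in auto)
    then show ?thesis by simp
  qed
  have A0: "A i = \<zero>" if "i mod int n = 1 mod int n" for i using that A(2) A1 by metis
  have "left_arrow_ring R n E J A"
  proof unfold_locales
    fix i x assume x: "x \<in> J"
    show "\<exists>r \<in> carrier R. x \<otimes> E i = r \<otimes> A i"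
      using J_E[OF _ x, of i] E1(1)[of i] A0[of i] JE1[OF x] by (cases "i mod int n = 1 mod int n") auto
  qed (use A in auto)
  then interpret A: left_nak_ring R n E J A
    by (intro left_nak_ring.intro left_nak_ring_axioms.intro path_nil)
  show ?thesis
  proof unfold_locales
    fix i x assume x: "x \<in> J"
    show "\<exists>r \<in> carrier R. E (i - 1) \<otimes> x = A i \<otimes> r"
      using E_J[OF _ x, of i] E1(2)[of i] A0[of i] EJ0[OF x] by (cases "i mod int n = 1 mod int n") auto
  qed
qed

end

text \<open>\<open>cyclic n id z\<close> is the representative of \<open>z\<close> in
  \<open>{1..n}\<close>; every cyclic extension factors through it.\<close>

lemma cyclic_index: "cyclic n c z = c (cyclic n id z)"
  by (simp add: cyclic_def)

lemma cyclic_cong: "z mod int n = w mod int n \<Longrightarrow> cyclic n c z = cyclic n c w"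
  unfolding cyclic_def by (metis mod_diff_left_eq)

lemma cyclic_nth: "j \<in> {1..n} \<Longrightarrow> cyclic n c (int j) = c j"
  by (auto simp: cyclic_def nat_diff_distrib of_nat_diff[symmetric] simp del: of_nat_diff)

context
  fixes n :: nat
  assumes n: "0 < n"
begin

lemma cyclic_index_range: "cyclic n id z \<in> {1..n}"
  using n by (simp add: cyclic_def nat_less_iff Suc_le_eq)

lemma cyclic_index_mod: "int (cyclic n id z) mod int n = z mod int n"
  using n by (simp add: cyclic_def mod_simps)

lemma cyclic_index_inj: "cyclic n id z = cyclic n id w \<longleftrightarrow> z mod int n = w mod int n"
  using cyclic_index_mod cyclic_cong by metis

lemma bij_betw_cyclic: "bij_betw t {1..n} I \<Longrightarrow> bij_betw (\<lambda>i. cyclic n t (int i)) {..<n} I"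
proof -
  assume t: "bij_betw t {1..n} I"
  have "bij_betw (\<lambda>i. cyclic n id (int i)) {..<n} {1..n}"
  proof (rule bij_betwI')
    fix i k assume "i \<in> {..<n}" "k \<in> {..<n}"
    then show "cyclic n id (int i) = cyclic n id (int k) \<longleftrightarrow> i = k"
      by (simp add: cyclic_index_inj)
  next
    fix j assume j: "j \<in> {1..n}"
    have "cyclic n id (int (j mod n)) = cyclic n id (int j)" by (rule cyclic_cong) (simp add: of_nat_mod)
    then show "\<exists>i\<in>{..<n}. j = cyclic n id (int i)"
      using n cyclic_nth[OF j, of id] by (intro bexI[of _ "j mod n"]) auto
  qed (rule cyclic_index_range)
  from bij_betw_trans[OF this t] show ?thesis unfolding comp_def by (subst cyclic_index)
qed

end

text \<open>\<open>uniserial_projective_iso\<close> matches each \<open>P j\<close> with a summand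
  of the regular module, and basicness makes the matching bijective. The idempotents are then
  renumbered by it, so that \<open>E (int j)\<close> belongs to \<open>P j\<close>.\<close>

lemma (in nakayama_algebra) kupisch_idempotents:
  fixes P :: "nat \<Rightarrow> 'a fmod"
  assumes basic: "basic_module \<Lambda> (regular_module \<Lambda>)" and nonzero: "carrier \<Lambda> \<noteq> {\<zero>\<^bsub>\<Lambda>\<^esub>}"
    and P: "\<And>j. j \<in> {1..n} \<Longrightarrow> projective \<Lambda> (P j) \<and> indecomposable \<Lambda> (P j)"
    and noniso: "\<And>i j. \<lbrakk>i \<in> {1..n}; j \<in> {1..n}; module_iso \<Lambda> (P i) (P j)\<rbrakk> \<Longrightarrow> i = j"
    and complete: "\<And>X :: 'a fmod. \<lbrakk>projective \<Lambda> X; indecomposable \<Lambda> X\<rbrakk> \<Longrightarrow> \<exists>j \<in> {1..n}. module_iso \<Lambda> X (P j)"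
  shows "\<exists>E. idem_ring \<Lambda> n E (rad_ideal E) \<and>
    (\<forall>j \<in> {1..n}. module_iso \<Lambda> (ideal_module \<Lambda> (lgen (E (int j)))) (P j)) \<and>
    (\<forall>i U V. left_ideal U \<Lambda> \<and> left_ideal V \<Lambda> \<and> U \<subseteq> lgen (E i) \<and> V \<subseteq> lgen (E i) \<longrightarrow> U \<subseteq> V \<or> V \<subseteq> U)"
proof -
  obtain I N where dec: "direct_decomposition \<Lambda> (regular_module \<Lambda>) I N"
    and ind: "\<And>i. i \<in> I \<Longrightarrow> indecomposable \<Lambda> (ideal_module \<Lambda> (N i))"
    and ni: "\<And>i j. \<lbrakk>i \<in> I; j \<in> I; module_iso \<Lambda> (ideal_module \<Lambda> (N i)) (ideal_module \<Lambda> (N j))\<rbrakk> \<Longrightarrow> i = j"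
    using basic unfolding basic_module_def by blast
  obtain e where e: "\<And>i. i \<in> I \<Longrightarrow> e i \<in> carrier \<Lambda> \<and> N i = lgen (e i) \<and> e i \<otimes>\<^bsub>\<Lambda>\<^esub> e i = e i"
    "\<And>i j. \<lbrakk>i \<in> I; j \<in> I; i \<noteq> j\<rbrakk> \<Longrightarrow> e i \<otimes>\<^bsub>\<Lambda>\<^esub> e j = \<zero>\<^bsub>\<Lambda>\<^esub>" "(\<Oplus>\<^bsub>\<Lambda>\<^esub>i\<in>I. e i) = \<one>\<^bsub>\<Lambda>\<^esub>" "finite I"
    using decomposition_idempotents[OF dec] by metis
  let ?L = "\<lambda>i. ideal_module \<Lambda> (lgen (e i))"
  have lm: "left_module \<Lambda> (?L i)" if "i \<in> I" for i
    using ideal_module_left_module[OF lgen_left_ideal] e(1)[OF that] by blast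
  have Lind: "indecomposable \<Lambda> (?L i)" if "i \<in> I" for i using ind[OF that] e(1)[OF that] by simp
  have Lni: "i = j" if "i \<in> I" "j \<in> I" "module_iso \<Lambda> (?L i) (?L j)" for i j
    using ni[of i j] that e(1) by metis
  have lP: "left_module \<Lambda> (P j)" if "j \<in> {1..n}" for j using P[OF that] by (simp add: indecomposable_def)
  have Puni: "uniserial \<Lambda> (P j)" if "j \<in> {1..n}" for j using projective_uniserial P[OF that] by blast
  have LP: "\<exists>j \<in> {1..n}. module_iso \<Lambda> (?L i) (P j)" if i: "i \<in> I" for i
  proof -
    obtain X :: "'a fmod" where X: "fg_module \<Lambda> X" "module_iso \<Lambda> (?L i) X"
      using fg_module_iso_fmod[OF ideal_module_fg] e(1)[OF i] by metis
    have lX: "left_module \<Lambda> X" by (rule fg_left_module[OF X(1)])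
    have "projective \<Lambda> X" using projective_iso[OF ideal_module_projective X(2) lX] e(1)[OF i] by blast
    moreover have "indecomposable \<Lambda> X" by (rule indecomposable_iso[OF Lind[OF i] X(2) lX])
    ultimately obtain j where "j \<in> {1..n}" "module_iso \<Lambda> X (P j)" using complete by metis
    then show ?thesis using module_iso_trans[OF X(2) _ lm[OF i]] by metis
  qed
  have "\<exists>i \<in> I. module_iso \<Lambda> (?L i) (P j)" if j: "j \<in> {1..n}" for j
  proof (rule uniserial_projective_iso[OF _ Puni[OF j] _ e(4,3) _ Lind])
    show "projective \<Lambda> (P j)" "carrier (P j) \<noteq> {\<zero>\<^bsub>P j\<^esub>}" using P[OF j] by (simp_all add: indecomposable_def)
  qed (use e(1) in simp)
  then obtain t where t: "\<And>j. j \<in> {1..n} \<Longrightarrow> t j \<in> I" "\<And>j. j \<in> {1..n} \<Longrightarrow> module_iso \<Lambda> (?L (t j)) (P j)" by metis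
  have inj: "j = k" if jk: "j \<in> {1..n}" "k \<in> {1..n}" "t j = t k" for j k
  proof -
    have "module_iso \<Lambda> (P j) (?L (t k))" using module_iso_sym[OF t(2)[OF jk(1)] lm[OF t(1)[OF jk(1)]]] jk(3) by simp
    from module_iso_trans[OF this t(2)[OF jk(2)] lP[OF jk(1)]] show ?thesis by (rule noniso[OF jk(1,2)])
  qed
  have bij: "bij_betw t {1..n} I"
  proof (rule bij_betwI')
    show "t j = t k \<longleftrightarrow> j = k" if "j \<in> {1..n}" "k \<in> {1..n}" for j k using inj[OF that] by blast
    show "t j \<in> I" if "j \<in> {1..n}" for j by (rule t(1)[OF that])
    fix i assume i: "i \<in> I"
    obtain j where j: "j \<in> {1..n}" "module_iso \<Lambda> (?L i) (P j)" using LP[OF i] by metis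
    have "module_iso \<Lambda> (P j) (?L (t j))" by (rule module_iso_sym[OF t(2)[OF j(1)] lm[OF t(1)[OF j(1)]]])
    from module_iso_trans[OF j(2) this lm[OF i]] have "i = t j" by (rule Lni[OF i t(1)[OF j(1)]])
    then show "\<exists>j\<in>{1..n}. i = t j" using j(1) by (rule bexI)
  qed
  have "I \<noteq> {}"
  proof
    assume "I = {}"
    then have "\<one>\<^bsub>\<Lambda>\<^esub> = \<zero>\<^bsub>\<Lambda>\<^esub>" using e(3) by simp
    then show False using nonzero by (simp add: carrier_one_zero)
  qed
  then have n: "0 < n" using bij by (cases "n = 0") (auto simp: bij_betw_def)
  define E where "E z = e (cyclic n t z)" for z
  have tc: "cyclic n t z \<in> I" for z
    using t(1)[OF cyclic_index_range[OF n, of z]] by (simp add: cyclic_index[of n t])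
  have tinj: "cyclic n t z = cyclic n t w \<Longrightarrow> z mod int n = w mod int n" for z w
    using inj[OF cyclic_index_range[OF n, of z] cyclic_index_range[OF n, of w]]
    by (simp add: cyclic_index[of n t] cyclic_index_inj[OF n])
  have bij': "bij_betw (\<lambda>i. cyclic n t (int i)) {..<n} I" by (rule bij_betw_cyclic[OF n bij])
  have uni: "U \<subseteq> V \<or> V \<subseteq> U" if UV: "left_ideal U \<Lambda>" "left_ideal V \<Lambda>" "U \<subseteq> lgen (E z)" "V \<subseteq> lgen (E z)" for z U V
  proof -
    define j where "j = cyclic n id z"
    have j: "j \<in> {1..n}" and tj: "cyclic n t z = t j"
      unfolding j_def by (rule cyclic_index_range[OF n]) (rule cyclic_index)
    have "uniserial \<Lambda> (?L (t j))"
      by (rule uniserial_iso[OF Puni[OF j] module_iso_sym[OF t(2)[OF j] lm[OF t(1)[OF j]]] lm[OF t(1)[OF j]]])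
    moreover have "submodule U \<Lambda> (?L (t j)) \<and> submodule V \<Lambda> (?L (t j))"
      using UV left_module.submodule_sub_module_iff[OF regular_left_module lgen_left_ideal, of "e (t j)"] e(1)[OF t(1)[OF j]]
      by (simp add: E_def tj)
    ultimately show ?thesis unfolding uniserial_def by metis
  qed
  have "idem_ring \<Lambda> n E (rad_ideal E)"
  proof (rule idem_ring_uniserial[OF n])
    show "E i \<in> carrier \<Lambda>" "E i \<otimes>\<^bsub>\<Lambda>\<^esub> E i = E i" for i using e(1)[OF tc] by (simp_all add: E_def)
    show "E (i mod int n) = E i" for i unfolding E_def by (rule arg_cong[OF cyclic_cong]) simp
    show "E i \<noteq> \<zero>\<^bsub>\<Lambda>\<^esub>" for i using Lind[OF tc[of i]] by (auto simp: E_def indecomposable_def lgen_zero)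
    show "E i \<otimes>\<^bsub>\<Lambda>\<^esub> E j = \<zero>\<^bsub>\<Lambda>\<^esub>" if "i mod int n \<noteq> j mod int n" for i j
      unfolding E_def using that tinj by (intro e(2) tc) metis
    show "i mod int n = j mod int n"
      if "module_iso \<Lambda> (ideal_module \<Lambda> (lgen (E i))) (ideal_module \<Lambda> (lgen (E j)))" for i j
      using Lni[OF tc tc that[unfolded E_def]] by (rule tinj)
    have "(\<Oplus>\<^bsub>\<Lambda>\<^esub>i\<in>{..<n}. E (int i)) = (\<Oplus>\<^bsub>\<Lambda>\<^esub>i\<in>(\<lambda>i. cyclic n t (int i)) ` {..<n}. e i)"
      unfolding E_def by (rule finsum_reindex[symmetric]) (use bij' e(1) in \<open>auto simp: bij_betw_def\<close>)
    then show "(\<Oplus>\<^bsub>\<Lambda>\<^esub>i\<in>{..<n}. E (int i)) = \<one>\<^bsub>\<Lambda>\<^esub>" using bij' e(3) by (simp add: bij_betw_def)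
  qed (rule uni)
  moreover have "module_iso \<Lambda> (ideal_module \<Lambda> (lgen (E (int j)))) (P j)" if "j \<in> {1..n}" for j
    using t(2)[OF that] cyclic_nth[OF that, of t] by (simp add: E_def)
  ultimately show ?thesis using uni by (intro exI[of _ E]) blast
qed

text \<open>The translate of the top of \<open>P (l - 1)\<close> being the top of \<open>P l\<close>
  yields the arrow from \<open>l - 1\<close> to \<open>l\<close>; the step from \<open>n\<close> to
  1 closes the cycle unless \<open>P 1\<close> is simple.\<close>

lemma (in nakayama_algebra) kupisch_nak_ring:
  fixes P :: "nat \<Rightarrow> 'a fmod"
  assumes basic: "basic_module \<Lambda> (regular_module \<Lambda>)" and nonzero: "carrier \<Lambda> \<noteq> {\<zero>\<^bsub>\<Lambda>\<^esub>}"
    and kup: "kupisch_series K \<phi> \<Lambda> n P"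
  obtains E J A where "nak_ring \<Lambda> n E J A"
    "\<And>j. j \<in> {1..n} \<Longrightarrow> module_iso \<Lambda> (ideal_module \<Lambda> (lgen (E (int j)))) (P j)"
proof -
  have P: "\<And>j. j \<in> {1..n} \<Longrightarrow> projective \<Lambda> (P j) \<and> indecomposable \<Lambda> (P j)"
    and noniso: "\<And>i j. \<lbrakk>i \<in> {1..n}; j \<in> {1..n}; module_iso \<Lambda> (P i) (P j)\<rbrakk> \<Longrightarrow> i = j"
    and complete: "\<And>X :: 'a fmod. \<lbrakk>projective \<Lambda> X; indecomposable \<Lambda> X\<rbrakk> \<Longrightarrow> \<exists>j \<in> {1..n}. module_iso \<Lambda> X (P j)"
    and tr: "\<And>i. i \<in> {1..<n} \<Longrightarrow>
      is_inverse_AR_translate K \<phi> \<Lambda> (module_top \<Lambda> (P i)) (module_top \<Lambda> (P (i + 1)))"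
    and tr1: "module_length \<Lambda> (P 1) \<noteq> 1 \<Longrightarrow>
      is_inverse_AR_translate K \<phi> \<Lambda> (module_top \<Lambda> (P n)) (module_top \<Lambda> (P 1))"
    using kup unfolding kupisch_series_def by (metis, metis, metis, metis, metis)
  have "\<exists>E. idem_ring \<Lambda> n E (rad_ideal E) \<and>
    (\<forall>j \<in> {1..n}. module_iso \<Lambda> (ideal_module \<Lambda> (lgen (E (int j)))) (P j)) \<and>
    (\<forall>i U V. left_ideal U \<Lambda> \<and> left_ideal V \<Lambda> \<and> U \<subseteq> lgen (E i) \<and> V \<subseteq> lgen (E i) \<longrightarrow> U \<subseteq> V \<or> V \<subseteq> U)"
    by (rule kupisch_idempotents[OF basic nonzero]) (fact P noniso complete)+
  then obtain E where IR: "idem_ring \<Lambda> n E (rad_ideal E)"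
    and iso: "\<And>j. j \<in> {1..n} \<Longrightarrow> module_iso \<Lambda> (ideal_module \<Lambda> (lgen (E (int j)))) (P j)"
    and uni: "\<And>i U V. \<lbrakk>left_ideal U \<Lambda>; left_ideal V \<Lambda>; U \<subseteq> lgen (E i); V \<subseteq> lgen (E i)\<rbrakk> \<Longrightarrow> U \<subseteq> V \<or> V \<subseteq> U" by metis
  define J where "J = rad_ideal E"
  interpret I: idem_ring \<Lambda> n E J unfolding J_def by (rule IR)
  note n = I.n_pos
  let ?L = "\<lambda>i. ideal_module \<Lambda> (lgen (E i))"
  have lm: "left_module \<Lambda> (?L i)" for i by (rule ideal_module_left_module[OF lgen_left_ideal]) simp
  have lP: "left_module \<Lambda> (P j)" if "j \<in> {1..n}" for j using P[OF that] by (simp add: indecomposable_def)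
  have top: "I.simple_at (int j) (module_top \<Lambda> (P j))" if j: "j \<in> {1..n}" for j
  proof -
    obtain f g where f: "f \<in> module_hom \<Lambda> (?L (int j)) (P j)" and g: "g \<in> module_hom \<Lambda> (P j) (?L (int j))"
      and gf: "\<And>x. x \<in> carrier (?L (int j)) \<Longrightarrow> g (f x) = x" and fg: "\<And>y. y \<in> carrier (P j) \<Longrightarrow> f (g y) = y"
      using module_isoE[OF iso[OF j] lm] by metis
    have El: "E (int j) \<in> carrier (?L (int j))" using lgen_self[of "E (int j)"] by simp
    have fs: "f (r \<otimes>\<^bsub>\<Lambda>\<^esub> E (int j)) = r \<odot>\<^bsub>P j\<^esub> f (E (int j))" if "r \<in> carrier \<Lambda>" for r
      using module_hom_smult[OF f that El] by simp
    show ?thesis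
    proof (rule I.simple_at_cyclic_top[OF lP[OF j], of "f (E (int j))"])
      show "f (E (int j)) \<in> carrier (P j)" by (rule module_hom_closed[OF f El])
      show "E (int j) \<odot>\<^bsub>P j\<^esub> f (E (int j)) = f (E (int j))" using fs[of "E (int j)"] by simp
      show "f (E (int j)) \<noteq> \<zero>\<^bsub>P j\<^esub>"
      proof
        assume "f (E (int j)) = \<zero>\<^bsub>P j\<^esub>"
        then have "E (int j) = \<zero>\<^bsub>\<Lambda>\<^esub>" using gf[OF El] module_hom_zero[OF g lP[OF j] lm] by simp
        then show False using I.E_nonzero by simp
      qed
      fix y assume y: "y \<in> carrier (P j)"
      have "g y \<in> lgen (E (int j))" using module_hom_closed[OF g y] by simp
      then obtain r where r: "r \<in> carrier \<Lambda>" "g y = r \<otimes>\<^bsub>\<Lambda>\<^esub> E (int j)" by (auto simp: lgen_def)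
      have "y = r \<odot>\<^bsub>P j\<^esub> f (E (int j))" using fg[OF y] fs[OF r(1)] r(2) by simp
      then show "\<exists>r \<in> carrier \<Lambda>. y = r \<odot>\<^bsub>P j\<^esub> f (E (int j))" using r(1) by (rule bexI)
    qed
  qed
  define simple where "simple \<longleftrightarrow> module_length \<Lambda> (P 1) = 1"
  define arrow where "arrow l a \<longleftrightarrow> a \<in> J \<and> E (l - 1) \<otimes>\<^bsub>\<Lambda>\<^esub> a = a \<and> a \<otimes>\<^bsub>\<Lambda>\<^esub> E l = a" for l a
  define covers where "covers l a \<longleftrightarrow> (\<forall>x \<in> J. \<exists>r \<in> carrier \<Lambda>. x \<otimes>\<^bsub>\<Lambda>\<^esub> E l = r \<otimes>\<^bsub>\<Lambda>\<^esub> a) \<and>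
    (\<forall>x \<in> J. \<exists>r \<in> carrier \<Lambda>. E (l - 1) \<otimes>\<^bsub>\<Lambda>\<^esub> x = a \<otimes>\<^bsub>\<Lambda>\<^esub> r)" for l a
  have translate: "\<exists>a. arrow l a \<and> covers l a"
    if "i \<in> {1..n}" "j \<in> {1..n}" "E (int i) = E (l - 1)" "E (int j) = E l"
      "is_inverse_AR_translate K \<phi> \<Lambda> (module_top \<Lambda> (P i)) (module_top \<Lambda> (P j))" for i j l
    using translate_arrow[OF I.idem_ring_axioms top[OF that(1)] top[OF that(2)] that(5)] that(3,4)
    unfolding arrow_def covers_def by metis
  \<comment> \<open>Zero is a placeholder for the arrow into 1 when \<open>P 1\<close> is simple;
    its generating properties are supplied by \<open>nak_ring_simple_projective\<close>.\<close>
  have "\<exists>a. arrow (int l) a \<and> (\<not> (simple \<and> l = 1) \<longrightarrow> covers (int l) a) \<and> (simple \<and> l = 1 \<longrightarrow> a = \<zero>\<^bsub>\<Lambda>\<^esub>)"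
    if l: "l \<in> {1..n}" for l
  proof (cases "l = 1")
    case True
    show ?thesis
    proof (cases simple)
      case True
      then show ?thesis using \<open>l = 1\<close> I.J_zero by (intro exI[of _ "\<zero>\<^bsub>\<Lambda>\<^esub>"]) (simp add: arrow_def)
    next
      case False
      have "E (int n) = E (int 1 - 1)" by (rule I.E_cong) simp
      then show ?thesis using translate[OF _ _ _ refl tr1] False l n \<open>l = 1\<close> by (auto simp: simple_def)
    qed
  next
    case False
    then have l1: "l - 1 \<in> {1..<n}" "l - 1 + 1 = l" using l by auto
    then have l2: "l - 1 \<in> {1..n}" "int (l - 1) = int l - 1" by auto
    have "is_inverse_AR_translate K \<phi> \<Lambda> (module_top \<Lambda> (P (l - 1))) (module_top \<Lambda> (P l))"
      using tr[OF l1(1)] unfolding l1(2) .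
    from translate[OF l2(1) l arg_cong[OF l2(2)] refl this] show ?thesis using False by simp
  qed
  then obtain a where a: "\<And>l. l \<in> {1..n} \<Longrightarrow> arrow (int l) (a l)"
    "\<And>l. \<lbrakk>l \<in> {1..n}; \<not> (simple \<and> l = 1)\<rbrakk> \<Longrightarrow> covers (int l) (a l)" "simple \<Longrightarrow> 1 \<in> {1..n} \<Longrightarrow> a 1 = \<zero>\<^bsub>\<Lambda>\<^esub>"
    by metis
  define A where "A = cyclic n a"
  have A_mod: "A (i mod int n) = A i" for i unfolding A_def by (rule cyclic_cong) simp
  have "\<exists>l \<in> {1..n}. int l mod int n = i mod int n \<and> A i = a l" for i
    using cyclic_index_mod[OF n, of i] cyclic_index[of n a i] cyclic_index_range[OF n, of i] unfolding A_def by metis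
  then obtain l where l: "\<And>i. l i \<in> {1..n}" "\<And>i. int (l i) mod int n = i mod int n" "\<And>i. A i = a (l i)" by metis
  have El: "E (int (l i)) = E i" "E (int (l i) - 1) = E (i - 1)" for i
    by (rule I.E_cong[OF l(2)]) (rule I.E_cong[OF mod_diff_cong[OF l(2) refl]])
  have arr: "A i \<in> J" "E (i - 1) \<otimes>\<^bsub>\<Lambda>\<^esub> A i = A i" "A i \<otimes>\<^bsub>\<Lambda>\<^esub> E i = A i" for i
    using a(1)[OF l(1)[of i]] by (simp_all add: arrow_def El l(3))
  have cov: "\<exists>r \<in> carrier \<Lambda>. x \<otimes>\<^bsub>\<Lambda>\<^esub> E i = r \<otimes>\<^bsub>\<Lambda>\<^esub> A i" "\<exists>r \<in> carrier \<Lambda>. E (i - 1) \<otimes>\<^bsub>\<Lambda>\<^esub> x = A i \<otimes>\<^bsub>\<Lambda>\<^esub> r"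
    if "\<not> (simple \<and> i mod int n = 1 mod int n)" "x \<in> J" for i x
  proof -
    have "\<not> (simple \<and> l i = 1)" using that(1) l(2)[of i] by auto
    then show "\<exists>r \<in> carrier \<Lambda>. x \<otimes>\<^bsub>\<Lambda>\<^esub> E i = r \<otimes>\<^bsub>\<Lambda>\<^esub> A i" "\<exists>r \<in> carrier \<Lambda>. E (i - 1) \<otimes>\<^bsub>\<Lambda>\<^esub> x = A i \<otimes>\<^bsub>\<Lambda>\<^esub> r"
      using a(2)[OF l(1)] that(2) by (simp_all add: covers_def El l(3))
  qed
  have "nak_ring \<Lambda> n E J A"
  proof (cases simple)
    case False
    have "left_arrow_ring \<Lambda> n E J A"
      by unfold_locales (use arr A_mod cov(1) False in simp_all)
    then interpret A: left_nak_ring \<Lambda> n E J A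
      by (intro left_nak_ring.intro left_nak_ring_axioms.intro path_nilpotent)
    show ?thesis by unfold_locales (use cov(2) False in simp)
  next
    case True
    have one: "1 \<in> {1..n}" using n by simp
    show ?thesis
    proof (rule I.nak_ring_simple_projective)
      have "A 1 = a 1" using cyclic_nth[OF one, of a] by (simp add: A_def)
      then show "A 1 = \<zero>\<^bsub>\<Lambda>\<^esub>" using a(3)[OF True one] by simp
      show "module_length \<Lambda> (?L 1) = 1"
        using module_length_iso[OF iso[OF one] lm lP[OF one]] True by (simp add: simple_def)
      show "\<exists>s. left_arrow_ring.path \<Lambda> E B i s = \<zero>\<^bsub>\<Lambda>\<^esub>" if "left_arrow_ring \<Lambda> n E J B" for B i
        by (rule path_nilpotent[OF that])
      show "\<exists>m. p m = \<zero>\<^bsub>\<Lambda>\<^esub>" if "\<And>k :: nat. c k \<in> J" "\<And>k. c k \<otimes>\<^bsub>\<Lambda>\<^esub> E 0 = c k" "p 0 = E 0"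
        "\<And>k. p (Suc k) = p k \<otimes>\<^bsub>\<Lambda>\<^esub> c k" for c p
        by (rule product_nilpotent[where c = c and p = p, OF I.idem_ring_axioms that])
    qed (use arr A_mod cov uni in simp_all)
  qed
  then show ?thesis using iso by (rule that)
qed

theorem theorem4:
  fixes K :: "('k, 's) ring_scheme" and \<phi> :: "'k \<Rightarrow> 'a" and \<Lambda> :: "('a, 'r) ring_scheme"
    and n :: nat and P :: "nat \<Rightarrow> 'a fmod" and c :: "nat \<Rightarrow> nat"
  assumes "nakayama_algebra K \<phi> \<Lambda>"
    and "basic_module \<Lambda> (regular_module \<Lambda>)"
    and "connected_ring \<Lambda>"
    and "has_n_simples \<Lambda> n"
    and "kupisch_series K \<phi> \<Lambda> n P"
    and "\<And>j. j \<in> {1..n} \<Longrightarrow> c j = module_length \<Lambda> (P j)"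
  shows "(\<exists>T :: 'a fmod. tilting_module \<Lambda> T \<and> T \<in> C_subcategory \<Lambda>) \<longleftrightarrow>
    noninjective_labels n c \<subseteq> {(j - int (cyclic n c j)) mod int n | j. j \<in> injective_labels n c}"
proof -
  interpret nakayama_algebra K \<phi> \<Lambda> by fact
  have "carrier \<Lambda> \<noteq> {\<zero>\<^bsub>\<Lambda>\<^esub>}" using assms(3) by (simp add: connected_ring_def)
  then obtain E J A where "nak_ring \<Lambda> n E J A"
    and iso: "\<And>j. j \<in> {1..n} \<Longrightarrow> module_iso \<Lambda> (ideal_module \<Lambda> (lgen (E (int j)))) (P j)"
    using kupisch_nak_ring[OF assms(2) _ assms(5)] by metis
  then interpret N: nak_ring \<Lambda> n E J A by simp
  have n: "0 < n" by (rule N.n_pos)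
  have P: "projective \<Lambda> (P j)" "left_module \<Lambda> (P j)" if "j \<in> {1..n}" for j
    using assms(5) that by (auto simp: kupisch_series_def indecomposable_def)
  have len: "cyclic n c z = N.len z" for z
  proof -
    define j where "j = cyclic n id z"
    have j: "j \<in> {1..n}" "int j mod int n = z mod int n" "cyclic n c z = c j"
      unfolding j_def by (rule cyclic_index_range[OF n], rule cyclic_index_mod[OF n], rule cyclic_index)
    have "c j = N.len (int j)"
      using module_length_iso[OF iso[OF j(1)] N.proj_left_module P(2)[OF j(1)]] assms(6)[OF j(1)]
      by (simp add: N.module_length_projective)
    then show ?thesis using j(3) N.len_cong[OF j(2)] by simp
  qed
  have "\<exists>i. module_iso \<Lambda> X (N.proj i)" if X: "projective \<Lambda> X" "indecomposable \<Lambda> X" for X :: "'a fmod"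
  proof -
    obtain j where j: "j \<in> {1..n}" "module_iso \<Lambda> X (P j)"
      using assms(5) X unfolding kupisch_series_def by metis
    have lX: "left_module \<Lambda> X" using X(2) by (simp add: indecomposable_def)
    have "module_iso \<Lambda> (P j) (N.proj (int j))" by (rule module_iso_sym[OF iso[OF j(1)] N.proj_left_module])
    from module_iso_trans[OF j(2) this lX] show ?thesis by (rule exI)
  qed
  then have "(\<exists>T :: 'a fmod. tilting_module \<Lambda> T \<and> T \<in> C_subcategory \<Lambda>) \<longleftrightarrow>
    (\<forall>i. \<not> N.inj_label i \<longrightarrow> (\<exists>k. N.inj_label k \<and> i mod int n = (k - int (N.len k)) mod int n))"
    by (rule N.tilting_in_C_iff)
  also have "\<dots> \<longleftrightarrow> noninjective_labels n c \<subseteq> {(j - int (cyclic n c j)) mod int n | j. j \<in> injective_labels n c}"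
  proof -
    \<comment> \<open>The label sets consist of residues, whereas \<open>inj_label\<close> and
      \<open>len\<close> are functions on all integers; reduction modulo \<open>n\<close> identifies
      the two descriptions.\<close>
    have red: "z mod int n \<in> {0..<int n}" "N.len (z mod int n) = N.len z"
      "N.len (z mod int n + 1) = N.len (z + 1)" for z
      using n by (auto intro!: N.len_cong simp: mod_simps)
    have inj: "z mod int n \<in> injective_labels n c \<longleftrightarrow> N.inj_label z" for z
      using red[of z] by (simp add: injective_labels_def len N.inj_label_def)
    have noninj: "z mod int n \<in> noninjective_labels n c \<longleftrightarrow> \<not> N.inj_label z" for z
      using red[of z] N.len_step[of z] by (auto simp: noninjective_labels_def len N.inj_label_def)
    have id: "z mod int n = z" if "z \<in> noninjective_labels n c \<union> injective_labels n c" for z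
      using that by (auto simp: noninjective_labels_def injective_labels_def)
    show ?thesis
    proof (intro iffI subsetI allI impI)
      fix i assume H: "\<forall>i. \<not> N.inj_label i \<longrightarrow> (\<exists>k. N.inj_label k \<and> i mod int n = (k - int (N.len k)) mod int n)"
        and i: "i \<in> noninjective_labels n c"
      have "\<not> N.inj_label i" using i noninj[of i] id[of i] by simp
      then obtain k where k: "N.inj_label k" "i mod int n = (k - int (N.len k)) mod int n" using H by blast
      have "i = (k mod int n - int (cyclic n c (k mod int n))) mod int n"
        using k(2) id[of i] i red(2)[of k] by (simp add: len mod_simps)
      then show "i \<in> {(j - int (cyclic n c j)) mod int n | j. j \<in> injective_labels n c}" using k(1) inj by blast
    next
      fix i assume H: "noninjective_labels n c \<subseteq> {(j - int (cyclic n c j)) mod int n | j. j \<in> injective_labels n c}"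
        and i: "\<not> N.inj_label i"
      obtain j where j: "j \<in> injective_labels n c" "i mod int n = (j - int (cyclic n c j)) mod int n"
        using subsetD[OF H iffD2[OF noninj i]] by blast
      have "N.inj_label j" using inj[of j] id[of j] j(1) by simp
      then show "\<exists>k. N.inj_label k \<and> i mod int n = (k - int (N.len k)) mod int n" using j(2) len by metis
    qed
  qed
  finally show ?thesis .
qed

end
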